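(* Let $\beta_1,\beta_2,\delta_1,\delta_2\ge 0$ and $\alpha_1,\alpha_2,\gamma_1,\gamma_2>0$ be real, and let $|\sigma|<1$. Let $f=h+\overline{g}\in C_{\hat H}$, with $B_1=g'(0)$. Write $W_i=W_{(\alpha_i,\beta_i),(\gamma_i,\delta_i)}$ for $i=1,2$. If $$\begin{aligned}&2W_1'''(1)+9W_1''(1)+6\big(W_1'(1)-1\big)+|B_1|\big(2W_1'''(1)+3W_1''(1)\big)\\&\quad+2W_2'''(1)+3W_2''(1)+|B_1|\Big(2W_2'''(1)+9W_2''(1)+6\big(W_2'(1)-1\big)\Big)\le 6(1-|B_1|),\end{aligned}$$ then $L(f)=H+\overline{\sigma G}\in C_{\hat H}$.
   Context: $D=\{z\in\mathbb C:|z|<1\}$. $\hat H$ is the class of complex-valued harmonic functions $f=h+\overline g$ on $D$ with $h,g$ analytic in $D$, $h(z)=z+\sum_{n=2}^\infty A_nz^n$, $g(z)=\sum_{n=1}^\infty B_nz^n$, $|B_1|<1$. $S_{\hat H}$ is the class of sense-preserving univalent functions in $\hat H$. A domain is close-to-convex if its complement can be written as a union of non-crossing half-lines (half-lines with pairwise disjoint relative interiors). $C_{\hat H}$ is the class of $f\in S_{\hat H}$ such that $f(D)$ is close-to-convex. Normalized four-parameter Wright function: for real $a,c>0$ and $b,d\ge0$, $$W_{(a,b),(c,d)}(z)=z+\sum_{n=2}^\infty\frac{\Gamma(a)\Gamma(c)}{\Gamma(a+(n-1)b)\,\Gamma(c+(n-1)d)}z^n .$$ $W'(1),W''(1),W'''(1)$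 denote the sums at $z=1$ of the termwise derivatives of this series; a hypothesis involving them is understood to include that they are finite (automatic if $b+d>0$). The operator $L$ (depending on $\alpha_i,\beta_i,\gamma_i,\delta_i$, $i=1,2$, and $\sigma$) is $L(f)=H+\overline{\sigma G}$, where $H=h*W_{(\alpha_1,\beta_1),(\gamma_1,\delta_1)}$ and $G=g*W_{(\alpha_2,\beta_2),(\gamma_2,\delta_2)}$; here $*$ is the Hadamard product $\left(\sum a_nz^n\right)*\left(\sum b_nz^n\right)=\sum a_nb_nz^n$. *)

theory Defs
  imports "HOL-Complex_Analysis.Complex_Analysis"
begin

definition harmonic_decomp :: "(complex \<Rightarrow> complex) \<Rightarrow> (complex \<Rightarrow> complex) \<Rightarrow> (complex \<Rightarrow> complex) \<Rightarrow> bool" where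
  "harmonic_decomp f h g \<longleftrightarrow>
     h holomorphic_on ball 0 1 \<and> g holomorphic_on ball 0 1 \<and>
     (\<forall>z\<in>ball 0 1. f z = h z + cnj (g z)) \<and>
     h 0 = 0 \<and> deriv h 0 = 1 \<and> g 0 = 0 \<and> norm (deriv g 0) < 1"

text \<open>The classes below are sets of total functions; membership only depends on the values
  in the unit disc.\<close>

definition H_hat :: "(complex \<Rightarrow> complex) set" where
  "H_hat = {f. \<exists>h g. harmonic_decomp f h g}"

text \<open>The determinant of the real derivative of \<open>f\<close>, with columns \<open>f\<^sub>x\<close> and \<open>f\<^sub>y\<close>.\<close>

definition jacobian :: "(complex \<Rightarrow> complex) \<Rightarrow> complex \<Rightarrow> real" where
  "jacobian f z =
     (let D = frechet_derivative f (at z) in Re (D 1) * Im (D \<i>) - Im (D 1) * Re (D \<i>))"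

definition sense_preserving_on :: "(complex \<Rightarrow> complex) \<Rightarrow> complex set \<Rightarrow> bool" where
  "sense_preserving_on f S \<longleftrightarrow> (\<forall>z\<in>S. f differentiable (at z) \<and> jacobian f z > 0)"

definition S_H_hat :: "(complex \<Rightarrow> complex) set" where
  "S_H_hat = {f \<in> H_hat. sense_preserving_on f (ball 0 1) \<and> inj_on f (ball 0 1)}"

definition half_line :: "complex set \<Rightarrow> bool" where
  "half_line R \<longleftrightarrow> (\<exists>p u. u \<noteq> 0 \<and> R = {p + of_real t * u |t. 0 \<le> (t::real)})"

definition close_to_convex :: "complex set \<Rightarrow> bool" where
  "close_to_convex S \<longleftrightarrow> open S \<and> connected S \<and> S \<noteq> {} \<and>
     (\<exists>\<R>. (\<forall>R\<in>\<R>. half_line R) \<and> \<Union>\<R> = - S \<and>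
          pairwise (\<lambda>R R'. disjnt (rel_interior R) (rel_interior R')) \<R>)"

definition C_H_hat :: "(complex \<Rightarrow> complex) set" where
  "C_H_hat = {f \<in> S_H_hat. close_to_convex (f ` ball 0 1)}"

definition wright_coeff :: "real \<Rightarrow> real \<Rightarrow> real \<Rightarrow> real \<Rightarrow> nat \<Rightarrow> real" where
  "wright_coeff a b c d n =
     (if n = 0 then 0 else if n = 1 then 1
      else Gamma a * Gamma c / (Gamma (a + real (n - 1) * b) * Gamma (c + real (n - 1) * d)))"

definition wright :: "real \<Rightarrow> real \<Rightarrow> real \<Rightarrow> real \<Rightarrow> complex \<Rightarrow> complex" where
  "wright a b c d z = (\<Sum>n. of_real (wright_coeff a b c d n) * z ^ n)"

text \<open>The coefficients of the \<open>k\<close>-th termwise derivative of the Wright series, which are also its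
  terms at \<open>z = 1\<close>, and the value of that derivative at \<open>z = 1\<close>. The point \<open>1\<close> may lie on the circle
  of convergence, so summability has to be required where the value is used.\<close>

definition wright_deriv_coeff :: "nat \<Rightarrow> real \<Rightarrow> real \<Rightarrow> real \<Rightarrow> real \<Rightarrow> nat \<Rightarrow> real" where
  "wright_deriv_coeff k a b c d = (diffs ^^ k) (wright_coeff a b c d)"

definition wright_deriv_at_1 :: "nat \<Rightarrow> real \<Rightarrow> real \<Rightarrow> real \<Rightarrow> real \<Rightarrow> real" where
  "wright_deriv_at_1 k a b c d = (\<Sum>n. wright_deriv_coeff k a b c d n)"

definition hadamard :: "(complex \<Rightarrow> complex) \<Rightarrow> (complex \<Rightarrow> complex) \<Rightarrow> complex \<Rightarrow> complex" where
  "hadamard F G z =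
     (\<Sum>n. fps_nth (fps_expansion F 0) n * fps_nth (fps_expansion G 0) n * z ^ n)"

text \<open>The operator acts on \<open>f = h + cnj g\<close> through \<open>h\<close> and \<open>g\<close>, which \<open>f\<close> determines
  uniquely on the disc because \<open>g 0 = 0\<close>.\<close>

definition L_op :: "real \<Rightarrow> real \<Rightarrow> real \<Rightarrow> real \<Rightarrow> real \<Rightarrow> real \<Rightarrow> real \<Rightarrow> real \<Rightarrow> complex \<Rightarrow>
    (complex \<Rightarrow> complex) \<Rightarrow> (complex \<Rightarrow> complex) \<Rightarrow> complex \<Rightarrow> complex" where
  "L_op \<alpha>\<^sub>1 \<beta>\<^sub>1 \<gamma>\<^sub>1 \<delta>\<^sub>1 \<alpha>\<^sub>2 \<beta>\<^sub>2 \<gamma>\<^sub>2 \<delta>\<^sub>2 \<sigma> h g z =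
     hadamard h (wright \<alpha>\<^sub>1 \<beta>\<^sub>1 \<gamma>\<^sub>1 \<delta>\<^sub>1) z + cnj (\<sigma> * hadamard g (wright \<alpha>\<^sub>2 \<beta>\<^sub>2 \<gamma>\<^sub>2 \<delta>\<^sub>2) z)"

end

theory Submission
  imports Defs "HOL-Real_Asymp.Real_Asymp"
begin

text \<open>
  The theorem combines sharp coefficient bounds for close-to-convex harmonic maps with a
  sufficient coefficient condition for close-to-convexity.

  For the bounds, an affine change of variables reduces to \<open>g' 0 = 0\<close>, and cutting the image by a
  square, shrinking it and precomposing with a Riemann map reduces to a bounded image in which every
  boundary point can be joined to infinity by a segment followed by a ray, no two of these crossing.
  The directions of the rays are then monotone along the circle, so there are antipodal points
  \<open>\<plusminus> cis t\<close> and an angle \<open>s\<close> with all directions over one arc in \<open>[s, s + pi]\<close> and all directions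
  over the other in \<open>[s + pi, s + 2 * pi]\<close>. Comparing \<open>F\<close> with its composition with the hyperbolic
  flow between these points, the argument of the difference lies in \<open>[s - pi, s + pi]\<close> at the
  boundary, hence inside by a Phragmen-Lindelof argument. In the limit of small times
  \<open>cis (t - s) * (h' - cis (2 * s) * g') * (1 - cis (- 2 * t) * z\<^sup>2)\<close> is constant or omits the negative real
  axis, so it is the square of a function with positive real part up to a factor, and the bounds
  \<open>(n + 1) * (2 * n + 1) / 6\<close> and \<open>(n - 1) * (2 * n - 1) / 6\<close> follow from Caratheodory's lemma.

  For the sufficient condition, \<open>f - id\<close> is a contraction of the closed disc; the normals to the
  unit circle are carried to non-crossing rays, which fill the complement of the image by Brouwer's
  fixed point theorem.
\<close>

section \<open>The Caratheodory coefficient lemma\<close>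

text \<open>\<open>F\<close> is not analytic, but \<open>Im (cis (- s) * F)\<close> is the imaginary
  part of the analytic \<open>cis (- s) * h - cis s * g\<close>; so a condition on arguments around
  the direction \<open>s\<close> becomes one on \<open>h' - cis (2 * s) * g'\<close>. The factor
  \<open>1 - cis (- 2 * t) * z\<^sup>2\<close> is, up to \<open>cis t\<close>, the velocity of the
  flow at time 0. The obstacle is the boundary, since \<open>f\<close> need not extend to the
  circle. Shrinking makes the closure of the new image a compact subset of the old one, where the
  inverse of \<open>f\<close> is continuous; \<open>f\<close> after the Riemann map then has a limit
  wherever the Riemann map has one. But the new frontier points lie on no given half-line. Each
  borrows the ray of a nearest point of the old complement, and the segment leads there. The
  coefficient bounds multiply three majorants: (1 + z)^2 / (1 - z)^2 for the square, 1 / (1 - z^2)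
  for the flow factor and 1 / (1 - z) for passing from \<open>h' - cis (2 * s) * g'\<close> to
  \<open>h'\<close>. Up to |h' 0| their product (1 + z) / (1 - z)^4 majorizes
  \<open>h'\<close>.\<close>

lemma has_fps_expansion_transfer:
  assumes "f has_fps_expansion F" "eventually (\<lambda>z. f z = g z) (nhds 0)"
  shows "g has_fps_expansion F"
  using has_fps_expansion_cong[OF assms(2) refl, of F] assms(1) by simp

text \<open>Cauchy's inequality on circles of radius r < 1, followed by r -> 1, because nothing is
  known on the unit circle itself.\<close>

lemma norm_fps_nth_bounded_holomorphic:
  assumes hol: "f holomorphic_on ball 0 1" and F: "f has_fps_expansion F"
    and bd: "\<And>z. norm z < 1 \<Longrightarrow> norm (f z) \<le> B"
  shows "norm (fps_nth F n) \<le> B"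
proof -
  have est: "norm (fps_nth F n) * r ^ n \<le> B" if r: "0 < r" "r < 1" for r :: real
  proof -
    have "norm ((deriv ^^ n) f 0) \<le> fact n * B / r ^ n"
    proof (rule Cauchy_inequality)
      show "f holomorphic_on ball 0 r"
        using hol r by (rule_tac holomorphic_on_subset) auto
      show "continuous_on (cball 0 r) f"
        by (rule holomorphic_on_imp_continuous_on, rule holomorphic_on_subset[OF hol]) (use r in auto)
    qed (use r bd in auto)
    then show ?thesis
      using r by (simp add: fps_nth_fps_expansion[OF F] norm_divide field_simps)
  qed
  have "((\<lambda>r. norm (fps_nth F n) * r ^ n) \<longlongrightarrow> norm (fps_nth F n) * 1 ^ n) (at_left (1::real))"
    by (intro tendsto_intros)
  moreover have "eventually (\<lambda>r. norm (fps_nth F n) * r ^ n \<le> B) (at_left (1::real))"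
    unfolding eventually_at_left_field by (rule exI[of _ 0]) (auto intro: est)
  ultimately show ?thesis
    by (intro tendsto_upperbound[where F = "at_left (1::real)"]) auto
qed

lemma sum_cis_multiples:
  assumes "0 < k" "k < n"
  shows "(\<Sum>j<n. cis (2 * pi * real j / real n) ^ k) = 0"
proof -
  define w where "w = cis (2 * pi * real k / real n)"
  have eq: "cis (2 * pi * real j / real n) ^ k = w ^ j" for j
    by (simp add: w_def Complex.DeMoivre algebra_simps)
  have "w \<noteq> 1"
  proof
    assume "w = 1"
    then have "cos (2 * pi * real k / real n) = 1"
      by (metis w_def cis.simps(1) one_complex.simps(1))
    then obtain m :: int where "2 * pi * real k / real n = real_of_int m * 2 * pi"
      using cos_one_2pi_int by auto
    then have "real k = real_of_int m * real n"
      using assms by (simp add: field_simps)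
    then have "int k = m * int n"
      by (metis of_int_eq_iff of_int_mult of_int_of_nat_eq)
    then show False
      using assms by (metis int_dvd_int_iff dvd_triv_right nat_dvd_not_less)
  qed
  moreover have "w ^ n = 1"
    using assms cis_multiple_2pi[of "real k"] by (simp add: w_def Complex.DeMoivre)
  ultimately show ?thesis
    by (simp add: eq sum_gp_strict)
qed

text \<open>Averaging \<open>P\<close> over the n-th roots of unity removes the coefficients of
  index 1, ..., n - 1 and keeps the n-th. The Cayley transform \<open>w\<close> of the average is
  bounded by 1 and starts at index n, where its coefficient is that of \<open>P\<close> divided by
  \<open>2 * Re (P 0)\<close>; the plain Cauchy bound for \<open>w\<close> then gives the sharp
  constant.\<close>

lemma caratheodory_coeff_strict:
  assumes hol: "P holomorphic_on ball 0 1" and F: "P has_fps_expansion p"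
    and pos: "\<And>z. norm z < 1 \<Longrightarrow> Re (P z) > 0" and n: "n \<ge> 1"
  shows "norm (fps_nth p n) \<le> 2 * Re (P 0)"
proof -
  define c where "c j = cis (2 * pi * real j / real n)" for j :: nat
  define Q where "Q z = (\<Sum>j<n. P (c j * z)) / of_nat n" for z
  define q where "q = fps_const (1 / of_nat n) * (\<Sum>j<n. p oo (fps_const (c j) * fps_X))"
  define w where "w z = (Q z - P 0) / (Q z + cnj (P 0))" for z
  have nc: "norm (c j) = 1" for j by (simp add: c_def)
  have P0: "fps_nth p 0 = P 0" using fps_nth_fps_expansion[OF F, of 0] by simp
  have qn: "fps_nth q k = (\<Sum>j<n. c j ^ k) * fps_nth p k / of_nat n" for k
    by (simp add: q_def fps_compose_linear fps_sum_nth sum_distrib_right)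
  have q0: "fps_nth q 0 = P 0" using n by (simp add: qn P0)
  have qk: "fps_nth q k = 0" if "0 < k" "k < n" for k
    using sum_cis_multiples[OF that] by (simp add: qn c_def)
  have cn: "c j ^ n = 1" for j
    using n cis_multiple_2pi[of "real j"] by (simp add: c_def Complex.DeMoivre)
  have qnn: "fps_nth q n = fps_nth p n" using n by (simp add: qn cn)
  have Qq: "Q has_fps_expansion q"
  proof -
    have "(\<lambda>z. (1 / of_nat n) * (\<Sum>j<n. (P \<circ> (\<lambda>z. c j * z)) z)) has_fps_expansion q"
      unfolding q_def by (intro fps_expansion_intros F) simp_all
    then show ?thesis by (simp add: Q_def[abs_def])
  qed
  have holP: "(\<lambda>z. P (c j * z)) holomorphic_on ball 0 1" for j
  proof -
    have "(P \<circ> (\<lambda>z. c j * z)) holomorphic_on ball 0 1"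
      by (rule holomorphic_on_compose_gen[OF _ hol]) (auto intro!: holomorphic_intros simp: norm_mult nc)
    then show ?thesis by (simp add: o_def)
  qed
  have holQ: "Q holomorphic_on ball 0 1"
    unfolding Q_def using n by (intro holomorphic_intros holP) auto
  have ReQ: "Re (Q z) > 0" if "norm z < 1" for z
  proof -
    have "(\<Sum>j<n. Re (P (c j * z))) > 0"
      using n that by (intro sum_pos pos) (auto simp: norm_mult nc lessThan_empty_iff)
    then show ?thesis using n by (simp add: Q_def)
  qed
  have R0: "Re (P 0) > 0" by (simp add: pos)
  have nz: "Q z + cnj (P 0) \<noteq> 0" if "norm z < 1" for z
    using ReQ[OF that] R0 by (auto simp: complex_eq_iff)
  have holw: "w holomorphic_on ball 0 1"
    unfolding w_def by (intro holomorphic_intros holQ) (use nz in auto)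
  obtain W where W: "w has_fps_expansion W"
    using has_fps_expansion_fps_expansion[OF _ _ holw] by auto
  have w1: "norm (w z) \<le> 1" if "norm z < 1" for z
  proof -
    have "norm (Q z - P 0) \<le> norm (Q z + cnj (P 0))"
    proof -
      have "\<bar>Re (Q z) - Re (P 0)\<bar> \<le> \<bar>Re (Q z) + Re (P 0)\<bar>"
        using ReQ[OF that] R0 by linarith
      then have "(Re (Q z) - Re (P 0))\<^sup>2 \<le> (Re (Q z) + Re (P 0))\<^sup>2"
        by (simp only: abs_le_square_iff)
      then show ?thesis unfolding cmod_def by simp
    qed
    then show ?thesis
      using nz[OF that] by (simp add: w_def norm_divide divide_le_eq_1)
  qed
  have eqF: "W * (q + fps_const (cnj (P 0))) = q - fps_const (P 0)"
  proof (rule fps_expansion_unique_complex)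
    show "(\<lambda>z. w z * (Q z + cnj (P 0))) has_fps_expansion W * (q + fps_const (cnj (P 0)))"
      by (intro fps_expansion_intros W Qq)
    have "(\<lambda>z. Q z - P 0) has_fps_expansion q - fps_const (P 0)"
      by (intro fps_expansion_intros Qq)
    moreover have "eventually (\<lambda>z. z \<in> ball 0 1) (nhds (0::complex))"
      by (intro eventually_nhds_in_open) auto
    then have "eventually (\<lambda>z. Q z - P 0 = w z * (Q z + cnj (P 0))) (nhds 0)"
      by eventually_elim (use nz in \<open>auto simp: w_def\<close>)
    ultimately show "(\<lambda>z. w z * (Q z + cnj (P 0))) has_fps_expansion q - fps_const (P 0)"
      by (rule has_fps_expansion_transfer)
  qed
  define s where "s = q + fps_const (cnj (P 0))"
  have s0: "fps_nth s 0 = 2 * Re (P 0)" using q0 by (simp add: s_def complex_eq_iff)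
  have s0': "fps_nth s 0 \<noteq> 0" using s0 R0 by simp
  \<comment> \<open>Coefficients are compared in \<open>W * s = q - fps_const (P 0)\<close>: the
    constant term of \<open>s\<close> is nonzero and the right side has no terms below n.\<close>
  have Wk: "fps_nth W k = 0" if "k < n" for k
    using that
  proof (induction k rule: less_induct)
    case (less k)
    have "fps_nth (W * s) k = fps_nth W k * fps_nth s 0"
    proof -
      have "fps_nth (W * s) k = (\<Sum>i=0..k. fps_nth W i * fps_nth s (k - i))"
        by (simp add: fps_mult_nth)
      also have "\<dots> = (\<Sum>i\<in>{k}. fps_nth W i * fps_nth s (k - i))"
        by (rule sum.mono_neutral_right) (use less in auto)
      finally show ?thesis by simp
    qed
    moreover have "fps_nth (W * s) k = 0"
      unfolding s_def eqF using qk[of k] q0 less.prems by (cases "k = 0") auto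
    ultimately show ?case using s0' by simp
  qed
  have "fps_nth (W * s) n = fps_nth W n * fps_nth s 0"
  proof -
    have "fps_nth (W * s) n = (\<Sum>i=0..n. fps_nth W i * fps_nth s (n - i))"
      by (simp add: fps_mult_nth)
    also have "\<dots> = (\<Sum>i\<in>{n}. fps_nth W i * fps_nth s (n - i))"
      by (rule sum.mono_neutral_right) (use Wk in auto)
    finally show ?thesis by simp
  qed
  moreover have "fps_nth (W * s) n = fps_nth p n"
    unfolding s_def eqF using n qnn by auto
  ultimately have "norm (fps_nth p n) = norm (fps_nth W n) * (2 * Re (P 0))"
    using R0 s0 by (simp add: norm_mult)
  also have "\<dots> \<le> 1 * (2 * Re (P 0))"
    using norm_fps_nth_bounded_holomorphic[OF holw W w1] R0 by (intro mult_right_mono) auto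
  finally show ?thesis by simp
qed

lemma caratheodory_coeff:
  assumes hol: "P holomorphic_on ball 0 1" and F: "P has_fps_expansion p"
    and pos: "\<And>z. norm z < 1 \<Longrightarrow> Re (P z) \<ge> 0" and n: "n \<ge> 1"
  shows "norm (fps_nth p n) \<le> 2 * Re (P 0)"
proof (rule field_le_epsilon)
  fix e :: real assume e: "e > 0"
  have "(\<lambda>z. P z + of_real (e/2)) has_fps_expansion p + fps_const (of_real (e/2))"
    by (intro fps_expansion_intros F)
  then have "norm (fps_nth (p + fps_const (of_real (e/2))) n) \<le> 2 * Re (P 0 + of_real (e/2))"
    using pos e n
    by (intro caratheodory_coeff_strict[where P = "\<lambda>z. P z + of_real (e/2)"] holomorphic_intros hol)
       (auto intro: add_nonneg_pos)
  then show "norm (fps_nth p n) \<le> 2 * Re (P 0) + e"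
    using n e by (cases n) auto
qed

section \<open>Coefficient bounds from a slit plane\<close>

lemma fps_mult_nth_le:
  assumes "\<And>i. norm (fps_nth F i) \<le> a i" "\<And>i. norm (fps_nth G i) \<le> b i" 
  shows "norm (fps_nth (F * G) n :: complex) \<le> (\<Sum>i\<le>n. a i * b (n - i))"
proof -
  have "norm (fps_nth (F * G) n) \<le> (\<Sum>i\<le>n. norm (fps_nth F i * fps_nth G (n - i)))"
    unfolding fps_mult_nth atMost_atLeast0 by (rule norm_sum)
  also have "\<dots> \<le> (\<Sum>i\<le>n. a i * b (n - i))"
    unfolding norm_mult
    by (intro sum_mono mult_mono assms) (auto intro: order_trans[OF norm_ge_zero assms(1)])
  finally show ?thesis .
qed

text \<open>By Caratheodory's lemma \<open>P\<close> is majorized by |P 0| (1 + z) / (1 - z), and (1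
  + z)^2 / (1 - z)^2 has the coefficients 1, 4, 8, 12, ...\<close>

lemma norm_fps_nth_square_right_half_plane:
  assumes hol: "P holomorphic_on ball 0 1" and F: "P has_fps_expansion p"
    and pos: "\<And>z. norm z < 1 \<Longrightarrow> Re (P z) \<ge> 0" 
  shows "norm (fps_nth (p ^ 2) n) \<le> (if n = 0 then 1 else 4 * real n) * norm (P 0) ^ 2"
proof -
  define a where "a = norm (P 0)"
  have P0: "fps_nth p 0 = P 0" using fps_nth_fps_expansion[OF F, of 0] by simp
  have le: "norm (fps_nth p i) \<le> (if i = 0 then a else 2 * a)" for i
  proof (cases "i = 0")
    case False
    then have "norm (fps_nth p i) \<le> 2 * Re (P 0)"
      by (intro caratheodory_coeff[OF hol F pos]) auto
    also have "\<dots> \<le> 2 * a" using complex_Re_le_cmod[of "P 0"] by (simp add: a_def)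
    finally show ?thesis using False by simp
  qed (simp add: P0 a_def)
  have "norm (fps_nth (p ^ 2) n) \<le> (\<Sum>i\<le>n. (if i = 0 then a else 2 * a) * (if n - i = 0 then a else 2 * a))"
    unfolding power2_eq_square by (rule fps_mult_nth_le; rule le)
  also have "\<dots> = (if n = 0 then 1 else 4 * real n) * a ^ 2"
  proof (cases "n = 0")
    case False
    then obtain m where m: "n = Suc m" by (cases n) auto
    have "(\<Sum>i\<le>n. (if i = 0 then a else 2 * a) * (if n - i = 0 then a else 2 * a)) =
       (\<Sum>i\<in>{0,n}. (if i = 0 then a else 2 * a) * (if n - i = 0 then a else 2 * a)) +
       (\<Sum>i\<in>{1..<n}. (if i = 0 then a else 2 * a) * (if n - i = 0 then a else 2 * a))"
    proof -
      have "{..n} = {0,n} \<union> {1..<n}" using False by auto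
      then show ?thesis by (simp only:) (rule sum.union_disjoint, use False in auto)
    qed
    also have "(\<Sum>i\<in>{1..<n}. (if i = 0 then a else 2 * a) * (if n - i = 0 then a else 2 * a)) 
      = (\<Sum>i\<in>{1..<n}. 4 * a ^ 2)"
      by (intro sum.cong) (auto simp: power2_eq_square)
    finally show ?thesis using False m by (simp add: power2_eq_square algebra_simps del: sum.atMost_Suc)
  qed (simp add: power2_eq_square)
  finally show ?thesis by (simp add: a_def)
qed

text \<open>Coefficients of (1 + z)^2 / (1 - z)^2 times 1 / (1 - z^2), a product that simplifies to
  (1 + z) / (1 - z)^3. The induction goes in steps of two because of the parity factor.\<close>

lemma sum_geometric_even:
  "(\<Sum>i\<le>n. (if i = 0 then 1 else 4 * real i) * (if even (n - i) then 1 else 0)) = (real n + 1) ^ 2"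
proof (induction n rule: less_induct)
  case (less n)
  consider "n = 0" | "n = 1" | m where "n = Suc (Suc m)"
    by (metis One_nat_def not0_implies_Suc)
  then show ?case
  proof cases
    case 3
    have "(\<Sum>i\<le>n. (if i = 0 then 1 else 4 * real i) * (if even (n - i) then 1 else 0)) =
      (\<Sum>i\<le>m. (if i = 0 then 1 else 4 * real i) * (if even (m - i) then 1 else 0)) + 4 * real n"
    proof -
      have "(\<Sum>i\<le>m. (if i = 0 then 1 else 4 * real i) * (if even (n - i) then 1 else 0)) =
        (\<Sum>i\<le>m. (if i = 0 then 1 else 4 * real i) * (if even (m - i) then 1 else 0 :: real))"
        unfolding 3 by (intro sum.cong) (auto simp: Suc_diff_le)
      then show ?thesis unfolding 3 sum.atMost_Suc by simp
    qed
    also have "\<dots> = (real m + 1) ^ 2 + 4 * real n" using less.IH[of m] 3 by simp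
    finally show ?thesis using 3 by (simp add: power2_eq_square algebra_simps)
  qed auto
qed

lemma sum_squares_Suc: "(\<Sum>i\<le>n. (real i + 1) ^ 2) = (real n + 1) * (real n + 2) * (2 * real n + 3) / 6"
  by (induction n) (auto simp: field_simps power2_eq_square)

lemma nat_times_fps_nth_deriv:
  fixes F :: "complex fps"
  shows "n \<ge> 1 \<Longrightarrow> real n * norm (fps_nth F n) = norm (fps_nth (fps_deriv F) (n - 1))"
  by (cases n) (auto simp: norm_mult simp del: of_nat_Suc)

text \<open>Here \<open>(h' - \<epsilon> g') (1 - x\<^sup>2 z\<^sup>2)\<close> is the square of a function with positive real part up to a
  constant factor, and dividing by \<open>1 - \<epsilon> g' / h'\<close> costs one more factor \<open>1 / (1 - z)\<close>.\<close>

lemma coefficient_bounds_from_slit: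
  fixes h g N :: "complex \<Rightarrow> complex" and \<epsilon> x :: complex
  assumes holh: "h holomorphic_on ball 0 1" and holg: "g holomorphic_on ball 0 1"
    and H: "h has_fps_expansion H" and G: "g has_fps_expansion G"
    and lt: "\<And>z. norm z < 1 \<Longrightarrow> norm (deriv g z) < norm (deriv h z)"
    and g0: "deriv g 0 = 0"
    and eps: "norm \<epsilon> = 1" "norm x = 1" "norm c = 1"
    and N: "\<And>z. norm z < 1 \<Longrightarrow> N z = c * (deriv h z - \<epsilon> * deriv g z) * (1 - x\<^sup>2 * z\<^sup>2)"
    and slit: "(\<forall>z\<in>ball 0 1. N z = N 0) \<or> (\<forall>z\<in>ball 0 1. N z \<notin> \<real>\<^sub>\<le>\<^sub>0)"
    and n: "n \<ge> 1"
  shows "norm (fps_nth H n) \<le> norm (deriv h 0) * (real n + 1) * (2 * real n + 1) / 6"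
    and "norm (fps_nth G n) \<le> norm (deriv h 0) * (real n - 1) * (2 * real n - 1) / 6"
proof -
  define a where "a = norm (deriv h 0)"
  define K where "K = fps_deriv H - fps_const \<epsilon> * fps_deriv G"
  \<comment> \<open>\<open>X\<close> is the expansion of
    \<open>1 / (1 - x\<^sup>2 * z\<^sup>2)\<close>.\<close>
  define X where "X = Abs_fps (\<lambda>n. if even n then x ^ n else 0)"
  define M where "M = fps_const c * K * (1 - fps_const (x ^ 2) * fps_X ^ 2)"
  define om where "om z = deriv g z / deriv h z" for z
  define k where "k z = deriv h z - \<epsilon> * deriv g z" for z
  have ev: "eventually (\<lambda>z. z \<in> ball 0 1) (nhds (0::complex))"
    by (intro eventually_nhds_in_open) auto
  have c0: "c \<noteq> 0" "\<epsilon> \<noteq> 0" using eps by auto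
  have hp0: "deriv h z \<noteq> 0" if "norm z < 1" for z
    using lt[OF that] by auto
  have dH: "deriv h has_fps_expansion fps_deriv H" and dG: "deriv g has_fps_expansion fps_deriv G"
    by (intro fps_expansion_intros H G)+
  have kK: "k has_fps_expansion K"
    unfolding k_def K_def by (intro fps_expansion_intros dH dG)
  have hold: "deriv h holomorphic_on ball 0 1" "deriv g holomorphic_on ball 0 1"
    by (intro holomorphic_deriv holh holg; simp)+
  have holN: "N holomorphic_on ball 0 1"
    by (rule holomorphic_transform[where f = "\<lambda>z. c * (deriv h z - \<epsilon> * deriv g z) * (1 - x\<^sup>2 * z\<^sup>2)"])
       (auto intro!: holomorphic_intros hold simp: N)
  have NM: "N has_fps_expansion M"
  proof -
    have "(\<lambda>z. c * k z * (1 - x\<^sup>2 * z\<^sup>2)) has_fps_expansion M"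
      unfolding M_def by (intro fps_expansion_intros kK)
    moreover have "eventually (\<lambda>z. c * k z * (1 - x\<^sup>2 * z\<^sup>2) = N z) (nhds 0)"
      using ev by eventually_elim (auto simp: N k_def)
    ultimately show ?thesis by (rule has_fps_expansion_transfer)
  qed
  have N0: "norm (N 0) = a" using eps g0 by (simp add: N norm_mult a_def)
  have Mle: "norm (fps_nth M n) \<le> (if n = 0 then 1 else 4 * real n) * a" for n
    using slit
  proof
    assume const: "\<forall>z\<in>ball 0 1. N z = N 0"
    have "(\<lambda>z. N 0) has_fps_expansion fps_const (N 0)" by simp
    moreover have "eventually (\<lambda>z. N 0 = N z) (nhds 0)"
      using ev by (rule eventually_mono) (rule sym, rule const[rule_format])
    ultimately have "N has_fps_expansion fps_const (N 0)" by (rule has_fps_expansion_transfer)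
    then have "M = fps_const (N 0)" using NM fps_expansion_unique_complex by blast
    then show ?thesis using N0 by (auto simp: a_def)
  next
    assume slit: "\<forall>z\<in>ball 0 1. N z \<notin> \<real>\<^sub>\<le>\<^sub>0"
    define P where "P z = csqrt (N z)" for z
    have holP: "P holomorphic_on ball 0 1"
      unfolding P_def by (intro holomorphic_intros holN) (use slit in auto)
    obtain p where p: "P has_fps_expansion p"
      using has_fps_expansion_fps_expansion[OF _ _ holP] by auto
    have "(\<lambda>z. P z ^ 2) has_fps_expansion p ^ 2" by (intro fps_expansion_intros p)
    then have "M = p ^ 2"
      using NM fps_expansion_unique_complex by (simp add: P_def)
    moreover have "norm (fps_nth (p ^ 2) n) \<le> (if n = 0 then 1 else 4 * real n) * norm (P 0) ^ 2"
      using csqrt_principal by (intro norm_fps_nth_square_right_half_plane[OF holP p]) (auto simp: P_def less_eq_real_def)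
    moreover have "norm (P 0) ^ 2 = a"
      by (simp add: P_def N0[symmetric] norm_power[symmetric])
    ultimately show ?thesis by simp
  qed
  have X1: "(1 - fps_const (x ^ 2) * fps_X ^ 2) * X = 1"
  proof (rule fps_ext)
    fix n show "fps_nth ((1 - fps_const (x ^ 2) * fps_X ^ 2) * X) n = fps_nth 1 n"
      by (cases "n < 2"; cases n)
         (auto simp: X_def left_diff_distrib mult.assoc fps_X_power_mult_nth power2_eq_square[symmetric] less_Suc_eq 
            simp flip: power_add)
  qed
  have Xle: "norm (fps_nth X n) \<le> (if even n then 1 else 0)" for n
    using eps by (auto simp: X_def norm_power)
  have Kle: "norm (fps_nth K n) \<le> a * (real n + 1) ^ 2" for n
  proof -
    have "fps_const c * K = M * X"
      unfolding M_def mult.assoc X1 by simp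
    then have "norm (fps_nth K n) = norm (fps_nth (M * X) n)"
      by (metis eps(3) fps_mult_left_const_nth mult_1 norm_mult)
    also have "\<dots> \<le> (\<Sum>i\<le>n. ((if i = 0 then 1 else 4 * real i) * a) * (if even (n - i) then 1 else 0))"
      by (rule fps_mult_nth_le) (use Mle Xle in auto)
    also have "\<dots> = a * (\<Sum>i\<le>n. (if i = 0 then 1 else 4 * real i) * (if even (n - i) then 1 else 0))"
      by (simp add: sum_distrib_left mult_ac)
    finally show ?thesis by (simp only: sum_geometric_even)
  qed
  have om: "norm (\<epsilon> * om z) < 1" if "norm z < 1" for z
    using lt[OF that] eps hp0[OF that] by (simp add: om_def norm_mult norm_divide)
  have nz: "1 - \<epsilon> * om z \<noteq> 0" if "norm z < 1" for z
    using om[OF that] by (metis eq_iff_diff_eq_0 less_irrefl norm_one)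
  have holom: "om holomorphic_on ball 0 1"
    unfolding om_def by (intro holomorphic_intros hold) (use hp0 in auto)
  \<comment> \<open>\<open>R = (1 + \<epsilon> om) / (1 - \<epsilon> om)\<close> has nonnegative
    real part, and \<open>1 / (1 - \<epsilon> om) = (R + 1) / 2\<close>; so Caratheodory's lemma
    bounds every coefficient of the latter by 1.\<close>
  define R where "R z = 2 / (1 - \<epsilon> * om z) - 1" for z
  have holR: "R holomorphic_on ball 0 1"
    unfolding R_def by (intro holomorphic_intros holom) (use nz in auto)
  obtain r where r: "R has_fps_expansion r"
    using has_fps_expansion_fps_expansion[OF _ _ holR] by auto
  have om0: "om 0 = 0" by (simp add: om_def g0)
  have R0: "R 0 = 1" "fps_nth r 0 = 1" using fps_nth_fps_expansion[OF r, of 0] by (auto simp: R_def om0)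
  have RR: "Re (R z) \<ge> 0" if z: "norm z < 1" for z
  proof -
    define u where "u = \<epsilon> * om z"
    have u: "norm u < 1" "1 - u \<noteq> 0" using om[OF z] nz[OF z] by (auto simp: u_def)
    have "R z = (1 + u) / (1 - u)" using u by (simp add: R_def u_def field_simps)
    also have "\<dots> = (1 + u) * cnj (1 - u) / of_real ((cmod (1 - u))\<^sup>2)"
      by (rule complex_div_cnj)
    finally have "Re (R z) = Re ((1 + u) * cnj (1 - u)) / (cmod (1 - u))\<^sup>2"
      by (simp only: Re_divide_of_real)
    moreover have "Re ((1 + u) * cnj (1 - u)) = 1 - (cmod u) ^ 2"
      unfolding cmod_power2 by (simp add: algebra_simps power2_eq_square)
    moreover have "(cmod u)^2 \<le> 1" using u by (simp add: abs_square_le_1)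
    ultimately show ?thesis by simp
  qed
  define C where "C = fps_const (1/2) * (r + 1)"
  \<comment> \<open>\<open>C'\<close> stands for \<open>\<epsilon> om / (1 - \<epsilon> om)\<close>.
    Its constant term is 0 since \<open>om 0 = 0\<close>, so the sum for \<open>g\<close> stops one
    term before that for \<open>h\<close>.\<close>
  define C' where "C' = fps_const (1/2) * (r - 1)"
  have Cn: "norm (fps_nth C n) \<le> 1" for n
  proof (cases "n = 0")
    case False
    then have "norm (fps_nth r n) \<le> 2 * Re (R 0)"
      by (intro caratheodory_coeff[OF holR r RR]) auto
    then show ?thesis using False by (simp add: C_def R0 norm_mult)
  qed (simp add: C_def R0)
  have Cn': "norm (fps_nth C' n) \<le> (if n = 0 then 0 else 1)" for n
    using Cn[of n] by (auto simp: C_def C'_def R0)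
  have "fps_deriv H = K * C"
  proof (rule fps_expansion_unique_complex[OF dH])
    have "(\<lambda>z. k z * ((1/2) * (R z + 1))) has_fps_expansion K * C"
      unfolding C_def by (intro fps_expansion_intros kK r)
    moreover have "eventually (\<lambda>z. k z * ((1/2) * (R z + 1)) = deriv h z) (nhds 0)"
      using ev
    proof eventually_elim
      case (elim z)
      then have z: "norm z < 1" by simp
      have "k z = deriv h z * (1 - \<epsilon> * om z)" using hp0[OF z] by (simp add: k_def om_def field_simps)
      then show ?case using nz[OF z] by (simp add: R_def)
    qed
    ultimately show "deriv h has_fps_expansion K * C" by (rule has_fps_expansion_transfer)
  qed
  then have Hn: "norm (fps_nth (fps_deriv H) n) \<le> (\<Sum>i\<le>n. a * (real i + 1) ^ 2 * 1)" for n
    using fps_mult_nth_le[of K "\<lambda>i. a * (real i + 1) ^ 2" C "\<lambda>_. 1" n] Kle Cn by simp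
  have "fps_const \<epsilon> * fps_deriv G = K * C'"
  proof (rule fps_expansion_unique_complex)
    show "(\<lambda>z. \<epsilon> * deriv g z) has_fps_expansion fps_const \<epsilon> * fps_deriv G"
      by (intro fps_expansion_intros dG)
    have "(\<lambda>z. k z * ((1/2) * (R z - 1))) has_fps_expansion K * C'"
      unfolding C'_def by (intro fps_expansion_intros kK r)
    moreover have "eventually (\<lambda>z. k z * ((1/2) * (R z - 1)) = \<epsilon> * deriv g z) (nhds 0)"
      using ev
    proof eventually_elim
      case (elim z)
      then have z: "norm z < 1" by simp
      have "k z = deriv h z * (1 - \<epsilon> * om z)" using hp0[OF z] by (simp add: k_def om_def field_simps)
      moreover have "deriv h z * om z = deriv g z" using hp0[OF z] by (simp add: om_def)
      moreover have "(1/2) * (R z - 1) = \<epsilon> * om z / (1 - \<epsilon> * om z)"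
        using nz[OF z] by (simp add: R_def field_simps)
      ultimately have "k z * ((1/2) * (R z - 1)) = \<epsilon> * (deriv h z * om z)"
        using nz[OF z] by simp
      then show ?case using \<open>deriv h z * om z = deriv g z\<close> by simp
    qed
    ultimately show "(\<lambda>z. \<epsilon> * deriv g z) has_fps_expansion K * C'" by (rule has_fps_expansion_transfer)
  qed
  then have "norm (fps_nth (fps_deriv G) n) = norm (fps_nth (K * C') n)" for n
    by (metis eps(1) fps_mult_left_const_nth mult_1 norm_mult)
  then have Gn: "norm (fps_nth (fps_deriv G) n) \<le> (\<Sum>i\<le>n. a * (real i + 1) ^ 2 * (if n - i = 0 then 0 else 1))" for n
    using fps_mult_nth_le[of K "\<lambda>i. a * (real i + 1) ^ 2" C' "\<lambda>i. if i = 0 then 0 else 1" n] Kle Cn' by simp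
  have Hs: "(\<Sum>i\<le>n. a * (real i + 1) ^ 2 * 1) = a * ((real n + 1) * (real n + 2) * (2 * real n + 3) / 6)" for n
    by (simp only: sum_squares_Suc[symmetric] sum_distrib_left mult_1_right)
  have Gs: "(\<Sum>i\<le>n. a * (real i + 1) ^ 2 * (if n - i = 0 then 0 else 1)) =
      a * (real n * (real n + 1) * (2 * real n + 1) / 6)" for n
  proof -
    have "(\<Sum>i\<le>n. a * (real i + 1) ^ 2 * (if n - i = 0 then 0 else 1)) + a * (real n + 1) ^ 2 =
      (\<Sum>i\<le>n. a * (real i + 1) ^ 2 * 1)"
    proof -
      have "(\<Sum>i\<le>n. a * (real i + 1) ^ 2 * (if n - i = 0 then 0 else 1)) = (\<Sum>i<n. a * (real i + 1) ^ 2)"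
        unfolding lessThan_Suc_atMost[symmetric] sum.lessThan_Suc by (auto intro!: sum.cong)
      then show ?thesis unfolding lessThan_Suc_atMost[symmetric] sum.lessThan_Suc by simp
    qed
    then show ?thesis unfolding Hs by (simp add: field_simps power2_eq_square)
  qed
  have n1: "real (n - 1) = real n - 1" using n by simp
  have pos: "real n > 0" using n by simp
  have "real n * norm (fps_nth H n) \<le> real n * (a * (real n + 1) * (2 * real n + 1) / 6)"
    using Hn[of "n - 1"] unfolding nat_times_fps_nth_deriv[OF n] Hs n1 by (simp add: algebra_simps)
  then show "norm (fps_nth H n) \<le> norm (deriv h 0) * (real n + 1) * (2 * real n + 1) / 6"
    using pos unfolding a_def by (simp add: mult.assoc)
  have "real n * norm (fps_nth G n) \<le> real n * (a * (real n - 1) * (2 * real n - 1) / 6)"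
    using Gn[of "n - 1"] unfolding nat_times_fps_nth_deriv[OF n] Gs n1 by (simp add: algebra_simps)
  then show "norm (fps_nth G n) \<le> norm (deriv h 0) * (real n - 1) * (2 * real n - 1) / 6"
    using pos unfolding a_def by (simp add: mult.assoc)
qed

section \<open>A Phragmen-Lindelof principle in the disc\<close>

text \<open>On the circle conjugation is inversion, so the product of the real parts of two
  monomials is half the real part of their product plus half the real part of the product with one
  factor conjugated, again a monomial up to conjugation. Thus the real parts of polynomials form an
  algebra on the circle, as the Stone-Weierstrass theorem requires.\<close>

lemma Re_poly_mult_circle:
  fixes p q :: "complex poly"
  shows "\<exists>r. \<forall>z\<in>sphere 0 1. Re (poly p z) * Re (poly q z) = Re (poly r z)"
proof -
  define R where "R = {f :: complex \<Rightarrow> real. \<exists>r. \<forall>z\<in>sphere 0 1. f z = Re (poly r z)}"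
  have add: "(\<lambda>z. f z + g z) \<in> R" if fg: "f \<in> R" "g \<in> R" for f g
  proof -
    obtain a where a: "\<forall>z\<in>sphere 0 1. f z = Re (poly a z)" using fg(1) unfolding R_def by blast
    obtain b where b: "\<forall>z\<in>sphere 0 1. g z = Re (poly b z)" using fg(2) unfolding R_def by blast
    have "\<forall>z\<in>sphere 0 1. f z + g z = Re (poly (a + b) z)" using a b by simp
    then show ?thesis unfolding R_def by blast
  qed
  have sum: "finite A \<Longrightarrow> (\<And>i. i \<in> A \<Longrightarrow> f i \<in> R) \<Longrightarrow> (\<lambda>z. \<Sum>i\<in>A. f i z) \<in> R"
    for A :: "nat set" and f
  proof (induction A rule: finite_induct)
    case empty
    show ?case unfolding R_def by (auto intro: exI[of _ 0])
  next
    case (insert x F)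
    then show ?case using add[of "f x" "\<lambda>z. \<Sum>i\<in>F. f i z"] by simp
  qed
  have mono: "(\<lambda>z. Re (a * z ^ m) * Re (b * z ^ n)) \<in> R" for a b m n
  proof -
    define r where "r = monom (a * b / 2) (m + n) +
      (if m \<ge> n then monom (a * cnj b / 2) (m - n) else monom (cnj a * b / 2) (n - m))"
    have "Re (a * z ^ m) * Re (b * z ^ n) = Re (poly r z)" if z: "z \<in> sphere 0 1" for z
    proof -
      have zz: "z * cnj z = 1" using z by (simp add: complex_norm_square[symmetric])
      have "Re (a * z ^ m) * Re (b * z ^ n) = Re (a * z ^ m * (b * z ^ n) / 2 + a * z ^ m * cnj (b * z ^ n) / 2)"
      proof -
        have "Re X * Re Y = Re (X * Y / 2 + X * cnj Y / 2)" for X Y :: complex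
          by (simp add: field_simps)
        then show ?thesis by blast
      qed
      also have "a * z ^ m * (b * z ^ n) / 2 = poly (monom (a * b / 2) (m + n)) z"
        by (simp add: poly_monom power_add)
      also have "Re (\<dots> + a * z ^ m * cnj (b * z ^ n) / 2) = Re (poly r z)"
      proof (cases "m \<ge> n")
        case True
        then have "z ^ m * cnj z ^ n = z ^ (m - n) * (z * cnj z) ^ n"
          by (simp add: power_mult_distrib mult.assoc[symmetric] flip: power_add)
        then show ?thesis using True by (simp add: r_def poly_monom zz mult_ac)
      next
        case False
        then have "cnj (z ^ m * cnj z ^ n) = z ^ (n - m) * (z * cnj z) ^ m"
          by (simp add: power_mult_distrib mult.assoc[symmetric] flip: power_add)
        then have "cnj (a * z ^ m * cnj (b * z ^ n) / 2) = poly (monom (cnj a * b / 2) (n - m)) z"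
          by (simp add: poly_monom zz mult_ac)
        then have "Re (a * z ^ m * cnj (b * z ^ n) / 2) = Re (poly (monom (cnj a * b / 2) (n - m)) z)"
          by (metis complex_cnj(1) cnj.sel(1))
        then show ?thesis using False by (simp add: r_def)
      qed
      finally show ?thesis .
    qed
    then show ?thesis unfolding R_def by blast
  qed
  have "(\<lambda>z. \<Sum>i\<le>degree p. \<Sum>j\<le>degree q. Re (coeff p i * z ^ i) * Re (coeff q j * z ^ j)) \<in> R"
    by (intro sum mono) auto
  then obtain r where "\<forall>z\<in>sphere 0 1. (\<Sum>i\<le>degree p. \<Sum>j\<le>degree q. Re (coeff p i * z ^ i) * Re (coeff q j * z ^ j))
      = Re (poly r z)"
    unfolding R_def by blast
  moreover have "(\<Sum>i\<le>degree p. \<Sum>j\<le>degree q. Re (coeff p i * z ^ i) * Re (coeff q j * z ^ j)) =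
      Re (poly p z) * Re (poly q z)" for z
    by (simp add: poly_altdef sum_product)
  ultimately show ?thesis by auto
qed

text \<open>Takes the place of the Poisson integral: continuous boundary data are approximated by
  harmonic polynomials, for which the mean value property is elementary.\<close>

lemma Re_poly_approx_circle:
  fixes v :: "complex \<Rightarrow> real"
  assumes "continuous_on (sphere 0 1) v" "e > 0"
  obtains p where "\<And>z. z \<in> sphere 0 1 \<Longrightarrow> \<bar>v z - Re (poly p z)\<bar> < e"
proof -
  define R where "R = {f :: complex \<Rightarrow> real. \<exists>r. \<forall>z\<in>sphere 0 1. f z = Re (poly r z)}"
  have RI: "f \<in> R" if "\<And>z. z \<in> sphere 0 1 \<Longrightarrow> f z = Re (poly r z)" for f r
    using that unfolding R_def by blast
  have "\<exists>g\<in>R. \<forall>x\<in>sphere 0 1. \<bar>v x - g x\<bar> < e"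
  proof (rule function_ring_on.Stone_Weierstrass_basic[OF _ assms], unfold_locales)
    show "continuous_on (sphere 0 1) f" if f: "f \<in> R" for f
    proof -
      obtain a where a: "\<forall>z\<in>sphere 0 1. f z = Re (poly a z)" using f unfolding R_def by blast
      have "continuous_on (sphere 0 1) (\<lambda>z. Re (poly a z))" by (intro continuous_intros)
      then show ?thesis by (rule continuous_on_eq) (use a in simp)
    qed
    show "(\<lambda>x. f x + g x) \<in> R" if fg: "f \<in> R" "g \<in> R" for f g
    proof -
      obtain a where a: "\<forall>z\<in>sphere 0 1. f z = Re (poly a z)" using fg(1) unfolding R_def by blast
      obtain b where b: "\<forall>z\<in>sphere 0 1. g z = Re (poly b z)" using fg(2) unfolding R_def by blast
      show ?thesis by (rule RI[of _ "a + b"]) (use a b in simp)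
    qed
    show "(\<lambda>x. f x * g x) \<in> R" if fg: "f \<in> R" "g \<in> R" for f g
    proof -
      obtain a where a: "\<forall>z\<in>sphere 0 1. f z = Re (poly a z)" using fg(1) unfolding R_def by blast
      obtain b where b: "\<forall>z\<in>sphere 0 1. g z = Re (poly b z)" using fg(2) unfolding R_def by blast
      obtain r where r: "\<forall>z\<in>sphere 0 1. Re (poly a z) * Re (poly b z) = Re (poly r z)"
        using Re_poly_mult_circle by blast
      show ?thesis by (rule RI[of _ r]) (use a b r in simp)
    qed
    show "(\<lambda>_. c) \<in> R" for c by (rule RI[of _ "[:of_real c:]"]) simp
    show "\<exists>f\<in>R. f x \<noteq> f y" if "x \<noteq> y" for x y :: complex
    proof -
      have "(\<lambda>z. Re z) \<in> R" by (rule RI[of _ "[:0, 1:]"]) simp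
      moreover have "(\<lambda>z. Im z) \<in> R" by (rule RI[of _ "[:0, -\<i>:]"]) simp
      moreover have "Re x \<noteq> Re y \<or> Im x \<noteq> Im y" using that complex_eq_iff by blast
      ultimately show ?thesis by blast
    qed
  qed auto
  then obtain g where g: "g \<in> R" "\<forall>x\<in>sphere 0 1. \<bar>v x - g x\<bar> < e" by blast
  then obtain r where "\<forall>z\<in>sphere 0 1. g z = Re (poly r z)" unfolding R_def by blast
  with g(2) show ?thesis by (intro that[of r]) auto
qed

lemma has_integral_poly_cis:
  "((\<lambda>t. poly p (cis t)) has_integral (2 * pi * poly p 0)) {0..2*pi}"
proof -
  have one: "((\<lambda>t. cis t ^ n) has_integral (if n = 0 then 2 * pi else 0)) {0..2*pi}" for n
  proof (cases "n = 0")
    case True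
    then show ?thesis using has_integral_const_real[of "1::complex" 0 "2*pi"] by (simp add: scaleR_conv_of_real)
  next
    case False
    have "((\<lambda>t. cis (real n * t)) has_integral
       (cis (real n * (2 * pi)) / (\<i> * of_nat n) - cis (real n * 0) / (\<i> * of_nat n))) {0..2*pi}"
    proof (rule fundamental_theorem_of_calculus)
      show "((\<lambda>t. cis (real n * t) / (\<i> * of_nat n)) has_vector_derivative cis (real n * t)) (at t within {0..2*pi})" for t
      proof -
        have "((\<lambda>w. exp (\<i> * of_nat n * w) / (\<i> * of_nat n)) has_field_derivative exp (\<i> * of_nat n * of_real t)) (at (of_real t))"
          using False by (auto intro!: derivative_eq_intros)
        from has_vector_derivative_real_field[OF this] show ?thesis
          by (simp add: cis_conv_exp mult_ac)
      qed
    qed auto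
    then show ?thesis using False cis_multiple_2pi[of "real n"] by (simp add: Complex.DeMoivre mult_ac)
  qed
  have "((\<lambda>t. \<Sum>i\<le>degree p. coeff p i * cis t ^ i) has_integral
      (\<Sum>i\<le>degree p. coeff p i * (if i = 0 then 2 * pi else 0))) {0..2*pi}"
    by (intro has_integral_sum has_integral_mult_right one) auto
  moreover have "(\<Sum>i\<le>degree p. coeff p i * (if i = 0 then 2 * pi else 0)) = 2 * pi * poly p 0"
    by (simp add: poly_0_coeff_0 if_distrib cong: if_cong)
  ultimately show ?thesis by (simp add: poly_altdef)
qed

text \<open>The Caratheodory bounds are summed as a geometric series in |z|, with the constant term
  counted twice. All that matters later is that the factor does not depend on
  \<open>P\<close>.\<close>

lemma harnack_upper:
  assumes hol: "P holomorphic_on ball 0 1" and pos: "\<And>z. norm z < 1 \<Longrightarrow> Re (P z) \<ge> 0"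
    and z: "norm z < 1"
  shows "Re (P z) \<le> 2 / (1 - norm z) * Re (P 0)"
proof -
  obtain p where p: "P has_fps_expansion p"
    using has_fps_expansion_fps_expansion[OF _ _ hol] by auto
  have le: "norm (fps_nth p n * z ^ n) \<le> norm (P 0) * (if n = 0 then 1 else 0) + 2 * Re (P 0) * norm z ^ n" for n
  proof (cases "n = 0")
    case True
    then show ?thesis using fps_nth_fps_expansion[OF p, of 0] pos[of 0] by simp
  next
    case False
    then show ?thesis using caratheodory_coeff[OF hol p pos, of n]
      by (simp add: norm_mult norm_power mult_right_mono)
  qed
  have s: "(\<lambda>n. fps_nth p n * z ^ n) sums P z"
    by (rule has_fps_expansion_imp_sums_complex[OF p, where r = 1])
       (use hol z in \<open>auto simp: one_ereal_def\<close>)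
  have R: "Re (fps_nth p n * z ^ n) \<le> 2 * Re (P 0) * norm z ^ n" for n
  proof (cases "n = 0")
    case True
    then show ?thesis using fps_nth_fps_expansion[OF p, of 0] pos[of 0] by simp
  next
    case False
    then show ?thesis using le[of n] complex_Re_le_cmod[of "fps_nth p n * z ^ n"] by simp
  qed
  have "(\<lambda>n. 2 * Re (P 0) * norm z ^ n) sums (2 * Re (P 0) * (1 / (1 - norm z)))"
    by (intro sums_mult geometric_sums) (use z in auto)
  then have "Re (P z) \<le> 2 * Re (P 0) * (1 / (1 - norm z))"
    using sums_le[OF R sums_Re[OF s]] by blast
  then show ?thesis by (simp add: mult_ac)
qed

text \<open>A Phragmen-Lindelof principle. The harmonic function \<open>Im M\<close>, cut off outside \<open>W\<close>, is dominated on
  circles by real parts of polynomials, whose mean values tend to zero.\<close>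

lemma phragmen_lindelof_disc:
  fixes M :: "complex \<Rightarrow> complex"
  assumes hol: "M holomorphic_on ball 0 1"
    and bd: "\<And>z. norm z < 1 \<Longrightarrow> \<bar>Im (M z)\<bar> \<le> C"
    and W: "open W" "W \<subseteq> ball 0 1"
    and pos: "\<And>z. z \<in> W \<Longrightarrow> Im (M z) > 0"
    and fr: "\<And>z. z \<in> frontier W \<Longrightarrow> norm z < 1 \<Longrightarrow> Im (M z) = 0"
    and E: "negligible E"
    and lim: "\<And>t. t \<in> {0..2*pi} - E \<Longrightarrow>
      ((\<lambda>r. if of_real r * cis t \<in> W then Im (M (of_real r * cis t)) else 0) \<longlongrightarrow> 0) (at_left 1)"
  shows "W = {}"
proof (rule ccontr)
  assume "W \<noteq> {}"
  then obtain z1 where z1: "z1 \<in> W" by blast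
  define \<rho> where "\<rho> = norm z1"
  have \<rho>: "\<rho> < 1" "\<rho> \<ge> 0" using z1 W by (auto simp: \<rho>_def)
  define v where "v z = (if z \<in> W then Im (M z) else 0)" for z
  have v0: "v z \<ge> 0" for z using pos by (auto simp: v_def less_eq_real_def)
  have vC: "v z \<le> C" if "norm z < 1" for z using bd[OF that] by (auto simp: v_def abs_le_iff)
  have contM: "continuous_on (ball 0 1) (\<lambda>z. Im (M z))"
    by (intro continuous_intros holomorphic_on_imp_continuous_on hol)
  \<comment> \<open>\<open>v\<close> is continuous across the frontier of \<open>W\<close> because
    \<open>Im M\<close> vanishes there.\<close>
  have contv: "continuous_on (ball 0 1) v"
  proof -
    have eq: "ball 0 1 = (ball 0 1 \<inter> closure W) \<union> (ball 0 1 - W)"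
      using closure_subset[of W] by auto
    have "continuous_on ((ball 0 1 \<inter> closure W) \<union> (ball 0 1 - W)) v"
      unfolding v_def
    proof (rule continuous_on_cases_local)
      show "closedin (top_of_set (ball 0 1 \<inter> closure W \<union> (ball 0 1 - W))) (ball 0 1 \<inter> closure W)"
        unfolding eq[symmetric] by (rule closedin_closed_Int) simp
      show "closedin (top_of_set (ball 0 1 \<inter> closure W \<union> (ball 0 1 - W))) (ball 0 1 - W)"
      proof -
        have "closedin (top_of_set (ball 0 1)) (ball 0 1 \<inter> - W)"
          by (rule closedin_closed_Int) (use W in auto)
        then show ?thesis unfolding eq[symmetric] by (simp add: Diff_eq)
      qed
      show "continuous_on (ball 0 1 \<inter> closure W) (\<lambda>z. Im (M z))"
        by (rule continuous_on_subset[OF contM]) auto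
      fix z assume "z \<in> ball 0 1 \<inter> closure W \<and> z \<notin> W \<or> z \<in> ball 0 1 - W \<and> z \<in> W"
      then have "z \<in> frontier W" "norm z < 1" using W by (auto simp: frontier_def interior_open)
      then show "Im (M z) = 0" by (rule fr)
    qed auto
    then show ?thesis using eq by simp
  qed
  \<comment> \<open>On the circle of radius \<open>r\<close> the real part of \<open>Q\<close> lies
    between \<open>v\<close> and \<open>v + 2 * e\<close>. By the maximum principle it dominates
    \<open>v\<close> at \<open>z1\<close>, and Harnack's inequality bounds it there by its value at
    0, which is its mean over the circle.\<close>
  have key: "v z1 \<le> 2 / (1 - \<rho> / r) * (2 * e + integral {0..2*pi} (\<lambda>t. v (of_real r * cis t)) / (2 * pi))"
    if r: "\<rho> < r" "r < 1" and e: "e > 0" for r e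
  proof -
    have rp: "r > 0" using r \<rho> by linarith
    have "continuous_on (sphere 0 1) (\<lambda>z. v (of_real r * z))"
      by (intro continuous_on_compose2[OF contv] continuous_intros) (use r rp in \<open>auto simp: norm_mult\<close>)
    then obtain p where p: "\<And>z. z \<in> sphere 0 1 \<Longrightarrow> \<bar>v (of_real r * z) - Re (poly p z)\<bar> < e"
      using Re_poly_approx_circle[OF _ e] by blast
    define Q where "Q z = poly p (z / of_real r) + of_real e" for z
    have contQ: "continuous_on A Q" for A unfolding Q_def by (intro continuous_intros) (use rp in auto)
    have holQ: "Q holomorphic_on A" for A unfolding Q_def by (intro holomorphic_intros) (use rp in auto)
    have Qs: "v z \<le> Re (Q z)" if z: "norm z = r" for z
    proof -
      have "z / of_real r \<in> sphere 0 1" using z rp by (simp add: norm_divide)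
      from p[OF this] show ?thesis using rp by (simp add: Q_def)
    qed
    have Qpos: "Re (Q z) \<ge> 0" if z: "norm z < r" for z
    proof -
      have "Re (- Q z) \<le> 0"
        by (rule maximum_real_frontier[of "\<lambda>z. - Q z" "ball 0 r"])
           (use z rp v0 order_trans[OF v0 Qs] in \<open>auto intro!: holomorphic_intros continuous_intros holQ contQ\<close>)
      then show ?thesis by simp
    qed
    have z1r: "z1 \<in> W \<inter> ball 0 r" using z1 r by (auto simp: \<rho>_def)
    \<comment> \<open>Frontier points of \<open>W \<inter> ball 0 r\<close> either lie in
      \<open>W\<close> on the circle, where \<open>Q\<close> dominates, or outside \<open>W\<close>,
      where \<open>Im M = 0\<close> and \<open>Re Q \<ge> 0\<close>.\<close>
    have "Re (- \<i> * M z1 - Q z1) \<le> 0"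
    proof (rule maximum_real_frontier[OF _ _ _ _ z1r])
      show "(\<lambda>z. - \<i> * M z - Q z) holomorphic_on interior (W \<inter> ball 0 r)"
        by (intro holomorphic_intros holQ holomorphic_on_subset[OF hol])
           (use W interior_subset[of "W \<inter> ball 0 r"] in blast)
      have cl: "closure (W \<inter> ball 0 r) \<subseteq> closure W \<inter> cball 0 r"
        using closure_mono[of "W \<inter> ball 0 r" W] closure_mono[of "W \<inter> ball 0 r" "ball 0 r"] rp by auto
      have cb: "cball 0 r \<subseteq> ball (0::complex) 1" using r by auto
      show "continuous_on (closure (W \<inter> ball 0 r)) (\<lambda>z. - \<i> * M z - Q z)"
        by (intro continuous_intros contQ holomorphic_on_imp_continuous_on holomorphic_on_subset[OF hol])
           (use cl cb in blast)
      show "bounded (W \<inter> ball 0 r)" by (meson bounded_Int bounded_ball)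
      fix z assume "z \<in> frontier (W \<inter> ball 0 r)"
      then have z: "z \<in> closure W" "norm z \<le> r" "z \<notin> W \<inter> ball 0 r"
        using cl W by (auto simp: frontier_def interior_open open_Int)
      then have z': "norm z < 1" using r by linarith
      show "Re (- \<i> * M z - Q z) \<le> 0"
      proof (cases "z \<in> W")
        case True
        then have "norm z = r" using z by auto
        from Qs[OF this] True show ?thesis by (simp add: v_def)
      next
        case False
        then have "Im (M z) = 0" using z z' W by (intro fr) (auto simp: frontier_def interior_open)
        moreover have "Re (Q z) \<ge> 0"
          using Qpos[of z] Qs[of z] v0[of z] z by (cases "norm z = r") auto
        ultimately show ?thesis by simp
      qed
    qed
    then have "v z1 \<le> Re (Q z1)" using z1 by (simp add: v_def)
    also have "Q z1 = (\<lambda>z. Q (of_real r * z)) (z1 / of_real r)" using rp by simp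
    also have "Re \<dots> \<le> 2 / (1 - norm (z1 / of_real r)) * Re (Q (of_real r * 0))"
      by (rule harnack_upper[where P = "\<lambda>z. Q (of_real r * z)"])
         (use rp r Qpos in \<open>auto intro!: holomorphic_on_compose_gen[OF _ holQ, unfolded o_def] holomorphic_intros
            simp: norm_mult norm_divide \<rho>_def\<close>)
    also have "\<dots> = 2 / (1 - \<rho> / r) * Re (Q 0)" using rp by (simp add: norm_divide \<rho>_def)
    also have "\<dots> \<le> 2 / (1 - \<rho> / r) * (2 * e + integral {0..2*pi} (\<lambda>t. v (of_real r * cis t)) / (2 * pi))"
    proof (rule mult_left_mono)
      have i1: "((\<lambda>t. Re (poly p (cis t))) has_integral (Re (2 * pi * poly p 0))) {0..2*pi}"
        using has_integral_poly_cis has_integral_linear[OF _ bounded_linear_Re, unfolded o_def] by blast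
      have c: "continuous_on {0..2*pi} (\<lambda>t. v (of_real r * cis t))"
        by (intro continuous_on_compose2[OF contv] continuous_intros) (use r rp in \<open>auto simp: norm_mult\<close>)
      have i2: "((\<lambda>t. v (of_real r * cis t) + e) has_integral
          (integral {0..2*pi} (\<lambda>t. v (of_real r * cis t)) + 2 * pi * e)) {0..2*pi}"
        using has_integral_add[OF integrable_integral[OF integrable_continuous_real[OF c]] has_integral_const_real[of e 0 "2*pi"]]
        by simp
      have "Re (2 * pi * poly p 0) \<le> integral {0..2*pi} (\<lambda>t. v (of_real r * cis t)) + 2 * pi * e"
      proof (rule has_integral_le[OF i1 i2])
        fix t show "Re (poly p (cis t)) \<le> v (of_real r * cis t) + e"
          using p[of "cis t"] by auto
      qed
      then show "Re (Q 0) \<le> 2 * e + integral {0..2*pi} (\<lambda>t. v (of_real r * cis t)) / (2 * pi)"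
        by (simp add: Q_def field_simps)
      have "\<rho> / r < 1" using r rp by simp
      then show "0 \<le> 2 / (1 - \<rho> / r)" by simp
    qed
    finally show ?thesis .
  qed
  define r where "r n = 1 - (1 - \<rho>) / (real n + 2)" for n :: nat
  have r: "\<rho> < r n" "r n < 1" for n
  proof -
    have "(1 - \<rho>) / (real n + 2) < (1 - \<rho>) / 1" using \<rho> by (intro divide_strict_left_mono) auto
    moreover have "(1 - \<rho>) / (real n + 2) > 0" using \<rho> by simp
    ultimately show "\<rho> < r n" "r n < 1" unfolding r_def by simp_all
  qed
  have r1: "filterlim r (at_left 1) sequentially"
  proof -
    have "(\<lambda>n. 1 - (1 - \<rho>) / (real n + 2)) \<longlonglongrightarrow> 1" by real_asymp
    then show ?thesis unfolding filterlim_at r_def[symmetric, abs_def]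
      using r by (auto simp: r_def[abs_def] intro!: always_eventually)
  qed
  define I where "I n = integral {0..2*pi} (\<lambda>t. v (of_real (r n) * cis t))" for n
  have Ilim: "I \<longlonglongrightarrow> 0"
  proof -
    let ?S = "{0..2*pi} - E"
    have neg: "negligible (E \<inter> A)" for A using E negligible_subset by blast
    have eqI: "integral ?S (\<lambda>t. v (of_real (r n) * cis t)) = I n" for n
      unfolding I_def by (rule integral_spike_set) (auto intro: negligible_subset[OF E])
    have c: "continuous_on {0..2*pi} (\<lambda>t. v (of_real (r n) * cis t))" for n
      using r[of n] \<rho> by (intro continuous_on_compose2[OF contv] continuous_intros) (auto simp: norm_mult)
    have int: "(\<lambda>t. v (of_real (r n) * cis t)) integrable_on ?S" for n
      by (rule integrable_spike_set[OF integrable_continuous_real[OF c]]) (auto intro: negligible_subset[OF E])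
    have "(\<lambda>n. integral ?S (\<lambda>t. v (of_real (r n) * cis t))) \<longlonglongrightarrow> integral ?S (\<lambda>t. 0)"
    proof (rule dominated_convergence(2)[OF int])
      show "(\<lambda>t. C) integrable_on ?S"
        by (rule integrable_spike_set[of _ "{0..2*pi}"]) (auto intro: negligible_subset[OF E])
      show "norm (v (of_real (r n) * cis t)) \<le> C" for n t
        using v0 vC[of "of_real (r n) * cis t"] r[of n] \<rho> by (auto simp: norm_mult)
      show "(\<lambda>n. v (of_real (r n) * cis t)) \<longlonglongrightarrow> 0" if "t \<in> ?S" for t
        using filterlim_compose[OF lim[OF that] r1] by (simp add: v_def)
    qed
    then show ?thesis by (simp add: eqI)
  qed
  have "(\<lambda>n. 2 / (1 - \<rho> / r n) * (2 * (1 / (real n + 1)) + I n / (2 * pi))) \<longlonglongrightarrow>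
      2 / (1 - \<rho> / 1) * (2 * 0 + 0 / (2 * pi))"
  proof (intro tendsto_intros Ilim)
    show "r \<longlonglongrightarrow> 1" using r1 by (simp add: filterlim_at)
    show "(\<lambda>n. 1 / (real n + 1)) \<longlonglongrightarrow> 0" by real_asymp
  qed (use \<rho> in auto)
  then have "v z1 \<le> 2 / (1 - \<rho> / 1) * (2 * 0 + 0 / (2 * pi))"
  proof (rule tendsto_lowerbound)
    show "\<forall>\<^sub>F n in sequentially. v z1 \<le> 2 / (1 - \<rho> / r n) * (2 * (1 / (real n + 1)) + I n / (2 * pi))"
      unfolding I_def by (intro always_eventually allI key r) auto
  qed auto
  then show False using pos[OF z1] z1 by (simp add: v_def)
qed

section \<open>The argument of the chord quotient\<close>

lemma cis_eq_lift:
  fixes f g :: "'a::topological_space \<Rightarrow> real"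
  assumes S: "connected S" "S \<noteq> {}" and f: "continuous_on S f" and g: "continuous_on S g"
    and eq: "\<And>x. x \<in> S \<Longrightarrow> cis (f x) = cis (g x)"
  obtains k :: int where "\<And>x. x \<in> S \<Longrightarrow> f x = g x + 2 * pi * of_int k"
proof -
  have ex: "\<exists>k::int. f x - g x = 2 * pi * of_int k" if "x \<in> S" for x
  proof -
    have "cis (f x - g x) = 1" using eq[OF that] by (simp add: cis_divide[symmetric])
    then have "cos (f x - g x) = 1" by (metis cis.simps(1) one_complex.simps(1))
    then show ?thesis using cos_one_2pi_int[of "f x - g x"] by (auto simp: mult_ac)
  qed
  have "(\<lambda>x. f x - g x) constant_on S"
  proof (rule continuous_discrete_range_constant[OF S(1)])
    show "continuous_on S (\<lambda>x. f x - g x)" by (intro continuous_intros f g)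
    fix x assume x: "x \<in> S"
    obtain k :: int where k: "f x - g x = 2 * pi * of_int k" using ex[OF x] by blast
    have "2 * pi \<le> norm (f y - g y - (f x - g x))" if y: "y \<in> S" "f y - g y \<noteq> f x - g x" for y
    proof -
      obtain l :: int where l: "f y - g y = 2 * pi * of_int l" using ex[OF y(1)] by blast
      have "l \<noteq> k" using y k l by auto
      then have "\<bar>l - k\<bar> \<ge> 1" by linarith
      then have "\<bar>real_of_int l - real_of_int k\<bar> \<ge> 1" by (metis of_int_1_le_iff of_int_abs of_int_diff)
      moreover have "f y - g y - (f x - g x) = 2 * pi * (real_of_int l - real_of_int k)"
        using k l by (simp add: algebra_simps)
      ultimately show ?thesis by (simp add: abs_mult)
    qed
    then show "\<exists>e>0. \<forall>y. y \<in> S \<and> f y - g y \<noteq> f x - g x \<longrightarrow> e \<le> norm (f y - g y - (f x - g x))"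
      by (intro exI[of _ "2*pi"]) auto
  qed
  then obtain c where c: "\<And>x. x \<in> S \<Longrightarrow> f x - g x = c" by (auto simp: constant_on_def)
  obtain x0 where x0: "x0 \<in> S" using S by blast
  obtain k :: int where "f x0 - g x0 = 2 * pi * of_int k" using ex[OF x0] by blast
  then have "f x = g x + 2 * pi * of_int k" if "x \<in> S" for x
    using c[OF that] c[OF x0] by linarith
  then show ?thesis by (rule that)
qed

text \<open>A logarithm exists on the convex set and differs from the given lift on
  \<open>S0\<close> by a constant multiple of 2 pi, which is subtracted. It serves to continue the
  argument of a chord from times inside the disc up to and beyond the boundary.\<close>

lemma extend_argument_lift:
  fixes q :: "'a::real_normed_vector \<Rightarrow> complex" and b :: "'a \<Rightarrow> real"
  assumes S: "convex S" and q: "continuous_on S q" and nz: "\<And>x. x \<in> S \<Longrightarrow> q x \<noteq> 0"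
    and S0: "S0 \<subseteq> S" "connected S0" and b: "continuous_on S0 b"
    and lift: "\<And>x. x \<in> S0 \<Longrightarrow> cis (b x) = sgn (q x)"
  obtains e where "continuous_on S e" "\<And>x. x \<in> S \<Longrightarrow> cis (e x) = sgn (q x)" "\<And>x. x \<in> S0 \<Longrightarrow> e x = b x"
proof -
  obtain g where g: "continuous_on S g" "\<And>x. x \<in> S \<Longrightarrow> q x = exp (g x)"
    using continuous_logarithm_on_contractible[OF q convex_imp_contractible[OF S] nz] by blast
  have cg: "cis (Im (g x)) = sgn (q x)" if "x \<in> S" for x
    by (simp add: g(2)[OF that] sgn_eq exp_eq_polar norm_exp_eq_Re norm_mult)
  have cI: "continuous_on S (\<lambda>x. Im (g x))" by (intro continuous_intros g)
  show ?thesis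
  proof (cases "S0 = {}")
    case True
    then show ?thesis using cI cg by (intro that[of "\<lambda>x. Im (g x)"]) auto
  next
    case False
    obtain k :: int where k: "\<And>x. x \<in> S0 \<Longrightarrow> Im (g x) = b x + 2 * pi * of_int k"
    proof (rule cis_eq_lift[OF S0(2) False continuous_on_subset[OF cI S0(1)] b])
      show "cis (Im (g x)) = cis (b x)" if "x \<in> S0" for x using cg lift that S0 by auto
    qed blast
    show ?thesis
    proof (rule that[of "\<lambda>x. Im (g x) - 2 * pi * of_int k"])
      show "continuous_on S (\<lambda>x. Im (g x) - 2 * pi * of_int k)" by (intro continuous_intros g)
      show "cis (Im (g x) - 2 * pi * of_int k) = sgn (q x)" if "x \<in> S" for x
        using cg[OF that] by (simp add: cis_divide[symmetric] cis_multiple_2pi)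
      show "Im (g x) - 2 * pi * of_int k = b x" if "x \<in> S0" for x using k[OF that] by simp
    qed
  qed
qed

definition disc_pairs :: "(complex \<times> complex) set" where
  "disc_pairs = {p. norm (fst p) < 1 \<and> norm (snd p) < 1 \<and> fst p \<noteq> snd p}"

text \<open>Strict differentiability: the mean value inequality is applied to \<open>k\<close> minus
  its linear part, so that both end points may vary.\<close>

lemma strong_derivative:
  assumes k: "k holomorphic_on S" and S: "open S" "z0 \<in> S" and K: "K > 0"
  obtains r where "r > 0" "\<And>z w. z \<in> ball z0 r \<Longrightarrow> w \<in> ball z0 r \<Longrightarrow>
      norm (k w - k z - deriv k z0 * (w - z)) \<le> K * norm (w - z)"
proof -
  obtain e where e: "e > 0" "ball z0 e \<subseteq> S" using S openE by blast
  have "continuous_on S (deriv k)"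
    by (intro holomorphic_on_imp_continuous_on holomorphic_deriv k S)
  then have "isCont (deriv k) z0" using S by (simp add: continuous_on_eq_continuous_at)
  then obtain s where s: "s > 0" "\<And>z. dist z z0 < s \<Longrightarrow> dist (deriv k z) (deriv k z0) < K"
    unfolding continuous_at_eps_delta using K by meson
  define r where "r = min s e"
  have "norm (k w - k z - deriv k z0 * (w - z)) \<le> K * norm (w - z)" if zw: "z \<in> ball z0 r" "w \<in> ball z0 r" for z w
  proof -
    have "norm ((k w - deriv k z0 * w) - (k z - deriv k z0 * z)) \<le> K * norm (w - z)"
    proof (rule field_differentiable_bound[of "ball z0 r" "\<lambda>z. k z - deriv k z0 * z" "\<lambda>z. deriv k z - deriv k z0"])
      fix x assume x: "x \<in> ball z0 r"
      have kx: "(k has_field_derivative deriv k x) (at x within ball z0 r)"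
        by (rule holomorphic_derivI[OF k S(1)]) (use e x in \<open>auto simp: r_def\<close>)
      show "((\<lambda>z. k z - deriv k z0 * z) has_field_derivative deriv k x - deriv k z0) (at x within ball z0 r)"
        by (intro DERIV_diff[OF kx] DERIV_cmult_Id)
      show "norm (deriv k x - deriv k z0) \<le> K"
        using s(2)[of x] x by (simp add: dist_norm r_def norm_minus_commute)
    qed (use zw in auto)
    then show ?thesis by (simp add: algebra_simps)
  qed
  then show ?thesis using s e by (intro that[of r]) (auto simp: r_def)
qed

lemma harmonic_quotient_near:
  assumes holh: "h holomorphic_on ball 0 1" and holg: "g holomorphic_on ball 0 1" and K: "K > 0"
  obtains r where "0 < r" "r < 1" "\<And>z w. norm z < r \<Longrightarrow> norm w < r \<Longrightarrow>
    norm (h w + cnj (g w) - (h z + cnj (g z)) - (deriv h 0 * (w - z) + cnj (deriv g 0 * (w - z)))) \<le> K * norm (w - z)"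
proof -
  have one: "\<exists>r. 0 < r \<and> r < 1 \<and> (\<forall>z w. norm z < r \<longrightarrow> norm w < r \<longrightarrow>
      norm (k w - k z - deriv k 0 * (w - z)) \<le> K / 2 * norm (w - z))"
    if k: "k holomorphic_on ball 0 1" for k :: "complex \<Rightarrow> complex"
  proof -
    obtain r where r: "r > 0" "\<And>z w. z \<in> ball 0 r \<Longrightarrow> w \<in> ball 0 r \<Longrightarrow>
        norm (k w - k z - deriv k 0 * (w - z)) \<le> K / 2 * norm (w - z)"
      using strong_derivative[OF k open_ball, of 0 "K / 2"] K by auto
    then show ?thesis by (intro exI[of _ "min r (1/2)"]) auto
  qed
  obtain r1 where r1: "0 < r1" "r1 < 1" "\<And>z w. norm z < r1 \<Longrightarrow> norm w < r1 \<Longrightarrow>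
      norm (h w - h z - deriv h 0 * (w - z)) \<le> K / 2 * norm (w - z)" using one[OF holh] by blast
  obtain r2 where r2: "0 < r2" "r2 < 1" "\<And>z w. norm z < r2 \<Longrightarrow> norm w < r2 \<Longrightarrow>
      norm (g w - g z - deriv g 0 * (w - z)) \<le> K / 2 * norm (w - z)" using one[OF holg] by blast
  show ?thesis
  proof (rule that[of "min r1 r2"])
    fix z w :: complex assume zw: "norm z < min r1 r2" "norm w < min r1 r2"
    have "h w + cnj (g w) - (h z + cnj (g z)) - (deriv h 0 * (w - z) + cnj (deriv g 0 * (w - z))) =
      (h w - h z - deriv h 0 * (w - z)) + cnj (g w - g z - deriv g 0 * (w - z))"
      by (simp add: algebra_simps)
    also have "norm \<dots> \<le> norm (h w - h z - deriv h 0 * (w - z)) + norm (g w - g z - deriv g 0 * (w - z))"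
      using norm_triangle_ineq complex_mod_cnj by metis
    also have "\<dots> \<le> K / 2 * norm (w - z) + K / 2 * norm (w - z)"
      using zw by (intro add_mono r1 r2) auto
    finally show "norm (h w + cnj (g w) - (h z + cnj (g z)) - (deriv h 0 * (w - z) + cnj (deriv g 0 * (w - z)))) \<le> K * norm (w - z)"
      by simp
  qed (use r1 r2 in auto)
qed

text \<open>The difference quotient is homotopic, by shrinking both points towards \<open>0\<close>, to a function with
  values in a half-plane, hence has a logarithm; swapping the two points by a rotation shows symmetry.\<close>

lemma chord_argument_exists:
  fixes F :: "complex \<Rightarrow> complex"
  assumes holh: "h holomorphic_on ball 0 1" and holg: "g holomorphic_on ball 0 1"
    and F: "\<And>z. norm z < 1 \<Longrightarrow> F z = h z + cnj (g z)"
    and inj: "inj_on F (ball 0 1)" and lt: "norm (deriv g 0) < norm (deriv h 0)"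
  obtains B where "continuous_on disc_pairs (\<lambda>p. B (fst p) (snd p) :: real)"
    "\<And>z w. (z, w) \<in> disc_pairs \<Longrightarrow> cis (B z w) = sgn ((F w - F z) / (w - z))"
    "\<And>z w. (z, w) \<in> disc_pairs \<Longrightarrow> B z w = B w z"
proof -
  define X where "X = disc_pairs"
  define q where "q p = (F (snd p) - F (fst p)) / (snd p - fst p)" for p
  have contF: "continuous_on (ball 0 1) F"
  proof -
    have "continuous_on (ball 0 1) (\<lambda>z. h z + cnj (g z))"
      by (intro continuous_intros holomorphic_on_imp_continuous_on holh holg)
    then show ?thesis by (rule continuous_on_eq) (use F in auto)
  qed
  have q0: "q p \<noteq> 0" if "p \<in> X" for p
  proof -
    have "F (snd p) \<noteq> F (fst p)"
      using inj that by (auto simp: X_def disc_pairs_def inj_on_def)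
    then show ?thesis using that by (auto simp: q_def X_def disc_pairs_def)
  qed
  have contq: "continuous_on X q"
    unfolding q_def
    by (intro continuous_intros continuous_on_compose2[OF contF]) (auto simp: X_def disc_pairs_def)
  \<comment> \<open>With half the gap between the two derivatives, the chord quotient near 0 stays
    within distance less than |a| of \<open>a\<close>, hence in a half-plane.\<close>
  define K where "K = (norm (deriv h 0) - norm (deriv g 0)) / 2"
  have K: "K > 0" using lt by (simp add: K_def)
  obtain r where r: "0 < r" "r < 1" "\<And>z w. norm z < r \<Longrightarrow> norm w < r \<Longrightarrow>
    norm (h w + cnj (g w) - (h z + cnj (g z)) - (deriv h 0 * (w - z) + cnj (deriv g 0 * (w - z)))) \<le> K * norm (w - z)"
    using harmonic_quotient_near[OF holh holg K] by blast
  define a where "a = deriv h 0"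
  have a0: "a \<noteq> 0" using lt by (auto simp: a_def)
  have sc: "t *\<^sub>R p \<in> X" if "p \<in> X" "0 < t" "t \<le> 1" for t and p :: "complex \<times> complex"
  proof -
    have "t * norm (fst p) < 1" "t * norm (snd p) < 1"
      using that mult_le_cancel_right1[of t "norm (fst p)"]
      by (auto simp: X_def disc_pairs_def intro: le_less_trans[OF mult_right_le_one_le[of _ t, unfolded mult.commute[of _ t]]])
    then show ?thesis using that by (auto simp: X_def disc_pairs_def)
  qed
  have near: "q (r *\<^sub>R p) / a \<notin> \<real>\<^sub>\<le>\<^sub>0" if p: "p \<in> X" for p
  proof -
    define z w where "z = r *\<^sub>R fst p" and "w = r *\<^sub>R snd p"
    have zw: "norm z < r" "norm w < r" "w \<noteq> z"
      using p r by (auto simp: z_def w_def X_def disc_pairs_def)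
    have z1: "norm z < 1" "norm w < 1" using zw r by auto
    have "norm ((F w - F z) - a * (w - z)) \<le> K * norm (w - z) + norm (deriv g 0) * norm (w - z)"
    proof -
      have "(F w - F z) - a * (w - z) = (F w - F z - (a * (w - z) + cnj (deriv g 0 * (w - z)))) + cnj (deriv g 0 * (w - z))"
        by simp
      then have "norm ((F w - F z) - a * (w - z)) \<le> norm (F w - F z - (a * (w - z) + cnj (deriv g 0 * (w - z))))
         + norm (cnj (deriv g 0 * (w - z)))"
        by (metis norm_triangle_ineq)
      moreover have "norm (F w - F z - (a * (w - z) + cnj (deriv g 0 * (w - z)))) \<le> K * norm (w - z)"
        using r(3)[OF zw(1,2)] by (simp only: F[OF z1(1)] F[OF z1(2)] a_def)
      moreover have "norm (cnj (deriv g 0 * (w - z))) = norm (deriv g 0) * norm (w - z)"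
        by (simp only: complex_mod_cnj norm_mult)
      ultimately show ?thesis by linarith
    qed
    also have "\<dots> < norm a * norm (w - z)"
    proof -
      have "K + norm (deriv g 0) < norm a" using lt by (simp add: K_def a_def field_simps)
      then show ?thesis using zw by (simp flip: distrib_right)
    qed
    finally have "norm ((F w - F z) - a * (w - z)) < norm (a * (w - z))" by (simp add: norm_mult)
    then have "norm (((F w - F z) - a * (w - z)) / (a * (w - z))) < 1"
      using a0 zw by (simp add: norm_divide)
    also have "((F w - F z) - a * (w - z)) / (a * (w - z)) = q (r *\<^sub>R p) / a - 1"
      using a0 zw r by (simp add: q_def z_def w_def field_simps)
    finally have "norm (q (r *\<^sub>R p) / a - 1) < 1" .
    then have "Re (q (r *\<^sub>R p) / a) > 0"
      using abs_Re_le_cmod[of "q (r *\<^sub>R p) / a - 1"] by (simp del: Re_divide)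
    then show ?thesis using complex_nonpos_Reals_iff by fastforce
  qed
  have contqr: "continuous_on X (\<lambda>p. q (r *\<^sub>R p))"
    by (intro continuous_on_compose2[OF contq] continuous_intros) (use r sc in auto)
  have "\<exists>l. continuous_on X l \<and> (\<forall>p\<in>X. q (r *\<^sub>R p) = exp (l p))"
  proof (intro exI conjI ballI)
    show "continuous_on X (\<lambda>p. Ln (q (r *\<^sub>R p) / a) + Ln a)"
      by (intro continuous_intros contqr) (use near a0 in auto)
    fix p assume "p \<in> X"
    then have "q (r *\<^sub>R p) \<noteq> 0" using q0 sc r by auto
    then show "q (r *\<^sub>R p) = exp (Ln (q (r *\<^sub>R p) / a) + Ln a)" using a0 by (simp add: exp_add)
  qed
  then obtain c where c: "homotopic_with_canon (\<lambda>h. True) X (-{0}) (\<lambda>p. q (r *\<^sub>R p)) (\<lambda>t. c)"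
    using inessential_eq_continuous_logarithm[of X "\<lambda>p. q (r *\<^sub>R p)"] by blast
  have "homotopic_with_canon (\<lambda>h. True) X (-{0}) q (\<lambda>p. q (r *\<^sub>R p))"
  proof -
    have t: "0 < 1 - t + t * r \<and> 1 - t + t * r \<le> 1" if "0 \<le> t" "t \<le> 1" for t
    proof -
      define u where "u = t * (1 - r)"
      have "u \<ge> 0" using that r by (simp add: u_def)
      moreover have "u \<le> 1 * (1 - r)" unfolding u_def using that r by (intro mult_right_mono) auto
      moreover have e: "1 - t + t * r = 1 - u" by (simp add: u_def algebra_simps)
      ultimately show ?thesis unfolding e using r(1,2) by auto
    qed
    have "continuous_on ({0..1} \<times> X) (\<lambda>y. q ((1 - fst y + fst y * r) *\<^sub>R snd y))"
      by (intro continuous_on_compose2[OF contq] continuous_intros) (use t sc in auto)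
    then show ?thesis
      by (subst homotopic_with, simp)
         (intro exI[of _ "\<lambda>y. q ((1 - fst y + fst y * r) *\<^sub>R snd y)"], use t sc q0 in auto)
  qed
  then have "homotopic_with_canon (\<lambda>h. True) X (-{0}) q (\<lambda>t. c)"
    using c homotopic_with_trans by blast
  then obtain l where l: "continuous_on X l" "\<And>p. p \<in> X \<Longrightarrow> q p = exp (l p)"
    using inessential_eq_continuous_logarithm[of X q] by blast
  define B where "B z w = Im (l (z, w))" for z w
  have cB: "cis (B z w) = sgn (q (z, w))" if "(z, w) \<in> X" for z w
    by (simp add: l(2)[OF that] B_def sgn_eq exp_eq_polar norm_exp_eq_Re norm_mult)
  have contB: "continuous_on X (\<lambda>p. B (fst p) (snd p))"
    unfolding B_def by (simp add: continuous_on_Im l(1))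
  define Df where "Df p = B (fst p) (snd p) - B (snd p) (fst p)" for p
  have swX: "(w, z) \<in> X" if "(z, w) \<in> X" for z w using that by (auto simp: X_def disc_pairs_def)
  have contD: "continuous_on X Df"
    unfolding Df_def
    by (intro continuous_intros contB continuous_on_compose2[OF contB, of X "\<lambda>p. (snd p, fst p)", simplified])
       (use swX in auto)
  have cD: "cis (Df p) = 1" if "p \<in> X" for p
  proof -
    obtain z w where p: "p = (z, w)" by (cases p)
    have "q (z, w) = q (w, z)" unfolding q_def fst_conv snd_conv by (metis minus_diff_eq minus_divide_divide)
    then show ?thesis using cB[of z w] cB[of w z] that swX p q0[of "(z, w)"]
      by (simp add: Df_def cis_divide[symmetric] sgn_zero_iff)
  qed
  \<comment> \<open>\<open>Df\<close> takes values in the multiples of 2 pi, so it is constant along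
    paths of pairs.\<close>
  have constp: "Df (\<gamma> 0) = Df (\<gamma> 1)" if g: "continuous_on {0..1} \<gamma>" "\<And>t::real. t \<in> {0..1} \<Longrightarrow> \<gamma> t \<in> X" for \<gamma>
  proof -
    have cc: "continuous_on {0..1} (\<lambda>t. Df (\<gamma> t))"
      by (rule continuous_on_compose2[OF contD g(1)]) (use g(2) in auto)
    have c1: "cis (Df (\<gamma> t)) = cis 0" if "t \<in> {0..1}" for t using cD g(2) that by simp
    obtain k :: int where k: "\<And>t. t \<in> {0..1} \<Longrightarrow> Df (\<gamma> t) = 0 + 2 * pi * of_int k"
      using cis_eq_lift[OF _ _ cc continuous_on_const c1] by auto
    then show ?thesis using k[of 0] k[of 1] by simp
  qed
  have sym: "Df (z, w) = 0" if p: "(z, w) \<in> X" for z w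
  proof -
    have half: "Df (z, w) = Df (z / 2, w / 2)" if p: "(z, w) \<in> X" for z w
    proof -
      have "Df ((1 - 0 / 2) *\<^sub>R (z, w)) = Df ((1 - 1 / 2) *\<^sub>R (z, w))"
      proof (rule constp[of "\<lambda>t. (1 - t / 2) *\<^sub>R (z, w)"])
        show "continuous_on {0..1} (\<lambda>t. (1 - t / 2) *\<^sub>R (z, w))" by (intro continuous_intros) auto
        show "(1 - t / 2) *\<^sub>R (z, w) \<in> X" if "t \<in> {0..1}" for t :: real
          by (rule sc[OF p]) (use that in auto)
      qed
      then show ?thesis by (simp add: scaleR_conv_of_real)
    qed
    \<comment> \<open>The halved pair is \<open>m - v\<close>, \<open>m + v\<close> with
      \<open>norm m + norm v < 1\<close>; turning \<open>v\<close> by pi swaps the two points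
      without leaving the disc.\<close>
    define m v where "m = (z + w) / 4" and "v = (w - z) / 4"
    have nm: "norm m \<le> (norm z + norm w) / 4" "norm v \<le> (norm z + norm w) / 4"
      using norm_triangle_ineq[of z w] norm_triangle_ineq4[of w z] by (simp_all add: m_def v_def norm_divide)
    have zw: "norm z < 1" "norm w < 1" "z \<noteq> w" using p by (auto simp: X_def disc_pairs_def)
    have "Df (m - cis (pi * 0) * v, m + cis (pi * 0) * v) = Df (m - cis (pi * 1) * v, m + cis (pi * 1) * v)"
    proof (rule constp[of "\<lambda>t. (m - cis (pi * t) * v, m + cis (pi * t) * v)"])
      show "continuous_on {0..1} (\<lambda>t. (m - cis (pi * t) * v, m + cis (pi * t) * v))" by (intro continuous_intros)
      fix t :: real
      have "norm (m - cis (pi * t) * v) < 1" "norm (m + cis (pi * t) * v) < 1"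
        using norm_triangle_ineq4[of m "cis (pi * t) * v"] norm_triangle_ineq[of m "cis (pi * t) * v"] nm zw
        by (simp_all add: norm_mult)
      then show "(m - cis (pi * t) * v, m + cis (pi * t) * v) \<in> X"
        using zw by (auto simp: X_def disc_pairs_def v_def)
    qed
    then have "Df (z / 2, w / 2) = Df (w / 2, z / 2)"
      by (simp add: m_def v_def field_simps) 
    then have "Df (z, w) = Df (w, z)" using half[OF p] half[OF swX[OF p]] by simp
    then show ?thesis by (simp add: Df_def)
  qed
  show ?thesis
  proof (rule that[of B])
    show "continuous_on disc_pairs (\<lambda>p. B (fst p) (snd p))" using contB by (simp add: X_def)
    show "cis (B z w) = sgn ((F w - F z) / (w - z))" if "(z, w) \<in> disc_pairs" for z w
      using cB[of z w] that by (simp add: X_def q_def)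
    show "B z w = B w z" if "(z, w) \<in> disc_pairs" for z w
      using sym[of z w] that by (simp add: X_def Df_def)
  qed
qed

section \<open>Non-crossing rays and boundary angles\<close>

text \<open>Otherwise the two rays leave the base from \<open>p1\<close> to \<open>p2\<close> on the
  same side with interior angles \<open>a\<close> and \<open>pi - g\<close> of sum less than pi, so
  they close a triangle and meet; the law of sines gives the parameters. If the sum is 0, they face
  each other on one line.\<close>

lemma noncrossing_rays_angles_le:
  fixes p1 p2 :: complex
  assumes e: "cis e = sgn (p2 - p1)" and ne: "p1 \<noteq> p2"
    and e1: "\<psi>1 \<le> e" and e2: "\<psi>2 - pi \<le> e" "e \<le> \<psi>2 + pi"
    and nc: "\<And>t u. 0 \<le> t \<Longrightarrow> 0 \<le> u \<Longrightarrow> p1 + of_real t * cis \<psi>1 = p2 + of_real u * cis \<psi>2 \<Longrightarrow> cis \<psi>1 = cis \<psi>2"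
  shows "\<psi>1 \<le> \<psi>2"
proof (rule ccontr)
  assume less: "\<not> \<psi>1 \<le> \<psi>2"
  define a g where "a = e - \<psi>1" and "g = e - \<psi>2"
  have ag: "0 \<le> a" "a < g" "g \<le> pi" using assms less by (auto simp: a_def g_def)
  define L where "L = norm (p2 - p1)"
  have L: "L > 0" using ne by (simp add: L_def)
  have p2: "p2 = p1 + of_real L * cis e"
  proof -
    have "p2 - p1 = of_real (norm (p2 - p1)) * sgn (p2 - p1)" by (simp add: sgn_eq)
    then show ?thesis unfolding e L_def by (simp add: algebra_simps)
  qed
  have ps: "\<psi>1 = e - a" "\<psi>2 = e - g" by (simp_all add: a_def g_def)
  have ncis: "cis \<psi>1 \<noteq> cis \<psi>2"
  proof
    assume "cis \<psi>1 = cis \<psi>2"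
    then have "cis (g - a) = 1" unfolding ps by (simp add: cis_divide[symmetric] field_simps)
    then have "cos (g - a) = 1" by (metis cis.simps(1) one_complex.simps(1))
    moreover have "cos (g - a) < cos 0" using ag by (intro cos_monotone_0_pi) auto
    ultimately show False by simp
  qed
  show False
  proof (cases "g - a = pi")
    case True
    then have "a = 0" "g = pi" using ag by auto
    then have "p1 + of_real L * cis \<psi>1 = p2 + of_real 0 * cis \<psi>2" unfolding ps p2 by simp
    from nc[OF _ _ this] L ncis show False by auto
  next
    case False
    then have s: "sin (g - a) > 0" using ag by (intro sin_gt_zero) auto
    define t u where "t = L * sin g / sin (g - a)" and "u = L * sin a / sin (g - a)"
    have tu: "t \<ge> 0" "u \<ge> 0" using ag L s sin_ge_zero[of g] sin_ge_zero[of a] by (auto simp: t_def u_def)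
    have "of_real t * cis (- a) = of_real L + of_real u * cis (- g)"
    proof -
      have "t * cos a * sin (g - a) = (L + u * cos g) * sin (g - a)"
      proof -
        have "t * cos a * sin (g - a) = L * (sin g * cos a)" using s by (simp add: t_def)
        also have "sin g * cos a = sin (g - a) + sin a * cos g" by (simp add: sin_diff)
        also have "L * \<dots> = (L + u * cos g) * sin (g - a)" using s by (simp add: u_def field_simps)
        finally show ?thesis .
      qed
      then have "t * cos a = L + u * cos g" using s by simp
      moreover have "t * sin a = u * sin g" using s by (simp add: t_def u_def)
      ultimately show ?thesis by (simp add: complex_eq_iff)
    qed
    then have "of_real t * (cis e * cis (- a)) = cis e * of_real L + of_real u * (cis e * cis (- g))"
      by (simp add: algebra_simps)
    then have "p1 + of_real t * cis \<psi>1 = p2 + of_real u * cis \<psi>2"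
      unfolding ps p2 by (simp add: cis_mult)
    from nc[OF tu this] ncis show False by simp
  qed
qed

text \<open>The second inequality is the first one for the complex conjugate configuration, with all
  angles negated and \<open>\<psi>1 + 2 * pi\<close> in place of \<open>\<psi>1\<close>.\<close>

lemma noncrossing_rays_angles:
  fixes p1 p2 :: complex
  assumes e: "cis e = sgn (p2 - p1)" and ne: "p1 \<noteq> p2"
    and e1: "\<psi>1 \<le> e" "e \<le> \<psi>1 + 2 * pi" and e2: "\<psi>2 \<le> e + pi" "e + pi \<le> \<psi>2 + 2 * pi"
    and nc: "\<And>t u. 0 \<le> t \<Longrightarrow> 0 \<le> u \<Longrightarrow> p1 + of_real t * cis \<psi>1 = p2 + of_real u * cis \<psi>2 \<Longrightarrow> cis \<psi>1 = cis \<psi>2"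
  shows "\<psi>1 \<le> \<psi>2" "\<psi>2 \<le> \<psi>1 + 2 * pi"
proof -
  show "\<psi>1 \<le> \<psi>2" by (rule noncrossing_rays_angles_le[OF e ne]) (use assms in auto)
  have "- (\<psi>1 + 2 * pi) \<le> - \<psi>2"
  proof (rule noncrossing_rays_angles_le[of "- e" "cnj p2" "cnj p1"])
    show "cis (- e) = sgn (cnj p2 - cnj p1)"
    proof -
      have "sgn (cnj p2 - cnj p1) = cnj (sgn (p2 - p1))" by (simp add: sgn_eq flip: complex_cnj_diff)
      then show ?thesis using e by (metis cis_cnj)
    qed
    fix t u :: real assume tu: "0 \<le> t" "0 \<le> u"
      and eq: "cnj p1 + of_real t * cis (- (\<psi>1 + 2 * pi)) = cnj p2 + of_real u * cis (- \<psi>2)"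
    have c1: "cis (- (\<psi>1 + 2 * pi)) = cnj (cis \<psi>1)"
      using cis_divide[of "- \<psi>1" "2 * pi"] by (simp add: cis_cnj)
    from eq have "cnj (p1 + of_real t * cis \<psi>1) = cnj (p2 + of_real u * cis \<psi>2)"
      unfolding c1 by (simp add: cis_cnj)
    then have "cis \<psi>1 = cis \<psi>2" using nc[OF tu] by (simp only: complex_cnj_cancel_iff)
    then show "cis (- (\<psi>1 + 2 * pi)) = cis (- \<psi>2)" unfolding c1 by (simp add: cis_cnj[symmetric])
  qed (use assms in auto)
  then show "\<psi>2 \<le> \<psi>1 + 2 * pi" by simp
qed

text \<open>Time 1 is the arrival at the boundary; the constant continuation leaves room for the
  segment to the foot.\<close>

definition path_end :: "(real \<Rightarrow> complex) \<Rightarrow> complex \<Rightarrow> real \<Rightarrow> complex" where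
  "path_end c l s = (if s < 1 then c s else l)"

lemma path_end_simps [simp]: "s < 1 \<Longrightarrow> path_end c l s = c s" "s \<ge> 1 \<Longrightarrow> path_end c l s = l"
  by (auto simp: path_end_def)

lemma continuous_on_path_end:
  assumes c: "continuous_on {0..<1} c" and lim: "(c \<longlongrightarrow> l) (at_left 1)"
  shows "continuous_on {0..} (path_end c l)"
proof -
  have "continuous_on {0..1} (path_end c l)"
  proof (rule continuous_on_IccI)
    have "continuous_on {0..1/2} c" by (rule continuous_on_subset[OF c]) auto
    then have "(c \<longlongrightarrow> c 0) (at 0 within {0..1/2})" by (auto simp: continuous_on_def)
    then have "(c \<longlongrightarrow> c 0) (at_right 0)" by (simp add: at_within_Icc_at_right)
    moreover have "eventually (\<lambda>s. c s = path_end c l s) (at_right (0::real))"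
      unfolding eventually_at_right_field by (rule exI[of _ 1]) (auto simp: path_end_def)
    ultimately show "(path_end c l \<longlongrightarrow> path_end c l 0) (at_right 0)"
      by (simp add: filterlim_cong)
    have "eventually (\<lambda>s. c s = path_end c l s) (at_left (1::real))"
      unfolding eventually_at_left_field by (rule exI[of _ 0]) (auto simp: path_end_def)
    then show "(path_end c l \<longlongrightarrow> path_end c l 1) (at_left 1)"
      using lim by (simp add: filterlim_cong)
    fix x :: real assume x: "0 < x" "x < 1"
    have "continuous_on {0<..<1} c" by (rule continuous_on_subset[OF c]) auto
    then have "(c \<longlongrightarrow> c x) (at x)" using x by (simp add: continuous_on_eq_continuous_at isCont_def)
    moreover have "eventually (\<lambda>s. s \<in> {0<..<1}) (at x)" using x by (intro eventually_at_in_open') auto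
    then have "eventually (\<lambda>s. c s = path_end c l s) (at x)" by eventually_elim (auto simp: path_end_def)
    ultimately show "path_end c l \<midarrow>x\<rightarrow> path_end c l x" using x by (simp add: filterlim_cong)
  qed auto
  then have "continuous_on ({0..1} \<union> {1..}) (path_end c l)"
    by (intro continuous_on_closed_Un) (auto intro: continuous_on_eq[of _ "\<lambda>_. l"])
  then show ?thesis by (rule continuous_on_subset) auto
qed

text \<open>The argument of \<open>z - cis \<theta>\<close> for \<open>z\<close> in the disc, taken in \<open>(\<theta> + pi / 2, \<theta> + 3 * pi / 2)\<close>.\<close>

definition disc_arg :: "real \<Rightarrow> complex \<Rightarrow> real" where
  "disc_arg \<theta> z = \<theta> + pi + Arg (1 - z * cis (- \<theta>))"

lemma Re_pos_disc:
  assumes "norm z < 1" shows "Re (1 - z * cis (- \<theta>)) > 0"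
  using assms abs_Re_le_cmod[of "z * cis (- \<theta>)"] by (simp add: norm_mult)


lemma Re_pos_Arg: "Re z > 0 \<Longrightarrow> \<bar>Arg z\<bar> < pi / 2"
  using Arg_eq_Im_Ln[of z] Re_Ln_pos_lt[of z] by (cases "z = 0") auto

lemma disc_arg_bounds:
  assumes "norm z < 1" shows "\<theta> + pi / 2 < disc_arg \<theta> z" "disc_arg \<theta> z < \<theta> + 3 * pi / 2"
  using Re_pos_Arg[OF Re_pos_disc[OF assms, of \<theta>]] unfolding disc_arg_def by auto

lemma cis_Arg_sgn: "z \<noteq> 0 \<Longrightarrow> cis (Arg z) = sgn z"
  by (rule cis_Arg)

lemma cis_disc_arg:
  assumes "norm z < 1" shows "cis (disc_arg \<theta> z) = sgn (z - cis \<theta>)"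
proof -
  have nz: "1 - z * cis (- \<theta>) \<noteq> 0" using Re_pos_disc[OF assms, of \<theta>] by (metis less_irrefl zero_complex.sel(1))
  have "cis (disc_arg \<theta> z) = cis \<theta> * cis pi * sgn (1 - z * cis (- \<theta>))"
    unfolding disc_arg_def cis_mult[symmetric] cis_Arg_sgn[OF nz] ..
  also have "\<dots> = sgn (cis \<theta>) * sgn (- 1) * sgn (1 - z * cis (- \<theta>))"
    by (simp add: sgn_eq)
  also have "\<dots> = sgn (cis \<theta> * (- 1) * (1 - z * cis (- \<theta>)))" by (simp only: sgn_mult)
  also have "cis \<theta> * (- 1) * (1 - z * cis (- \<theta>)) = z - cis \<theta>"
    by (simp add: algebra_simps) (simp add: mult.left_commute[of _ z] cis_mult)
  finally show ?thesis .
qed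

lemma continuous_on_disc_arg: "continuous_on (ball 0 1) (disc_arg \<theta>)"
  unfolding disc_arg_def
proof (intro continuous_intros continuous_on_Arg)
  fix z :: complex assume "z \<in> ball 0 1"
  then have "Re (1 - z * cis (- \<theta>)) > 0" by (intro Re_pos_disc) auto
  then show "1 - z * cis (- \<theta>) \<notin> \<real>\<^sub>\<le>\<^sub>0" unfolding complex_nonpos_Reals_iff by linarith
qed

text \<open>A frontier point \<open>b\<close> is joined to infinity by the segment from \<open>b\<close> to \<open>foot b\<close>, outside the image, followed
  by the ray from \<open>foot b\<close> in direction \<open>dir b\<close>. \<open>B z w\<close> is a continuous argument of the chord quotient.\<close>

locale ray_image =
  fixes F :: "complex \<Rightarrow> complex" and B :: "complex \<Rightarrow> complex \<Rightarrow> real"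
    and foot dir :: "complex \<Rightarrow> complex"
  assumes contF: "continuous_on (ball 0 1) F"
    and injF: "inj_on F (ball 0 1)"
    and contB: "continuous_on disc_pairs (\<lambda>p. B (fst p) (snd p))"
    and cisB: "\<And>z w. (z, w) \<in> disc_pairs \<Longrightarrow> cis (B z w) = sgn ((F w - F z) / (w - z))"
    and symB: "\<And>z w. (z, w) \<in> disc_pairs \<Longrightarrow> B z w = B w z"
    and norm_dir: "\<And>b. b \<in> frontier (F ` ball 0 1) \<Longrightarrow> norm (dir b) = 1"
    and foot_ne: "\<And>b. b \<in> frontier (F ` ball 0 1) \<Longrightarrow> foot b \<noteq> b"
    and ray_avoids: "\<And>b w t. b \<in> frontier (F ` ball 0 1) \<Longrightarrow> w \<in> closed_segment b (foot b) \<Longrightarrow> 0 \<le> t \<Longrightarrow>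
        w + of_real t * dir b \<notin> F ` ball 0 1"
    and segment_avoids: "\<And>b b' w t. b \<in> frontier (F ` ball 0 1) \<Longrightarrow> b' \<in> frontier (F ` ball 0 1) \<Longrightarrow>
        w \<in> closed_segment b (foot b) \<Longrightarrow> w \<noteq> foot b \<Longrightarrow> 0 \<le> t \<Longrightarrow> w \<noteq> foot b' + of_real t * dir b'"
    and segments_disjoint: "\<And>b b'. b \<in> frontier (F ` ball 0 1) \<Longrightarrow> b' \<in> frontier (F ` ball 0 1) \<Longrightarrow>
        foot b \<noteq> foot b' \<Longrightarrow> closed_segment b (foot b) \<inter> closed_segment b' (foot b') = {}"
    and same_foot: "\<And>b b'. b \<in> frontier (F ` ball 0 1) \<Longrightarrow> b' \<in> frontier (F ` ball 0 1) \<Longrightarrow>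
        foot b = foot b' \<Longrightarrow> dir b = dir b'"
    and rays_noncrossing: "\<And>b b' t t'. b \<in> frontier (F ` ball 0 1) \<Longrightarrow> b' \<in> frontier (F ` ball 0 1) \<Longrightarrow>
        0 \<le> t \<Longrightarrow> 0 \<le> t' \<Longrightarrow> foot b \<noteq> foot b' \<Longrightarrow>
        foot b + of_real t * dir b = foot b' + of_real t' * dir b' \<Longrightarrow> dir b = dir b'"
begin

abbreviation "Bd \<equiv> frontier (F ` ball 0 1)"

text \<open>For \<open>cis \<psi> = d\<close> this is the argument in (\<psi>, \<psi> + 2 pi),
  continuous on the plane slit along the ray of direction \<open>d\<close> from 0.\<close>

definition ray_arg :: "real \<Rightarrow> complex \<Rightarrow> complex \<Rightarrow> real" where
  "ray_arg \<psi> d z = \<psi> + pi + Arg (- z / d)"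

lemma ray_arg_bounds:
  assumes "norm d = 1" "\<And>t. 0 \<le> t \<Longrightarrow> z \<noteq> of_real t * d"
  shows "\<psi> < ray_arg \<psi> d z" "ray_arg \<psi> d z < \<psi> + 2 * pi" "- z / d \<notin> \<real>\<^sub>\<le>\<^sub>0"
    "cis \<psi> = d \<Longrightarrow> cis (ray_arg \<psi> d z) = sgn z"
proof -
  have d: "d \<noteq> 0" using assms(1) by auto
  show n: "- z / d \<notin> \<real>\<^sub>\<le>\<^sub>0"
  proof
    assume "- z / d \<in> \<real>\<^sub>\<le>\<^sub>0"
    then obtain r where r: "- z / d = of_real r" "r \<le> 0" by (metis nonpos_Reals_cases)
    have "z = - ((- z / d) * d)" using d by simp
    then have "z = of_real (- r) * d" unfolding r(1) by simp
    then show False using assms(2)[of "- r"] r by simp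
  qed
  then have "Arg (- z / d) \<noteq> pi"
    by (metis Arg_eq_pi complex_nonpos_Reals_iff less_eq_real_def)
  then show "\<psi> < ray_arg \<psi> d z" "ray_arg \<psi> d z < \<psi> + 2 * pi"
    using mpi_less_Arg[of "- z / d"] Arg_le_pi[of "- z / d"] by (auto simp: ray_arg_def)
  have nz: "- z / d \<noteq> 0" using n by (metis nonpos_Reals_zero_I)
  assume c: "cis \<psi> = d"
  have "cis (ray_arg \<psi> d z) = d * (- 1) * sgn (- z / d)"
    unfolding ray_arg_def cis_mult[symmetric] cis_Arg_sgn[OF nz] c by simp
  also have "\<dots> = sgn (d * (- 1) * (- z / d))"
    using assms(1) by (simp add: sgn_mult) (simp add: sgn_eq)
  also have "d * (- 1) * (- z / d) = z" using d by simp
  finally show "cis (ray_arg \<psi> d z) = sgn z" .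
qed

lemma continuous_on_ray_arg:
  assumes "norm d = 1" "continuous_on S g" "\<And>x t. x \<in> S \<Longrightarrow> 0 \<le> t \<Longrightarrow> g x \<noteq> of_real t * d"
  shows "continuous_on S (\<lambda>x. ray_arg \<psi> d (g x))"
  unfolding ray_arg_def using assms(1)
  by (intro continuous_intros continuous_on_Arg assms(2) ray_arg_bounds(3)[OF assms(1)] assms(3)) auto

definition access :: "real \<Rightarrow> complex \<Rightarrow> (real \<Rightarrow> complex) \<Rightarrow> bool" where
  "access \<theta> b c \<longleftrightarrow> continuous_on {0..<1} c \<and> (\<forall>s\<in>{0..<1}. norm (c s) < 1) \<and>
     (c \<longlongrightarrow> cis \<theta>) (at_left 1) \<and> ((\<lambda>s. F (c s)) \<longlongrightarrow> b) (at_left 1) \<and> b \<in> Bd"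

text \<open>Here \<open>\<psi>\<close> is a real number, not an angle modulo 2 pi: among the
  arguments of \<open>dir b\<close> it is the one for which \<open>B\<close> tends to the argument
  of \<open>F z - b\<close>, counted from \<open>\<psi>\<close>, minus the argument of
  \<open>z - cis \<theta>\<close>. Angles at different boundary points become comparable in this
  way.\<close>

definition ray_access :: "real \<Rightarrow> real \<Rightarrow> complex \<Rightarrow> (real \<Rightarrow> complex) \<Rightarrow> bool" where
  "ray_access \<theta> \<psi> b c \<longleftrightarrow> access \<theta> b c \<and> cis \<psi> = dir b \<and>
     (\<forall>z\<in>ball 0 1. ((\<lambda>s. B (c s) z) \<longlongrightarrow> ray_arg \<psi> (dir b) (F z - b) - disc_arg \<theta> z) (at_left 1))"

lemma boundary_notin: "b \<in> Bd \<Longrightarrow> 0 \<le> t \<Longrightarrow> z \<in> ball 0 1 \<Longrightarrow> F z - b \<noteq> of_real t * dir b"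
  using ray_avoids[of b b t] by (metis add.commute diff_eq_eq ends_in_segment(1) image_eqI)

lemma access_hat:
  assumes "access \<theta> b c"
  shows "continuous_on {0..} (path_end c (cis \<theta>))" "continuous_on {0..} (path_end (\<lambda>s. F (c s)) b)"
proof -
  show "continuous_on {0..} (path_end c (cis \<theta>))"
    using assms by (intro continuous_on_path_end) (auto simp: access_def)
  have "continuous_on {0..<1} (\<lambda>s. F (c s))"
    by (rule continuous_on_compose2[OF contF]) (use assms in \<open>auto simp: access_def\<close>)
  then show "continuous_on {0..} (path_end (\<lambda>s. F (c s)) b)"
    using assms by (intro continuous_on_path_end) (auto simp: access_def)
qed

text \<open>The chord quotient extends continuously to the end of the path, so on each segment from
  0 the limit of \<open>B\<close> differs from \<open>L\<close> by a fixed multiple of 2 pi. All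
  these segments start at 0, which makes the multiple the same for every \<open>z\<close>; it is
  then absorbed into \<open>\<psi>\<close>.\<close>

lemma ray_access_exists:
  assumes acc: "access \<theta> b c"
  obtains \<psi> where "ray_access \<theta> \<psi> b c"
proof -
  have bBd: "b \<in> Bd" and cc: "continuous_on {0..<1} c" and cD: "\<And>s. 0 \<le> s \<Longrightarrow> s < 1 \<Longrightarrow> norm (c s) < 1"
    and cl: "(c \<longlongrightarrow> cis \<theta>) (at_left 1)"
    using acc by (auto simp: access_def)
  have nd: "norm (dir b) = 1" using norm_dir bBd by blast
  define \<psi>0 where "\<psi>0 = Arg (dir b)"
  have c0: "cis \<psi>0 = dir b" using nd cis_Arg_sgn[of "dir b"] by (cases "dir b = 0") (auto simp: \<psi>0_def sgn_eq)
  define L where "L z = ray_arg \<psi>0 (dir b) (F z - b) - disc_arg \<theta> z" for z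
  have contL: "continuous_on (ball 0 1) L"
    unfolding L_def by (intro continuous_intros continuous_on_disc_arg continuous_on_ray_arg nd contF boundary_notin bBd)
  have Fb: "F z \<noteq> b" if "z \<in> ball 0 1" for z using boundary_notin[OF bBd, of 0 z] that by auto
  have cisL: "cis (L z) = sgn ((F z - b) / (z - cis \<theta>))" if "z \<in> ball 0 1" for z
  proof -
    have "cis (ray_arg \<psi>0 (dir b) (F z - b)) = sgn (F z - b)"
      by (rule ray_arg_bounds(4)[OF nd _ c0]) (use boundary_notin[OF bBd _ that] in auto)
    then show ?thesis using that by (simp add: L_def cis_divide[symmetric] cis_disc_arg sgn_divide)
  qed
  have main: "\<exists>k::int. \<forall>w\<in>closed_segment 0 z. ((\<lambda>s. B (c s) w) \<longlongrightarrow> L w + 2 * pi * of_int k) (at_left 1)"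
    if z: "z \<in> ball 0 1" for z
  proof -
    define K where "K = closed_segment 0 z"
    have Kz: "norm w \<le> norm z" if "w \<in> K" for w
      using that unfolding K_def by (metis closed_segment_commute diff_zero norm_minus_commute segment_bound(2) segment_bound1)
    have KD: "K \<subseteq> ball 0 1" using Kz z by fastforce
    have "((\<lambda>s. norm (c s)) \<longlongrightarrow> 1) (at_left 1)" using tendsto_norm[OF cl] by simp
    \<comment> \<open>From the time \<open>\<alpha>\<close> on, the path stays outside the closed
      disc of radius \<open>norm z\<close>, so it does not meet the segment
      \<open>K\<close>.\<close>
    then have "eventually (\<lambda>s. norm (c s) > norm z) (at_left 1)"
      using z by (intro order_tendstoD) auto
    then obtain \<alpha>' where \<alpha>': "\<alpha>' < 1" "\<And>s. \<alpha>' < s \<Longrightarrow> s < 1 \<Longrightarrow> norm (c s) > norm z"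
      unfolding eventually_at_left_field by blast
    define \<alpha> where "\<alpha> = (max \<alpha>' 0 + 1) / 2"
    have \<alpha>: "0 \<le> \<alpha>" "\<alpha> < 1" "\<alpha>' < \<alpha>" using \<alpha>' by (auto simp: \<alpha>_def max_def)
    define zh where "zh = path_end c (cis \<theta>)"
    define wh where "wh = path_end (\<lambda>s. F (c s)) b"
    define S where "S = {\<alpha>..1} \<times> K"
    define q where "q p = (F (snd p) - wh (fst p)) / (snd p - zh (fst p))" for p
    have zw: "w \<noteq> zh s" if "w \<in> K" "\<alpha> \<le> s" "s \<le> 1" for w s
    proof (cases "s < 1")
      case True
      then show ?thesis using \<alpha>'(2)[of s] Kz[OF that(1)] that \<alpha> by (auto simp: zh_def)
    next
      case False
      then show ?thesis using KD that by (auto simp: zh_def)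
    qed
    have contq: "continuous_on S q"
      unfolding q_def S_def
      by (intro continuous_intros continuous_on_compose2[OF contF] continuous_on_compose2[OF access_hat(1)[OF acc, folded zh_def]]
           continuous_on_compose2[OF access_hat(2)[OF acc, folded wh_def]]) (use KD \<alpha> zw in auto)
    have nz: "q p \<noteq> 0" if "p \<in> S" for p
    proof -
      obtain s w where p': "p = (s, w)" by (cases p)
      then have p: "p = (s, w)" "w \<in> K" "\<alpha> \<le> s" "s \<le> 1" using that by (auto simp: S_def)
      have "F w \<noteq> wh s"
      proof (cases "s < 1")
        case True
        then have "w \<noteq> c s" using zw[OF p(2-4)] by (simp add: zh_def)
        then show ?thesis using True injF p KD cD[of s] \<alpha> by (auto simp: wh_def inj_on_def)
      next
        case False
        have "w \<in> ball 0 1" using p KD by blast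
        then show ?thesis using False Fb by (simp add: wh_def)
      qed
      then show ?thesis using zw[OF p(2-4)] p(1) by (simp add: q_def)
    qed
    define S0 where "S0 = {\<alpha>..<1} \<times> K"
    have S0: "S0 \<subseteq> S" by (auto simp: S0_def S_def)
    have cK: "c s \<notin> K" if "\<alpha> \<le> s" "s < 1" for s using zw[of "c s" s] that by (auto simp: zh_def)
    have cvx: "convex S" unfolding S_def K_def by (intro convex_Times) auto
    have cn: "connected S0" unfolding S0_def K_def by (intro connected_Times) auto
    have cb: "continuous_on S0 (\<lambda>p. B (c (fst p)) (snd p))"
      by (rule continuous_on_compose2[OF contB, of _ "\<lambda>p. (c (fst p), snd p)", simplified])
         (intro continuous_intros continuous_on_compose2[OF cc], use \<alpha> KD cD cK in \<open>auto simp: S0_def disc_pairs_def\<close>)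
    have cl: "cis (B (c (fst p)) (snd p)) = sgn (q p)" if "p \<in> S0" for p
      using that cisB[of "c (fst p)" "snd p"] \<alpha> KD cD[of "fst p"] zw[of "snd p" "fst p"]
      by (auto simp: S0_def disc_pairs_def q_def zh_def wh_def)
    obtain e where e: "continuous_on S e" "\<And>p. p \<in> S \<Longrightarrow> cis (e p) = sgn (q p)"
        "\<And>p. p \<in> S0 \<Longrightarrow> e p = B (c (fst p)) (snd p)"
      by (rule extend_argument_lift[OF cvx contq nz S0 cn cb cl], assumption, assumption, rule that)
    have lim: "((\<lambda>s. B (c s) w) \<longlongrightarrow> e (1, w)) (at_left 1)" if w: "w \<in> K" for w
    proof -
      have "continuous_on {\<alpha>..1} (\<lambda>s. e (s, w))"
        by (rule continuous_on_compose2[OF e(1)]) (use w in \<open>auto simp: S_def intro!: continuous_intros\<close>)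
      then have "((\<lambda>s. e (s, w)) \<longlongrightarrow> e (1, w)) (at 1 within {\<alpha>..1})" using \<alpha> by (auto simp: continuous_on_def)
      then have "((\<lambda>s. e (s, w)) \<longlongrightarrow> e (1, w)) (at_left 1)" using \<alpha> by (simp add: at_within_Icc_at_left)
      moreover have "eventually (\<lambda>s. e (s, w) = B (c s) w) (at_left (1::real))"
        unfolding eventually_at_left_field by (rule exI[of _ \<alpha>]) (use \<alpha> w e(3) in \<open>auto simp: S0_def\<close>)
      ultimately show ?thesis by (simp add: filterlim_cong)
    qed
    obtain k :: int where k: "\<And>w. w \<in> K \<Longrightarrow> e (1, w) = L w + 2 * pi * of_int k"
    proof (rule cis_eq_lift[of K "\<lambda>w. e (1, w)" L])
      show "continuous_on K (\<lambda>w. e (1, w))"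
        by (rule continuous_on_compose2[OF e(1)]) (use \<alpha> in \<open>auto simp: S_def intro!: continuous_intros\<close>)
      show "continuous_on K L" by (rule continuous_on_subset[OF contL KD])
      show "cis (e (1, w)) = cis (L w)" if "w \<in> K" for w
        using e(2)[of "(1, w)"] cisL[of w] that \<alpha> KD by (auto simp: S_def q_def zh_def wh_def)
    qed (auto simp: K_def)
    show ?thesis using lim k unfolding K_def by auto
  qed
  obtain k0 :: int where k0: "((\<lambda>s. B (c s) 0) \<longlongrightarrow> L 0 + 2 * pi * of_int k0) (at_left 1)"
    using main[of 0] by auto
  have all: "((\<lambda>s. B (c s) z) \<longlongrightarrow> L z + 2 * pi * of_int k0) (at_left 1)" if z: "z \<in> ball 0 1" for z
  proof -
    obtain k :: int where k: "\<forall>w\<in>closed_segment 0 z. ((\<lambda>s. B (c s) w) \<longlongrightarrow> L w + 2 * pi * of_int k) (at_left 1)"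
      using main[OF z] by blast
    then have "((\<lambda>s. B (c s) 0) \<longlongrightarrow> L 0 + 2 * pi * of_int k) (at_left 1)" by auto
    then have "L 0 + 2 * pi * of_int k = L 0 + 2 * pi * of_int k0"
      using k0 tendsto_unique trivial_limit_at_left_real by blast
    then have "k = k0" by simp
    then show ?thesis using k by auto
  qed
  have "ray_access \<theta> (\<psi>0 + 2 * pi * of_int k0) b c"
    unfolding ray_access_def
  proof (intro conjI ballI acc)
    show "cis (\<psi>0 + 2 * pi * of_int k0) = dir b"
      using c0 by (simp add: cis_mult[symmetric] cis_multiple_2pi)
    fix z :: complex assume "z \<in> ball 0 1"
    from all[OF this] show "((\<lambda>s. B (c s) z) \<longlongrightarrow> ray_arg (\<psi>0 + 2 * pi * of_int k0) (dir b) (F z - b) - disc_arg \<theta> z) (at_left 1)"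
      by (simp add: L_def ray_arg_def algebra_simps)
  qed
  then show ?thesis by (rule that)
qed

lemma ray_access_shift:
  "ray_access \<theta> \<psi> b c \<Longrightarrow> ray_access (\<theta> + 2 * pi) (\<psi> + 2 * pi) b c"
proof -
  have c2: "cis (x + 2 * pi) = cis x" for x by (simp add: cis_mult[symmetric])
  have "cis (- x - 2 * pi) = cis (- x)" for x using cis_divide[of "- x" "2 * pi"] by simp
  then have d: "disc_arg (\<theta> + 2 * pi) z = disc_arg \<theta> z + 2 * pi" for z by (simp add: disc_arg_def)
  show "ray_access \<theta> \<psi> b c \<Longrightarrow> ray_access (\<theta> + 2 * pi) (\<psi> + 2 * pi) b c"
    unfolding ray_access_def access_def c2 d by (simp add: ray_arg_def algebra_simps)
qed

text \<open>\<open>access_path b c\<close> follows \<open>F\<close> along \<open>c\<close> to \<open>b\<close> for times up to \<open>1\<close> and then the segment to the foot.\<close>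

definition access_path :: "complex \<Rightarrow> (real \<Rightarrow> complex) \<Rightarrow> real \<Rightarrow> complex" where
  "access_path b c s = path_end (\<lambda>s. F (c s)) b s + of_real (max 0 (s - 1)) * (foot b - b)"

lemma access_path_less [simp]: "s < 1 \<Longrightarrow> access_path b c s = F (c s)"
  and access_path_one [simp]: "access_path b c 1 = b"
  and access_path_two [simp]: "access_path b c 2 = foot b"
  by (auto simp: access_path_def)

lemma access_path_ge: 
  assumes "1 \<le> s" "s \<le> 2" 
  shows "access_path b c s \<in> closed_segment b (foot b)" "s < 2 \<Longrightarrow> b \<noteq> foot b \<Longrightarrow> access_path b c s \<noteq> foot b"
proof -
  have eq: "access_path b c s = (1 - (s - 1)) *\<^sub>R b + (s - 1) *\<^sub>R foot b"
    using assms by (simp add: access_path_def scaleR_conv_of_real algebra_simps)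
  show "access_path b c s \<in> closed_segment b (foot b)"
    unfolding eq in_segment using assms by (intro exI[of _ "s - 1"]) auto
  assume "s < 2" "b \<noteq> foot b"
  moreover have "access_path b c s - foot b = of_real (2 - s) * (b - foot b)"
    unfolding eq by (simp add: scaleR_conv_of_real algebra_simps)
  ultimately have "access_path b c s - foot b \<noteq> 0" by (simp del: of_real_diff)
  then show "access_path b c s \<noteq> foot b" by simp
qed

lemma continuous_on_access_path: "access \<theta> b c \<Longrightarrow> continuous_on {0..} (access_path b c)"
  unfolding access_path_def by (intro continuous_intros access_hat(2))

lemma access_path_tail:
  assumes "b \<in> Bd" "b' \<in> Bd" "1 \<le> s" "s < 2" "b \<noteq> foot b" "0 \<le> t"
  shows "access_path b c s \<noteq> foot b' + of_real t * dir b'"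
  using assms access_path_ge[of s b c] by (intro segment_avoids[of b]) auto

text \<open>Limits in the first variable, then transport along the segment from \<open>b\<close> to its foot, keep the
  argument of a chord inside an open interval of length \<open>2 \<pi>\<close> determined by the ray at \<open>b\<close>.\<close>

lemma chord_arg_first_bounds:
  assumes ra: "ray_access \<theta> \<psi> b c" and \<alpha>: "0 \<le> \<alpha>" "\<alpha> < 1" and T: "1 \<le> T" "T \<le> 2"
    and e: "continuous_on ({\<alpha>..T} \<times> {\<alpha>..T}) e"
    and w: "continuous_on {\<alpha>..T} w"
    and z: "\<And>s. s \<in> {\<alpha>..<1} \<Longrightarrow> norm (z s) < 1 \<and> w s = F (z s)"
    and ce: "\<And>s t. s \<in> {\<alpha>..T} \<Longrightarrow> t \<in> {\<alpha>..T} \<Longrightarrow> cis (e (s, t)) = sgn (w t - access_path b c s)"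
    and eB: "\<And>s t. s \<in> {\<alpha>..<1} \<Longrightarrow> t \<in> {\<alpha>..<1} \<Longrightarrow> e (s, t) = B (c s) (z t) + \<beta> s t"
    and \<beta>: "\<And>t. t \<in> {\<alpha>..<1} \<Longrightarrow> ((\<lambda>s. \<beta> s t) \<longlongrightarrow> disc_arg \<theta> (z t)) (at_left 1)"
    and off: "\<And>s t. s \<in> {1..<T} \<Longrightarrow> 0 \<le> t \<Longrightarrow> w s \<noteq> access_path b c T + of_real t * dir b"
  shows "\<psi> \<le> e (T, T)" "e (T, T) \<le> \<psi> + 2 * pi"
proof -
  have bBd: "b \<in> Bd" and acc: "access \<theta> b c" and c\<psi>: "cis \<psi> = dir b"
    using ra by (auto simp: ray_access_def access_def)
  have nd: "norm (dir b) = 1" using norm_dir[OF bBd] .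
  define W where "W = access_path b c"
  have contW: "continuous_on {0..} W" unfolding W_def by (rule continuous_on_access_path[OF acc])
  have Wseg: "W s \<in> closed_segment b (foot b)" if "1 \<le> s" "s \<le> T" for s
    using access_path_ge(1)[of s] that T by (auto simp: W_def)
  have av1: "w t - W s \<noteq> of_real r * dir b" if "t \<in> {\<alpha>..<1}" "1 \<le> s" "s \<le> T" "0 \<le> r" for r s t
  proof
    assume "w t - W s = of_real r * dir b"
    then have "F (z t) = W s + of_real r * dir b" using z[OF that(1)] by (simp add: algebra_simps)
    moreover have "F (z t) \<in> F ` ball 0 1" using z[OF that(1)] by auto
    ultimately show False using ray_avoids[OF bBd Wseg[OF that(2,3)] that(4)] by simp
  qed
  have step1: "e (1, t) = ray_arg \<psi> (dir b) (w t - W 1)" if t: "t \<in> {\<alpha>..<1}" for t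
  proof -
    have "continuous_on {\<alpha>..1} (\<lambda>s. e (s, t))"
      by (rule continuous_on_compose2[OF e]) (use t T in \<open>auto intro!: continuous_intros\<close>)
    then have "((\<lambda>s. e (s, t)) \<longlongrightarrow> e (1, t)) (at 1 within {\<alpha>..1})" using \<alpha> by (auto simp: continuous_on_def)
    then have "((\<lambda>s. e (s, t)) \<longlongrightarrow> e (1, t)) (at_left 1)" using \<alpha> by (simp add: at_within_Icc_at_left)
    moreover have "((\<lambda>s. B (c s) (z t) + \<beta> s t) \<longlongrightarrow>
        (ray_arg \<psi> (dir b) (F (z t) - b) - disc_arg \<theta> (z t)) + disc_arg \<theta> (z t)) (at_left 1)"
      using ra z[OF t] by (intro tendsto_add \<beta>[OF t]) (auto simp: ray_access_def)
    moreover have "eventually (\<lambda>s. B (c s) (z t) + \<beta> s t = e (s, t)) (at_left (1::real))"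
      unfolding eventually_at_left_field by (rule exI[of _ \<alpha>]) (use \<alpha> t eB in auto)
    ultimately have "e (1, t) = ray_arg \<psi> (dir b) (F (z t) - b)"
      using tendsto_unique[OF trivial_limit_at_left_real] by (simp add: filterlim_cong)
    then show ?thesis using z[OF t] by (simp add: W_def)
  qed
  have step2: "e (T, t) = ray_arg \<psi> (dir b) (w t - W T)" if t: "t \<in> {\<alpha>..<1}" for t
  proof -
    obtain k :: int where k: "\<And>s. s \<in> {1..T} \<Longrightarrow> e (s, t) = ray_arg \<psi> (dir b) (w t - W s) + 2 * pi * of_int k"
    proof (rule cis_eq_lift[of "{1..T}" "\<lambda>s. e (s, t)" "\<lambda>s. ray_arg \<psi> (dir b) (w t - W s)"])
      show "continuous_on {1..T} (\<lambda>s. e (s, t))"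
        by (rule continuous_on_compose2[OF e]) (use t T \<alpha> in \<open>auto intro!: continuous_intros\<close>)
      show "continuous_on {1..T} (\<lambda>s. ray_arg \<psi> (dir b) (w t - W s))"
        by (intro continuous_on_ray_arg nd continuous_intros continuous_on_subset[OF contW]) (use av1[OF t] in auto)
      show "cis (e (s, t)) = cis (ray_arg \<psi> (dir b) (w t - W s))" if "s \<in> {1..T}" for s
        using ce[of s t] t that \<alpha> T ray_arg_bounds(4)[OF nd _ c\<psi>, of "w t - W s"] av1[OF t]
        by (auto simp: W_def)
    qed (use T in auto)
    from k[of 1] step1[OF t] T have "k = 0" by simp
    then show ?thesis using k[of T] T by simp
  qed
  have av2: "w t - W T \<noteq> of_real r * dir b" if "t \<in> {\<alpha>..<T}" "0 \<le> r" for r t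
  proof (cases "t < 1")
    case True
    then show ?thesis using av1[of t T r] that T by auto
  next
    case False
    then show ?thesis using off[of t r] that by (auto simp: W_def algebra_simps)
  qed
  have step3: "e (T, t) = ray_arg \<psi> (dir b) (w t - W T)" if t: "t \<in> {\<alpha>..<T}" for t
  proof -
    obtain k :: int where k: "\<And>t. t \<in> {\<alpha>..<T} \<Longrightarrow> e (T, t) = ray_arg \<psi> (dir b) (w t - W T) + 2 * pi * of_int k"
    proof (rule cis_eq_lift[of "{\<alpha>..<T}" "\<lambda>t. e (T, t)" "\<lambda>t. ray_arg \<psi> (dir b) (w t - W T)"])
      show "continuous_on {\<alpha>..<T} (\<lambda>t. e (T, t))"
        by (rule continuous_on_compose2[OF e]) (use T \<alpha> in \<open>auto intro!: continuous_intros\<close>)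
      show "continuous_on {\<alpha>..<T} (\<lambda>t. ray_arg \<psi> (dir b) (w t - W T))"
        by (intro continuous_on_ray_arg nd continuous_intros continuous_on_subset[OF w]) (use av2 in auto)
      show "cis (e (T, t)) = cis (ray_arg \<psi> (dir b) (w t - W T))" if "t \<in> {\<alpha>..<T}" for t
        using ce[of T t] that \<alpha> T ray_arg_bounds(4)[OF nd _ c\<psi>, of "w t - W T"] av2[OF that]
        by (auto simp: W_def)
    qed (use T \<alpha> in auto)
    from k[of \<alpha>] step2[of \<alpha>] T \<alpha> have "k = 0" by simp
    then show ?thesis using k[OF t] by simp
  qed
  have "continuous_on {\<alpha>..T} (\<lambda>t. e (T, t))"
    by (rule continuous_on_compose2[OF e]) (use T \<alpha> in \<open>auto intro!: continuous_intros\<close>)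
  then have "((\<lambda>t. e (T, t)) \<longlongrightarrow> e (T, T)) (at T within {\<alpha>..T})" using \<alpha> T by (auto simp: continuous_on_def)
  then have lim: "((\<lambda>t. e (T, t)) \<longlongrightarrow> e (T, T)) (at_left T)" using \<alpha> T by (simp add: at_within_Icc_at_left)
  \<comment> \<open>The ray is avoided for \<open>t < T\<close> only, so just the weak inequalities
    pass to the limit.\<close>
  have ev: "eventually (\<lambda>t. \<psi> \<le> e (T, t) \<and> e (T, t) \<le> \<psi> + 2 * pi) (at_left T)"
    unfolding eventually_at_left_field
  proof (intro exI[of _ \<alpha>] conjI allI impI)
    fix t assume "\<alpha> < t" "t < T"
    then have t: "t \<in> {\<alpha>..<T}" by auto
    show "\<psi> \<le> e (T, t)" "e (T, t) \<le> \<psi> + 2 * pi"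
      unfolding step3[OF t] using ray_arg_bounds(1,2)[OF nd, of "w t - W T" \<psi>] av2[OF t] by auto
  qed (use \<alpha> T in auto)
  show "\<psi> \<le> e (T, T)"
    by (rule tendsto_lowerbound[OF lim]) (use ev in \<open>auto elim: eventually_mono\<close>)
  show "e (T, T) \<le> \<psi> + 2 * pi"
    by (rule tendsto_upperbound[OF lim]) (use ev in \<open>auto elim: eventually_mono\<close>)
qed

end

section \<open>Chords with both ends at the boundary\<close>

lemma cis_diff_formula:
  "cis b - cis a = of_real (2 * sin ((b - a) / 2)) * cis ((a + b) / 2 + pi / 2)"
proof -
  have 1: "cos b - cos a = 2 * sin ((b - a) / 2) * (- sin ((a + b) / 2))"
  proof -
    have "sin ((a - b) / 2) = - sin ((b - a) / 2)" using sin_minus[of "(b - a) / 2"] by (simp add: minus_divide_left)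
    then show ?thesis using cos_diff_cos[of b a] by (simp add: add.commute)
  qed
  have 2: "sin b - sin a = 2 * sin ((b - a) / 2) * cos ((a + b) / 2)"
    using sin_diff_sin[of b a] by (simp add: add.commute)
  show ?thesis using 1 2 by (simp add: complex_eq_iff cos_add sin_add)
qed

lemma abs_diff_cis_eq:
  assumes "cis x = cis y" "\<bar>x - y\<bar> < 2 * pi" shows "x = y"
proof -
  have "cis (x - y) = 1" using assms(1) by (simp add: cis_divide[symmetric])
  then have "cos (x - y) = 1" by (metis cis.simps(1) one_complex.simps(1))
  then obtain n :: int where n: "x - y = of_int n * 2 * pi" using cos_one_2pi_int by auto
  have "\<bar>real_of_int n\<bar> * (2 * pi) < 1 * (2 * pi)" using assms(2) unfolding n by (simp add: abs_mult mult_ac)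
  then have "\<bar>real_of_int n\<bar> < 1" by (rule mult_right_less_imp_less) simp
  then have "n = 0" by linarith
  then show ?thesis using n by simp
qed

context ray_image
begin

text \<open>\<open>pair_arg\<close> is the argument of \<open>w - z\<close> for \<open>z\<close> near \<open>cis a\<close> and \<open>w\<close> near \<open>cis b\<close>.\<close>

definition pair_arg :: "real \<Rightarrow> real \<Rightarrow> complex \<Rightarrow> complex \<Rightarrow> real" where
  "pair_arg a b z w = (a + b) / 2 + pi / 2 + Arg ((w - z) / (cis b - cis a))"

lemma pair_arg:
  assumes ab: "a < b" "b < a + 2 * pi" and zw: "norm (w - z - (cis b - cis a)) < norm (cis b - cis a)"
  shows "\<bar>pair_arg a b z w - ((a + b) / 2 + pi / 2)\<bar> < pi / 2" "cis (pair_arg a b z w) = sgn (w - z)"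
    "(w - z) / (cis b - cis a) \<notin> \<real>\<^sub>\<le>\<^sub>0" "w \<noteq> z"
proof -
  define c where "c = cis b - cis a"
  have s: "sin ((b - a) / 2) > 0" using ab by (intro sin_gt_zero) auto
  have c: "c = of_real (2 * sin ((b - a) / 2)) * cis ((a + b) / 2 + pi / 2)"
    unfolding c_def by (rule cis_diff_formula)
  have c0: "c \<noteq> 0" unfolding c using s by simp
  have "norm ((w - z) / c - 1) < 1"
  proof -
    have "(w - z) / c - 1 = (w - z - c) / c" using c0 by (simp add: field_simps)
    then show ?thesis using zw c0 by (simp add: norm_divide c_def[symmetric])
  qed
  then have R: "Re ((w - z) / c) > 0" using abs_Re_le_cmod[of "(w - z) / c - 1"] by (simp del: Re_divide)
  show "\<bar>pair_arg a b z w - ((a + b) / 2 + pi / 2)\<bar> < pi / 2"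
    using Re_pos_Arg[OF R] by (simp add: pair_arg_def c_def)
  show "(w - z) / (cis b - cis a) \<notin> \<real>\<^sub>\<le>\<^sub>0"
    using R unfolding c_def complex_nonpos_Reals_iff by linarith
  then show wz: "w \<noteq> z" by auto
  have "cis (pair_arg a b z w) = cis ((a + b) / 2 + pi / 2) * sgn ((w - z) / c)"
    unfolding pair_arg_def cis_mult[symmetric] c_def[symmetric] using wz c0 by (subst cis_Arg_sgn) auto
  also have "cis ((a + b) / 2 + pi / 2) = sgn c" unfolding c using s by (simp add: sgn_mult sgn_of_real) (simp add: sgn_eq)
  finally show "cis (pair_arg a b z w) = sgn (w - z)" using c0 by (simp add: sgn_divide sgn_zero_iff)
qed

text \<open>In both claims the two sides lift the same direction and differ by less than 2 pi. The
  additional pi for \<open>b\<close> reflects that the chord is then seen from its other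
  end.\<close>

lemma pair_arg_disc_arg:
  assumes ab: "a < b" "b < a + 2 * pi"
  shows "norm w < 1 \<Longrightarrow> norm (w - cis a - (cis b - cis a)) < norm (cis b - cis a) \<Longrightarrow> pair_arg a b (cis a) w = disc_arg a w"
    and "norm z < 1 \<Longrightarrow> norm (cis b - z - (cis b - cis a)) < norm (cis b - cis a) \<Longrightarrow> pair_arg a b z (cis b) + pi = disc_arg b z"
proof -
  assume w: "norm w < 1" "norm (w - cis a - (cis b - cis a)) < norm (cis b - cis a)"
  show "pair_arg a b (cis a) w = disc_arg a w"
    by (rule abs_diff_cis_eq)
       (use pair_arg(1,2)[OF ab w(2)] cis_disc_arg[OF w(1), of a] disc_arg_bounds[OF w(1), of a] ab in \<open>auto simp: abs_less_iff field_simps\<close>)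
next
  assume z: "norm z < 1" "norm (cis b - z - (cis b - cis a)) < norm (cis b - cis a)"
  have "cis (pair_arg a b z (cis b) + pi) = sgn (z - cis b)"
    unfolding cis_mult[symmetric] pair_arg(2)[OF ab z(2)] by (simp add: sgn_minus[symmetric])
  then show "pair_arg a b z (cis b) + pi = disc_arg b z"
    by (intro abs_diff_cis_eq)
       (use pair_arg(1)[OF ab z(2)] cis_disc_arg[OF z(1), of b] disc_arg_bounds[OF z(1), of b] ab in \<open>auto simp: abs_less_iff field_simps\<close>)
qed

text \<open>The sum of \<open>B\<close> and \<open>pair_arg\<close> is an argument of the chord
  between the two access paths. It extends to the square of times up to \<open>T\<close>, and the
  bounds at \<open>(T, T)\<close> come from \<open>chord_arg_first_bounds\<close> applied to both
  orders of the paths; reversing the chord adds pi. \<open>T = 1\<close> compares the boundary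
  points, \<open>T = 2\<close> their feet.\<close>

lemma chord_arg_limit:
  assumes ra1: "ray_access a \<psi>1 b1 c1" and ra2: "ray_access b \<psi>2 b2 c2" and ab: "a < b" "b < a + 2 * pi"
    and T: "1 \<le> T" "T \<le> 2"
    and ne: "\<And>s t. 0 \<le> s \<Longrightarrow> s \<le> T \<Longrightarrow> 0 \<le> t \<Longrightarrow> t \<le> T \<Longrightarrow> 1 \<le> max s t \<Longrightarrow>
        access_path b1 c1 s \<noteq> access_path b2 c2 t"
    and off1: "\<And>s t. s \<in> {1..<T} \<Longrightarrow> 0 \<le> t \<Longrightarrow> access_path b2 c2 s \<noteq> access_path b1 c1 T + of_real t * dir b1"
    and off2: "\<And>s t. s \<in> {1..<T} \<Longrightarrow> 0 \<le> t \<Longrightarrow> access_path b1 c1 s \<noteq> access_path b2 c2 T + of_real t * dir b2"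
  obtains e where "cis e = sgn (access_path b2 c2 T - access_path b1 c1 T)" "\<psi>1 \<le> e" "e \<le> \<psi>1 + 2 * pi"
    "\<psi>2 \<le> e + pi" "e + pi \<le> \<psi>2 + 2 * pi"
    "T = 1 \<Longrightarrow> ((\<lambda>s. B (c1 s) (c2 s)) \<longlongrightarrow> e - (a + b) / 2 - pi / 2) (at_left 1)"
proof -
  have acc1: "access a b1 c1" and acc2: "access b b2 c2" using ra1 ra2 by (auto simp: ray_access_def)
  have cc: "continuous_on {0..<1} c1" "continuous_on {0..<1} c2"
    and cD1: "\<And>s. 0 \<le> s \<Longrightarrow> s < 1 \<Longrightarrow> norm (c1 s) < 1" and cD2: "\<And>s. 0 \<le> s \<Longrightarrow> s < 1 \<Longrightarrow> norm (c2 s) < 1"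
    and cl: "(c1 \<longlongrightarrow> cis a) (at_left 1)" "(c2 \<longlongrightarrow> cis b) (at_left 1)"
    using acc1 acc2 by (auto simp: access_def)
  define d where "d = cis b - cis a"
  have s: "sin ((b - a) / 2) > 0" using ab by (intro sin_gt_zero) auto
  have d0: "norm d > 0" unfolding d_def cis_diff_formula using s by simp
  have "eventually (\<lambda>s. dist (c1 s) (cis a) < norm d / 2 \<and> dist (c2 s) (cis b) < norm d / 2) (at_left 1)"
    using d0 by (intro eventually_conj tendstoD cl) auto
  then obtain \<alpha>' where \<alpha>': "\<alpha>' < 1" "\<And>s. \<alpha>' < s \<Longrightarrow> s < 1 \<Longrightarrow>
      dist (c1 s) (cis a) < norm d / 2 \<and> dist (c2 s) (cis b) < norm d / 2"
    unfolding eventually_at_left_field by blast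
  define \<alpha> where "\<alpha> = (max \<alpha>' 0 + 1) / 2"
  have \<alpha>: "0 \<le> \<alpha>" "\<alpha> < 1" "\<alpha>' < \<alpha>" using \<alpha>' by (auto simp: \<alpha>_def max_def)
  define z1 z2 where "z1 = path_end c1 (cis a)" and "z2 = path_end c2 (cis b)"
  have cz: "continuous_on {0..} z1" "continuous_on {0..} z2"
    unfolding z1_def z2_def by (rule access_hat(1)[OF acc1], rule access_hat(1)[OF acc2])
  have near: "norm (z2 t - z1 s - (cis b - cis a)) < norm (cis b - cis a)" if "\<alpha> \<le> s" "\<alpha> \<le> t" for s t
  proof -
    have 1: "norm (z1 s - cis a) < norm d / 2"
      using \<alpha>'(2)[of s] that \<alpha> d0 by (cases "s < 1") (auto simp: z1_def dist_norm)
    have 2: "norm (z2 t - cis b) < norm d / 2"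
      using \<alpha>'(2)[of t] that \<alpha> d0 by (cases "t < 1") (auto simp: z2_def dist_norm)
    have "z2 t - z1 s - (cis b - cis a) = (z2 t - cis b) - (z1 s - cis a)" by simp
    then have "norm (z2 t - z1 s - (cis b - cis a)) \<le> norm (z2 t - cis b) + norm (z1 s - cis a)"
      by (metis norm_triangle_ineq4)
    then show ?thesis using 1 2 by (simp add: d_def)
  qed
  define P where "P p = pair_arg a b (z1 (fst p)) (z2 (snd p))" for p
  have contP: "continuous_on ({\<alpha>..} \<times> {\<alpha>..}) P"
    unfolding P_def pair_arg_def
    by (intro continuous_intros continuous_on_Arg continuous_on_compose2[OF cz(1)] continuous_on_compose2[OF cz(2)])
       (use \<alpha> near pair_arg(3)[OF ab] d0 in \<open>auto simp: d_def\<close>)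
  define S where "S = {\<alpha>..T} \<times> {\<alpha>..T}"
  define S0 where "S0 = {\<alpha>..<1} \<times> {\<alpha>..<1}"
  define q where "q p = access_path b2 c2 (snd p) - access_path b1 c1 (fst p)" for p
  have contq: "continuous_on S q"
    unfolding q_def S_def
    by (intro continuous_intros continuous_on_compose2[OF continuous_on_access_path[OF acc1]]
         continuous_on_compose2[OF continuous_on_access_path[OF acc2]]) (use \<alpha> in auto)
  have nz: "q p \<noteq> 0" if "p \<in> S" for p
  proof -
    obtain s t where p': "p = (s, t)" by (cases p)
    then have p: "\<alpha> \<le> s" "s \<le> T" "\<alpha> \<le> t" "t \<le> T" using that by (auto simp: S_def)
    have "access_path b1 c1 s \<noteq> access_path b2 c2 t"
    proof (cases "s < 1 \<and> t < 1")
      case True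
      then have "c2 t \<noteq> c1 s" using pair_arg(4)[OF ab near[OF p(1,3)]] by (auto simp: z1_def z2_def)
      then show ?thesis using True injF cD1[of s] cD2[of t] p \<alpha> by (auto simp: inj_on_def)
    next
      case False
      then show ?thesis using p \<alpha> by (intro ne) auto
    qed
    then show ?thesis by (simp add: q_def p')
  qed
  have S0: "S0 \<subseteq> S" using T by (auto simp: S0_def S_def)
  have S0D: "(c1 (fst p), c2 (snd p)) \<in> disc_pairs" if "p \<in> S0" for p
    using that cD1[of "fst p"] cD2[of "snd p"] \<alpha> pair_arg(4)[OF ab near[of "fst p" "snd p"]]
    by (auto simp: S0_def disc_pairs_def z1_def z2_def)
  have cvx: "convex S" unfolding S_def by (intro convex_Times) auto
  have cn: "connected S0" unfolding S0_def by (intro connected_Times) auto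
  define bb where "bb p = B (c1 (fst p)) (c2 (snd p)) + P p" for p
  have cb: "continuous_on S0 bb"
    unfolding bb_def
    by (intro continuous_intros continuous_on_subset[OF contP]
        continuous_on_compose2[OF contB, of _ "\<lambda>p. (c1 (fst p), c2 (snd p))", simplified]
        continuous_on_compose2[OF cc(1)] continuous_on_compose2[OF cc(2)])
       (use S0D \<alpha> in \<open>auto simp: S0_def\<close>)
  have cl': "cis (bb p) = sgn (q p)" if p: "p \<in> S0" for p
  proof -
    have p': "\<alpha> \<le> fst p" "\<alpha> \<le> snd p" "fst p < 1" "snd p < 1" using p by (auto simp: S0_def)
    have "cis (P p) = sgn (c2 (snd p) - c1 (fst p))"
      using pair_arg(2)[OF ab near[OF p'(1,2)]] p' by (simp add: P_def z1_def z2_def)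
    then show ?thesis using cisB[OF S0D[OF p]] p' S0D[OF p]
      by (simp add: bb_def cis_mult[symmetric] q_def sgn_divide disc_pairs_def sgn_zero_iff)
  qed
  obtain e where e: "continuous_on S e" "\<And>p. p \<in> S \<Longrightarrow> cis (e p) = sgn (q p)" "\<And>p. p \<in> S0 \<Longrightarrow> e p = bb p"
    by (rule extend_argument_lift[OF cvx contq nz S0 cn cb cl'], assumption, assumption, rule that)
  have Plim: "((\<lambda>s. P (f s)) \<longlongrightarrow> P (f 1)) (at_left 1)"
    if f: "continuous_on {\<alpha>..1} f" "\<And>s. s \<in> {\<alpha>..1} \<Longrightarrow> f s \<in> {\<alpha>..} \<times> {\<alpha>..}" for f
  proof -
    have "continuous_on {\<alpha>..1} (\<lambda>s. P (f s))" by (rule continuous_on_compose2[OF contP f(1)]) (use f(2) in blast)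
    then have "((\<lambda>s. P (f s)) \<longlongrightarrow> P (f 1)) (at 1 within {\<alpha>..1})" using \<alpha> by (auto simp: continuous_on_def)
    then show ?thesis using \<alpha> by (simp add: at_within_Icc_at_left)
  qed
  have b1: "\<psi>1 \<le> e (T, T)" "e (T, T) \<le> \<psi>1 + 2 * pi"
  proof -
    have h1: "continuous_on ({\<alpha>..T} \<times> {\<alpha>..T}) e" using e(1) by (simp add: S_def)
    have h2: "continuous_on {\<alpha>..T} (access_path b2 c2)"
      by (rule continuous_on_subset[OF continuous_on_access_path[OF acc2]]) (use \<alpha> in auto)
    have h3: "norm (c2 s) < 1 \<and> access_path b2 c2 s = F (c2 s)" if "s \<in> {\<alpha>..<1}" for s
      using that cD2 \<alpha> by auto
    have h4: "cis (e (s, t)) = sgn (access_path b2 c2 t - access_path b1 c1 s)" if "s \<in> {\<alpha>..T}" "t \<in> {\<alpha>..T}" for s t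
      using e(2)[of "(s, t)"] that by (simp add: S_def q_def)
    have h5: "e (s, t) = B (c1 s) (c2 t) + P (s, t)" if "s \<in> {\<alpha>..<1}" "t \<in> {\<alpha>..<1}" for s t
      using e(3)[of "(s, t)"] that by (simp add: S0_def bb_def)
    have h6: "((\<lambda>s. P (s, t)) \<longlongrightarrow> disc_arg a (c2 t)) (at_left 1)" if t: "t \<in> {\<alpha>..<1}" for t
    proof -
      have "P (1, t) = disc_arg a (c2 t)"
        using pair_arg_disc_arg(1)[OF ab, of "c2 t"] near[of 1 t] t \<alpha> cD2[of t]
        by (simp add: P_def z1_def z2_def)
      moreover have "((\<lambda>s. P (s, t)) \<longlongrightarrow> P (1, t)) (at_left 1)"
        by (rule Plim[of "\<lambda>s. (s, t)"], intro continuous_intros) (use t \<alpha> in auto)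
      ultimately show ?thesis by simp
    qed
    show "\<psi>1 \<le> e (T, T)" "e (T, T) \<le> \<psi>1 + 2 * pi"
      using chord_arg_first_bounds[OF ra1 \<alpha>(1,2) T h1 h2 h3 h4 h5 h6 off1] by auto
  qed
  have b2: "\<psi>2 \<le> e (T, T) + pi" "e (T, T) + pi \<le> \<psi>2 + 2 * pi"
  proof -
    define e' where "e' p = e (snd p, fst p) + pi" for p
    have h1: "continuous_on ({\<alpha>..T} \<times> {\<alpha>..T}) e'"
      unfolding e'_def by (intro continuous_intros continuous_on_compose2[OF e(1)]) (auto simp: S_def)
    have h2: "continuous_on {\<alpha>..T} (access_path b1 c1)"
      by (rule continuous_on_subset[OF continuous_on_access_path[OF acc1]]) (use \<alpha> in auto)
    have h3: "norm (c1 s) < 1 \<and> access_path b1 c1 s = F (c1 s)" if "s \<in> {\<alpha>..<1}" for s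
      using that cD1 \<alpha> by auto
    have h4: "cis (e' (s, t)) = sgn (access_path b1 c1 t - access_path b2 c2 s)" if "s \<in> {\<alpha>..T}" "t \<in> {\<alpha>..T}" for s t
    proof -
      have "cis (e' (s, t)) = - sgn (q (t, s))"
        using e(2)[of "(t, s)"] that by (simp add: e'_def cis_mult[symmetric] S_def)
      then show ?thesis by (simp add: q_def sgn_minus[symmetric])
    qed
    have h5: "e' (s, t) = B (c2 s) (c1 t) + (P (t, s) + pi)" if "s \<in> {\<alpha>..<1}" "t \<in> {\<alpha>..<1}" for s t
      using e(3)[of "(t, s)"] that symB[OF S0D[of "(t, s)"]] by (simp add: e'_def S0_def bb_def)
    have h6: "((\<lambda>s. P (t, s) + pi) \<longlongrightarrow> disc_arg b (c1 t)) (at_left 1)" if t: "t \<in> {\<alpha>..<1}" for t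
    proof -
      have "P (t, 1) + pi = disc_arg b (c1 t)"
        using pair_arg_disc_arg(2)[OF ab, of "c1 t"] near[of t 1] t \<alpha> cD1[of t]
        by (simp add: P_def z1_def z2_def)
      moreover have "((\<lambda>s. P (t, s)) \<longlongrightarrow> P (t, 1)) (at_left 1)"
        by (rule Plim[of "\<lambda>s. (t, s)"], intro continuous_intros) (use t \<alpha> in auto)
      ultimately show ?thesis using tendsto_add[OF _ tendsto_const[of pi]] by metis
    qed
    show "\<psi>2 \<le> e (T, T) + pi" "e (T, T) + pi \<le> \<psi>2 + 2 * pi"
      using chord_arg_first_bounds[OF ra2 \<alpha>(1,2) T h1 h2 h3 h4 h5 h6 off2] by (auto simp: e'_def)
  qed
  have lim: "((\<lambda>s. B (c1 s) (c2 s)) \<longlongrightarrow> e (T, T) - (a + b) / 2 - pi / 2) (at_left 1)" if "T = 1"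
  proof -
    have "continuous_on {\<alpha>..1} (\<lambda>s. e (s, s))"
      by (rule continuous_on_compose2[OF e(1)]) (use T that in \<open>auto simp: S_def intro!: continuous_intros\<close>)
    then have "((\<lambda>s. e (s, s)) \<longlongrightarrow> e (1, 1)) (at 1 within {\<alpha>..1})" using \<alpha> by (auto simp: continuous_on_def)
    then have "((\<lambda>s. e (s, s)) \<longlongrightarrow> e (1, 1)) (at_left 1)" using \<alpha> by (simp add: at_within_Icc_at_left)
    then have "((\<lambda>s. e (s, s) - P (s, s)) \<longlongrightarrow> e (1, 1) - P (1, 1)) (at_left 1)"
      using \<alpha> by (intro tendsto_diff Plim[of "\<lambda>s. (s, s)"]) (auto intro!: continuous_intros)
    moreover have "P (1, 1) = (a + b) / 2 + pi / 2"
      using d0 by (auto simp: P_def z1_def z2_def pair_arg_def d_def)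
    moreover have "eventually (\<lambda>s. e (s, s) - P (s, s) = B (c1 s) (c2 s)) (at_left (1::real))"
      unfolding eventually_at_left_field by (rule exI[of _ \<alpha>]) (use \<alpha> e(3) in \<open>auto simp: S0_def bb_def\<close>)
    ultimately show ?thesis using that by (simp add: filterlim_cong diff_diff_eq)
  qed
  show ?thesis
    by (rule that[of "e (T, T)"]) (use b1 b2 lim e(2)[of "(T, T)"] \<alpha> T in \<open>auto simp: S_def q_def\<close>)
qed

lemma chord_arg_boundary:
  assumes ra1: "ray_access a \<psi>1 b1 c1" and ra2: "ray_access b \<psi>2 b2 c2" and ab: "a < b" "b < a + 2 * pi"
    and ne: "b1 \<noteq> b2"
  obtains e where "cis e = sgn (b2 - b1)" "\<psi>1 \<le> e" "e \<le> \<psi>1 + 2 * pi" "\<psi>2 \<le> e + pi" "e + pi \<le> \<psi>2 + 2 * pi"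
    "((\<lambda>s. B (c1 s) (c2 s)) \<longlongrightarrow> e - (a + b) / 2 - pi / 2) (at_left 1)"
proof -
  have acc1: "access a b1 c1" and acc2: "access b b2 c2" using ra1 ra2 by (auto simp: ray_access_def)
  have Fb: "F z \<noteq> b'" if "norm z < 1" "b' \<in> Bd" for z b'
    using boundary_notin[OF that(2), of 0 z] that by auto
  show ?thesis
  proof (rule chord_arg_limit[OF ra1 ra2 ab, of 1])
    fix s t :: real assume st: "0 \<le> s" "s \<le> 1" "0 \<le> t" "t \<le> 1" "1 \<le> max s t"
    then consider "s = 1" "t = 1" | "s = 1" "t < 1" | "s < 1" "t = 1" by fastforce
    then show "access_path b1 c1 s \<noteq> access_path b2 c2 t"
    proof cases
      case 2
      then have "F (c2 t) \<noteq> b1" using st acc1 acc2 by (intro Fb) (auto simp: access_def)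
      then show ?thesis using 2 by auto
    next
      case 3
      then have "F (c1 s) \<noteq> b2" using st acc1 acc2 by (intro Fb) (auto simp: access_def)
      then show ?thesis using 3 by auto
    qed (use ne in auto)
  qed (auto intro: that)
qed

text \<open>With \<open>T = 2\<close> the chord joins the feet, where the rays start, so that its
  argument and the non-crossing of the rays order the two angles.\<close>

lemma ray_angle_le_distinct_feet:
  assumes ra1: "ray_access a \<psi>1 b1 c1" and ra2: "ray_access b \<psi>2 b2 c2" and ab: "a < b" "b < a + 2 * pi"
    and ne: "foot b1 \<noteq> foot b2"
  shows "\<psi>1 \<le> \<psi>2" "\<psi>2 \<le> \<psi>1 + 2 * pi"
proof -
  have acc: "access a b1 c1" "access b b2 c2" and Bd: "b1 \<in> Bd" "b2 \<in> Bd" and cd: "cis \<psi>1 = dir b1" "cis \<psi>2 = dir b2"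
    using ra1 ra2 by (auto simp: ray_access_def access_def)
  have Fw: "F z \<noteq> w" if "norm z < 1" "b' \<in> Bd" "w \<in> closed_segment b' (foot b')" for z b' w
    using ray_avoids[OF that(2,3), of 0] that by auto
  have bf: "b1 \<noteq> foot b2" "b2 \<noteq> foot b1"
    using segments_disjoint[OF Bd ne] by (metis disjoint_iff ends_in_segment)+
  have tail: "access_path b' c s \<noteq> foot b'' + of_real t * dir b''"
    if "b' \<in> Bd" "b'' \<in> Bd" "1 \<le> s" "s < 2" "0 \<le> t" "foot b' \<noteq> foot b''" for b' b'' c s t
    using access_path_tail[OF that(1,2,3,4) _ that(5)] foot_ne[OF that(1)] by auto
  obtain e where e: "cis e = sgn (access_path b2 c2 2 - access_path b1 c1 2)" "\<psi>1 \<le> e" "e \<le> \<psi>1 + 2 * pi"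
      "\<psi>2 \<le> e + pi" "e + pi \<le> \<psi>2 + 2 * pi"
  proof (rule chord_arg_limit[OF ra1 ra2 ab, of 2])
    fix s t :: real assume st: "0 \<le> s" "s \<le> 2" "0 \<le> t" "t \<le> 2" "1 \<le> max s t"
    then consider "s < 1" "1 \<le> t" | "1 \<le> s" "t < 1" | "1 \<le> s" "1 \<le> t" by fastforce
    then show "access_path b1 c1 s \<noteq> access_path b2 c2 t"
    proof cases
      case 1
      then have "F (c1 s) \<noteq> access_path b2 c2 t"
        using st acc Bd by (intro Fw[of _ b2] access_path_ge(1)) (auto simp: access_def)
      then show ?thesis using 1 by auto
    next
      case 2
      then have "F (c2 t) \<noteq> access_path b1 c1 s"
        using st acc Bd by (intro Fw[of _ b1] access_path_ge(1)) (auto simp: access_def)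
      then show ?thesis using 2 by auto
    next
      case 3
      then show ?thesis
        using access_path_ge(1)[of s b1 c1] access_path_ge(1)[of t b2 c2] segments_disjoint[OF Bd ne] st by auto
    qed
  next
    fix s t :: real assume "s \<in> {1..<2}" "0 \<le> t"
    then show "access_path b2 c2 s \<noteq> access_path b1 c1 2 + of_real t * dir b1"
      using tail[of b2 b1 s t c2] Bd ne by auto
  next
    fix s t :: real assume "s \<in> {1..<2}" "0 \<le> t"
    then show "access_path b1 c1 s \<noteq> access_path b2 c2 2 + of_real t * dir b2"
      using tail[of b1 b2 s t c1] Bd ne by auto
  qed auto
  show "\<psi>1 \<le> \<psi>2" "\<psi>2 \<le> \<psi>1 + 2 * pi"
    using noncrossing_rays_angles[of e "foot b2" "foot b1" \<psi>1 \<psi>2] e ne rays_noncrossing[OF Bd _ _ ne] cd by auto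
qed

end

section \<open>Monotonicity of the ray angles along the circle\<close>

context ray_image begin

lemma ray_access_shift_iff: "ray_access (\<theta> + 2 * pi) (\<psi> + 2 * pi) b c \<longleftrightarrow> ray_access \<theta> \<psi> b c"
proof -
  have c2: "cis (x + 2 * pi) = cis x" for x by (simp add: cis_mult[symmetric])
  have "cis (- x - 2 * pi) = cis (- x)" for x using cis_divide[of "- x" "2 * pi"] by simp
  then have d: "disc_arg (\<theta> + 2 * pi) z = disc_arg \<theta> z + 2 * pi" for z by (simp add: disc_arg_def)
  show ?thesis unfolding ray_access_def access_def c2 d by (simp add: ray_arg_def algebra_simps)
qed

text \<open>For a common foot the directions agree, so the angles differ by a multiple of 2 pi. The
  chord between the boundary points confines the difference to [- pi, 3 pi], which leaves 0 and 2
  pi.\<close>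

lemma ray_angle_le_distinct:
  assumes ra1: "ray_access a \<psi>1 b1 c1" and ra2: "ray_access b \<psi>2 b2 c2" and ab: "a < b" "b < a + 2 * pi"
    and ne: "b1 \<noteq> b2"
  shows "\<psi>1 \<le> \<psi>2 \<and> \<psi>2 \<le> \<psi>1 + 2 * pi"
proof (cases "foot b1 = foot b2")
  case False
  then show ?thesis using ray_angle_le_distinct_feet[OF ra1 ra2 ab] by simp
next
  case True
  have "b1 \<in> Bd" "b2 \<in> Bd" "cis \<psi>1 = dir b1" "cis \<psi>2 = dir b2"
    using ra1 ra2 by (auto simp: ray_access_def access_def)
  then have "cis \<psi>1 = cis \<psi>2" using same_foot[of b1 b2] True by simp
  then have "cis (\<psi>2 - \<psi>1) = 1" by (simp add: cis_divide[symmetric])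
  then have "cos (\<psi>2 - \<psi>1) = 1" by (metis cis.simps(1) one_complex.simps(1))
  then obtain m :: int where m: "\<psi>2 - \<psi>1 = of_int m * 2 * pi" using cos_one_2pi_int by auto
  obtain e where e: "\<psi>1 \<le> e" "e \<le> \<psi>1 + 2 * pi" "\<psi>2 \<le> e + pi" "e + pi \<le> \<psi>2 + 2 * pi"
    using chord_arg_boundary[OF ra1 ra2 ab ne] by metis
  have "\<psi>2 - \<psi>1 \<le> 3 * pi" "- 1 * pi \<le> \<psi>2 - \<psi>1" using e by linarith+
  then have "real_of_int m * 2 \<le> 3" "- 1 \<le> real_of_int m * 2"
    unfolding m mult_le_cancel_right using pi_gt_zero by linarith+
  then have "m = 0 \<or> m = 1" by linarith
  then have "\<psi>2 = \<psi>1 \<or> \<psi>2 = \<psi>1 + 2 * pi" using m by auto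
  then show ?thesis using pi_ge_zero by linarith
qed

end

text \<open>The accessible points of an arc must not all have the same boundary value, since angles
  are compared directly only for distinct frontier points.\<close>

locale dense_ray_image = ray_image +
  assumes dense: "\<And>x y b. x < y \<Longrightarrow> \<exists>\<theta> b' c. x < \<theta> \<and> \<theta> < y \<and> access \<theta> b' c \<and> b' \<noteq> b"
begin

lemma dense_ray_access: "x < y \<Longrightarrow> \<exists>\<theta> \<psi> b' c. x < \<theta> \<and> \<theta> < y \<and> ray_access \<theta> \<psi> b' c \<and> b' \<noteq> b"
  using dense[of x y b] ray_access_exists by metis

text \<open>If the two boundary points coincide, access points with another value are inserted, one
  between \<open>a\<close> and \<open>b\<close> and one between \<open>b\<close> and the copy of
  \<open>a\<close> shifted by a full turn.\<close>

lemma ray_angle_mono: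
  assumes ra1: "ray_access a \<psi>1 b1 c1" and ra2: "ray_access b \<psi>2 b2 c2" and ab: "a < b" "b < a + 2 * pi"
  shows "\<psi>1 \<le> \<psi>2 \<and> \<psi>2 \<le> \<psi>1 + 2 * pi"
proof (cases "b1 = b2")
  case False
  then show ?thesis using ray_angle_le_distinct[OF ra1 ra2 ab] by simp
next
  case True
  obtain \<theta>3 \<psi>3 b3 c3 where 3: "a < \<theta>3" "\<theta>3 < b" "ray_access \<theta>3 \<psi>3 b3 c3" "b3 \<noteq> b1"
    using dense_ray_access[OF ab(1)] by blast
  obtain \<theta>4 \<psi>4 b4 c4 where 4: "b < \<theta>4" "\<theta>4 < a + 2 * pi" "ray_access \<theta>4 \<psi>4 b4 c4" "b4 \<noteq> b1"
    using dense_ray_access[OF ab(2)] by blast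
  have "\<psi>1 \<le> \<psi>3" "\<psi>3 \<le> \<psi>2"
    using ray_angle_le_distinct[OF ra1 3(3)] ray_angle_le_distinct[OF 3(3) ra2] 3 ab True by auto
  moreover have "\<psi>2 \<le> \<psi>4"  using ray_angle_le_distinct[OF ra2 4(3)] 4 ab True by auto
  moreover have "\<psi>4 \<le> \<psi>1 + 2 * pi"
    using ray_angle_le_distinct[OF 4(3) ray_access_shift[OF ra1]] 4 ab True by auto
  ultimately show ?thesis by simp
qed

text \<open>The left limit at \<open>x\<close> of the monotone correspondence from boundary angles
  to ray angles; a window of length pi suffices by monotonicity.\<close>

definition ray_sup :: "real \<Rightarrow> real" where
  "ray_sup x = Sup {\<psi>. \<exists>\<theta> b c. x - pi < \<theta> \<and> \<theta> < x \<and> ray_access \<theta> \<psi> b c}"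

lemma ray_sup_set:
  "{\<psi>. \<exists>\<theta> b c. x - pi < \<theta> \<and> \<theta> < x \<and> ray_access \<theta> \<psi> b c} \<noteq> {}"
  "x < \<theta> \<Longrightarrow> \<theta> < x + pi \<Longrightarrow> ray_access \<theta> \<psi> b c \<Longrightarrow>
     y \<in> {\<psi>. \<exists>\<theta> b c. x - pi < \<theta> \<and> \<theta> < x \<and> ray_access \<theta> \<psi> b c} \<Longrightarrow> y \<le> \<psi>"
proof -
  show "{\<psi>. \<exists>\<theta> b c. x - pi < \<theta> \<and> \<theta> < x \<and> ray_access \<theta> \<psi> b c} \<noteq> {}"
    using dense_ray_access[of "x - pi" x 0] by auto
  assume "x < \<theta>" "\<theta> < x + pi" "ray_access \<theta> \<psi> b c"
    "y \<in> {\<psi>. \<exists>\<theta> b c. x - pi < \<theta> \<and> \<theta> < x \<and> ray_access \<theta> \<psi> b c}"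
  then show "y \<le> \<psi>" using ray_angle_mono by fastforce
qed

lemma ray_sup_lower: "x < \<theta> \<Longrightarrow> \<theta> < x + pi \<Longrightarrow> ray_access \<theta> \<psi> b c \<Longrightarrow> ray_sup x \<le> \<psi>"
  unfolding ray_sup_def by (intro cSup_least ray_sup_set)

lemma ray_sup_upper: "x - pi < \<theta> \<Longrightarrow> \<theta> < x \<Longrightarrow> ray_access \<theta> \<psi> b c \<Longrightarrow> \<psi> \<le> ray_sup x"
  unfolding ray_sup_def
proof (rule cSup_upper)
  obtain \<theta>' \<psi>' b' c' where "x < \<theta>'" "\<theta>' < x + pi" "ray_access \<theta>' \<psi>' b' c'"
    using dense_ray_access[of x "x + pi" 0] by auto
  then show "bdd_above {\<psi>. \<exists>\<theta> b c. x - pi < \<theta> \<and> \<theta> < x \<and> ray_access \<theta> \<psi> b c}"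
    using ray_sup_set(2) by (meson bdd_aboveI)
qed auto

lemma ray_sup_le: "(\<And>\<theta> \<psi> b c. x - pi < \<theta> \<Longrightarrow> \<theta> < x \<Longrightarrow> ray_access \<theta> \<psi> b c \<Longrightarrow> \<psi> \<le> M) \<Longrightarrow> ray_sup x \<le> M"
  unfolding ray_sup_def by (rule cSup_least[OF ray_sup_set(1)]) auto

lemma ray_sup_mono: "x < y \<Longrightarrow> y < x + pi \<Longrightarrow> ray_sup x \<le> ray_sup y"
proof -
  assume xy: "x < y" "y < x + pi"
  obtain \<theta> \<psi> b c where "x < \<theta>" "\<theta> < y" "ray_access \<theta> \<psi> b c" using dense_ray_access[OF xy(1)] by blast
  then show ?thesis using ray_sup_lower[of x \<theta> \<psi> b c] ray_sup_upper[of y \<theta> \<psi> b c] xy by linarith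
qed

lemma ray_sup_shift: "ray_sup (x + 2 * pi) = ray_sup x + 2 * pi"
proof (rule antisym)
  show "ray_sup (x + 2 * pi) \<le> ray_sup x + 2 * pi"
  proof (rule ray_sup_le)
    fix \<theta> \<psi> b c assume "x + 2 * pi - pi < \<theta>" "\<theta> < x + 2 * pi" "ray_access \<theta> \<psi> b c"
    then show "\<psi> \<le> ray_sup x + 2 * pi"
      using ray_sup_upper[of x "\<theta> - 2 * pi" "\<psi> - 2 * pi" b c] ray_access_shift_iff[of "\<theta> - 2 * pi" "\<psi> - 2 * pi" b c] by simp
  qed
  have "ray_sup x \<le> ray_sup (x + 2 * pi) - 2 * pi"
  proof (rule ray_sup_le)
    fix \<theta> \<psi> b c assume "x - pi < \<theta>" "\<theta> < x" "ray_access \<theta> \<psi> b c"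
    then show "\<psi> \<le> ray_sup (x + 2 * pi) - 2 * pi"
      using ray_sup_upper[of "x + 2 * pi" "\<theta> + 2 * pi" "\<psi> + 2 * pi" b c] ray_access_shift[of \<theta> \<psi> b c] by simp
  qed
  then show "ray_sup x + 2 * pi \<le> ray_sup (x + 2 * pi)" by simp
qed

text \<open>\<open>ray_sup (x + pi) - ray_sup x - pi\<close> changes sign when \<open>x\<close> moves by \<open>pi\<close>; at the sign change there are
  opposite ray directions at opposite boundary points.\<close>

lemma opposite_rays:
  obtains t s where
    "\<And>\<theta> \<psi> b c. t < \<theta> \<Longrightarrow> \<theta> < t + pi \<Longrightarrow> ray_access \<theta> \<psi> b c \<Longrightarrow> s \<le> \<psi> \<and> \<psi> \<le> s + pi"
    "\<And>\<theta> \<psi> b c. t + pi < \<theta> \<Longrightarrow> \<theta> < t + 2 * pi \<Longrightarrow> ray_access \<theta> \<psi> b c \<Longrightarrow> s + pi \<le> \<psi> \<and> \<psi> \<le> s + 2 * pi"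
proof -
  define \<delta> where "\<delta> x = ray_sup (x + pi) - ray_sup x - pi" for x
  have dshift: "\<delta> (x + pi) = - \<delta> x" for x
    using ray_sup_shift[of x] by (simp add: \<delta>_def add.assoc)
  obtain t0 where t0: "\<delta> t0 \<le> 0"
  proof (cases "\<delta> 0 \<le> 0")
    case False
    then have "\<delta> pi \<le> 0" using dshift[of 0] by simp
    then show ?thesis by (rule that)
  qed
  define A where "A = {x. t0 \<le> x \<and> x \<le> t0 + pi \<and> \<delta> x \<le> 0}"
  have t0A: "t0 \<in> A" using t0 pi_ge_zero by (simp add: A_def)
  have At: "x \<le> t0 + pi" if "x \<in> A" for x using that by (simp add: A_def)
  have A: "A \<noteq> {}" "bdd_above A" using t0A bdd_aboveI[OF At] by auto
  define t where "t = Sup A"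
  have t: "t0 \<le> t" "t \<le> t0 + pi"
    unfolding t_def by (rule cSup_upper[OF t0A A(2)], rule cSup_least[OF A(1) At])
  \<comment> \<open>The upper bounds wanted on the two arcs force \<open>s\<close> to be at least
    each of these numbers, and the maximum is the least choice. The facts \<open>i\<close> and
    \<open>ii\<close> show that the lower bounds still hold.\<close>
  define s where "s = max (ray_sup t) (ray_sup (t + pi) - pi)"
  have i: "ray_sup (t + pi) - pi \<le> \<psi>" if "t < \<theta>" "\<theta> < t + pi" "ray_access \<theta> \<psi> b c" for \<theta> \<psi> b c
  proof -
    have "ray_sup (t + pi) \<le> \<psi> + pi"
    proof (rule ray_sup_le)
      fix \<theta>' \<psi>' b' c' assume 1: "t + pi - pi < \<theta>'" "\<theta>' < t + pi" "ray_access \<theta>' \<psi>' b' c'"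
      have "max (\<theta>' - pi) (\<theta> - pi) < t" using 1(2) that(2) by simp
      then obtain x where x: "x \<in> A" "max (\<theta>' - pi) (\<theta> - pi) < x"
        using less_cSup_iff[OF A, of "max (\<theta>' - pi) (\<theta> - pi)"] unfolding t_def by blast
      then have xt: "x \<le> t" using cSup_upper[OF x(1) A(2)] by (simp add: t_def)
      have "\<psi>' \<le> ray_sup (x + pi)" by (rule ray_sup_upper[OF _ _ 1(3)]) (use x(2) xt 1(1,2) in auto)
      also have "\<dots> \<le> ray_sup x + pi" using x(1) by (auto simp: A_def \<delta>_def)
      also have "ray_sup x \<le> \<psi>" by (rule ray_sup_lower[OF _ _ that(3)]) (use x(2) xt that(1,2) in auto)
      finally show "\<psi>' \<le> \<psi> + pi" by simp
    qed
    then show ?thesis by simp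
  qed
  have ii: "ray_sup t + pi \<le> \<psi>" if "t + pi < \<theta>" "\<theta> < t + 2 * pi" "ray_access \<theta> \<psi> b c" for \<theta> \<psi> b c
  proof (cases "t = t0 + pi")
    case True
    then have "\<delta> t \<ge> 0" using dshift[of t0] t0 by simp
    then have "ray_sup t + pi \<le> ray_sup (t + pi)" by (simp add: \<delta>_def)
    also have "\<dots> \<le> \<psi>" by (rule ray_sup_lower[OF _ _ that(3)]) (use that(1,2) in auto)
    finally show ?thesis .
  next
    case False
    define y where "y = (t + min (\<theta> - pi) (t0 + pi)) / 2"
    have y: "t < y" "y < \<theta> - pi" "y \<le> t0 + pi" "y < t + pi" using t False that by (auto simp: y_def min_def)
    then have "y \<notin> A" using cSup_upper[OF _ A(2), of y] unfolding t_def by linarith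
    then have "\<delta> y > 0" using y t by (auto simp: A_def)
    then have "ray_sup y + pi < ray_sup (y + pi)" by (simp add: \<delta>_def)
    also have "\<dots> \<le> \<psi>" by (rule ray_sup_lower[OF _ _ that(3)]) (use that(1,2) y in auto)
    finally show ?thesis using ray_sup_mono[OF y(1,4)] by simp
  qed
  show ?thesis
  proof (rule that[of t s])
    fix \<theta> \<psi> b c assume 1: "t < \<theta>" "\<theta> < t + pi" "ray_access \<theta> \<psi> b c"
    have "ray_sup t \<le> \<psi>" by (rule ray_sup_lower[OF 1])
    moreover have "\<psi> \<le> ray_sup (t + pi)" by (rule ray_sup_upper[OF _ _ 1(3)]) (use 1(1,2) in auto)
    ultimately show "s \<le> \<psi> \<and> \<psi> \<le> s + pi" using i[OF 1] unfolding s_def by linarith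
  next
    fix \<theta> \<psi> b c assume 1: "t + pi < \<theta>" "\<theta> < t + 2 * pi" "ray_access \<theta> \<psi> b c"
    have "ray_sup (t + pi) \<le> \<psi>" by (rule ray_sup_lower[OF _ _ 1(3)]) (use 1(1,2) in auto)
    moreover have "\<psi> \<le> ray_sup (t + 2 * pi)" by (rule ray_sup_upper[OF _ _ 1(3)]) (use 1(1,2) in auto)
    ultimately show "s + pi \<le> \<psi> \<and> \<psi> \<le> s + 2 * pi"
      using ii[OF 1] ray_sup_shift[of t] unfolding s_def by linarith
  qed
qed

end

section \<open>The hyperbolic flow\<close>

text \<open>For 0 < a < 1 the hyperbolic automorphism of the disc that fixes \<open>cis t\<close>
  and \<open>- cis t\<close> and moves other points towards \<open>cis t\<close>;
  \<open>a = 0\<close> would be the identity.\<close>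

definition flow :: "real \<Rightarrow> real \<Rightarrow> complex \<Rightarrow> complex" where
  "flow t a z = (z + of_real a * cis t) / (1 + of_real a * cis (- t) * z)"

lemma flow_denominator:
  assumes "0 < a" "a < 1" "norm z \<le> 1"
  shows "Re (1 + of_real a * cis (- t) * z) > 0" "1 + of_real a * cis (- t) * z \<noteq> 0"
proof -
  have "a * norm z \<le> a" using assms by (intro mult_left_le) auto
  then have "a * norm z < 1" using assms by linarith
  then have "norm (of_real a * cis (- t) * z) < 1" using assms by (simp add: norm_mult)
  then show "Re (1 + of_real a * cis (- t) * z) > 0"
    using abs_Re_le_cmod[of "of_real a * cis (- t) * z"] by (simp del: times_complex.sel)
  then show "1 + of_real a * cis (- t) * z \<noteq> 0" by (metis less_irrefl zero_complex.sel(1))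
qed

lemma norm_flow_less:
  assumes a: "0 < a" "a < 1" and z: "norm z < 1"
  shows "norm (flow t a z) < 1"
proof -
  define w where "w = cis (- t) * z"
  have zw: "z = cis t * w" by (simp add: w_def mult.assoc[symmetric] cis_mult)
  have w: "norm w < 1" using z by (simp add: w_def norm_mult)
  have "norm (w + of_real a) ^ 2 < norm (1 + of_real a * w) ^ 2"
  proof -
    have "(norm w)\<^sup>2 < 1" using w by (simp add: abs_square_less_1)
    then have "0 < (1 - (norm w)\<^sup>2) * (1 - a\<^sup>2)" using a by (intro mult_pos_pos) (auto simp: abs_square_less_1)
    moreover have "norm (1 + of_real a * w) ^ 2 - norm (w + of_real a) ^ 2 = (1 - (norm w)\<^sup>2) * (1 - a\<^sup>2)"
      unfolding cmod_power2 by (simp add: algebra_simps power2_eq_square)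
    ultimately show ?thesis by simp
  qed
  then have "norm (w + of_real a) < norm (1 + of_real a * w)" by (simp add: power2_less_imp_less)
  moreover have "z + of_real a * cis t = cis t * (w + of_real a)" by (simp add: zw algebra_simps)
  ultimately show ?thesis
    using flow_denominator(2)[OF a, of z t] z
    by (simp add: flow_def norm_divide norm_mult w_def mult.assoc)
qed

lemma flow_diff:
  assumes a: "0 < a" "a < 1" and z: "norm z \<le> 1"
  shows "flow t a z - z = of_real a * cis t * (1 - cis (- (2 * t)) * z ^ 2) / (1 + of_real a * cis (- t) * z)"
proof -
  have "(z + of_real a * cis t) - z * (1 + of_real a * cis (- t) * z) = of_real a * cis t * (1 - cis (- (2 * t)) * z ^ 2)"
  proof -
    have "cis t * cis (- (2 * t)) = cis (- t)" by (simp add: cis_mult)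
    then show ?thesis by (simp add: algebra_simps power2_eq_square)
  qed
  moreover have "N / D - z = (N - z * D) / D" if "D \<noteq> 0" for N D :: complex using that by (simp add: field_simps)
  ultimately show ?thesis
    using flow_denominator(2)[OF a z, of t] by (simp add: flow_def)
qed

text \<open>The displacement stays in the half-plane around the direction \<open>cis t\<close>, so
  the principal argument provides a continuous branch of its argument on the whole disc.\<close>

lemma Re_flow_diff_pos:
  assumes a: "0 < a" "a < 1" and z: "norm z < 1"
  shows "Re ((flow t a z - z) / cis t) > 0"
proof -
  define w where "w = cis (- t) * z"
  have w: "norm w < 1" using z by (simp add: w_def norm_mult)
  have nz: "1 + of_real a * w \<noteq> 0" using flow_denominator(2)[OF a, of z t] z by (simp add: w_def mult.assoc)
  have w2: "w ^ 2 = cis (- (2 * t)) * z ^ 2" by (simp add: w_def power_mult_distrib Complex.DeMoivre)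
  have "(flow t a z - z) / cis t = of_real a * (1 - w ^ 2) / (1 + of_real a * w)"
    using z by (subst flow_diff[OF a]) (auto simp: w2, simp add: w_def mult.assoc)
  also have "\<dots> = of_real a * ((1 - w ^ 2) * cnj (1 + of_real a * w)) / of_real ((cmod (1 + of_real a * w))\<^sup>2)"
    by (subst complex_div_cnj) (simp add: mult.assoc)
  finally have eq: "Re ((flow t a z - z) / cis t) = a * Re ((1 - w ^ 2) * cnj (1 + of_real a * w)) / (cmod (1 + of_real a * w))\<^sup>2"
    by (simp only: Re_divide_of_real) simp
  have n2: "(Re w)\<^sup>2 + (Im w)\<^sup>2 < 1" using w by (metis abs_square_less_1 abs_norm_cancel cmod_power2)
  have "a * \<bar>Re w\<bar> < 1"
  proof -
    have "\<bar>Re w\<bar> < 1" using abs_Re_le_cmod[of w] w by linarith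
    then show ?thesis using a mult_strict_mono[of a 1 "\<bar>Re w\<bar>" 1] by simp
  qed
  then have "- (a * Re w) < 1" using a by (metis abs_le_iff abs_mult abs_of_pos le_less_trans order_refl)
  then have "0 < (1 - ((Re w)\<^sup>2 + (Im w)\<^sup>2)) * (1 + a * Re w)" using n2 by (intro mult_pos_pos) auto
  also have "\<dots> \<le> (1 - ((Re w)\<^sup>2 + (Im w)\<^sup>2)) * (1 + a * Re w) + 2 * (Im w)\<^sup>2" by simp
  also have "\<dots> = Re ((1 - w ^ 2) * cnj (1 + of_real a * w))"
    by (simp add: algebra_simps power2_eq_square)
  finally show ?thesis unfolding eq using a nz by (intro divide_pos_pos mult_pos_pos) auto
qed

text \<open>On the circle the flow multiplies by \<open>cnj \<rho> / \<rho>\<close>, a rotation by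
  twice the argument of \<open>\<rho>\<close>. The sine of the angle relative to \<open>t\<close>
  keeps its sign, so each arc between the fixed points is mapped into itself, towards
  \<open>cis t\<close>.\<close>

lemma flow_boundary:
  fixes \<theta> t :: real
  assumes a: "0 < a" "a < 1"
  defines "\<eta> \<equiv> 2 * Arg (1 + of_real a * cis (\<theta> - t))"
  shows "flow t a (cis \<theta>) = cis (\<theta> - \<eta>)"
    "t < \<theta> \<Longrightarrow> \<theta> < t + pi \<Longrightarrow> t < \<theta> - \<eta> \<and> \<theta> - \<eta> < \<theta>"
    "t + pi < \<theta> \<Longrightarrow> \<theta> < t + 2 * pi \<Longrightarrow> \<theta> < \<theta> - \<eta> \<and> \<theta> - \<eta> < t + 2 * pi"
proof -
  define v where "v = cis (\<theta> - t)"
  define \<rho> where "\<rho> = 1 + of_real a * v"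
  have ct: "cis \<theta> = cis t * v" by (simp add: v_def cis_mult)
  have vv: "v * cnj v = 1" by (simp add: v_def cis_cnj cis_mult)
  have R: "Re \<rho> > 0" "\<rho> \<noteq> 0"
    using flow_denominator[OF a, of "cis (\<theta> - t)" 0] by (auto simp: \<rho>_def v_def)
  have c\<eta>: "cis \<eta> = \<rho> / cnj \<rho>"
  proof -
    have "cis \<eta> = sgn \<rho> * sgn \<rho>"
      unfolding \<eta>_def v_def[symmetric] \<rho>_def[symmetric] mult_2 cis_mult[symmetric] cis_Arg_sgn[OF R(2)] ..
    also have "\<dots> = \<rho> * \<rho> / of_real (norm \<rho>) ^ 2" by (simp add: sgn_eq power2_eq_square)
    also have "of_real (norm \<rho>) ^ 2 = \<rho> * cnj \<rho>" using complex_norm_square by simp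
    finally show ?thesis using R by simp
  qed
  have "1 + of_real a * cis (- t) * cis \<theta> = \<rho>" by (simp add: \<rho>_def v_def mult.assoc cis_mult)
  moreover have "cis \<theta> + of_real a * cis t = cis \<theta> * cnj \<rho>"
    using vv unfolding ct \<rho>_def by (simp add: algebra_simps)
  moreover have "cis (\<theta> - \<eta>) = cis \<theta> * (cnj \<rho> / \<rho>)"
    using R unfolding cis_divide[symmetric] c\<eta> by simp
  ultimately show fb: "flow t a (cis \<theta>) = cis (\<theta> - \<eta>)" by (simp add: flow_def)
  have im: "sin (\<theta> - t - \<eta>) = (1 - a\<^sup>2) * sin (\<theta> - t) / (norm \<rho>)\<^sup>2"
  proof -
    have "cis (\<theta> - t - \<eta>) = v * (cnj \<rho> / \<rho>)"
      using R unfolding cis_divide[symmetric] c\<eta> v_def by simp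
    also have "cnj \<rho> / \<rho> = cnj \<rho> * cnj \<rho> / of_real ((norm \<rho>)\<^sup>2)"
      by (rule complex_div_cnj)
    also have "v * (cnj \<rho> * cnj \<rho> / of_real ((norm \<rho>)\<^sup>2)) = (v * cnj \<rho> * cnj \<rho>) / of_real ((norm \<rho>)\<^sup>2)" by (simp add: mult.assoc)
    also have "v * cnj \<rho> * cnj \<rho> = v + 2 * of_real a + of_real (a\<^sup>2) * cnj v"
    proof -
      have "v * cnj \<rho> = v + of_real a" using vv by (simp add: \<rho>_def algebra_simps)
      moreover have vx: "v * (cnj v * x) = x" for x using vv by (metis mult.assoc mult_1)
      ultimately show ?thesis using vv by (simp add: \<rho>_def algebra_simps power2_eq_square vx)
    qed
    finally have "Im (cis (\<theta> - t - \<eta>)) = Im (v + 2 * of_real a + of_real (a\<^sup>2) * cnj v) / (norm \<rho>)\<^sup>2"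
      by (simp only: Im_divide_of_real)
    then show ?thesis by (simp add: v_def algebra_simps)
  qed
  have a2: "1 - a\<^sup>2 > 0" using a by (simp add: abs_square_less_1)
  have A: "\<bar>Arg \<rho>\<bar> < pi / 2" using Re_pos_Arg[OF R(1)] .
  have \<eta>A: "\<eta> = 2 * Arg \<rho>" by (simp add: \<eta>_def \<rho>_def v_def)
  have Im\<rho>: "Im \<rho> = a * sin (\<theta> - t)" by (simp add: \<rho>_def v_def)
  { assume th: "t < \<theta>" "\<theta> < t + pi"
    then have s: "sin (\<theta> - t) > 0" by (intro sin_gt_zero) auto
    then have "Im \<rho> > 0" using a Im\<rho> by simp
    then have "Arg \<rho> > 0" using Arg_lt_pi[of \<rho>] by blast
    moreover have "sin (\<theta> - t - \<eta>) > 0" unfolding im using s a2 R by simp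
    moreover have "sin (\<theta> - t - \<eta>) \<le> 0" if "\<theta> - t - \<eta> \<le> 0"
    proof -
      have "sin (- (\<theta> - t - \<eta>)) \<ge> 0" using that A \<eta>A th by (intro sin_ge_zero) auto
      then show ?thesis using sin_minus[of "\<theta> - t - \<eta>"] by linarith
    qed
    ultimately show "t < \<theta> - \<eta> \<and> \<theta> - \<eta> < \<theta>" using \<eta>A by linarith
  }
  { assume th: "t + pi < \<theta>" "\<theta> < t + 2 * pi"
    have s: "sin (\<theta> - t) < 0" using sin_gt_zero[of "\<theta> - t - pi"] th sin_minus_pi[of "\<theta> - t"] by auto
    then have "Im \<rho> < 0" using a Im\<rho> by (simp add: mult_pos_neg)
    then have "Arg \<rho> < 0" using Arg_neg_iff[of \<rho>] by blast
    moreover have "sin (\<theta> - t - \<eta>) < 0" unfolding im using s a2 R by (simp add: divide_neg_pos mult_pos_neg)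
    moreover have "sin (\<theta> - t - \<eta>) \<ge> 0" if "\<theta> - t - \<eta> \<ge> 2 * pi"
    proof -
      have "sin (\<theta> - t - \<eta> - 2 * pi) \<ge> 0" using that A \<eta>A th by (intro sin_ge_zero) auto
      then show ?thesis by (simp add: sin_diff)
    qed
    ultimately show "\<theta> < \<theta> - \<eta> \<and> \<theta> - \<eta> < t + 2 * pi" using \<eta>A by linarith
  }
qed

lemma holomorphic_flow: 
  assumes "0 < a" "a < 1" shows "flow t a holomorphic_on cball 0 1"
  unfolding flow_def using flow_denominator(2)[OF assms] by (intro holomorphic_intros) auto

lemma continuous_flow: 
  assumes "0 < a" "a < 1" shows "continuous_on (cball 0 1) (flow t a)"
  by (rule holomorphic_on_imp_continuous_on[OF holomorphic_flow[OF assms]])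


section \<open>Moving \<open>F\<close> along the flow\<close>

locale harmonic_ray_image = dense_ray_image +
  fixes h g :: "complex \<Rightarrow> complex"
  assumes holh: "h holomorphic_on ball 0 1" and holg: "g holomorphic_on ball 0 1"
    and F_eq: "\<And>z. z \<in> ball 0 1 \<Longrightarrow> F z = h z + cnj (g z)"
    and boundedF: "bounded (F ` ball 0 1)"
    and flow_limits: "\<And>t a. 0 < a \<Longrightarrow> a < 1 \<Longrightarrow> \<exists>E. negligible E \<and> (\<forall>\<theta>\<in>{0..2*pi} - E. \<exists>b1 b2.
        ((\<lambda>r. F (of_real r * cis \<theta>)) \<longlongrightarrow> b1) (at_left 1) \<and> b1 \<in> Bd \<and>
        ((\<lambda>r. F (flow t a (of_real r * cis \<theta>))) \<longlongrightarrow> b2) (at_left 1) \<and> b2 \<in> Bd)"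
begin

text \<open>The continuous argument of \<open>F (flow t a z) - F z\<close>, composed of the argument
  of the chord quotient and that of the displacement.\<close>

definition flow_arg :: "real \<Rightarrow> real \<Rightarrow> complex \<Rightarrow> real" where
  "flow_arg t a z = B z (flow t a z) + (t + Arg ((flow t a z - z) / cis t))"

lemma flow_pair:
  assumes "0 < a" "a < 1" "norm z < 1" shows "(z, flow t a z) \<in> disc_pairs"
proof -
  have "flow t a z \<noteq> z" using Re_flow_diff_pos[OF assms, of t] by auto
  then show ?thesis using assms norm_flow_less[OF assms] by (auto simp: disc_pairs_def)
qed

lemma cis_flow_arg:
  assumes "0 < a" "a < 1" "norm z < 1" shows "cis (flow_arg t a z) = sgn (F (flow t a z) - F z)"
proof -
  define w where "w = (flow t a z - z) / cis t"
  have w: "w \<noteq> 0" using Re_flow_diff_pos[OF assms, of t] unfolding w_def by (metis less_irrefl zero_complex.sel(1))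
  have "cis (t + Arg w) = sgn (cis t) * sgn w"
    unfolding cis_mult[symmetric] cis_Arg_sgn[OF w] by (simp add: sgn_eq)
  also have "\<dots> = sgn (flow t a z - z)" unfolding sgn_mult[symmetric] by (simp add: w_def)
  finally show ?thesis
    using cisB[OF flow_pair[OF assms, of t]] flow_pair[OF assms, of t]
    by (simp add: flow_arg_def cis_mult[symmetric] w_def[symmetric] sgn_divide sgn_zero_iff disc_pairs_def)
qed

lemma continuous_on_flow_arg:
  assumes a: "0 < a" "a < 1" shows "continuous_on (ball 0 1) (flow_arg t a)"
proof -
  have cf: "continuous_on (ball 0 1) (flow t a)" by (rule continuous_on_subset[OF continuous_flow[OF a]]) auto
  have "continuous_on (ball 0 1) (\<lambda>z. B z (flow t a z))"
    by (rule continuous_on_compose2[OF contB, of _ "\<lambda>z. (z, flow t a z)", simplified])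
       (intro continuous_intros cf, use flow_pair[OF a] in auto)
  moreover have "(flow t a z - z) / cis t \<notin> \<real>\<^sub>\<le>\<^sub>0" if "z \<in> ball 0 1" for z
    using Re_flow_diff_pos[OF a, of z t] that unfolding complex_nonpos_Reals_iff by auto
  ultimately show ?thesis
    unfolding flow_arg_def by (intro continuous_intros continuous_on_Arg cf) auto
qed

lemma radial_access:
  assumes "((\<lambda>r. F (of_real r * cis \<theta>)) \<longlongrightarrow> b) (at_left 1)" "b \<in> Bd"
  shows "access \<theta> b (\<lambda>r. of_real r * cis \<theta>)"
proof -
  have "((\<lambda>r. of_real r * cis \<theta>) \<longlongrightarrow> of_real 1 * cis \<theta>) (at_left 1)" by (intro tendsto_intros)
  then show ?thesis using assms unfolding access_def by (auto intro!: continuous_intros simp: norm_mult)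
qed

lemma radial_flow_tendsto:
  assumes a: "0 < a" "a < 1"
  shows "((\<lambda>r. flow t a (of_real r * cis \<theta>)) \<longlongrightarrow> flow t a (cis \<theta>)) (at_left 1)"
proof -
  have "continuous_on {0..1} (\<lambda>r::real. flow t a (of_real r * cis \<theta>))"
    by (rule continuous_on_compose2[OF continuous_flow[OF a]]) (auto intro!: continuous_intros simp: norm_mult)
  then have "((\<lambda>r::real. flow t a (of_real r * cis \<theta>)) \<longlongrightarrow> flow t a (of_real 1 * cis \<theta>)) (at 1 within {0..1})"
    unfolding continuous_on_def by (rule bspec) simp
  then show ?thesis by (simp add: at_within_Icc_at_left)
qed

lemma flow_access:
  assumes a: "0 < a" "a < 1" and lim: "((\<lambda>r. F (flow t a (of_real r * cis \<theta>))) \<longlongrightarrow> b) (at_left 1)" "b \<in> Bd"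
    and \<theta>': "flow t a (cis \<theta>) = cis \<theta>'"
  shows "access \<theta>' b (\<lambda>r. flow t a (of_real r * cis \<theta>))"
proof -
  have "continuous_on {0..<1} (\<lambda>r::real. flow t a (of_real r * cis \<theta>))"
    by (rule continuous_on_compose2[OF continuous_flow[OF a]]) (auto intro!: continuous_intros simp: norm_mult)
  then show ?thesis
    using lim radial_flow_tendsto[OF a, of t \<theta>] norm_flow_less[OF a]
    unfolding access_def \<theta>' by (auto simp: norm_mult)
qed

text \<open>On the arc from t to t + pi the flow lowers the angle, so
  \<open>chord_arg_boundary\<close> applies to the pair in reverse order and its argument is shifted
  by - pi; on the other arc the order is kept and the shift is - 2 pi. With the bounds on the ray
  angles both cases end in [s - pi, s + pi].\<close>

lemma flow_arg_boundary:
  assumes a: "0 < a" "a < 1"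
    and top: "\<And>\<theta> \<psi> b c. t < \<theta> \<Longrightarrow> \<theta> < t + pi \<Longrightarrow> ray_access \<theta> \<psi> b c \<Longrightarrow> s \<le> \<psi> \<and> \<psi> \<le> s + pi"
    and bot: "\<And>\<theta> \<psi> b c. t + pi < \<theta> \<Longrightarrow> \<theta> < t + 2 * pi \<Longrightarrow> ray_access \<theta> \<psi> b c \<Longrightarrow> s + pi \<le> \<psi> \<and> \<psi> \<le> s + 2 * pi"
    and th: "t < \<theta>" "\<theta> < t + 2 * pi" "\<theta> \<noteq> t + pi"
    and l1: "((\<lambda>r. F (of_real r * cis \<theta>)) \<longlongrightarrow> b1) (at_left 1)" "b1 \<in> Bd"
    and l2: "((\<lambda>r. F (flow t a (of_real r * cis \<theta>))) \<longlongrightarrow> b2) (at_left 1)" "b2 \<in> Bd"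
    and ne: "b1 \<noteq> b2"
  obtains D where "((\<lambda>r. flow_arg t a (of_real r * cis \<theta>)) \<longlongrightarrow> D) (at_left 1)" "s - pi \<le> D" "D \<le> s + pi"
    "cis D = sgn (b2 - b1)"
proof -
  define \<theta>' where "\<theta>' = \<theta> - 2 * Arg (1 + of_real a * cis (\<theta> - t))"
  have fb: "flow t a (cis \<theta>) = cis \<theta>'" unfolding \<theta>'_def by (rule flow_boundary(1)[OF a])
  define c1 where "c1 = (\<lambda>r. complex_of_real r * cis \<theta>)"
  define c2 where "c2 = (\<lambda>r. flow t a (complex_of_real r * cis \<theta>))"
  obtain \<psi>1 where r1: "ray_access \<theta> \<psi>1 b1 c1"
    using ray_access_exists[OF radial_access[OF l1]] unfolding c1_def by blast
  obtain \<psi>2 where r2: "ray_access \<theta>' \<psi>2 b2 c2"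
    using ray_access_exists[OF flow_access[OF a l2 fb]] unfolding c2_def by blast
  have c12: "(c1 r, c2 r) \<in> disc_pairs" if "0 \<le> r" "r < 1" for r
    unfolding c1_def c2_def by (rule flow_pair[OF a]) (use that in \<open>simp add: norm_mult\<close>)
  have cl: "(c1 \<longlongrightarrow> cis \<theta>) (at_left 1)" "(c2 \<longlongrightarrow> cis \<theta>') (at_left 1)"
    using r1 r2 by (auto simp: ray_access_def access_def)
  have Alim: "((\<lambda>r. Arg ((c2 r - c1 r) / cis t)) \<longlongrightarrow> x) (at_left 1)"
    if x: "\<bar>x\<bar> < pi / 2" "of_real \<rho> * cis (t + x) = cis \<theta>' - cis \<theta>" "\<rho> > 0" for x \<rho>
  proof -
    have q: "(cis \<theta>' - cis \<theta>) / cis t = of_real \<rho> * cis x"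
      unfolding x(2)[symmetric] cis_mult[symmetric] by simp
    have "((\<lambda>r. (c2 r - c1 r) / cis t) \<longlongrightarrow> of_real \<rho> * cis x) (at_left 1)"
      unfolding q[symmetric] by (intro tendsto_intros cl) simp
    moreover have "isCont Arg (of_real \<rho> * cis x)"
    proof (rule continuous_at_Arg)
      have "cos x > 0" using x(1) by (intro cos_gt_zero_pi) auto
      then show "of_real \<rho> * cis x \<notin> \<real>\<^sub>\<le>\<^sub>0" using x(3) by (auto simp: complex_nonpos_Reals_iff mult_le_0_iff)
    qed
    ultimately have "((\<lambda>r. Arg ((c2 r - c1 r) / cis t)) \<longlongrightarrow> Arg (of_real \<rho> * cis x)) (at_left 1)"
      by (rule isCont_tendsto_compose[rotated])
    moreover have "Arg (of_real \<rho> * cis x) = x"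
      using x by (simp add: Arg_times_of_real cis_conv_exp Arg_exp)
    ultimately show ?thesis by simp
  qed
  have D: "flow_arg t a (of_real r * cis \<theta>) = B (c1 r) (c2 r) + (t + Arg ((c2 r - c1 r) / cis t))" for r
    by (simp add: flow_arg_def c1_def c2_def)
  show ?thesis
  proof (cases "\<theta> < t + pi")
    case True
    then have \<theta>'t: "t < \<theta>'" "\<theta>' < \<theta>" using flow_boundary(2)[OF a th(1)] by (auto simp: \<theta>'_def)
    have ps: "s \<le> \<psi>1" "\<psi>1 \<le> s + pi" "s \<le> \<psi>2" "\<psi>2 \<le> s + pi"
      using top[OF th(1) True r1] top[OF \<theta>'t(1) _ r2] \<theta>'t True by auto
    obtain e where e: "cis e = sgn (b1 - b2)" "\<psi>2 \<le> e" "e \<le> \<psi>2 + 2 * pi" "\<psi>1 \<le> e + pi" "e + pi \<le> \<psi>1 + 2 * pi"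
       "((\<lambda>r. B (c2 r) (c1 r)) \<longlongrightarrow> e - (\<theta>' + \<theta>) / 2 - pi / 2) (at_left 1)"
      by (rule chord_arg_boundary[OF r2 r1 _ _ ne[symmetric]]) (use \<theta>'t True in auto)
    \<comment> \<open>The direction of \<open>cis \<theta>' - cis \<theta>\<close> relative to
      \<open>t\<close>, within (- pi / 2, pi / 2), where the principal argument is
      continuous.\<close>
    define x where "x = (\<theta>' + \<theta>) / 2 - pi / 2 - t"
    have sp: "sin ((\<theta> - \<theta>') / 2) > 0" using \<theta>'t True by (intro sin_gt_zero) auto
    have "cis (t + x) = - cis ((\<theta>' + \<theta>) / 2 + pi / 2)" by (simp add: x_def complex_eq_iff cos_add sin_add cos_diff sin_diff)
    then have "of_real (2 * sin ((\<theta> - \<theta>') / 2)) * cis (t + x) = cis \<theta>' - cis \<theta>"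
      using cis_diff_formula[of \<theta> \<theta>'] by (simp add: algebra_simps)
    then have A: "((\<lambda>r. Arg ((c2 r - c1 r) / cis t)) \<longlongrightarrow> x) (at_left 1)"
      using sp \<theta>'t True by (intro Alim[of x "2 * sin ((\<theta> - \<theta>') / 2)"]) (auto simp: x_def abs_less_iff field_simps)
    have "eventually (\<lambda>r. B (c2 r) (c1 r) = B (c1 r) (c2 r)) (at_left (1::real))"
      unfolding eventually_at_left_field by (rule exI[of _ 0]) (use symB[OF c12] in auto)
    then have "((\<lambda>r. B (c1 r) (c2 r)) \<longlongrightarrow> e - (\<theta>' + \<theta>) / 2 - pi / 2) (at_left 1)"
      using e(6) by (simp add: filterlim_cong)
    then have "((\<lambda>r. flow_arg t a (of_real r * cis \<theta>)) \<longlongrightarrow> (e - (\<theta>' + \<theta>) / 2 - pi / 2) + (t + x)) (at_left 1)"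
      unfolding D by (intro tendsto_add tendsto_const A)
    moreover have "(e - (\<theta>' + \<theta>) / 2 - pi / 2) + (t + x) = e - pi" by (simp add: x_def)
    moreover have "cis (e - pi) = sgn (b2 - b1)"
      using e(1) by (simp add: cis_divide[symmetric] sgn_minus[symmetric])
    ultimately show ?thesis using e ps by (intro that[of "e - pi"]) auto
  next
    case False
    then have th': "t + pi < \<theta>" using th by auto
    have \<theta>'t: "\<theta> < \<theta>'" "\<theta>' < t + 2 * pi" using flow_boundary(3)[OF a th' th(2)] by (auto simp: \<theta>'_def)
    have ps: "s + pi \<le> \<psi>1" "\<psi>1 \<le> s + 2 * pi" "s + pi \<le> \<psi>2" "\<psi>2 \<le> s + 2 * pi"
      using bot[OF th' th(2) r1] bot[OF _ \<theta>'t(2) r2] \<theta>'t th' by auto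
    obtain e where e: "cis e = sgn (b2 - b1)" "\<psi>1 \<le> e" "e \<le> \<psi>1 + 2 * pi" "\<psi>2 \<le> e + pi" "e + pi \<le> \<psi>2 + 2 * pi"
       "((\<lambda>r. B (c1 r) (c2 r)) \<longlongrightarrow> e - (\<theta> + \<theta>') / 2 - pi / 2) (at_left 1)"
      by (rule chord_arg_boundary[OF r1 r2 _ _ ne]) (use \<theta>'t th' in auto)
    define x where "x = (\<theta> + \<theta>') / 2 + pi / 2 - t - 2 * pi"
    have sp: "sin ((\<theta>' - \<theta>) / 2) > 0" using \<theta>'t th' by (intro sin_gt_zero) auto
    have "cis (t + x) = cis ((\<theta> + \<theta>') / 2 + pi / 2 - 2 * pi)" by (simp add: x_def)
    also have "\<dots> = cis ((\<theta> + \<theta>') / 2 + pi / 2)" unfolding cis_divide[symmetric] by simp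
    finally have "of_real (2 * sin ((\<theta>' - \<theta>) / 2)) * cis (t + x) = cis \<theta>' - cis \<theta>"
      using cis_diff_formula[of \<theta>' \<theta>] by simp
    then have A: "((\<lambda>r. Arg ((c2 r - c1 r) / cis t)) \<longlongrightarrow> x) (at_left 1)"
      using sp \<theta>'t th' by (intro Alim[of x "2 * sin ((\<theta>' - \<theta>) / 2)"]) (auto simp: x_def abs_less_iff field_simps)
    have "((\<lambda>r. flow_arg t a (of_real r * cis \<theta>)) \<longlongrightarrow> (e - (\<theta> + \<theta>') / 2 - pi / 2) + (t + x)) (at_left 1)"
      unfolding D by (intro tendsto_add tendsto_const A e(6))
    moreover have "(e - (\<theta> + \<theta>') / 2 - pi / 2) + (t + x) = e - 2 * pi" by (simp add: x_def)
    moreover have "cis (e - 2 * pi) = sgn (b2 - b1)"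
      using e(1) by (simp add: cis_divide[symmetric])
    ultimately show ?thesis using e ps by (intro that[of "e - 2 * pi"]) auto
  qed
qed

end

section \<open>From the boundary behaviour to the slit function\<close>

lemma negligible_sin_zero: "negligible {\<theta>::real. sin (\<theta> - t) = 0}"
proof -
  have "{\<theta>. sin (\<theta> - t) = 0} \<subseteq> range (\<lambda>i::int. t + of_int i * pi)"
    unfolding sin_zero_iff_int2 by (auto simp: algebra_simps image_iff) 
  then have "countable {\<theta>. sin (\<theta> - t) = 0}" by (rule countable_subset) auto
  then show ?thesis using negligible_iff_null_sets countable_imp_null_set_lborel
    by (metis null_sets_completionI)
qed

lemma sin_shift_npi: "cos (pi * of_int n) * sin x = sin (x - pi * of_int n)"
  by (simp add: sin_diff)

text \<open>The limit is taken jointly in the time and the point: a sign found at one point has to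
  hold on a neighbourhood of it for all small times.\<close>

lemma flow_quotient_tendsto:
  assumes k: "k holomorphic_on ball 0 1" and z0: "norm z0 < 1"
  shows "((\<lambda>p. (k (flow t (fst p) (snd p)) - k (snd p)) / of_real (fst p)) \<longlongrightarrow>
     deriv k z0 * (cis t * (1 - cis (- (2 * t)) * z0\<^sup>2))) (at_right 0 \<times>\<^sub>F nhds z0)" (is "(_ \<longlongrightarrow> _) ?G")
proof -
  have f1: "((\<lambda>p. fst p) \<longlongrightarrow> (0::real)) ?G"
    using filterlim_fst[of "at_right (0::real)" "nhds z0"] tendsto_mono[of "at_right 0" "nhds 0"] filterlim_mono at_within_le_nhds by blast
  have f2: "((\<lambda>p. snd p) \<longlongrightarrow> z0) ?G" by (rule filterlim_snd)
  have "((\<lambda>p. flow t (fst p) (snd p)) \<longlongrightarrow> (z0 + of_real 0 * cis t) / (1 + of_real 0 * cis (- t) * z0)) ?G"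
    unfolding flow_def by (intro tendsto_intros f1 f2) auto
  then have fw: "((\<lambda>p. flow t (fst p) (snd p)) \<longlongrightarrow> z0) ?G" by simp
  have e01: "eventually (\<lambda>p. 0 < fst p \<and> fst p < 1) ?G"
  proof (rule eventually_conj)
    show "eventually (\<lambda>p. 0 < fst p) ?G"
      using filterlim_fst[of "at_right (0::real)" "nhds z0"] eventually_at_right_less[of "0::real"]
      unfolding filterlim_iff by blast
    show "eventually (\<lambda>p. fst p < 1) ?G" by (rule order_tendstoD(2)[OF f1]) simp
  qed
  have ez: "eventually (\<lambda>p. norm (snd p) < 1) ?G"
    by (rule order_tendstoD(2)[OF tendsto_norm[OF f2] z0])
  define q where "q p = (k (flow t (fst p) (snd p)) - k (snd p)) / (flow t (fst p) (snd p) - snd p)" for p :: "real \<times> complex"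
  have lq: "(q \<longlongrightarrow> deriv k z0) ?G"
  proof (rule tendstoI)
    fix \<epsilon> :: real assume \<epsilon>: "\<epsilon> > 0"
    obtain r where r: "r > 0" "\<And>z w. z \<in> ball z0 r \<Longrightarrow> w \<in> ball z0 r \<Longrightarrow>
      norm (k w - k z - deriv k z0 * (w - z)) \<le> \<epsilon> / 2 * norm (w - z)"
      using strong_derivative[OF k, of z0 "\<epsilon> / 2"] \<epsilon> z0 by auto
    show "eventually (\<lambda>p. dist (q p) (deriv k z0) < \<epsilon>) ?G"
      using tendstoD[OF fw r(1)] tendstoD[OF f2 r(1)] e01 ez
    proof eventually_elim
      case (elim p)
      define w where "w = flow t (fst p) (snd p)"
      have ne: "w - snd p \<noteq> 0"
        using Re_flow_diff_pos[of "fst p" "snd p" t] elim by (auto simp: w_def)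
      have "q p - deriv k z0 = (k w - k (snd p) - deriv k z0 * (w - snd p)) / (w - snd p)"
        using ne by (simp add: q_def w_def[symmetric] field_simps)
      also have "norm \<dots> \<le> \<epsilon> / 2"
        using r(2)[of "snd p" w] elim ne by (simp add: norm_divide field_simps w_def dist_commute)
      finally show ?case using \<epsilon> by (simp add: dist_norm)
    qed
  qed
  have "((\<lambda>p. q p * (cis t * (1 - cis (- (2 * t)) * (snd p)\<^sup>2) / (1 + of_real (fst p) * cis (- t) * snd p))) \<longlongrightarrow>
     deriv k z0 * (cis t * (1 - cis (- (2 * t)) * z0\<^sup>2) / (1 + of_real 0 * cis (- t) * z0))) ?G"
    by (intro tendsto_intros lq f1 f2) auto
  then have lim: "((\<lambda>p. q p * (cis t * (1 - cis (- (2 * t)) * (snd p)\<^sup>2) / (1 + of_real (fst p) * cis (- t) * snd p))) \<longlongrightarrow>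
     deriv k z0 * (cis t * (1 - cis (- (2 * t)) * z0\<^sup>2))) ?G" by simp
  show ?thesis
  proof (rule Lim_transform_eventually[OF lim])
    show "eventually (\<lambda>p. q p * (cis t * (1 - cis (- (2 * t)) * (snd p)\<^sup>2) / (1 + of_real (fst p) * cis (- t) * snd p)) =
       (k (flow t (fst p) (snd p)) - k (snd p)) / of_real (fst p)) ?G"
      using e01 ez
    proof eventually_elim
      case (elim p)
      have ne: "flow t (fst p) (snd p) - snd p \<noteq> 0"
        using Re_flow_diff_pos[of "fst p" "snd p" t] elim by auto
      have "flow t (fst p) (snd p) - snd p = of_real (fst p) * (cis t * (1 - cis (- (2 * t)) * (snd p)\<^sup>2) / (1 + of_real (fst p) * cis (- t) * snd p))"
        using flow_diff[of "fst p" "snd p" t] elim by (simp add: mult.assoc)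
      then have "q p * (cis t * (1 - cis (- (2 * t)) * (snd p)\<^sup>2) / (1 + of_real (fst p) * cis (- t) * snd p)) =
          q p * ((flow t (fst p) (snd p) - snd p) / of_real (fst p))" using elim by simp
      also have "\<dots> = (k (flow t (fst p) (snd p)) - k (snd p)) / of_real (fst p)"
        using ne unfolding q_def by (metis nonzero_mult_div_cancel_right times_divide_eq_left times_divide_eq_right)
      finally show ?case .
    qed
  qed
qed

lemma cis_mult_polar: "z = of_real r * cis x \<Longrightarrow> cis (- s) * z = of_real r * cis (x - s)"
  by (simp add: mult.left_commute cis_mult)

context harmonic_ray_image begin

definition slit_function :: "real \<Rightarrow> real \<Rightarrow> complex \<Rightarrow> complex" where
  "slit_function t s z = cis (t - s) * (deriv h z - cis (2 * s) * deriv g z) * (1 - (cis (- t))\<^sup>2 * z\<^sup>2)"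

text \<open>On the set \<open>W\<close> where the argument lies in the strip of number
  \<open>n\<close>, \<open>Im M\<close> is positive, and it vanishes at the ends of the strip. Along
  almost every radius the argument tends to a value in [s - pi, s + pi], or the two boundary values
  coincide and \<open>Im M\<close> tends to 0. So the Phragmen-Lindelof principle leaves
  \<open>W\<close> empty; the strips \<open>n = 0\<close> and \<open>n = -1\<close> are those that
  make up this interval.\<close>

lemma flow_arg_strip:
  assumes a: "0 < a" "a < 1"
    and top: "\<And>\<theta> \<psi> b c. t < \<theta> \<Longrightarrow> \<theta> < t + pi \<Longrightarrow> ray_access \<theta> \<psi> b c \<Longrightarrow> s \<le> \<psi> \<and> \<psi> \<le> s + pi"
    and bot: "\<And>\<theta> \<psi> b c. t + pi < \<theta> \<Longrightarrow> \<theta> < t + 2 * pi \<Longrightarrow> ray_access \<theta> \<psi> b c \<Longrightarrow> s + pi \<le> \<psi> \<and> \<psi> \<le> s + 2 * pi"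
    and n: "n \<noteq> 0" "n \<noteq> -1" and z0: "norm z0 < 1"
  shows "\<not> (pi * of_int n < flow_arg t a z0 - s \<and> flow_arg t a z0 - s < pi * of_int n + pi)"
proof -
  \<comment> \<open>\<open>k\<close> is analytic with the imaginary part of
    \<open>cis (- s) * F\<close>, since conjugating \<open>cis s * g\<close> changes the sign of its
    imaginary part.\<close>
  define k where "k z = cis (- s) * h z - cis s * g z" for z
  define M where "M z = of_real (cos (pi * of_int n)) * (k (flow t a z) - k z)" for z
  define \<Delta> where "\<Delta> z = F (flow t a z) - F z" for z
  have fl: "flow t a z \<in> ball 0 1" if "norm z < 1" for z using norm_flow_less[OF a that] by simp
  have "Im (k z) = Im (cis (- s) * F z)" if "z \<in> ball 0 1" for z
    by (simp add: k_def F_eq[OF that] algebra_simps)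
  then have ImM: "Im (M z) = cos (pi * of_int n) * Im (cis (- s) * \<Delta> z)" if "norm z < 1" for z
  proof -
    have "Im (M z) = cos (pi * of_int n) * (Im (k (flow t a z)) - Im (k z))" by (simp add: M_def)
    also have "\<dots> = cos (pi * of_int n) * Im (cis (- s) * \<Delta> z)"
      using \<open>\<And>z. z \<in> ball 0 1 \<Longrightarrow> Im (k z) = Im (cis (- s) * F z)\<close> that fl[OF that]
      unfolding \<Delta>_def right_diff_distrib minus_complex.sel by simp
    finally show ?thesis .
  qed
  have ImM2: "Im (M z) = norm (\<Delta> z) * sin (flow_arg t a z - s - pi * of_int n)" if "norm z < 1" for z
  proof -
    have "\<Delta> z = of_real (norm (\<Delta> z)) * cis (flow_arg t a z)"
      using cis_flow_arg[OF a that, of t] by (simp add: \<Delta>_def sgn_eq)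
    then have "cis (- s) * \<Delta> z = of_real (norm (\<Delta> z)) * cis (flow_arg t a z - s)"
      using cis_mult_polar by metis
    then show ?thesis
      unfolding ImM[OF that] sin_shift_npi[symmetric] by (simp add: algebra_simps)
  qed
  have \<Delta>0: "\<Delta> z \<noteq> 0" if "norm z < 1" for z
    using injF flow_pair[OF a that, of t] fl[OF that] that by (auto simp: \<Delta>_def inj_on_def disc_pairs_def)
  define W where "W = {z \<in> ball 0 1. flow_arg t a z \<in> {s + pi * of_int n <..< s + pi * of_int n + pi}}"
  have cfa: "continuous_on (ball 0 1) (flow_arg t a)" by (rule continuous_on_flow_arg[OF a])
  obtain K where K: "\<And>z. z \<in> ball 0 1 \<Longrightarrow> norm (F z) \<le> K" using boundedF unfolding bounded_iff by blast
  obtain E where E: "negligible E" and lims: "\<And>\<theta>. \<theta> \<in> {0..2*pi} - E \<Longrightarrow> \<exists>b1 b2.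
        ((\<lambda>r. F (of_real r * cis \<theta>)) \<longlongrightarrow> b1) (at_left 1) \<and> b1 \<in> Bd \<and>
        ((\<lambda>r. F (flow t a (of_real r * cis \<theta>))) \<longlongrightarrow> b2) (at_left 1) \<and> b2 \<in> Bd"
    using flow_limits[OF a, of t] by blast
  have "W = {}"
  proof (rule phragmen_lindelof_disc[of M "2 * K" W "E \<union> {\<theta>. sin (\<theta> - t) = 0}"])
    have "h \<circ> flow t a holomorphic_on ball 0 1" "g \<circ> flow t a holomorphic_on ball 0 1"
      using holomorphic_on_subset[OF holomorphic_flow[OF a, of t], of "ball 0 1"] fl
      by (auto intro!: holomorphic_on_compose_gen[where t = "ball 0 1"] holh holg)
    then show "M holomorphic_on ball 0 1"
      unfolding M_def k_def by (intro holomorphic_intros holh holg) (auto simp: o_def)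
    show "\<bar>Im (M z)\<bar> \<le> 2 * K" if "norm z < 1" for z
    proof -
      have "\<bar>Im (M z)\<bar> \<le> 1 * norm (cis (- s) * \<Delta> z)"
        unfolding ImM[OF that] abs_mult by (intro mult_mono abs_cos_le_one abs_Im_le_cmod) auto
      also have "\<dots> \<le> norm (F (flow t a z)) + norm (F z)" by (simp add: norm_mult \<Delta>_def norm_triangle_ineq4)
      also have "\<dots> \<le> 2 * K" using K[OF fl[OF that]] K[of z] that by simp
      finally show ?thesis .
    qed
    show "open W" unfolding W_def
      using continuous_open_preimage[OF cfa open_ball open_greaterThanLessThan] by (simp add: vimage_def Int_def)
    then have oW: "open W" .
    show "W \<subseteq> ball 0 1" by (auto simp: W_def)
    show "Im (M z) > 0" if "z \<in> W" for z
      using that \<Delta>0[of z] unfolding W_def by (subst ImM2) (auto intro!: mult_pos_pos sin_gt_zero)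
    show "Im (M z) = 0" if "z \<in> frontier W" "norm z < 1" for z
    proof -
      define A where "A = flow_arg t a z"
      have zW: "z \<notin> W" using that(1) oW by (simp add: frontier_def interior_open)
      have "z \<in> closure W" using that(1) by (simp add: frontier_def)
      then obtain x where x: "\<And>n. x n \<in> W" "x \<longlonglongrightarrow> z" by (auto simp: closure_sequential)
      have "(\<lambda>n. flow_arg t a (x n)) \<longlonglongrightarrow> A" unfolding A_def
        by (rule continuous_on_tendsto_compose[OF cfa x(2)]) (use that x(1) in \<open>auto simp: W_def\<close>)
      moreover have "s + pi * of_int n \<le> flow_arg t a (x m)" "flow_arg t a (x m) \<le> s + pi * of_int n + pi" for m
        using x(1)[of m] by (auto simp: W_def)
      ultimately have "A \<ge> s + pi * of_int n" "A \<le> s + pi * of_int n + pi"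
        by (meson LIMSEQ_le_const LIMSEQ_le_const2)+
      moreover have "\<not> (A > s + pi * of_int n \<and> A < s + pi * of_int n + pi)"
        using zW that by (auto simp: W_def A_def)
      ultimately have "A = s + pi * of_int n \<or> A = s + pi * of_int n + pi" by linarith
      then have "sin (A - s - pi * of_int n) = 0" by auto
      then show ?thesis using ImM2[OF that(2)] by (simp add: A_def)
    qed
    show "negligible (E \<union> {\<theta>. sin (\<theta> - t) = 0})" by (intro negligible_Un E negligible_sin_zero)
    fix \<theta>0 assume th0: "\<theta>0 \<in> {0..2*pi} - (E \<union> {\<theta>. sin (\<theta> - t) = 0})"
    \<comment> \<open>The boundary angle is reduced to the period from t to t + 2 pi on which
      \<open>top\<close> and \<open>bot\<close> are stated.\<close>
    define j where "j = \<lfloor>(\<theta>0 - t) / (2 * pi)\<rfloor>"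
    define \<theta> where "\<theta> = \<theta>0 - 2 * pi * of_int j"
    have c0: "cis \<theta>0 = cis \<theta>" by (simp add: \<theta>_def cis_divide[symmetric] cis_multiple_2pi)
    have "of_int j \<le> (\<theta>0 - t) / (2 * pi)" "(\<theta>0 - t) / (2 * pi) < of_int j + 1" unfolding j_def by linarith+
    then have th1: "t \<le> \<theta>" "\<theta> < t + 2 * pi" by (auto simp: \<theta>_def field_simps)
    have "sin (\<theta> - t) = sin (\<theta>0 - t)"
      using sin_int_2pin[of j] cos_int_2pin[of j] sin_diff[of "\<theta>0 - t" "2 * pi * of_int j"]
      by (simp add: \<theta>_def algebra_simps)
    then have "sin (\<theta> - t) \<noteq> 0" using th0 by auto
    then have th: "t < \<theta>" "\<theta> < t + 2 * pi" "\<theta> \<noteq> t + pi" using th1 by (auto simp: less_le)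
    obtain b1 b2 where l: "((\<lambda>r. F (of_real r * cis \<theta>)) \<longlongrightarrow> b1) (at_left 1)" "b1 \<in> Bd"
        "((\<lambda>r. F (flow t a (of_real r * cis \<theta>))) \<longlongrightarrow> b2) (at_left 1)" "b2 \<in> Bd"
      using lims[of \<theta>0] th0 unfolding c0 by blast
    have lD: "((\<lambda>r. \<Delta> (of_real r * cis \<theta>)) \<longlongrightarrow> b2 - b1) (at_left 1)"
      unfolding \<Delta>_def by (intro tendsto_intros l)
    have near: "eventually (\<lambda>r::real. norm (of_real r * cis \<theta>) < 1) (at_left 1)"
      unfolding eventually_at_left_field by (rule exI[of _ 0]) (simp add: norm_mult)
    have lM: "((\<lambda>r. Im (M (of_real r * cis \<theta>))) \<longlongrightarrow> cos (pi * of_int n) * Im (cis (- s) * (b2 - b1))) (at_left 1)"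
    proof -
      have "((\<lambda>r. cos (pi * of_int n) * Im (cis (- s) * \<Delta> (of_real r * cis \<theta>))) \<longlongrightarrow> cos (pi * of_int n) * Im (cis (- s) * (b2 - b1))) (at_left 1)"
        by (intro tendsto_intros lD)
      then show ?thesis
        by (rule Lim_transform_eventually) (use near in eventually_elim, use ImM in simp)
    qed
    have Mz: "((\<lambda>r. if of_real r * cis \<theta> \<in> W then Im (M (of_real r * cis \<theta>)) else 0) \<longlongrightarrow> 0) (at_left 1)"
      if "Im (cis (- s) * (b2 - b1)) = 0"
    proof -
      have "((\<lambda>r. \<bar>Im (M (of_real r * cis \<theta>))\<bar>) \<longlongrightarrow> 0) (at_left 1)" using lM that by (simp add: tendsto_rabs_zero)
      then show ?thesis by (rule Lim_null_comparison[rotated]) (auto intro!: always_eventually)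
    qed
    have fab: "\<exists>D. ((\<lambda>r. flow_arg t a (of_real r * cis \<theta>)) \<longlongrightarrow> D) (at_left 1) \<and> s - pi \<le> D \<and> D \<le> s + pi \<and> cis D = sgn (b2 - b1)"
      if ne: "b1 \<noteq> b2"
    proof (rule flow_arg_boundary[where t = t and s = s and \<theta> = \<theta> and ?b1.0 = b1 and ?b2.0 = b2, OF a])
    qed (fact th l ne top bot | blast intro: top bot)+
    have "((\<lambda>r. if of_real r * cis \<theta> \<in> W then Im (M (of_real r * cis \<theta>)) else 0) \<longlongrightarrow> 0) (at_left 1)"
    proof (cases "b1 = b2")
      case True then show ?thesis using Mz by simp
    next
      case False
      obtain D where D: "((\<lambda>r. flow_arg t a (of_real r * cis \<theta>)) \<longlongrightarrow> D) (at_left 1)" "s - pi \<le> D" "D \<le> s + pi" "cis D = sgn (b2 - b1)"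
        using fab[OF False] by blast
      have "b2 - b1 = of_real (norm (b2 - b1)) * cis D" using D(4) False by (simp add: sgn_eq)
      then have "cis (- s) * (b2 - b1) = of_real (norm (b2 - b1)) * cis (D - s)"
        using cis_mult_polar by metis
      then have imb: "Im (cis (- s) * (b2 - b1)) = norm (b2 - b1) * sin (D - s)" by (simp del: minus_complex.sel)
      show ?thesis
      proof (cases "sin (D - s) = 0")
        case True then show ?thesis using Mz imb by simp
      next
        case False
        then have Dst: "s - pi < D" "D < s + pi" using D(2,3) by (auto simp: less_le)
        have nn: "n \<ge> 1 \<or> n \<le> -2" using n by linarith
        have "eventually (\<lambda>r. of_real r * cis \<theta> \<notin> W) (at_left 1)"
        proof -
          have "eventually (\<lambda>r. flow_arg t a (of_real r * cis \<theta>) \<in> {s - pi<..<s + pi}) (at_left 1)"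
            using topological_tendstoD[OF D(1) open_greaterThanLessThan[of "s - pi" "s + pi"]] Dst by simp
          then show ?thesis
          proof eventually_elim
            case (elim r)
            show ?case using nn
            proof
              assume "n \<ge> 1"
              then have "pi * of_int n \<ge> pi * 1" by (intro mult_left_mono) auto
              then show ?thesis using elim unfolding W_def mem_Collect_eq greaterThanLessThan_iff by linarith
            next
              assume "n \<le> -2"
              then have "of_int n \<le> (-2::real)" by simp
              then have "pi * of_int n \<le> pi * (-2)" by (intro mult_left_mono) auto
              then show ?thesis using elim unfolding W_def mem_Collect_eq greaterThanLessThan_iff by linarith
            qed
          qed
        qed
        then have "eventually (\<lambda>r. 0 = (if of_real r * cis \<theta> \<in> W then Im (M (of_real r * cis \<theta>)) else 0)) (at_left 1)"
          by eventually_elim simp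
        then show ?thesis by (rule Lim_transform_eventually[rotated]) simp
      qed
    qed
    then show "((\<lambda>r. if of_real r * cis \<theta>0 \<in> W then Im (M (of_real r * cis \<theta>0)) else 0) \<longlongrightarrow> 0) (at_left 1)"
      unfolding c0 .
  qed
  then have "z0 \<notin> W" by simp
  then show ?thesis using z0 unfolding W_def mem_Collect_eq mem_ball dist_0_norm greaterThanLessThan_iff by linarith
qed

text \<open>The slit function is the derivative, in the flow parameter at time 0, of the analytic function whose imaginary part
  is that of \<open>cis (- s) * (F (flow t a z) - F z)\<close>. Near a negative value of it this difference would have
  arguments on both sides of an odd multiple of \<open>pi\<close>, against the strip condition.\<close>

lemma slit_function_range:
  assumes lt: "\<And>z. norm z < 1 \<Longrightarrow> norm (deriv g z) < norm (deriv h z)"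
  obtains t s where "(\<forall>z\<in>ball 0 1. slit_function t s z = slit_function t s 0) \<or> (\<forall>z\<in>ball 0 1. slit_function t s z \<notin> \<real>\<^sub>\<le>\<^sub>0)"
proof -
  obtain t s where
    top: "\<And>\<theta> \<psi> b c. t < \<theta> \<Longrightarrow> \<theta> < t + pi \<Longrightarrow> ray_access \<theta> \<psi> b c \<Longrightarrow> s \<le> \<psi> \<and> \<psi> \<le> s + pi"
    and bot: "\<And>\<theta> \<psi> b c. t + pi < \<theta> \<Longrightarrow> \<theta> < t + 2 * pi \<Longrightarrow> ray_access \<theta> \<psi> b c \<Longrightarrow> s + pi \<le> \<psi> \<and> \<psi> \<le> s + 2 * pi"
    using opposite_rays by metis
  have "(\<forall>z\<in>ball 0 1. slit_function t s z = slit_function t s 0) \<or> (\<forall>z\<in>ball 0 1. slit_function t s z \<notin> \<real>\<^sub>\<le>\<^sub>0)"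
  proof (rule ccontr)
    assume "\<not> ?thesis"
    then obtain z0 where nc: "\<not> (\<forall>z\<in>ball 0 1. slit_function t s z = slit_function t s 0)" and z0: "norm z0 < 1" "slit_function t s z0 \<in> \<real>\<^sub>\<le>\<^sub>0"
      by auto
    define v where "v z = cis t * (1 - cis (- (2 * t)) * z\<^sup>2)" for z
    have v0: "v z \<noteq> 0" if "norm z < 1" for z
    proof -
      have "norm (cis (- (2 * t)) * z\<^sup>2) < 1" using that by (simp add: norm_mult norm_power abs_square_less_1)
      then show ?thesis by (auto simp: v_def)
    qed
    \<comment> \<open>\<open>q\<close> is the limit of the difference quotients \<open>Q\<close>; it
      has the imaginary part of the slit function, but in general another real part.\<close>
    define q where "q z = cis (- s) * (deriv h z * v z) + cnj (cis s * (deriv g z * v z))" for z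
    define Q where "Q p = cis (- s) * (F (flow t (fst p) (snd p)) - F (snd p)) / of_real (fst p)" for p :: "real \<times> complex"
    have Nv: "slit_function t s z = cis (- s) * (deriv h z * v z) - cis s * (deriv g z * v z)" for z
    proof -
      have e: "cis (t - s) = cis t * cis (- s)" "cis (- s) * cis (2 * s) = cis s" "(cis (- t))\<^sup>2 = cis (- (2 * t))"
        by (simp_all add: cis_mult Complex.DeMoivre)
      have "slit_function t s z = (cis (- s) * deriv h z - (cis (- s) * cis (2 * s)) * deriv g z) * v z"
        unfolding slit_function_def v_def e(1,3) by (simp add: algebra_simps)
      then show ?thesis unfolding e(2) by (simp add: algebra_simps)
    qed
    have Imq: "Im (q z) = Im (slit_function t s z)" for z by (simp add: q_def Nv del: times_complex.sel complex_cnj_mult)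
    have Qlim: "(Q \<longlongrightarrow> q z) (at_right 0 \<times>\<^sub>F nhds z)" if z: "norm z < 1" for z
    proof -
      define kk where "kk k p = (k (flow t (fst p) (snd p)) - k (snd p)) / of_real (fst p)" for k :: "complex \<Rightarrow> complex" and p :: "real \<times> complex"
      have hl: "(kk h \<longlongrightarrow> deriv h z * v z) (at_right 0 \<times>\<^sub>F nhds z)"
        unfolding kk_def v_def by (rule flow_quotient_tendsto[OF holh z])
      have gl: "(kk g \<longlongrightarrow> deriv g z * v z) (at_right 0 \<times>\<^sub>F nhds z)"
        unfolding kk_def v_def by (rule flow_quotient_tendsto[OF holg z])
      have lim: "((\<lambda>p. cis (- s) * kk h p + cnj (cis s * kk g p)) \<longlongrightarrow> q z) (at_right 0 \<times>\<^sub>F nhds z)"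
        unfolding q_def by (intro tendsto_intros hl gl)
      have ev: "eventually (\<lambda>p::real \<times> complex. 0 < fst p \<and> fst p < 1 \<and> norm (snd p) < 1) (at_right 0 \<times>\<^sub>F nhds z)"
      proof -
        have "eventually (\<lambda>a::real. 0 < a \<and> a < 1) (at_right 0)"
          unfolding eventually_at_right_field by (rule exI[of _ 1]) auto
        moreover have "eventually (\<lambda>z. norm z < 1) (nhds z)"
          by (rule order_tendstoD(2)[OF tendsto_norm[OF filterlim_ident] z])
        ultimately show ?thesis using eventually_prodI[of "\<lambda>a::real. 0 < a \<and> a < 1" _ "\<lambda>z::complex. norm z < 1"] by (simp only: conj_assoc)
      qed
      show ?thesis
      proof (rule Lim_transform_eventually[OF lim])
        show "eventually (\<lambda>p. cis (- s) * kk h p + cnj (cis s * kk g p) = Q p) (at_right 0 \<times>\<^sub>F nhds z)"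
          using ev
        proof eventually_elim
          case (elim p)
          have "flow t (fst p) (snd p) \<in> ball 0 1" using norm_flow_less[of "fst p" "snd p" t] elim by simp
          then have "F (flow t (fst p) (snd p)) - F (snd p) =
              (h (flow t (fst p) (snd p)) - h (snd p)) + cnj (g (flow t (fst p) (snd p)) - g (snd p))"
            using elim by (simp add: F_eq)
          then show ?case by (simp add: Q_def kk_def cis_cnj add_divide_distrib distrib_left)
        qed
      qed
    qed
    \<comment> \<open>The slit function is \<open>p1 - p2\<close>, and \<open>q\<close> has the real
      part of \<open>p1 + p2\<close>. As the imaginary parts agree, \<open>norm p2 < norm p1\<close>
      compares the absolute values of the real parts, and the negative sign passes over.\<close>
    have Req: "Re (q z0) < 0"
    proof -
      define p1 where "p1 = cis (- s) * (deriv h z0 * v z0)"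
      define p2 where "p2 = cis s * (deriv g z0 * v z0)"
      have n12: "norm p2 < norm p1" using lt[OF z0(1)] v0[OF z0(1)] by (simp add: p1_def p2_def norm_mult)
      have "p1 - p2 \<in> \<real>\<^sub>\<le>\<^sub>0" using z0(2) by (simp add: Nv p1_def p2_def)
      then have i: "Im p1 = Im p2" "Re p1 \<le> Re p2" by (auto simp: complex_nonpos_Reals_iff)
      have "(Re p2)\<^sup>2 + (Im p2)\<^sup>2 < (Re p1)\<^sup>2 + (Im p1)\<^sup>2"
        using n12 unfolding cmod_power2[symmetric] by (intro power_strict_mono) auto
      then have "\<bar>Re p2\<bar> < \<bar>Re p1\<bar>" using i(1) unfolding not_le[symmetric] abs_le_square_iff by simp
      then have "Re p1 + Re p2 < 0" using i by linarith
      then show ?thesis by (simp add: q_def p1_def p2_def del: times_complex.sel complex_cnj_mult)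
    qed
    have "eventually (\<lambda>p. Re (Q p) < 0) (at_right 0 \<times>\<^sub>F nhds z0)"
      by (rule order_tendstoD(2)[OF tendsto_Re[OF Qlim[OF z0(1)]] Req])
    then obtain P1 P2 where P: "eventually P1 (at_right 0)" "eventually P2 (nhds z0)"
        "\<And>a z. P1 a \<Longrightarrow> P2 z \<Longrightarrow> Re (Q (a, z)) < 0"
      unfolding eventually_prod_filter by auto
    obtain \<delta>1 where \<delta>1: "\<delta>1 > 0" "\<And>z. dist z z0 < \<delta>1 \<Longrightarrow> P2 z" using P(2) unfolding eventually_nhds_metric by blast
    define \<delta> where "\<delta> = min \<delta>1 (1 - norm z0)"
    have \<delta>: "\<delta> > 0" "ball z0 \<delta> \<subseteq> ball 0 1" "\<And>z. z \<in> ball z0 \<delta> \<Longrightarrow> P2 z"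
      using \<delta>1 z0 by (auto simp: \<delta>_def ball_subset_ball_iff dist_norm norm_minus_commute)
    have holN: "slit_function t s holomorphic_on ball 0 1"
      unfolding slit_function_def by (intro holomorphic_intros holomorphic_deriv holh holg) auto
    have "\<not> slit_function t s constant_on ball 0 1"
    proof
      assume "slit_function t s constant_on ball 0 1"
      then obtain y where "\<And>z. z \<in> ball 0 1 \<Longrightarrow> slit_function t s z = y" unfolding constant_on_def by blast
      then show False using nc by simp
    qed
    then have opN: "open (slit_function t s ` ball z0 \<delta>)"
      using \<delta>(2) by (intro open_mapping_thm[OF holN]) auto
    have "slit_function t s z0 \<in> slit_function t s ` ball z0 \<delta>" using \<delta>(1) by auto
    then obtain e where e: "e > 0" "ball (slit_function t s z0) e \<subseteq> slit_function t s ` ball z0 \<delta>" using opN openE by blast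
    have near: "\<exists>z\<in>ball z0 \<delta>. slit_function t s z = slit_function t s z0 + of_real x * \<i>" if "\<bar>x\<bar> < e" for x
      using subsetD[OF e(2), of "slit_function t s z0 + of_real x * \<i>"] that by (auto simp: dist_norm norm_mult)
    have Im0: "Im (slit_function t s z0) = 0" using z0(2) by (simp add: complex_nonpos_Reals_iff)
    obtain zp where zp: "zp \<in> ball z0 \<delta>" "Im (slit_function t s zp) > 0" using near[of "e/2"] e Im0 by auto
    obtain zm where zm: "zm \<in> ball z0 \<delta>" "Im (slit_function t s zm) < 0" using near[of "-e/2"] e Im0 by auto
    have pt: "((\<lambda>a. Im (Q (a, z))) \<longlongrightarrow> Im (slit_function t s z)) (at_right 0)" if "z \<in> ball z0 \<delta>" for z
    proof -
      have "LIM a at_right 0. (a, z) :> at_right (0::real) \<times>\<^sub>F nhds z"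
        by (intro filterlim_Pair filterlim_ident tendsto_const)
      moreover have "norm z < 1" using that \<delta> by auto
      ultimately show ?thesis
        unfolding Imq[symmetric] by (intro tendsto_Im filterlim_compose[OF Qlim]) auto
    qed
    have "eventually (\<lambda>a. P1 a \<and> Im (Q (a, zp)) > 0 \<and> Im (Q (a, zm)) < 0 \<and> 0 < a \<and> a < 1) (at_right 0)"
      using P(1) order_tendstoD(1)[OF pt[OF zp(1)] zp(2)] order_tendstoD(2)[OF pt[OF zm(1)] zm(2)]
      by (intro eventually_conj) (auto simp: eventually_at_right_field intro!: exI[of _ 1])
    then obtain a where A: "P1 a" "Im (Q (a, zp)) > 0" "Im (Q (a, zm)) < 0" "0 < a" "a < 1"
      using eventually_happens'[of "at_right (0::real)"] trivial_limit_at_right_real by blast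
    define \<Delta> where "\<Delta> z = F (flow t a z) - F z" for z
    define f where "f z = flow_arg t a z - s" for z
    have Qa: "Q (a, z) = of_real (norm (\<Delta> z) / a) * cis (f z)" if "norm z < 1" for z
    proof -
      have "\<Delta> z = of_real (norm (\<Delta> z)) * cis (flow_arg t a z)"
        using cis_flow_arg[OF A(4,5) that, of t] by (simp add: \<Delta>_def sgn_eq)
      then have "cis (- s) * \<Delta> z = of_real (norm (\<Delta> z)) * cis (f z)"
        unfolding f_def using cis_mult_polar by metis
      then show ?thesis by (simp add: Q_def \<Delta>_def)
    qed
    have sgn_im: "Im (Q (a, z)) > 0 \<Longrightarrow> sin (f z) > 0" "Im (Q (a, z)) < 0 \<Longrightarrow> sin (f z) < 0"
       "Re (Q (a, z)) < 0 \<Longrightarrow> cos (f z) < 0" if "norm z < 1" for z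
      unfolding Qa[OF that] using A(4) by (auto simp: zero_less_mult_iff mult_less_0_iff divide_less_0_iff zero_less_divide_iff)
    have cosneg: "cos (f z) < 0" if "z \<in> ball z0 \<delta>" for z
      using sgn_im(3)[of z] P(3)[OF A(1) \<delta>(3)[OF that]] that \<delta>(2) by auto
    have strip: "\<not> (pi * of_int n < f z \<and> f z < pi * of_int n + pi)" if "n \<noteq> 0" "n \<noteq> -1" "norm z < 1" for n z
      unfolding f_def by (rule flow_arg_strip[OF A(4,5) top bot that])
    have rng: "- pi \<le> f z \<and> f z \<le> pi" if z: "norm z < 1" and sn: "sin (f z) \<noteq> 0" for z
    proof -
      define n where "n = \<lfloor>f z / pi\<rfloor>"
      have "of_int n \<le> f z / pi" "f z / pi < of_int n + 1" unfolding n_def by linarith+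
      then have b: "pi * of_int n \<le> f z" "f z < pi * of_int n + pi" by (auto simp: field_simps)
      moreover have "f z \<noteq> pi * of_int n" using sn by auto
      ultimately have "n = 0 \<or> n = -1" using strip[of n z] z by auto
      then show ?thesis using b by auto
    qed
    have zpm: "norm zp < 1" "norm zm < 1" using zp zm \<delta>(2) by auto
    have sp: "sin (f zp) > 0" and sm: "sin (f zm) < 0" using sgn_im A zpm by auto
    have "f zp > 0"
    proof (rule ccontr)
      assume "\<not> ?thesis"
      then have "sin (- f zp) \<ge> 0" using rng[OF zpm(1)] sp by (intro sin_ge_zero) auto
      then show False using sp by simp
    qed
    moreover have "f zm < 0"
    proof (rule ccontr)
      assume "\<not> ?thesis"
      then have "sin (f zm) \<ge> 0" using rng[OF zpm(2)] sm by (intro sin_ge_zero) auto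
      then show False using sm by simp
    qed
    moreover have "continuous_on (ball z0 \<delta>) f"
      unfolding f_def by (intro continuous_intros continuous_on_subset[OF continuous_on_flow_arg[OF A(4,5)] \<delta>(2)])
    then have "connected (f ` ball z0 \<delta>)" by (rule connected_continuous_image) simp
    \<comment> \<open>\<open>f\<close> has values of both signs on the connected ball, so it takes
      the value 0 there, where the cosine is 1 and not negative.\<close>
    ultimately have "0 \<in> f ` ball z0 \<delta>"
      using connectedD_interval[of "f ` ball z0 \<delta>" "f zm" "f zp" 0] zp zm by auto
    then show False using cosneg by force
  qed
  then show ?thesis by (rule that)
qed

lemma ray_image_coefficient_bounds:
  assumes lt: "\<And>z. norm z < 1 \<Longrightarrow> norm (deriv g z) < norm (deriv h z)" and g0: "deriv g 0 = 0"
    and H: "h has_fps_expansion H" and G: "g has_fps_expansion G" and n: "n \<ge> 1"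
  shows "norm (fps_nth H n) \<le> norm (deriv h 0) * (real n + 1) * (2 * real n + 1) / 6"
    and "norm (fps_nth G n) \<le> norm (deriv h 0) * (real n - 1) * (2 * real n - 1) / 6"
proof -
  obtain t s where slit: "(\<forall>z\<in>ball 0 1. slit_function t s z = slit_function t s 0) \<or> (\<forall>z\<in>ball 0 1. slit_function t s z \<notin> \<real>\<^sub>\<le>\<^sub>0)"
    using slit_function_range[OF lt] by blast
  show "norm (fps_nth H n) \<le> norm (deriv h 0) * (real n + 1) * (2 * real n + 1) / 6"
    by (rule coefficient_bounds_from_slit(1)[OF holh holg H G lt g0 _ _ _ slit_function_def slit n]) auto
  show "norm (fps_nth G n) \<le> norm (deriv h 0) * (real n - 1) * (2 * real n - 1) / 6"
    by (rule coefficient_bounds_from_slit(2)[OF holh holg H G lt g0 _ _ _ slit_function_def slit n]) auto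
qed

end

section \<open>Ray structures of close-to-convex domains\<close>

text \<open>Crossing is allowed for equal directions because several frontier points can lie on one
  half-line of the complement, and their rays then overlap.\<close>

definition ray_structure :: "complex set \<Rightarrow> (complex \<Rightarrow> complex) \<Rightarrow> bool" where
  "ray_structure \<Omega> d \<longleftrightarrow>
     (\<forall>b\<in>frontier \<Omega>. norm (d b) = 1 \<and> (\<forall>t\<ge>0. b + of_real t * d b \<notin> \<Omega>)) \<and>
     (\<forall>b\<in>frontier \<Omega>. \<forall>b'\<in>frontier \<Omega>. \<forall>t\<ge>0. \<forall>t'\<ge>0.
        b \<noteq> b' \<longrightarrow> b + of_real t * d b = b' + of_real t' * d b' \<longrightarrow> d b = d b')"

lemma rel_interior_half_line:
  fixes p u :: complex
  assumes u: "u \<noteq> 0"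
  shows "rel_interior {p + of_real t * u |t. 0 \<le> (t::real)} = {p + of_real t * u |t. 0 < t}" (is "rel_interior ?R = _")
proof -
  have line: "affine {p + of_real t * u |t. True}"
    unfolding affine_alt
  proof safe
    fix s t r :: real
    have "(1 - r) *\<^sub>R (p + of_real s * u) + r *\<^sub>R (p + of_real t * u) = p + of_real ((1 - r) * s + r * t) * u"
      by (simp add: scaleR_conv_of_real algebra_simps)
    then show "\<exists>x. (1 - r) *\<^sub>R (p + of_real s * u) + r *\<^sub>R (p + of_real t * u) = p + of_real x * u \<and> True" by blast
  qed
  have aff: "affine hull ?R \<subseteq> {p + of_real t * u |t. True}"
    by (intro hull_minimal line) auto
  show ?thesis
  proof safe
    fix x assume x: "x \<in> rel_interior ?R"
    then obtain e where e: "e > 0" "cball x e \<inter> affine hull ?R \<subseteq> ?R" and xR: "x \<in> ?R"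
      unfolding mem_rel_interior_cball by auto
    obtain t where t: "t \<ge> 0" "x = p + of_real t * u" using xR by auto
    \<comment> \<open>The point at distance \<open>e\<close> from \<open>x\<close> backwards along
      the line; it must still belong to the half-line, so \<open>x\<close> is not its
      origin.\<close>
    define q where "q = p + of_real (t - e / norm u) * u"
    have A: "p + of_real r * u \<in> affine hull ?R" if "r \<ge> 0" for r
      by (rule hull_inc) (use that in blast)
    have "p + of_real t * u \<in> affine hull ?R" "p + of_real (t + 1) * u \<in> affine hull ?R"
      by (rule A, use t(1) in simp)+
    then have "(1 + e / norm u) *\<^sub>R (p + of_real t * u) + (- e / norm u) *\<^sub>R (p + of_real (t + 1) * u) \<in> affine hull ?R"
      by (intro mem_affine affine_affine_hull) auto
    also have "(1 + e / norm u) *\<^sub>R (p + of_real t * u) + (- e / norm u) *\<^sub>R (p + of_real (t + 1) * u) = q"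
      by (simp add: q_def scaleR_conv_of_real algebra_simps add_divide_distrib)
    finally have "q \<in> affine hull ?R" .
    moreover have "q \<in> cball x e" using e u by (simp add: q_def t dist_norm norm_mult norm_divide flip: left_diff_distrib)
    ultimately obtain r where r: "r \<ge> 0" "q = p + of_real r * u" using e(2) by auto
    then have "of_real r = complex_of_real (t - e / norm u)" using u by (simp add: q_def)
    then have "r = t - e / norm u" by (metis of_real_eq_iff)
    then have "t > 0" using r e u by (smt (verit) divide_pos_pos zero_less_norm_iff)
    then show "\<exists>t. x = p + of_real t * u \<and> 0 < t" using t by blast
  next
    fix t :: real assume t: "0 < t"
    have "cball (p + of_real t * u) (t * norm u / 2) \<inter> affine hull ?R \<subseteq> ?R"
    proof
      fix y assume y: "y \<in> cball (p + of_real t * u) (t * norm u / 2) \<inter> affine hull ?R"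
      then obtain s where s: "y = p + of_real s * u" using aff by blast
      have "norm (of_real (t - s) * u) \<le> t * norm u / 2"
        using y by (simp add: s dist_norm flip: left_diff_distrib of_real_diff)
      then have "\<bar>t - s\<bar> * norm u \<le> (t / 2) * norm u" by (simp add: norm_mult mult.commute del: of_real_diff)
      then have "\<bar>t - s\<bar> \<le> t / 2" using u by simp
      then have "s \<ge> 0" by linarith
      then show "y \<in> ?R" using s by blast
    qed
    moreover have "t * norm u / 2 > 0" using t u by simp
    moreover have "p + of_real t * u \<in> ?R" using t by (auto intro!: exI[of _ t])
    ultimately show "p + of_real t * u \<in> rel_interior ?R"
      unfolding mem_rel_interior_cball by blast
  qed
qed

text \<open>Half-lines with disjoint relative interiors may still touch at an end point. Each
  frontier point is assigned a half-line that contains it in the relative interior whenever there is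
  one; that one is unique, so if the rays of two distinct frontier points meet, they come from the
  same half-line.\<close>

lemma close_to_convex_ray_structure:
  assumes "close_to_convex \<Omega>"
  obtains d where "ray_structure \<Omega> d"
proof -
  have op: "open \<Omega>" using assms by (simp add: close_to_convex_def)
  obtain \<R> where \<R>: "\<And>R. R \<in> \<R> \<Longrightarrow> half_line R" "\<Union>\<R> = - \<Omega>"
      and pw: "pairwise (\<lambda>R R'. disjnt (rel_interior R) (rel_interior R')) \<R>"
    using assms unfolding close_to_convex_def by blast
  have dj: "rel_interior R \<inter> rel_interior R' = {}" if "R \<in> \<R>" "R' \<in> \<R>" "R \<noteq> R'" for R R'
    using pairwiseD[OF pw that] by (simp add: disjnt_def)
  have "\<forall>R\<in>\<R>. \<exists>q. snd q \<noteq> 0 \<and> R = {fst q + of_real t * snd q |t. 0 \<le> (t::real)}"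
    using \<R>(1) unfolding half_line_def by force
  from bchoice[OF this] obtain q where
    q: "\<forall>R\<in>\<R>. snd (q R) \<noteq> 0 \<and> R = {fst (q R) + of_real t * snd (q R) |t. 0 \<le> (t::real)}" ..
  define p where "p R = fst (q R)" for R
  define u where "u R = snd (q R)" for R
  have pu: "u R \<noteq> 0" "R = {p R + of_real t * u R |t. 0 \<le> (t::real)}" if "R \<in> \<R>" for R
    unfolding p_def u_def by (rule conjunct1[OF bspec[OF q that]], rule conjunct2[OF bspec[OF q that]])
  have ri: "rel_interior R = {p R + of_real t * u R |t. 0 < (t::real)}" if "R \<in> \<R>" for R
    by (rule trans[OF arg_cong[where f = rel_interior, OF pu(2)[OF that]] rel_interior_half_line[OF pu(1)[OF that]]])
  define chosen where "chosen b = (if \<exists>R\<in>\<R>. b \<in> rel_interior R then SOME R. R \<in> \<R> \<and> b \<in> rel_interior R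
     else SOME R. R \<in> \<R> \<and> b \<in> R)" for b
  have ch: "chosen b \<in> \<R>" "b \<in> chosen b" "\<And>R. R \<in> \<R> \<Longrightarrow> b \<in> rel_interior R \<Longrightarrow> chosen b = R" if "b \<in> - \<Omega>" for b
  proof -
    have "chosen b \<in> \<R> \<and> b \<in> chosen b \<and> (\<forall>R\<in>\<R>. b \<in> rel_interior R \<longrightarrow> chosen b = R)"
    proof (cases "\<exists>R\<in>\<R>. b \<in> rel_interior R")
      case True
      then have "\<exists>R. R \<in> \<R> \<and> b \<in> rel_interior R" by blast
      from someI_ex[OF this] have c: "chosen b \<in> \<R>" "b \<in> rel_interior (chosen b)"
        unfolding chosen_def if_P[OF True] by auto
      then have "chosen b = R" if "R \<in> \<R>" "b \<in> rel_interior R" for R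
        using dj[OF c(1) that(1)] that(2) by blast
      then show ?thesis using c rel_interior_subset by blast
    next
      case False
      have "\<exists>R. R \<in> \<R> \<and> b \<in> R" using that \<R>(2) by blast
      from someI_ex[OF this] have "chosen b \<in> \<R>" "b \<in> chosen b"
        unfolding chosen_def if_not_P[OF False] by auto
      then show ?thesis using False by blast
    qed
    then show "chosen b \<in> \<R>" "b \<in> chosen b" "\<And>R. R \<in> \<R> \<Longrightarrow> b \<in> rel_interior R \<Longrightarrow> chosen b = R" by auto
  qed
  define d where "d b = sgn (u (chosen b))" for b
  have fr: "b \<in> - \<Omega>" if "b \<in> frontier \<Omega>" for b using that op by (simp add: frontier_def interior_open)
  have move: "b + of_real t * d b \<in> chosen b" "t > 0 \<Longrightarrow> b + of_real t * d b \<in> rel_interior (chosen b)"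
    if b: "b \<in> frontier \<Omega>" and t: "t \<ge> 0" for b t
  proof -
    define R where "R = chosen b"
    have R: "R \<in> \<R>" "b \<in> R" using ch(1,2)[OF fr[OF b]] by (auto simp: R_def)
    obtain r where r: "r \<ge> 0" "b = p R + of_real r * u R" using subsetD[OF equalityD1[OF pu(2)[OF R(1)]] R(2)] by blast
    have eq: "b + of_real t * d b = p R + of_real (r + t / norm (u R)) * u R"
    proof -
      have db: "d b = sgn (u R)" by (simp add: d_def R_def)
      show ?thesis unfolding db by (subst r(2)) (simp add: sgn_eq algebra_simps)
    qed
    have "r + t / norm (u R) \<ge> 0" using r t by simp
    then have "b + of_real t * d b \<in> {p R + of_real t * u R |t. 0 \<le> (t::real)}" using eq by blast
    then show "b + of_real t * d b \<in> chosen b" unfolding R_def[symmetric] by (rule subsetD[OF equalityD2[OF pu(2)[OF R(1)]]])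
    show "b + of_real t * d b \<in> rel_interior (chosen b)" if "t > 0"
    proof -
      have "r + t / norm (u R) > 0" using r that pu(1)[OF R(1)] by (simp add: add_nonneg_pos)
      then show ?thesis using eq unfolding R_def[symmetric] ri[OF R(1)] by blast
    qed
  qed
  have "ray_structure \<Omega> d"
    unfolding ray_structure_def
  proof (intro conjI ballI allI impI)
    fix b assume b: "b \<in> frontier \<Omega>"
    show "norm (d b) = 1" using pu(1)[OF ch(1)[OF fr[OF b]]] by (simp add: d_def norm_sgn)
    show "b + of_real t * d b \<notin> \<Omega>" if "t \<ge> 0" for t
      using move(1)[OF b that] ch(1)[OF fr[OF b]] \<R>(2) by blast
  next
    fix b b' t t' assume b: "b \<in> frontier \<Omega>" "b' \<in> frontier \<Omega>" and t: "t \<ge> (0::real)" "t' \<ge> (0::real)"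
      and ne: "b \<noteq> b'" and eq: "b + of_real t * d b = b' + of_real t' * d b'"
    have "chosen b = chosen b'"
    proof -
      have half: "chosen b1 = chosen b2" if b12: "b1 \<in> frontier \<Omega>" "b2 \<in> frontier \<Omega>" "t2 > 0" "b1 = b2 + of_real t2 * d b2" for b1 b2 t2
        using move(2)[of b2 t2] b12 ch(3)[OF fr[OF b12(1)], of "chosen b2"] ch(1)[OF fr[OF b12(2)]] by simp
      consider "t = 0" "t' > 0" | "t' = 0" "t > 0" | "t > 0" "t' > 0" using t ne eq by fastforce
      then show ?thesis
      proof cases
        case 1 then show ?thesis using half[OF b] eq by simp
      next
        case 2 then show ?thesis using half[OF b(2,1), of t] eq by simp
      next
        case 3
        then have "rel_interior (chosen b) \<inter> rel_interior (chosen b') \<noteq> {}"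
          using move(2)[OF b(1) t(1)] move(2)[OF b(2) t(2)] eq by auto
        then show ?thesis using dj ch(1)[OF fr[OF b(1)]] ch(1)[OF fr[OF b(2)]] by blast
      qed
    qed
    then show "d b = d b'" by (simp add: d_def)
  qed
  then show ?thesis by (rule that)
qed

section \<open>Images, cuts and shrinkings of ray structures\<close>

lemma frontier_homeomorphism_image:
  assumes "homeomorphism UNIV UNIV T T'"
  shows "frontier (T ` S) = T ` frontier (S :: 'a::topological_space set)"
proof -
  have "homeomorphic_map euclidean euclidean T"
    using assms unfolding homeomorphic_map_maps homeomorphic_maps_def homeomorphism_def by auto
  from homeomorphic_map_frontier_of[OF this, of S] show ?thesis by simp
qed

lemma ray_structure_image:
  assumes RS: "ray_structure \<Omega> d" and hom: "homeomorphism UNIV UNIV T T'"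
    and lin: "\<And>x r v. T (x + of_real r * v) = T x + of_real r * L v" and L: "\<And>v. L v = 0 \<Longrightarrow> v = 0"
  obtains d' where "ray_structure (T ` \<Omega>) d'"
proof -
  have inv: "T' (T x) = x" "T (T' x) = x" for x using hom by (auto simp: homeomorphism_def)
  have injT: "T x = T y \<longleftrightarrow> x = y" for x y using inv by metis
  have fr: "frontier (T ` \<Omega>) = T ` frontier \<Omega>" by (rule frontier_homeomorphism_image[OF hom])
  define d' where "d' b = sgn (L (d (T' b)))" for b
  have RS1: "norm (d b) = 1" "t \<ge> 0 \<Longrightarrow> b + of_real t * d b \<notin> \<Omega>" if "b \<in> frontier \<Omega>" for b t
    using RS that unfolding ray_structure_def by auto
  have nz: "L (d b) \<noteq> 0" if "b \<in> frontier \<Omega>" for b using L[of "d b"] RS1(1)[OF that] by auto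
  have step: "T b + of_real t * d' (T b) = T (b + of_real (t / norm (L (d b))) * d b)" for b t
    using lin[of b "t / norm (L (d b))" "d b"] by (simp add: d'_def inv sgn_eq)
  have "ray_structure (T ` \<Omega>) d'"
    unfolding ray_structure_def fr
  proof (safe)
    fix b assume b: "b \<in> frontier \<Omega>"
    show "norm (d' (T b)) = 1" using nz[OF b] by (simp add: d'_def inv norm_sgn)
    fix t x assume t: "0 \<le> (t::real)" and x: "T b + of_real t * d' (T b) = T x" "x \<in> \<Omega>"
    then show False using RS1(2)[OF b, of "t / norm (L (d b))"] by (simp add: step injT)
  next
    fix b b' t t' assume b: "b \<in> frontier \<Omega>" "b' \<in> frontier \<Omega>" and t: "t \<ge> (0::real)" "t' \<ge> (0::real)"
      and ne: "T b \<noteq> T b'" and eq: "T b + of_real t * d' (T b) = T b' + of_real t' * d' (T b')"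
    have "d b = d b'"
      using RS[unfolded ray_structure_def, THEN conjunct2, rule_format, OF b, of "t / norm (L (d b))" "t' / norm (L (d b'))"]
        t ne eq by (simp add: step injT)
    then show "d' (T b) = d' (T b')" by (simp add: d'_def inv)
  qed
  then show ?thesis by (rule that)
qed

text \<open>Rays into the closed upper half-plane whose angles do not increase from left to right
  diverge: if they crossed at different angles, two sums of nonnegative terms would vanish, which
  forces the angles pi and 0, pointing away from each other.\<close>

lemma upward_rays_cross:
  assumes xy: "x < y" and AB: "0 \<le> B" "B \<le> A" "A \<le> pi" and s: "s \<ge> 0" "s' \<ge> 0"
    and eq: "of_real x + of_real s * cis A = of_real y + of_real s' * cis B"
  shows "A = B"
proof (rule ccontr)
  assume "A \<noteq> B"
  then have lt: "B < A" using AB by simp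
  have re: "x + s * cos A = y + s' * cos B" and im: "s * sin A = s' * sin B"
    using eq by (auto simp: complex_eq_iff)
  have sAB: "sin (A - B) \<ge> 0" "sin A \<ge> 0" "sin B \<ge> 0" using lt AB by (auto intro!: sin_ge_zero)
  have yx: "y - x = s * cos A - s' * cos B" using re by linarith
  have e1: "(y - x) * sin A + s' * sin (A - B) = 0"
  proof -
    have "(y - x) * sin A + s' * sin (A - B) = (s * cos A - s' * cos B) * sin A + s' * (sin A * cos B - cos A * sin B)"
      using re by (simp only: yx sin_diff)
    also have "\<dots> = cos A * (s * sin A - s' * sin B)" by (simp add: algebra_simps)
    finally show ?thesis using im by simp
  qed
  have e2: "(y - x) * sin B + s * sin (A - B) = 0"
  proof -
    have "(y - x) * sin B + s * sin (A - B) = (s * cos A - s' * cos B) * sin B + s * (sin A * cos B - cos A * sin B)"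
      using re by (simp only: yx sin_diff)
    also have "\<dots> = cos B * (s * sin A - s' * sin B)" by (simp add: algebra_simps)
    finally show ?thesis using im by simp
  qed
  have n: "(y - x) * sin A \<ge> 0" "(y - x) * sin B \<ge> 0" "s * sin (A - B) \<ge> 0" "s' * sin (A - B) \<ge> 0"
    using xy sAB s by auto
  have "(y - x) * sin A = 0" "(y - x) * sin B = 0" using e1 e2 n by linarith+
  then have "sin A = 0" "sin B = 0" using xy by auto
  then have "A = pi" "B = 0" using sin_gt_zero[of A] sin_gt_zero[of B] lt AB by fastforce+
  then show False using re xy s by simp
qed

text \<open>The parameters are the sides of the triangle given by the law of sines.\<close>

lemma upward_rays_meet:
  fixes x y A B :: real
  assumes "x < y" "0 < A" "A < B" "B < pi"
  obtains s s' where "s > 0" "s' > 0" "of_real x + of_real s * cis A = of_real y + of_real s' * cis B"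
proof -
  define s where "s = (y - x) * sin B / sin (B - A)"
  define s' where "s' = (y - x) * sin A / sin (B - A)"
  have sp: "sin (B - A) > 0" "sin A > 0" "sin B > 0" using assms by (auto intro!: sin_gt_zero)
  have "s * sin A = s' * sin B" by (simp add: s_def s'_def)
  moreover have "s * cos A - s' * cos B = (y - x) * (sin B * cos A - cos B * sin A) / sin (B - A)"
    by (simp add: s_def s'_def algebra_simps diff_divide_distrib add_divide_distrib)
  then have "s * cos A - s' * cos B = y - x" using sp by (simp add: sin_diff[symmetric])
  then have "x + s * cos A = y + s' * cos B" using sp by linarith
  ultimately have "of_real x + of_real s * cis A = of_real y + of_real s' * cis B"
    by (simp add: complex_eq_iff)
  moreover have "s > 0" "s' > 0" using assms sp by (auto simp: s_def s'_def intro!: divide_pos_pos)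
  ultimately show ?thesis by (rule that[rotated 2])
qed

lemma frontier_Int_halfplane:
  assumes "b \<in> frontier (\<Omega> \<inter> {w. Im w < 0})"
  shows "Im b \<le> 0" "Im b < 0 \<Longrightarrow> b \<in> frontier \<Omega>"
proof -
  have bc: "b \<in> closure (\<Omega> \<inter> {w. Im w < 0})" using assms by (simp add: frontier_def)
  have "closure (\<Omega> \<inter> {w. Im w < 0}) \<subseteq> {w. Im w \<le> 0}"
    by (rule closure_minimal) (auto simp: closed_halfspace_Im_le)
  then show "Im b \<le> 0" using bc by blast
  show "b \<in> frontier \<Omega>" if "Im b < 0"
  proof (rule ccontr)
    assume n: "b \<notin> frontier \<Omega>"
    have cl: "b \<in> closure \<Omega>" using bc closure_mono[of "\<Omega> \<inter> {w. Im w < 0}" \<Omega>] by blast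
    then have "b \<in> interior \<Omega>" using n by (simp add: frontier_def)
    moreover have "b \<in> interior {w. Im w < 0}" using that by (simp add: interior_open open_halfspace_Im_lt)
    ultimately show False using assms by (simp add: frontier_def interior_Int)
  qed
qed

text \<open>A new frontier point \<open>x\<close> on the cutting line gets the direction of the ray leaving the half-plane at \<open>x\<close>, if
  there is one. These angles decrease along the line, and \<open>\<alpha>\<close> extends them to a decreasing function.\<close>

lemma ray_structure_cut:
  assumes RS: "ray_structure \<Omega> d"
  obtains d' where "ray_structure (\<Omega> \<inter> {w. Im w < 0}) d'"
proof -
  define S where "S = \<Omega> \<inter> {w. Im w < 0}"
  have nd: "norm (d b) = 1" and av: "t \<ge> 0 \<Longrightarrow> b + of_real t * d b \<notin> \<Omega>" if "b \<in> frontier \<Omega>" for b t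
    using RS that unfolding ray_structure_def by auto
  have nc: "d b = d b'" if "b \<in> frontier \<Omega>" "b' \<in> frontier \<Omega>" "t \<ge> 0" "t' \<ge> 0"
      "b + of_real t * d b = b' + of_real t' * d b'" for b b' t t'
    using RS[unfolded ray_structure_def, THEN conjunct2, rule_format, of b b' t t'] that by (cases "b = b'") simp_all
  define hits where "hits x b \<longleftrightarrow> b \<in> frontier \<Omega> \<and> Im b < 0 \<and> (\<exists>t\<ge>0. b + of_real t * d b = of_real x)" for x b
  define X where "X = {x. \<exists>b. hits x b}"
  \<comment> \<open>All rays that reach \<open>x\<close> have the same direction by
    \<open>nc\<close>, so the choice of the frontier point does not matter.\<close>
  define \<beta> where "\<beta> x = Arg (d (SOME b. hits x b))" for x
  \<comment> \<open>The infimum over all crossings at or to the left of \<open>x\<close> makes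
    \<open>\<alpha>\<close> decreasing; the value is pi where there are none.\<close>
  define \<alpha> where "\<alpha> x = Inf (insert pi {\<beta> y |y. y \<in> X \<and> y \<le> x})" for x
  have \<beta>: "cis (\<beta> x) = d b" "0 < \<beta> x" "\<beta> x < pi" if h: "hits x b" for x b
  proof -
    define c where "c = (SOME b. hits x b)"
    have c: "hits x c" unfolding c_def by (rule someI[of "hits x", OF h])
    have bc: "d c = d b"
    proof -
      obtain t t' where "t \<ge> 0" "c + of_real t * d c = of_real x" "t' \<ge> 0" "b + of_real t' * d b = of_real x"
        "c \<in> frontier \<Omega>" "b \<in> frontier \<Omega>" using c h unfolding hits_def by blast
      then show ?thesis by (intro nc[of c b t t']) auto
    qed
    obtain t where t: "t \<ge> 0" "b + of_real t * d b = of_real x" and ib: "Im b < 0" and fb: "b \<in> frontier \<Omega>"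
      using h unfolding hits_def by blast
    have "Im b + t * Im (d b) = 0" using arg_cong[OF t(2), of Im] by simp
    then have "t * Im (d b) > 0" using ib by linarith
    then have pos: "Im (d b) > 0" using t(1) by (simp add: zero_less_mult_iff)
    show "cis (\<beta> x) = d b" unfolding \<beta>_def c_def[symmetric] bc
      using nd[OF fb] by (subst cis_Arg_sgn) (auto simp: sgn_eq)
    show "0 < \<beta> x" "\<beta> x < pi" unfolding \<beta>_def c_def[symmetric] bc using pos Arg_lt_pi[of "d b"] by auto
  qed
  have mono\<beta>: "\<beta> y \<le> \<beta> x" if "x \<in> X" "y \<in> X" "x < y" for x y
  proof (rule ccontr)
    assume n: "\<not> \<beta> y \<le> \<beta> x"
    obtain b b' where h: "hits x b" "hits y b'" using \<open>x \<in> X\<close> \<open>y \<in> X\<close> unfolding X_def by blast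
    obtain s s' where s: "s > 0" "s' > 0" "of_real x + of_real s * cis (\<beta> x) = of_real y + of_real s' * cis (\<beta> y)"
      by (rule upward_rays_meet[of x y "\<beta> x" "\<beta> y"]) (use \<beta>[OF h(1)] \<beta>[OF h(2)] n \<open>x < y\<close> in auto)
    obtain t t' where t: "t \<ge> 0" "b + of_real t * d b = of_real x" "t' \<ge> 0" "b' + of_real t' * d b' = of_real y"
      and fb: "b \<in> frontier \<Omega>" "b' \<in> frontier \<Omega>"
      using h unfolding hits_def by blast
    have "b + of_real (t + s) * d b = b' + of_real (t' + s') * d b'"
      using s(3) t(2,4) \<beta>(1)[OF h(1)] \<beta>(1)[OF h(2)] by (simp add: distrib_right add.assoc[symmetric])
    then have "d b = d b'" using nc[OF fb, of "t + s" "t' + s'"] t s by simp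
    then have "cis (\<beta> x) = cis (\<beta> y)" using \<beta>(1)[OF h(1)] \<beta>(1)[OF h(2)] by simp
    then have "Re (cis (\<beta> x)) = Re (cis (\<beta> y))" by (rule arg_cong)
    then have "cos (\<beta> x) = cos (\<beta> y)" by simp
    then have "\<beta> x = \<beta> y" using \<beta>(2,3)[OF h(1)] \<beta>(2,3)[OF h(2)] by (intro cos_inj_pi[of "\<beta> x" "\<beta> y"]) linarith+
    then show False using n by simp
  qed
  have bdd: "bdd_below (insert pi {\<beta> y |y. y \<in> X \<and> y \<le> x})" for x
    using \<beta>(2) by (intro bdd_belowI[of _ 0]) (auto simp: X_def less_imp_le)
  have \<alpha>X: "\<alpha> x = \<beta> x" if "x \<in> X" for x
    unfolding \<alpha>_def
  proof (rule cInf_eq_minimum)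
    show "\<beta> x \<in> insert pi {\<beta> y |y. y \<in> X \<and> y \<le> x}" using that by blast
    show "\<beta> x \<le> v" if vin: "v \<in> insert pi {\<beta> y |y. y \<in> X \<and> y \<le> x}" for v
    proof -
      obtain b where b: "hits x b" using \<open>x \<in> X\<close> by (auto simp: X_def)
      consider "v = pi" | y where "v = \<beta> y" "y \<in> X" "y \<le> x" using vin by blast
      then show ?thesis
      proof cases
        case 1 then show ?thesis using \<beta>(3)[OF b] by simp
      next
        case 2 then show ?thesis using mono\<beta>[of y x] \<open>x \<in> X\<close> by (cases "y = x") auto
      qed
    qed
  qed
  have mono\<alpha>: "\<alpha> y \<le> \<alpha> x" if "x \<le> y" for x y
    unfolding \<alpha>_def using that by (intro cInf_superset_mono bdd) auto
  have \<alpha>01: "0 \<le> \<alpha> x" "\<alpha> x \<le> pi" for x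
  proof -
    show "0 \<le> \<alpha> x" unfolding \<alpha>_def
      by (rule cInf_greatest) (use \<beta>(2) in \<open>auto simp: X_def less_imp_le\<close>)
    show "\<alpha> x \<le> pi" unfolding \<alpha>_def by (rule cInf_lower[OF insertI1 bdd])
  qed
  define d' where "d' b = (if Im b < 0 then d b else cis (\<alpha> (Re b)))" for b
  \<comment> \<open>On and above the cutting line every point of a ray, inherited or new, lies on
    the ray from a point \<open>x\<close> of the line at angle \<open>\<alpha> x\<close>, so only
    such rays have to be compared there.\<close>
  have line: "\<exists>x s. s \<ge> 0 \<and> b + of_real t * d' b = of_real x + of_real s * cis (\<alpha> x) \<and> d' b = cis (\<alpha> x)"
    if b: "b \<in> frontier S" and t: "t \<ge> 0" and up: "Im (b + of_real t * d' b) \<ge> 0" for b t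
  proof (cases "Im b < 0")
    case False
    then have "Im b = 0" using frontier_Int_halfplane(1)[of b \<Omega>] b by (simp add: S_def)
    then have "b = of_real (Re b)" by (simp add: complex_eq_iff)
    then show ?thesis using False t by (intro exI[of _ "Re b"] exI[of _ t]) (simp add: d'_def)
  next
    case True
    then have fb: "b \<in> frontier \<Omega>" using frontier_Int_halfplane(2)[of b \<Omega>] b by (simp add: S_def)
    have db: "d' b = d b" using True by (simp add: d'_def)
    have up': "Im b + t * Im (d b) \<ge> 0" using up db by simp
    then have "t * Im (d b) > 0" using True by linarith
    then have pos: "Im (d b) > 0" using t by (simp add: zero_less_mult_iff)
    define \<tau> where "\<tau> = - Im b / Im (d b)"
    have \<tau>: "0 \<le> \<tau>" "\<tau> \<le> t" using True pos up' by (auto simp: \<tau>_def field_simps divide_nonpos_pos)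
    define x where "x = Re (b + of_real \<tau> * d b)"
    have x: "b + of_real \<tau> * d b = of_real x" using pos by (simp add: x_def complex_eq_iff \<tau>_def)
    have h: "hits x b" using fb True \<tau>(1) x by (auto simp: hits_def)
    then have "x \<in> X" unfolding X_def by blast
    then have a: "cis (\<alpha> x) = d b" using \<alpha>X[of x] \<beta>(1)[OF h] by simp
    have "b + of_real t * d b = of_real x + of_real (t - \<tau>) * d b"
      unfolding x[symmetric] by (simp add: algebra_simps)
    then show ?thesis using \<tau> a db by (intro exI[of _ x] exI[of _ "t - \<tau>"]) simp
  qed
  have below: "Im b < 0 \<and> b \<in> frontier \<Omega> \<and> d' b = d b"
    if b: "b \<in> frontier S" and t: "t \<ge> 0" and dn: "Im (b + of_real t * d' b) < 0" for b t
  proof -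
    have "Im b < 0"
    proof (rule ccontr)
      assume n: "\<not> Im b < 0"
      then have "Im (b + of_real t * d' b) = Im b + t * sin (\<alpha> (Re b))" by (simp add: d'_def)
      also have "\<dots> \<ge> 0" using n t \<alpha>01[of "Re b"] by (intro add_nonneg_nonneg mult_nonneg_nonneg sin_ge_zero) auto
      finally show False using dn by simp
    qed
    then show ?thesis using frontier_Int_halfplane(2)[of b \<Omega>] b by (simp add: S_def d'_def)
  qed
  have "ray_structure S d'"
    unfolding ray_structure_def
  proof (intro conjI ballI allI impI)
    fix b assume b: "b \<in> frontier S"
    show "norm (d' b) = 1" using b nd frontier_Int_halfplane(2)[of b \<Omega>] by (auto simp: d'_def S_def)
    show "b + of_real t * d' b \<notin> S" if t: "0 \<le> t" for t
    proof (cases "Im (b + of_real t * d' b) < 0")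
      case True
      then show ?thesis using below[OF b t True] av[of b t] t by (auto simp: S_def)
    qed (simp add: S_def)
  next
    fix b b' t t' assume b: "b \<in> frontier S" "b' \<in> frontier S" and t: "t \<ge> (0::real)" "t' \<ge> (0::real)"
      and eq: "b + of_real t * d' b = b' + of_real t' * d' b'"
    show "d' b = d' b'"
    proof (cases "Im (b + of_real t * d' b) < 0")
      case True
      then show ?thesis using below[OF b(1) t(1)] below[OF b(2) t(2)] eq nc[of b b' t t'] t by simp
    next
      case False
      obtain x s where x: "s \<ge> 0" "b + of_real t * d' b = of_real x + of_real s * cis (\<alpha> x)" "d' b = cis (\<alpha> x)"
        using line[OF b(1) t(1)] False by (auto simp: not_less)
      obtain y s' where y: "s' \<ge> 0" "b' + of_real t' * d' b' = of_real y + of_real s' * cis (\<alpha> y)" "d' b' = cis (\<alpha> y)"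
        using line[OF b(2) t(2)] False eq by (auto simp: not_less)
      have xy: "of_real x + of_real s * cis (\<alpha> x) = of_real y + of_real s' * cis (\<alpha> y)" using x y eq by simp
      have "\<alpha> x = \<alpha> y"
      proof (cases x y rule: linorder_cases)
        case less
        then show ?thesis using upward_rays_cross[of x y "\<alpha> y" "\<alpha> x" s s'] mono\<alpha>[of x y] \<alpha>01 x y xy by auto
      next
        case greater
        then show ?thesis using upward_rays_cross[of y x "\<alpha> x" "\<alpha> y" s' s] mono\<alpha>[of y x] \<alpha>01 x y xy by auto
      qed simp
      then show ?thesis using x y by simp
    qed
  qed
  then show ?thesis unfolding S_def by (rule that)
qed

lemma ray_structure_cut_halfplane:
  assumes RS: "ray_structure \<Omega> d" and a: "a \<noteq> 0"
  obtains d' where "ray_structure (\<Omega> \<inter> {w. Im (a * w) < c}) d'"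
proof -
  define T where "T w = a * w - of_real c * \<i>" for w
  define T' where "T' w = (w + of_real c * \<i>) / a" for w
  have TT: "T' (T w) = w" "T (T' w) = w" for w using a by (auto simp: T_def T'_def)
  have hom: "homeomorphism UNIV UNIV T T'"
    unfolding homeomorphism_def
  proof (intro conjI ballI)
    show "range T = UNIV" "range T' = UNIV" by (rule surjI[of T T'], rule TT) (rule surjI[of T' T], rule TT)
    show "continuous_on UNIV T" "continuous_on UNIV T'" unfolding T_def T'_def using a by (auto intro!: continuous_intros)
  qed (rule TT)+
  obtain d1 where d1: "ray_structure (T ` \<Omega>) d1"
    by (rule ray_structure_image[OF RS hom, of "\<lambda>v. a * v"]) (use a in \<open>auto simp: T_def algebra_simps\<close>)
  obtain d2 where d2: "ray_structure (T ` \<Omega> \<inter> {w. Im w < 0}) d2" by (rule ray_structure_cut[OF d1])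
  obtain d3 where d3: "ray_structure (T' ` (T ` \<Omega> \<inter> {w. Im w < 0})) d3"
    by (rule ray_structure_image[OF d2 homeomorphism_symD[OF hom], of "\<lambda>v. v / a"])
       (use a in \<open>auto simp: T'_def algebra_simps add_divide_distrib\<close>)
  have "T' ` (T ` \<Omega> \<inter> {w. Im w < 0}) = \<Omega> \<inter> {w. Im (a * w) < c}"
  proof safe
    fix x assume "x \<in> \<Omega>" "Im (a * x) < c"
    then have "T x \<in> T ` \<Omega> \<inter> {w. Im w < 0}" by (auto simp: T_def)
    then show "x \<in> T' ` (T ` \<Omega> \<inter> {w. Im w < 0})" using TT(1) by (metis imageI)
  qed (auto simp: TT, simp add: T_def)
  then show ?thesis using d3 that by simp
qed

lemma ray_structure_cut_square:
  assumes RS: "ray_structure \<Omega> d"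
  obtains d' where "ray_structure (\<Omega> \<inter> {w. \<bar>Re w\<bar> < c \<and> \<bar>Im w\<bar> < c}) d'"
proof -
  obtain d1 where d1: "ray_structure (\<Omega> \<inter> {w. Im (1 * w) < c}) d1"
    by (rule ray_structure_cut_halfplane[OF RS, of 1]) auto
  obtain d2 where d2: "ray_structure (\<Omega> \<inter> {w. Im (1 * w) < c} \<inter> {w. Im (- 1 * w) < c}) d2"
    by (rule ray_structure_cut_halfplane[OF d1, of "- 1"]) auto
  obtain d3 where d3: "ray_structure (\<Omega> \<inter> {w. Im (1 * w) < c} \<inter> {w. Im (- 1 * w) < c} \<inter> {w. Im (\<i> * w) < c}) d3"
    by (rule ray_structure_cut_halfplane[OF d2, of \<i>]) auto
  obtain d4 where d4: "ray_structure (\<Omega> \<inter> {w. Im (1 * w) < c} \<inter> {w. Im (- 1 * w) < c} \<inter> {w. Im (\<i> * w) < c} \<inter> {w. Im (- \<i> * w) < c}) d4"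
    by (rule ray_structure_cut_halfplane[OF d3, of "- \<i>"]) auto
  have "\<Omega> \<inter> {w. Im (1 * w) < c} \<inter> {w. Im (- 1 * w) < c} \<inter> {w. Im (\<i> * w) < c} \<inter> {w. Im (- \<i> * w) < c} =
      \<Omega> \<inter> {w. \<bar>Re w\<bar> < c \<and> \<bar>Im w\<bar> < c}" by (auto simp: abs_less_iff)
  then show ?thesis using d4 that by simp
qed


text \<open>A bounded component of the complement contains a frontier point of \<open>C\<close>, and
  the ray from it is connected and avoids \<open>C\<close>, so it would lie in that bounded
  component.\<close>

lemma simply_connected_if_frontier_rays:
  fixes C :: "complex set"
  assumes C: "open C" "connected C"
    and ray: "\<And>b. b \<in> frontier C \<Longrightarrow> \<exists>u. u \<noteq> 0 \<and> (\<forall>t\<ge>0. b + of_real t * u \<notin> C)"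
  shows "simply_connected C"
  unfolding simply_connected_eq_unbounded_complement_components[OF C(1)]
proof (intro conjI ballI C(2) notI)
  fix K assume K: "K \<in> components (- C)" "bounded K"
  then have "K \<noteq> {}" "K \<noteq> UNIV" using in_components_nonempty not_bounded_UNIV by auto
  then have "frontier K \<noteq> {}" by (simp add: frontier_eq_empty)
  then obtain b where b: "b \<in> frontier K" by blast
  have "closed K" using closed_components[OF _ K(1)] C(1) by (simp add: closed_Compl)
  then have bK: "b \<in> K" using b frontier_subset_closed by blast
  have "b \<in> frontier C" using frontier_of_components_subset[OF K(1)] b by (auto simp: frontier_complement)
  then obtain u where u: "u \<noteq> 0" "\<And>t. t \<ge> 0 \<Longrightarrow> b + of_real t * u \<notin> C" using ray by blast
  define R where "R = (\<lambda>t. b + of_real t * u) ` {0::real..}"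
  have "connected R" unfolding R_def by (intro connected_continuous_image continuous_intros) auto
  moreover have "R \<subseteq> - C" using u by (auto simp: R_def)
  moreover have "b \<in> R" unfolding R_def by (rule image_eqI[of _ _ 0]) auto
  ultimately have "R \<subseteq> K" using components_maximal[OF K(1)] bK by blast
  then have "bounded R" using K(2) bounded_subset by blast
  then obtain M where M: "\<And>x. x \<in> R \<Longrightarrow> norm x \<le> M" unfolding bounded_iff by blast
  define t where "t = (\<bar>M\<bar> + norm b + 1) / norm u"
  have "b + of_real t * u \<in> R" unfolding R_def by (rule image_eqI[of _ _ t]) (auto simp: t_def)
  then have "norm (b + of_real t * u) \<le> M" by (rule M)
  moreover have "norm (of_real t * u) = \<bar>M\<bar> + norm b + 1" 
  proof -
    have "t \<ge> 0" by (simp add: t_def)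
    then show ?thesis using u(1) by (simp add: norm_mult t_def del: of_real_divide of_real_add)
  qed
  moreover have "norm (of_real t * u) \<le> norm (b + of_real t * u) + norm b"
    using norm_triangle_ineq4[of "b + of_real t * u" b] by simp
  ultimately show False by linarith
qed

text \<open>At a common point \<open>w\<close> the minimality of both distances turns the triangle
  inequalities into equalities: \<open>w\<close> is equally far from \<open>p\<close> and
  \<open>p'\<close>, and both lie straight behind \<open>w\<close> as seen from \<open>b\<close> and
  from \<open>b'\<close>. Unless \<open>b = w = b'\<close> this gives \<open>p = p'\<close>.\<close>

lemma nearest_segments_disjoint:
  fixes b b' p p' :: complex
  assumes d: "dist b p = \<epsilon>" "dist b' p' = \<epsilon>" "\<epsilon> \<le> dist b p'" "\<epsilon> \<le> dist b' p" and e: "\<epsilon> > 0" and ne: "p \<noteq> p'" "b \<noteq> b'"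
  shows "closed_segment b p \<inter> closed_segment b' p' = {}"
proof (rule ccontr)
  assume "\<not> ?thesis"
  then obtain w where w: "w \<in> closed_segment b p" "w \<in> closed_segment b' p'" by blast
  have s: "dist b p = dist b w + dist w p" "dist b' p' = dist b' w + dist w p'"
    using w by (auto simp: between_mem_segment[symmetric] between)
  have t: "dist b p' \<le> dist b w + dist w p'" "dist b' p \<le> dist b' w + dist w p" by (rule dist_triangle)+
  have eq: "dist w p = dist w p'" using s t d by linarith
  have bw: "dist b p' = dist b w + dist w p'" using s t d eq by linarith
  have b'w: "dist b' p = dist b' w + dist w p" using s t d eq by linarith
  have "p = p'" if "c \<noteq> w" "dist c p = dist c w + dist w p" "dist c p' = dist c w + dist w p'" for c
  proof -
    have "norm (w - c) *\<^sub>R (p - w) = norm (p - w) *\<^sub>R (w - c)"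
      using that(2) norm_triangle_eq[of "w - c" "p - w"] by (simp add: dist_norm norm_minus_commute)
    moreover have "norm (w - c) *\<^sub>R (p' - w) = norm (p' - w) *\<^sub>R (w - c)"
      using that(3) norm_triangle_eq[of "w - c" "p' - w"] by (simp add: dist_norm norm_minus_commute)
    moreover have "norm (p - w) = norm (p' - w)" using eq by (simp add: dist_norm norm_minus_commute)
    ultimately have "norm (w - c) *\<^sub>R (p - w) = norm (w - c) *\<^sub>R (p' - w)" by metis
    then show ?thesis using that(1) by (simp add: scaleR_left_imp_eq)
  qed
  note key = this
  have "b = w" using key[of b] ne(1) s(1) bw by blast
  moreover have "b' = w" using key[of b'] ne(1) s(2) b'w by blast
  ultimately show False using ne(2) by simp
qed


text \<open>The foot of a frontier point of \<open>C\<close> is a nearest point of the complement of \<open>\<Omega>\<close>.\<close>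

lemma shrink_ray_structure:
  fixes \<Omega> :: "complex set"
  assumes op: "open \<Omega>" and bd: "bounded \<Omega>" and RS: "ray_structure \<Omega> d" and e: "\<epsilon> > 0"
    and C: "C \<in> components {w. \<epsilon> < infdist w (- \<Omega>)}"
  obtains foot dir where "open C" "closure C \<subseteq> \<Omega>" "simply_connected C"
    "\<And>b. b \<in> frontier C \<Longrightarrow> norm (dir b) = 1" "\<And>b. b \<in> frontier C \<Longrightarrow> foot b \<noteq> b"
    "\<And>b w t. b \<in> frontier C \<Longrightarrow> w \<in> closed_segment b (foot b) \<Longrightarrow> 0 \<le> t \<Longrightarrow> w + of_real t * dir b \<notin> C"
    "\<And>b b' w t. b \<in> frontier C \<Longrightarrow> b' \<in> frontier C \<Longrightarrow> w \<in> closed_segment b (foot b) \<Longrightarrow> w \<noteq> foot b \<Longrightarrow>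
       0 \<le> t \<Longrightarrow> w \<noteq> foot b' + of_real t * dir b'"
    "\<And>b b'. b \<in> frontier C \<Longrightarrow> b' \<in> frontier C \<Longrightarrow> foot b \<noteq> foot b' \<Longrightarrow>
       closed_segment b (foot b) \<inter> closed_segment b' (foot b') = {}"
    "\<And>b b'. b \<in> frontier C \<Longrightarrow> b' \<in> frontier C \<Longrightarrow> foot b = foot b' \<Longrightarrow> dir b = dir b'"
    "\<And>b b' t t'. b \<in> frontier C \<Longrightarrow> b' \<in> frontier C \<Longrightarrow> 0 \<le> t \<Longrightarrow> 0 \<le> t' \<Longrightarrow> foot b \<noteq> foot b' \<Longrightarrow>
       foot b + of_real t * dir b = foot b' + of_real t' * dir b' \<Longrightarrow> dir b = dir b'"
proof -
  define U where "U = {w. \<epsilon> < infdist w (- \<Omega>)}"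
  have clo: "closed (- \<Omega>)" using op by (rule closed_Compl)
  have ne: "- \<Omega> \<noteq> {}" using bd not_bounded_UNIV by (metis Compl_UNIV_eq double_complement)
  have le: "infdist w (- \<Omega>) \<le> dist w q" if "q \<notin> \<Omega>" for w q
    by (rule infdist_le) (use that in simp)
  have oU: "open U" unfolding U_def by (intro open_Collect_less continuous_intros)
  have oC: "open C" using open_components[OF oU] C by (simp add: U_def)
  have coC: "connected C" using in_components_connected[OF C] .
  have CU: "C \<subseteq> U" using in_components_subset[OF C] by (simp add: U_def)
  have clU: "closure C \<subseteq> {w. \<epsilon> \<le> infdist w (- \<Omega>)}"
    by (intro closure_minimal closed_Collect_le continuous_intros) (use CU in \<open>auto simp: U_def\<close>)
  have frC: "infdist b (- \<Omega>) = \<epsilon>" if b: "b \<in> frontier C" for b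
  proof (rule ccontr)
    assume n: "infdist b (- \<Omega>) \<noteq> \<epsilon>"
    have bC: "b \<in> closure C" "b \<notin> C" using b oC by (auto simp: frontier_def interior_open)
    then have "b \<in> U" using clU n by (auto simp: U_def)
    \<comment> \<open>Adding to the component a limit point that lies in \<open>U\<close> keeps it
      connected, so the point would already belong to it.\<close>
    have "connected (insert b C)" by (rule connected_intermediate_closure[OF coC]) (use bC closure_subset in auto)
    then have "insert b C \<subseteq> C"
      by (rule components_maximal[OF C]) (use CU \<open>b \<in> U\<close> in_components_nonempty[OF C] in \<open>auto simp: U_def\<close>)
    then show False using bC by blast
  qed
  define foot where "foot b = (SOME p. p \<in> - \<Omega> \<and> infdist b (- \<Omega>) = dist b p)" for b
  have foot: "foot b \<notin> \<Omega>" "dist b (foot b) = \<epsilon>" if b: "b \<in> frontier C" for b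
  proof -
    have "\<exists>p. p \<in> - \<Omega> \<and> infdist b (- \<Omega>) = dist b p" using infdist_attains_inf[OF clo ne] by metis
    from someI_ex[OF this] show "foot b \<notin> \<Omega>" "dist b (foot b) = \<epsilon>"
      unfolding foot_def[symmetric] using frC[OF b] by auto
  qed
  \<comment> \<open>A point of the complement on the segment before the foot would be nearer to
    \<open>b\<close> than the foot.\<close>
  have inner: "w \<in> \<Omega>" if b: "b \<in> frontier C" and w: "w \<in> closed_segment b (foot b)" "w \<noteq> foot b" for b w
  proof (rule ccontr)
    assume "w \<notin> \<Omega>"
    then have "\<epsilon> \<le> dist b w" using le[of w b] frC[OF b] by simp
    moreover have "dist b (foot b) = dist b w + dist w (foot b)"
      using w by (auto simp: between_mem_segment[symmetric] between)
    ultimately show False using foot(2)[OF b] w(2) by simp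
  qed
  have footfr: "foot b \<in> frontier \<Omega>" if b: "b \<in> frontier C" for b
  proof -
    have "foot b \<noteq> b" using foot(2)[OF b] e by auto
    then have "foot b \<in> closure (open_segment b (foot b))" by (simp add: closure_open_segment)
    moreover have "open_segment b (foot b) \<subseteq> \<Omega>" using inner[OF b] by (auto simp: open_segment_def)
    ultimately have "foot b \<in> closure \<Omega>" using closure_mono by blast
    then show ?thesis using foot(1)[OF b] op by (simp add: frontier_def interior_open)
  qed
  define dir where "dir b = d (foot b)" for b
  have RS1: "norm (d b) = 1" "t \<ge> 0 \<Longrightarrow> b + of_real t * d b \<notin> \<Omega>" if "b \<in> frontier \<Omega>" for b t
    using RS that unfolding ray_structure_def by auto
  \<comment> \<open>The translate of the foot along its ray is outside \<open>\<Omega>\<close> and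
    at distance at most \<open>\<epsilon>\<close> from the translate of \<open>w\<close>, which is
    therefore too close to the complement to be in \<open>C\<close>.\<close>
  have av: "w + of_real t * dir b \<notin> C" if b: "b \<in> frontier C" and w: "w \<in> closed_segment b (foot b)" and t: "0 \<le> t" for b w t
  proof -
    have "infdist (w + of_real t * dir b) (- \<Omega>) \<le> dist (w + of_real t * dir b) (foot b + of_real t * dir b)"
      by (rule le) (use RS1(2)[OF footfr[OF b] t] in \<open>simp add: dir_def\<close>)
    also have "\<dots> = dist w (foot b)" by (simp add: dist_norm)
    also have "\<dots> \<le> dist b (foot b)" using w by (auto simp: between_mem_segment[symmetric] between)
    also have "\<dots> = \<epsilon>" by (rule foot(2)[OF b])
    finally show ?thesis using CU by (auto simp: U_def)
  qed
  have sc: "simply_connected C"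
  proof (rule simply_connected_if_frontier_rays[OF oC coC])
    fix b assume b: "b \<in> frontier C"
    show "\<exists>u. u \<noteq> 0 \<and> (\<forall>t\<ge>0. b + of_real t * u \<notin> C)"
      using av[OF b, of b] RS1(1)[OF footfr[OF b]] by (intro exI[of _ "dir b"]) (auto simp: dir_def)
  qed
  have sub: "closure C \<subseteq> \<Omega>"
  proof
    fix w assume w: "w \<in> closure C"
    show "w \<in> \<Omega>"
    proof (rule ccontr)
      assume "w \<notin> \<Omega>"
      then show False using le[of w w] clU w e by auto
    qed
  qed
  show ?thesis
  proof (rule that[of dir foot])
    show "open C" "simply_connected C" "closure C \<subseteq> \<Omega>" by (fact oC sc sub)+
    show "norm (dir b) = 1" if "b \<in> frontier C" for b using RS1(1)[OF footfr[OF that]] by (simp add: dir_def)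
    show "foot b \<noteq> b" if "b \<in> frontier C" for b using foot(2)[OF that] e by auto
    show "w + of_real t * dir b \<notin> C" if "b \<in> frontier C" "w \<in> closed_segment b (foot b)" "0 \<le> t" for b w t
      by (rule av[OF that])
    show "w \<noteq> foot b' + of_real t * dir b'" if "b \<in> frontier C" "b' \<in> frontier C"
      "w \<in> closed_segment b (foot b)" "w \<noteq> foot b" "0 \<le> t" for b b' w t
      using inner[OF that(1,3,4)] RS1(2)[OF footfr[OF that(2)] that(5)] by (auto simp: dir_def)
    show "closed_segment b (foot b) \<inter> closed_segment b' (foot b') = {}"
      if b: "b \<in> frontier C" "b' \<in> frontier C" and ne: "foot b \<noteq> foot b'" for b b'
    proof (rule nearest_segments_disjoint[OF foot(2)[OF b(1)] foot(2)[OF b(2)] _ _ e ne])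
      show "\<epsilon> \<le> dist b (foot b')" using le[OF foot(1)[OF b(2)], of b] frC[OF b(1)] by simp
      show "\<epsilon> \<le> dist b' (foot b)" using le[OF foot(1)[OF b(1)], of b'] frC[OF b(2)] by simp
      show "b \<noteq> b'" using ne by auto
    qed
    show "dir b = dir b'" if "foot b = foot b'" for b b' using that by (simp add: dir_def)
    show "dir b = dir b'" if b: "b \<in> frontier C" "b' \<in> frontier C" and t: "0 \<le> t" "0 \<le> t'" and ne: "foot b \<noteq> foot b'"
      and eq: "foot b + of_real t * dir b = foot b' + of_real t' * dir b'" for b b' t t'
      using RS[unfolded ray_structure_def, THEN conjunct2, rule_format, OF footfr[OF b(1)] footfr[OF b(2)] t ne] eq
      by (simp add: dir_def)
  qed
qed

section \<open>Radial limits of bounded injective functions\<close>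

text \<open>Coordinates for the change of variables formula, which computes the measure of an image
  in \<open>real ^ 2\<close> by determinants.\<close>

definition complex_of_vec :: "real ^ 2 \<Rightarrow> complex" where "complex_of_vec v = Complex (v $ 1) (v $ 2)"
definition vec_of_complex :: "complex \<Rightarrow> real ^ 2" where "vec_of_complex z = vector [Re z, Im z]"

lemma complex_of_vec_of_complex [simp]: "complex_of_vec (vec_of_complex z) = z" and vec_of_complex_of_vec [simp]: "vec_of_complex (complex_of_vec v) = v"
  by (simp_all add: complex_of_vec_def vec_of_complex_def vec_eq_iff forall_2)

lemma linear_complex_of_vec: "linear complex_of_vec" and linear_vec_of_complex: "linear vec_of_complex"
  by (rule linearI; simp add: complex_of_vec_def vec_of_complex_def vec_eq_iff forall_2 complex_eq_iff)+

lemma bounded_linear_complex_of_vec: "bounded_linear complex_of_vec" and bounded_linear_vec_of_complex: "bounded_linear vec_of_complex"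
  by (simp_all add: linear_conv_bounded_linear[symmetric] linear_complex_of_vec linear_vec_of_complex)

lemma det_complex_mult: "det (matrix (\<lambda>u. vec_of_complex (c * complex_of_vec u))) = (norm c)\<^sup>2"
  unfolding cmod_power2 by (simp add: det_2 matrix_def vec_of_complex_def complex_of_vec_def axis_def algebra_simps power2_eq_square)

lemma exists_2: "(\<exists>i::2. P i) \<longleftrightarrow> P 1 \<or> P 2"
  using forall_2[of "\<lambda>i. \<not> P i"] by auto

text \<open>The Jacobian of an analytic map is |k'|^2, so by injectivity the integral is the area of
  the image, which lies in a square of side 2 |M|.\<close>

lemma area_integral_bound:
  fixes k :: "complex \<Rightarrow> complex"
  assumes k: "k holomorphic_on S" and S: "open S" and sub: "complex_of_vec ` cbox a b \<subseteq> S" and inj: "inj_on k (complex_of_vec ` cbox a b)"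
    and M: "\<And>z. z \<in> complex_of_vec ` cbox a b \<Longrightarrow> norm (k z) \<le> M"
  shows "(\<lambda>v. (norm (deriv k (complex_of_vec v)))\<^sup>2) integrable_on cbox a b"
    "integral (cbox a b) (\<lambda>v. (norm (deriv k (complex_of_vec v)))\<^sup>2) \<le> (2 * \<bar>M\<bar>)\<^sup>2"
proof -
  define f where "f v = vec_of_complex (k (complex_of_vec v))" for v
  have contcv: "continuous_on A complex_of_vec" for A
    by (rule linear_continuous_on[OF bounded_linear_complex_of_vec])
  have "continuous_on S (deriv k)" by (intro holomorphic_on_imp_continuous_on holomorphic_deriv k S)
  then have c1: "continuous_on (cbox a b) (\<lambda>v. deriv k (complex_of_vec v))"
    by (rule continuous_on_compose2[OF _ contcv sub])
  have "continuous_on (cbox a b) (\<lambda>v. (norm (deriv k (complex_of_vec v)))\<^sup>2)" by (intro continuous_intros c1)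
  then show int: "(\<lambda>v. (norm (deriv k (complex_of_vec v)))\<^sup>2) integrable_on cbox a b" by (rule integrable_continuous)
  have der: "(f has_derivative (\<lambda>u. vec_of_complex (deriv k (complex_of_vec v) * complex_of_vec u))) (at v within cbox a b)" if v: "v \<in> cbox a b" for v
  proof -
    have "(complex_of_vec has_derivative complex_of_vec) (at v within cbox a b)"
      by (rule bounded_linear_imp_has_derivative[OF bounded_linear_complex_of_vec])
    moreover have "(k has_derivative (\<lambda>x. deriv k (complex_of_vec v) * x)) (at (complex_of_vec v) within complex_of_vec ` cbox a b)"
      using holomorphic_derivI[OF k S, of "complex_of_vec v"] sub v
      by (auto simp: has_field_derivative_def intro: has_derivative_at_withinI)
    ultimately have "((\<lambda>v. k (complex_of_vec v)) has_derivative (\<lambda>u. deriv k (complex_of_vec v) * complex_of_vec u)) (at v within cbox a b)"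
      by (rule has_derivative_in_compose)
    then show ?thesis unfolding f_def by (rule bounded_linear.has_derivative[OF bounded_linear_vec_of_complex])
  qed
  have injf: "inj_on f (cbox a b)"
  proof (rule inj_onI)
    fix x y assume xy: "x \<in> cbox a b" "y \<in> cbox a b" "f x = f y"
    then have "k (complex_of_vec x) = k (complex_of_vec y)" unfolding f_def by (metis complex_of_vec_of_complex)
    then have "complex_of_vec x = complex_of_vec y" using inj_onD[OF inj] xy by blast
    then show "x = y" by (metis vec_of_complex_of_vec)
  qed
  have "f ` cbox a b \<in> lmeasurable \<and> measure lebesgue (f ` cbox a b) = integral (cbox a b) (\<lambda>v. (norm (deriv k (complex_of_vec v)))\<^sup>2)"
  proof (subst has_measure_differentiable_image[OF _ der injf])
    show "cbox a b \<in> sets lebesgue" by simp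
    show "((\<lambda>x. \<bar>det (matrix (\<lambda>u. vec_of_complex (deriv k (complex_of_vec x) * complex_of_vec u)))\<bar>) has_integral
        integral (cbox a b) (\<lambda>v. (norm (deriv k (complex_of_vec v)))\<^sup>2)) (cbox a b)"
      using integrable_integral[OF int] by (simp add: det_complex_mult)
  qed
  then have m: "f ` cbox a b \<in> lmeasurable" "integral (cbox a b) (\<lambda>v. (norm (deriv k (complex_of_vec v)))\<^sup>2) = measure lebesgue (f ` cbox a b)"
    by auto
  define B :: "(real ^ 2) set" where "B = cbox (vector [- \<bar>M\<bar>, - \<bar>M\<bar>]) (vector [\<bar>M\<bar>, \<bar>M\<bar>])"
  have fB: "f ` cbox a b \<subseteq> B"
  proof safe
    fix v assume v: "v \<in> cbox a b"
    have "norm (k (complex_of_vec v)) \<le> \<bar>M\<bar>" using M[of "complex_of_vec v"] v by force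
    then have "\<bar>Re (k (complex_of_vec v))\<bar> \<le> \<bar>M\<bar>" "\<bar>Im (k (complex_of_vec v))\<bar> \<le> \<bar>M\<bar>"
      using abs_Re_le_cmod abs_Im_le_cmod order_trans by blast+
    then show "f v \<in> B" by (auto simp: f_def B_def vec_of_complex_def mem_box_cart forall_2 abs_le_iff)
  qed
  have "measure lebesgue (f ` cbox a b) \<le> measure lebesgue B"
    by (rule measure_mono_fmeasurable[OF fB]) (use m in \<open>auto simp: B_def fmeasurableD\<close>)
  also have "measure lebesgue B = (2 * \<bar>M\<bar>)\<^sup>2"
    unfolding B_def by (simp add: content_cbox_if_cart interval_eq_empty_cart exists_2 prod.neutral UNIV_2 power2_eq_square)
  finally show "integral (cbox a b) (\<lambda>v. (norm (deriv k (complex_of_vec v)))\<^sup>2) \<le> (2 * \<bar>M\<bar>)\<^sup>2" using m(2) by simp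
qed

lemma integral_cart_2:
  fixes F :: "real ^ 2 \<Rightarrow> real"
  assumes F: "continuous_on (cbox (vector [a, c]) (vector [b, d])) F"
  shows "integral (cbox (vector [a, c]) (vector [b, d])) F =
     integral {c..d} (\<lambda>y. integral {a..b} (\<lambda>x. F (vector [x, y])))"
proof -
  define g :: "real \<times> real \<Rightarrow> real ^ 2" where "g p = vector [snd p, fst p]" for p
  define h :: "real ^ 2 \<Rightarrow> real \<times> real" where "h v = (v $ 2, v $ 1)" for v
  have hg: "h (g p) = p" "g (h v) = v" for p v by (simp_all add: g_def h_def vec_eq_iff forall_2)
  have gbox: "g ` cbox u v = cbox (g u) (g v)" for u v
  proof -
    have "g ` cbox u v = {x. h x \<in> cbox u v}" using hg by (auto simp: image_iff) metis
    also have "\<dots> = cbox (g u) (g v)"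
      by (cases u; cases v) (auto simp: h_def g_def mem_box_cart forall_2 cbox_Pair_eq)
    finally show ?thesis .
  qed
  have hbox: "h ` cbox u v = cbox (h u) (h v)" for u v
    using gbox[of "h u" "h v"] by (simp add: hg image_image[symmetric]) (metis (no_types, lifting) hg(1) image_cong image_ident image_image)
  have lg: "bounded_linear g" unfolding g_def
    by (subst linear_conv_bounded_linear[symmetric], rule linearI) (auto simp: vec_eq_iff forall_2)
  have "((\<lambda>p. F (g p)) has_integral (1 / 1) *\<^sub>R integral (cbox (vector [a, c]) (vector [b, d])) F) (h ` cbox (vector [a, c]) (vector [b, d]))"
  proof (rule has_integral_twiddle[where g = g])
    show "measure lborel (g ` cbox u v) = 1 * measure lborel (cbox u v)" for u v
      unfolding gbox by (cases u; cases v)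
        (auto simp: content_cbox_if_cart interval_eq_empty_cart exists_2 g_def UNIV_2 content_Pair content_real_if)
    show "(F has_integral integral (cbox (vector [a, c]) (vector [b, d])) F) (cbox (vector [a, c]) (vector [b, d]))"
      by (intro integrable_integral integrable_continuous F)
    show "\<exists>w z. g ` cbox u v = cbox w z" for u v using gbox by blast
    show "\<exists>w z. h ` cbox u v = cbox w z" for u v using hbox by blast
  qed (use hg linear_continuous_at[OF lg] in \<open>auto\<close>)
  then have 1: "((\<lambda>p. F (g p)) has_integral integral (cbox (vector [a, c]) (vector [b, d])) F) (cbox (c, a) (d, b))"
    by (simp add: hbox) (simp add: h_def)
  have "continuous_on (cbox (c, a) (d, b)) (\<lambda>p. F (g p))"
  proof (rule continuous_on_compose2[OF F linear_continuous_on[OF lg]])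
    show "g ` cbox (c, a) (d, b) \<subseteq> cbox (vector [a, c]) (vector [b, d])" unfolding gbox by (simp add: g_def)
  qed
  from integral_prod_continuous[OF this] 1 show ?thesis
    by (simp add: g_def integral_unique)
qed


text \<open>Monotone convergence: the supremum has a finite integral and is therefore finite almost
  everywhere.\<close>

lemma increasing_bounded_integrals_AE:
  fixes f :: "nat \<Rightarrow> real \<Rightarrow> real"
  assumes cont: "\<And>n. continuous_on {a..b} (f n)" and nn: "\<And>n y. y \<in> {a..b} \<Longrightarrow> 0 \<le> f n y"
    and inc: "\<And>n y. y \<in> {a..b} \<Longrightarrow> f n y \<le> f (Suc n) y" and bd: "\<And>n. integral {a..b} (f n) \<le> A"
  obtains E where "negligible E" "\<And>y. y \<in> {a..b} - E \<Longrightarrow> \<exists>G. \<forall>n. f n y \<le> G"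
proof -
  define F where "F n y = indicator {a..b} y *\<^sub>R f n y" for n y
  have si: "set_integrable lborel {a..b} (f n)" for n
    by (rule borel_integrable_atLeastAtMost'[OF cont])
  have int: "integrable lborel (F n)" for n using si[of n] by (simp add: set_integrable_def F_def[abs_def])
  have F0: "0 \<le> F n y" for n y using nn by (auto simp: F_def indicator_def)
  have "(\<integral>\<^sup>+y. ennreal (F n y) \<partial>lborel) \<le> ennreal A" for n
  proof -
    have "(\<integral>\<^sup>+y. ennreal (F n y) \<partial>lborel) = ennreal (\<integral>y. F n y \<partial>lborel)"
      by (rule nn_integral_eq_integral[OF int]) (use F0 in auto)
    also have "(\<integral>y. F n y \<partial>lborel) = integral {a..b} (f n)"
      using set_borel_integral_eq_integral(2)[OF si] by (simp add: set_lebesgue_integral_def F_def)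
    finally show ?thesis using bd[of n] by (simp add: ennreal_leI)
  qed
  then have "(SUP n. \<integral>\<^sup>+y. ennreal (F n y) \<partial>lborel) \<le> ennreal A" by (intro SUP_least)
  moreover have "(\<integral>\<^sup>+y. (SUP n. ennreal (F n y)) \<partial>lborel) = (SUP n. \<integral>\<^sup>+y. ennreal (F n y) \<partial>lborel)"
  proof (rule nn_integral_monotone_convergence_SUP)
    show "incseq (\<lambda>n y. ennreal (F n y))"
      using inc by (intro incseq_SucI le_funI ennreal_leI) (auto simp: F_def indicator_def)
    show "(\<lambda>y. ennreal (F n y)) \<in> borel_measurable lborel" for n
      using borel_measurable_integrable[OF int[of n]] by simp
  qed
  ultimately have "(\<integral>\<^sup>+y. (SUP n. ennreal (F n y)) \<partial>lborel) \<noteq> \<infinity>"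
    using ennreal_less_top[of A] by (metis infinity_ennreal_def leD)
  then have "AE y in lborel. (SUP n. ennreal (F n y)) \<noteq> \<infinity>"
    by (intro nn_integral_PInf_AE) (use borel_measurable_integrable[OF int] in auto)
  then obtain N where N: "\<And>y. y \<in> space lborel - N \<Longrightarrow> (SUP n. ennreal (F n y)) \<noteq> \<infinity>" "N \<in> null_sets lborel"
    by (rule AE_E3) blast
  show ?thesis
  proof (rule that[of N])
    show "negligible N" using N(2) negligible_iff_null_sets null_sets_completionI by blast
    fix y assume y: "y \<in> {a..b} - N"
    then have fin: "(SUP n. ennreal (F n y)) < top" using N(1)[of y] unfolding infinity_ennreal_def top.not_eq_extremum by simp
    have "f n y \<le> enn2real (SUP n. ennreal (F n y))" for n
    proof -
      have "ennreal (F n y) \<le> (SUP n. ennreal (F n y))" by (intro SUP_upper) auto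
      then have "enn2real (ennreal (F n y)) \<le> enn2real (SUP n. ennreal (F n y))"
        using fin by (rule enn2real_mono)
      then show ?thesis using y F0[of n y] by (simp add: F_def)
    qed
    then show "\<exists>G. \<forall>n. f n y \<le> G" by blast
  qed
qed

text \<open>The image has finite area, so by Fubini almost every horizontal segment has a square integrable derivative.\<close>

lemma finite_length_limits:
  fixes k :: "complex \<Rightarrow> complex"
  assumes k: "k holomorphic_on {w. Re w < 0}" and ab: "\<alpha> \<le> \<beta>"
    and inj: "inj_on k {w. Re w < 0 \<and> \<alpha> \<le> Im w \<and> Im w \<le> \<beta>}"
    and M: "\<And>w. Re w < 0 \<Longrightarrow> norm (k w) \<le> M"
  obtains E where "negligible E" "\<And>y. y \<in> {\<alpha>..\<beta>} - E \<Longrightarrow> \<exists>l. ((\<lambda>x. k (Complex x y)) \<longlongrightarrow> l) (at_left 0)"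
proof -
  have oH: "open {w. Re w < 0}" by (rule open_halfspace_Re_lt)
  define D where "D x y = (norm (deriv k (Complex x y)))\<^sup>2" for x y
  have contd: "continuous_on {w. Re w < 0} (deriv k)"
    by (intro holomorphic_on_imp_continuous_on holomorphic_deriv k oH)
  have cvv: "complex_of_vec (vector [x, y]) = Complex x y" for x y by (simp add: complex_of_vec_def)
  \<comment> \<open>Right ends that increase to 0 without reaching it, since \<open>k\<close> is
    given on the open half-plane only.\<close>
  define c where "c n = - 1 / (real n + 2)" for n :: nat
  have c: "- 1 < c n" "c n < 0" "c n \<le> c (Suc n)" for n by (auto simp: c_def field_simps)
  define f where "f n y = integral {-1..c n} (\<lambda>x. D x y)" for n y
  have contC: "continuous_on S (\<lambda>p. Complex (u p) (v p))" if "continuous_on S u" "continuous_on S v" for S and u v :: "real \<times> real \<Rightarrow> real"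
    unfolding Complex_eq using that by (intro continuous_intros)
  have contC1: "continuous_on S (\<lambda>p. Complex p y)" for S and y :: real
    unfolding Complex_eq by (intro continuous_intros)
  have contD: "continuous_on ({\<alpha>..\<beta>} \<times> cbox (-1) (c n)) (\<lambda>(y, x). D x y)" for n
  proof -
    have "continuous_on ({\<alpha>..\<beta>} \<times> cbox (-1) (c n)) (\<lambda>p. deriv k (Complex (snd p) (fst p)))"
      by (rule continuous_on_compose2[OF contd contC]) (use c[of n] in \<open>auto intro!: continuous_intros\<close>)
    then show ?thesis unfolding D_def case_prod_beta by (intro continuous_intros)
  qed
  have intD: "(\<lambda>x. D x y) integrable_on {u..v}" if "v < 0" for u v y
  proof -
    have "continuous_on {u..v} (\<lambda>x. deriv k (Complex x y))"
      by (rule continuous_on_compose2[OF contd contC1]) (use that in auto)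
    then show ?thesis unfolding D_def by (intro integrable_continuous_interval continuous_intros)
  qed
  have bound: "integral {\<alpha>..\<beta>} (f n) \<le> (2 * \<bar>M\<bar>)\<^sup>2" for n
  proof -
    let ?R = "cbox (vector [-1, \<alpha>]) (vector [c n, \<beta>]) :: (real ^ 2) set"
    have R: "complex_of_vec ` ?R \<subseteq> {w. Re w < 0 \<and> \<alpha> \<le> Im w \<and> Im w \<le> \<beta>}"
      using c[of n] by (auto simp: complex_of_vec_def mem_box_cart forall_2)
    have "integral ?R (\<lambda>v. (norm (deriv k (complex_of_vec v)))\<^sup>2) \<le> (2 * \<bar>M\<bar>)\<^sup>2"
      by (rule area_integral_bound(2)[OF k oH _ inj_on_subset[OF inj R]]) (use R M in auto)
    moreover have "continuous_on ?R (\<lambda>v. (norm (deriv k (complex_of_vec v)))\<^sup>2)"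
    proof -
      have "continuous_on ?R (\<lambda>v. deriv k (complex_of_vec v))"
        by (rule continuous_on_compose2[OF contd linear_continuous_on[OF bounded_linear_complex_of_vec]]) (use R in auto)
      then show ?thesis by (intro continuous_intros)
    qed
    ultimately show ?thesis
      using integral_cart_2[of "-1" \<alpha> "c n" \<beta> "\<lambda>v. (norm (deriv k (complex_of_vec v)))\<^sup>2"]
      by (simp add: cvv f_def[abs_def] D_def)
  qed
  obtain E where E: "negligible E" "\<And>y. y \<in> {\<alpha>..\<beta>} - E \<Longrightarrow> \<exists>G. \<forall>n. f n y \<le> G"
  proof (rule increasing_bounded_integrals_AE[of \<alpha> \<beta> f "(2 * \<bar>M\<bar>)\<^sup>2"])
    show "continuous_on {\<alpha>..\<beta>} (f n)" for n
      using integral_continuous_on_param[OF contD[of n]] by (simp add: f_def[abs_def])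
    show "0 \<le> f n y" for n y unfolding f_def
      by (intro integral_nonneg intD) (use c in \<open>auto simp: D_def\<close>)
    show "f n y \<le> f (Suc n) y" for n y unfolding f_def
      by (intro integral_subset_le intD) (use c[of n] c[of "Suc n"] in \<open>auto simp: D_def\<close>)
  qed (use bound in auto)
  show ?thesis
  proof (rule that[OF E(1)])
    fix y assume "y \<in> {\<alpha>..\<beta>} - E"
    then obtain G where G: "\<And>n. f n y \<le> G" using E(2) by blast
    define K where "K x = k (Complex x y)" for x
    have intG: "integral {u..v} (\<lambda>x. D x y) \<le> G" if "-1 \<le> u" "v < 0" for u v
    proof -
      obtain n where n: "inverse (real (Suc n)) < - v" using reals_Archimedean[of "- v"] \<open>v < 0\<close> by auto
      then have "v \<le> c (Suc n)"
      proof -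
        have "1 / (real n + 3) \<le> inverse (real (Suc n))" by (simp add: field_simps)
        moreover have "c (Suc n) = - (1 / (real n + 3))" by (simp add: c_def)
        ultimately show ?thesis using n by linarith
      qed
      then have "integral {u..v} (\<lambda>x. D x y) \<le> f (Suc n) y" unfolding f_def
        by (intro integral_subset_le intD) (use that c[of "Suc n"] in \<open>auto simp: D_def\<close>)
      then show ?thesis using G[of "Suc n"] by linarith
    qed
    have G0: "G \<ge> 0"
      using intG[of "-1" "-2"] by simp
    \<comment> \<open>Instead of the Cauchy-Schwarz inequality, |k'| is bounded by L + |k'|^2 / L
      with a free parameter \<open>L\<close>; a large \<open>L\<close> makes the second part small,
      and short intervals then make the first one small.\<close>
    have step: "norm (K v - K u) \<le> L * (v - u) + G / L" if uv: "-1 \<le> u" "u \<le> v" "v < 0" and L: "L > 0" for u v L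
    proof -
      have der: "(K has_vector_derivative deriv k (Complex x y)) (at x within {u..v})" if "x \<in> {u..v}" for x
      proof -
        have "((\<lambda>x. Complex x y) has_vector_derivative 1) (at x within {u..v})"
          unfolding Complex_eq by (auto intro!: derivative_eq_intros)
        moreover have "(k has_field_derivative deriv k (Complex x y)) (at (Complex x y))"
          using holomorphic_derivI[OF k oH, of "Complex x y"] that uv by simp
        ultimately show ?thesis
          using field_vector_diff_chain_within[of "\<lambda>x. Complex x y" 1 x "{u..v}" k "deriv k (Complex x y)"]
          by (auto simp: K_def[abs_def] o_def intro: has_field_derivative_at_within)
      qed
      have "((\<lambda>x. deriv k (Complex x y)) has_integral (K v - K u)) {u..v}"
        by (rule fundamental_theorem_of_calculus[OF uv(2) der])
      then have "norm (K v - K u) \<le> integral {u..v} (\<lambda>x. L + D x y / L)"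
      proof (subst integral_unique[symmetric], assumption, intro integral_norm_bound_integral)
        show "(\<lambda>x. L + D x y / L) integrable_on {u..v}"
          using intD[OF uv(3)] by (intro integrable_add integrable_const_ivl integrable_on_divide)
        show "norm (deriv k (Complex x y)) \<le> L + D x y / L" for x
        proof -
          have "2 * L * norm (deriv k (Complex x y)) \<le> L\<^sup>2 + D x y"
            using sum_squares_bound[of L "norm (deriv k (Complex x y))"] by (simp add: D_def)
          moreover have "L * norm (deriv k (Complex x y)) \<ge> 0" using L by simp
          ultimately have "L * norm (deriv k (Complex x y)) \<le> L\<^sup>2 + D x y" by linarith
          then show ?thesis using L by (simp add: field_simps power2_eq_square)
        qed
      qed (auto simp: has_integral_integrable)
      also have "\<dots> = L * (v - u) + integral {u..v} (\<lambda>x. D x y) / L"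
        using intD[OF uv(3)] uv by (subst integral_add) (auto intro!: integrable_on_divide)
      also have "\<dots> \<le> L * (v - u) + G / L" using intG[OF uv(1,3)] L by (simp add: divide_right_mono)
      finally show ?thesis .
    qed
    have "uniformly_continuous_on {-1..<0} K"
      unfolding uniformly_continuous_on_def
    proof (intro allI impI)
      fix e :: real assume e: "e > 0"
      define L where "L = 2 * (G + 1) / e"
      have L: "L > 0" "G / L < e / 2" using e G0 by (auto simp: L_def field_simps)
      have one: "dist (K v) (K u) < e" if "u \<in> {-1..<0}" "v \<in> {-1..<0}" "u \<le> v" "v - u < e / (2 * L)" for u v
      proof -
        have "L * (v - u) < e / 2" using that(4) L(1) by (simp add: field_simps)
        moreover have "norm (K v - K u) \<le> L * (v - u) + G / L" using step[of u v L] that L by simp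
        ultimately show ?thesis using L(2) unfolding dist_norm by linarith
      qed
      show "\<exists>d>0. \<forall>x\<in>{-1..<0}. \<forall>x'\<in>{-1..<0}. dist x' x < d \<longrightarrow> dist (K x') (K x) < e"
      proof (intro exI[of _ "e / (2 * L)"] conjI ballI impI)
        fix x x' assume x: "x \<in> {-1..<0::real}" "x' \<in> {-1..<0}" "dist x' x < e / (2 * L)"
        show "dist (K x') (K x) < e"
          using one[of x x'] one[of x' x] x by (cases "x \<le> x'") (auto simp: dist_real_def dist_commute)
      qed (use e L in auto)
    qed
    then obtain l where "(K \<longlongrightarrow> l) (at 0 within {-1..<0})"
      by (rule uniformly_continuous_on_extension_at_closure[of _ _ 0]) auto
    moreover have "at 0 within {-1..<0} = at_left (0::real)"
      by (rule at_within_nhd[of _ "{-1<..}"]) auto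
    ultimately show "\<exists>l. ((\<lambda>x. k (Complex x y)) \<longlongrightarrow> l) (at_left 0)" unfolding K_def[symmetric] by auto
  qed
qed

text \<open>The exponential turns horizontal half-lines of the left half-plane into radii. Strips of
  height less than 2 pi are mapped injectively, which is why half a circle is treated at a
  time.\<close>

lemma radial_limits_half:
  assumes \<phi>: "\<phi> holomorphic_on ball 0 1" "inj_on \<phi> (ball 0 1)" and M: "\<And>z. norm z < 1 \<Longrightarrow> norm (\<phi> z) \<le> M"
  obtains E where "negligible E" "\<And>\<theta>. \<theta> \<in> {\<alpha>..\<alpha> + pi} - E \<Longrightarrow> \<exists>l. ((\<lambda>r. \<phi> (of_real r * cis \<theta>)) \<longlongrightarrow> l) (at_left 1)"
proof -
  define k where "k w = \<phi> (exp w)" for w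
  have ex: "exp w \<in> ball 0 1" if "Re w < 0" for w using that by simp
  have holk: "k holomorphic_on {w. Re w < 0}"
    unfolding k_def by (rule holomorphic_on_compose_gen[OF holomorphic_on_exp \<phi>(1), unfolded o_def]) (use ex in auto)
  have injk: "inj_on k {w. Re w < 0 \<and> \<alpha> \<le> Im w \<and> Im w \<le> \<alpha> + pi}"
  proof (rule inj_onI)
    fix w z assume wz: "w \<in> {w. Re w < 0 \<and> \<alpha> \<le> Im w \<and> Im w \<le> \<alpha> + pi}" "z \<in> {w. Re w < 0 \<and> \<alpha> \<le> Im w \<and> Im w \<le> \<alpha> + pi}"
      and eq: "k w = k z"
    have ee: "exp w = exp z" using inj_onD[OF \<phi>(2)] eq ex wz unfolding k_def by simp
    have "Im w - Im z \<le> pi" "Im z - Im w \<le> pi" using wz by auto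
    then have "\<bar>Im w - Im z\<bar> < 2 * pi" using pi_gt_zero by linarith
    then show "w = z" using ee by (rule exp_complex_eqI)
  qed
  obtain E where E: "negligible E" "\<And>y. y \<in> {\<alpha>..\<alpha> + pi} - E \<Longrightarrow> \<exists>l. ((\<lambda>x. k (Complex x y)) \<longlongrightarrow> l) (at_left 0)"
    by (rule finite_length_limits[OF holk _ injk, where M = M]) (use M ex in \<open>auto simp: k_def\<close>)
  show ?thesis
  proof (rule that[OF E(1)])
    fix \<theta> assume "\<theta> \<in> {\<alpha>..\<alpha> + pi} - E"
    then obtain l where l: "((\<lambda>x. k (Complex x \<theta>)) \<longlongrightarrow> l) (at_left 0)" using E(2) by blast
    have "filterlim ln (at_left 0) (at_left (1::real))"
      unfolding filterlim_at
    proof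
      show "(ln \<longlongrightarrow> 0) (at_left (1::real))"
        using tendsto_ln[OF tendsto_ident_at, of 1 "{..<1::real}"] by simp
      show "eventually (\<lambda>x. ln x \<in> {..<0} \<and> ln x \<noteq> 0) (at_left (1::real))"
        unfolding eventually_at_left_field by (rule exI[of _ 0]) auto
    qed
    from filterlim_compose[OF l this] have lim: "((\<lambda>r. k (Complex (ln r) \<theta>)) \<longlongrightarrow> l) (at_left 1)" .
    have "eventually (\<lambda>r. k (Complex (ln r) \<theta>) = \<phi> (of_real r * cis \<theta>)) (at_left 1)"
      unfolding eventually_at_left_field
      by (rule exI[of _ 0]) (auto simp: k_def exp_eq_polar cis_conv_exp[symmetric])
    from Lim_transform_eventually[OF lim this]
    show "\<exists>l. ((\<lambda>r. \<phi> (of_real r * cis \<theta>)) \<longlongrightarrow> l) (at_left 1)" by blast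
  qed
qed

lemma negligible_translates:
  assumes "negligible E" shows "negligible (\<Union>m::int. (\<lambda>e. e + c * of_int m) ` (E :: real set))"
proof -
  have "negligible ((\<lambda>e. e + c * of_int m) ` E)" for m :: int
    using negligible_translation[OF assms, of "c * of_int m"] by (simp add: add.commute)
  then show ?thesis
    using negligible_countable_Union[of "range (\<lambda>m::int. (\<lambda>e. e + c * of_int m) ` E)"] by auto
qed

lemma radial_limits:
  assumes \<phi>: "\<phi> holomorphic_on ball 0 1" "inj_on \<phi> (ball 0 1)" and M: "\<And>z. norm z < 1 \<Longrightarrow> norm (\<phi> z) \<le> M"
  obtains E where "negligible E" "\<And>\<theta>. \<theta> \<notin> E \<Longrightarrow> \<exists>l. ((\<lambda>r. \<phi> (of_real r * cis \<theta>)) \<longlongrightarrow> l) (at_left 1)"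
proof -
  obtain E1 where E1: "negligible E1" "\<And>\<theta>. \<theta> \<in> {0..0 + pi} - E1 \<Longrightarrow> \<exists>l. ((\<lambda>r. \<phi> (of_real r * cis \<theta>)) \<longlongrightarrow> l) (at_left 1)"
    using radial_limits_half[OF \<phi> M, of 0] by metis
  obtain E2 where E2: "negligible E2" "\<And>\<theta>. \<theta> \<in> {pi..pi + pi} - E2 \<Longrightarrow> \<exists>l. ((\<lambda>r. \<phi> (of_real r * cis \<theta>)) \<longlongrightarrow> l) (at_left 1)"
    using radial_limits_half[OF \<phi> M, of pi] by metis
  define E where "E = (\<Union>m::int. (\<lambda>e. e + 2 * pi * of_int m) ` (E1 \<union> E2))"
  show ?thesis
  proof (rule that[of E])
    show "negligible E" unfolding E_def by (intro negligible_translates negligible_Un E1(1) E2(1))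
    fix \<theta> assume \<theta>: "\<theta> \<notin> E"
    define m where "m = \<lfloor>\<theta> / (2 * pi)\<rfloor>"
    define t where "t = \<theta> - 2 * pi * of_int m"
    have "of_int m \<le> \<theta> / (2 * pi)" "\<theta> / (2 * pi) < of_int m + 1" unfolding m_def by linarith+
    then have t01: "0 \<le> t" "t \<le> 2 * pi" by (auto simp: t_def field_simps)
    have "t \<notin> E1 \<union> E2"
    proof
      assume "t \<in> E1 \<union> E2"
      then have "t + 2 * pi * of_int m \<in> E" unfolding E_def by blast
      then show False using \<theta> by (simp add: t_def)
    qed
    moreover have "cis \<theta> = cis t" by (simp add: t_def cis_divide[symmetric])
    ultimately show "\<exists>l. ((\<lambda>r. \<phi> (of_real r * cis \<theta>)) \<longlongrightarrow> l) (at_left 1)"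
      using E1(2)[of t] E2(2)[of t] t01 by (cases "t \<le> pi") auto
  qed
qed

text \<open>By the Phragmen-Lindelof principle the set where \<open>Im (c * f)\<close> is positive
  is empty; the four units c = 1, -1, \<i>, -\<i> together give \<open>f = 0\<close>.\<close>

lemma zero_radial_limits:
  assumes hol: "f holomorphic_on ball 0 1" and bd: "\<And>z. norm z < 1 \<Longrightarrow> norm (f z) \<le> C" and E: "negligible E"
    and lim: "\<And>\<theta>. \<theta> \<in> {0..2*pi} - E \<Longrightarrow> ((\<lambda>r. f (of_real r * cis \<theta>)) \<longlongrightarrow> 0) (at_left 1)"
    and z: "norm z < 1"
  shows "f z = 0"
proof -
  have half: "Im (c * f z) \<le> 0" if c: "norm c = 1" and z: "norm z < 1" for c z
  proof -
    define W where "W = {z \<in> ball 0 1. Im (c * f z) > 0}"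
    have cont: "continuous_on (ball 0 1) (\<lambda>z. Im (c * f z))"
      by (intro continuous_intros holomorphic_on_imp_continuous_on hol)
    have oW: "open W"
      using continuous_open_preimage[OF cont open_ball open_greaterThan[of 0]]
      by (simp add: W_def vimage_def Int_def)
    have "W = {}"
    proof (rule phragmen_lindelof_disc[of "\<lambda>z. c * f z" C W E])
      show "(\<lambda>z. c * f z) holomorphic_on ball 0 1" by (intro holomorphic_intros hol)
      show "\<bar>Im (c * f z)\<bar> \<le> C" if "norm z < 1" for z
        using abs_Im_le_cmod[of "c * f z"] bd[OF that] c by (simp add: norm_mult)
      show "Im (c * f z) = 0" if "z \<in> frontier W" "norm z < 1" for z
      proof -
        have zW: "z \<notin> W" using that(1) oW by (simp add: frontier_def interior_open)
        have "z \<in> closure W" using that(1) by (simp add: frontier_def)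
        then obtain x where x: "\<And>n. x n \<in> W" "x \<longlonglongrightarrow> z" by (auto simp: closure_sequential)
        have "(\<lambda>n. Im (c * f (x n))) \<longlonglongrightarrow> Im (c * f z)"
          by (rule continuous_on_tendsto_compose[OF cont x(2)]) (use that x(1) in \<open>auto simp: W_def\<close>)
        moreover have "0 \<le> Im (c * f (x n))" for n using x(1)[of n] by (auto simp: W_def)
        ultimately have "Im (c * f z) \<ge> 0" by (meson LIMSEQ_le_const)
        then show ?thesis using zW that by (auto simp: W_def)
      qed
      fix t assume t: "t \<in> {0..2*pi} - E"
      have "((\<lambda>r. c * f (of_real r * cis t)) \<longlongrightarrow> c * 0) (at_left 1)" by (intro tendsto_intros lim t)
      then have "((\<lambda>r. c * f (of_real r * cis t)) \<longlongrightarrow> 0) (at_left 1)" by simp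
      then show "((\<lambda>r. if of_real r * cis t \<in> W then Im (c * f (of_real r * cis t)) else 0) \<longlongrightarrow> 0) (at_left 1)"
        by (rule tendsto_0_le[where K = 1]) (auto intro!: always_eventually simp: abs_Im_le_cmod simp del: times_complex.sel)
    qed (use oW E in \<open>auto simp: W_def\<close>)
    then have "z \<notin> W" by simp
    then show ?thesis using z by (simp add: W_def not_less)
  qed
  have "Im (1 * f z) \<le> 0" "Im (- 1 * f z) \<le> 0" "Im (\<i> * f z) \<le> 0" "Im (- \<i> * f z) \<le> 0"
    by (rule half[OF _ z]; simp)+
  then show ?thesis by (simp add: complex_eq_iff)
qed

text \<open>If the limits were \<open>c\<close> along an arc, the product of \<open>\<phi> - c\<close> over finitely many rotations would have zero
  limits almost everywhere, hence vanish.\<close>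

lemma radial_limits_not_constant:
  assumes \<phi>: "\<phi> holomorphic_on ball 0 1" "inj_on \<phi> (ball 0 1)" and M: "\<And>z. norm z < 1 \<Longrightarrow> norm (\<phi> z) \<le> M"
    and xy: "x < y" and E: "negligible E"
  shows "\<exists>\<theta>. x < \<theta> \<and> \<theta> < y \<and> \<theta> \<notin> E \<and> \<not> ((\<lambda>r. \<phi> (of_real r * cis \<theta>)) \<longlongrightarrow> c) (at_left 1)"
proof (rule ccontr)
  assume no: "\<not> ?thesis"
  then have lim: "((\<lambda>r. \<phi> (of_real r * cis \<theta>)) \<longlongrightarrow> c) (at_left 1)" if "x < \<theta>" "\<theta> < y" "\<theta> \<notin> E" for \<theta>
    using no that by blast
  \<comment> \<open>The rotations by multiples of 2 pi / n move every angle into (x, y), so one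
    factor of the product tends to 0 on each good radius while the others stay bounded.\<close>
  obtain n :: nat where n: "n > 0" "2 * pi / real n < y - x"
  proof -
    obtain n where n: "2 * pi / (y - x) < real n" using reals_Archimedean2 by blast
    moreover have "2 * pi / (y - x) > 0" using xy by simp
    ultimately have "real n > 0" by linarith
    then show ?thesis using n xy by (intro that[of n]) (auto simp: field_simps)
  qed
  define \<omega> where "\<omega> j = cis (2 * pi / real n * of_int j)" for j :: int
  define f where "f z = (\<Prod>j<n. \<phi> (\<omega> (int j) * z) - c)" for z
  define K where "K = \<bar>M\<bar> + norm c + 1"
  have fac: "norm (\<phi> (\<omega> j * z) - c) \<le> K" if "norm z < 1" for j z
  proof -
    have "norm (\<omega> j * z) < 1" using that by (simp add: \<omega>_def norm_mult)
    then show ?thesis using M[of "\<omega> j * z"] norm_triangle_ineq4[of "\<phi> (\<omega> j * z)" c] by (simp add: K_def)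
  qed
  have "f z = 0" if z: "norm z < 1" for z
  proof (rule zero_radial_limits[OF _ _ _ _ z])
    show "f holomorphic_on ball 0 1"
      unfolding f_def
    proof (intro holomorphic_intros)
      fix j
      show "(\<lambda>z. \<phi> (\<omega> (int j) * z)) holomorphic_on ball 0 1"
        by (rule holomorphic_on_compose_gen[OF _ \<phi>(1), of "\<lambda>z. \<omega> (int j) * z", unfolded o_def])
           (auto intro!: holomorphic_intros simp: \<omega>_def norm_mult)
    qed
    show "norm (f z) \<le> K ^ n" if "norm z < 1" for z
    proof -
      have "norm (f z) \<le> (\<Prod>j<n. K)" unfolding f_def prod_norm[symmetric]
        by (intro prod_mono) (use fac[OF that] in auto)
      then show ?thesis by simp
    qed
    show "negligible (\<Union>m::int. (\<lambda>e. e + 2 * pi / real n * of_int m) ` E)" by (rule negligible_translates[OF E])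
    fix \<theta> assume \<theta>: "\<theta> \<in> {0..2*pi} - (\<Union>m::int. (\<lambda>e. e + 2 * pi / real n * of_int m) ` E)"
    define m where "m = \<lfloor>(x - \<theta>) / (2 * pi / real n)\<rfloor> + 1"
    define \<theta>' where "\<theta>' = \<theta> + 2 * pi / real n * of_int m"
    have p: "2 * pi / real n > 0" using n by simp
    have "(x - \<theta>) / (2 * pi / real n) < of_int m" "of_int m - 1 \<le> (x - \<theta>) / (2 * pi / real n)"
      unfolding m_def by linarith+
    then have "x - \<theta> < of_int m * (2 * pi / real n)" "(of_int m - 1) * (2 * pi / real n) \<le> x - \<theta>"
      unfolding pos_divide_less_eq[OF p] pos_le_divide_eq[OF p] by blast+
    then have "x < \<theta>' \<and> \<theta>' \<le> x + 2 * pi / real n"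
      unfolding \<theta>'_def left_diff_distrib by (simp add: mult.commute)
    then have th: "x < \<theta>'" "\<theta>' < y" using n(2) by linarith+
    have "\<theta>' \<notin> E"
    proof
      assume "\<theta>' \<in> E"
      then have "\<theta>' + 2 * pi / real n * of_int (- m) \<in> (\<Union>m::int. (\<lambda>e. e + 2 * pi / real n * of_int m) ` E)" by blast
      then show False using \<theta> by (simp add: \<theta>'_def)
    qed
    from lim[OF th this] have l0: "((\<lambda>r. \<phi> (of_real r * cis \<theta>') - c) \<longlongrightarrow> 0) (at_left 1)" by (simp add: LIM_zero)
    define j where "j = nat (m mod int n)"
    have j: "j < n" "int j = m mod int n" using n by (auto simp: j_def nat_less_iff)
    have "\<omega> (int j) = \<omega> m"
    proof -
      have "\<omega> m = cis (2 * pi / real n * of_int (int j + int n * (m div int n)))" by (simp add: \<omega>_def j(2))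
      also have "2 * pi / real n * of_int (int j + int n * (m div int n)) = 2 * pi / real n * of_int (int j) + 2 * pi * of_int (m div int n)"
        using n by (simp add: field_simps)
      also have "cis \<dots> = \<omega> (int j)" by (simp add: \<omega>_def cis_mult[symmetric])
      finally show ?thesis by simp
    qed
    then have rot: "\<omega> (int j) * (of_real r * cis \<theta>) = of_real r * cis \<theta>'" for r
      by (simp add: \<omega>_def \<theta>'_def cis_mult[symmetric])
    show "((\<lambda>r. f (of_real r * cis \<theta>)) \<longlongrightarrow> 0) (at_left 1)"
    proof (rule tendsto_0_le[OF l0, of _ "K ^ (n - 1)"])
      show "eventually (\<lambda>r. norm (f (of_real r * cis \<theta>)) \<le> norm (\<phi> (of_real r * cis \<theta>') - c) * K ^ (n - 1)) (at_left 1)"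
        unfolding eventually_at_left_field
      proof (intro exI[of _ 0] conjI allI impI)
        fix r :: real assume r: "0 < r" "r < 1"
        let ?z = "of_real r * cis \<theta>"
        have "norm (f ?z) = norm (\<phi> (\<omega> (int j) * ?z) - c) * (\<Prod>i\<in>{..<n} - {j}. norm (\<phi> (\<omega> (int i) * ?z) - c))"
          unfolding f_def prod_norm[symmetric] by (rule prod.remove) (use j in auto)
        also have "\<dots> \<le> norm (\<phi> (\<omega> (int j) * ?z) - c) * (\<Prod>i\<in>{..<n} - {j}. K)"
          by (intro mult_left_mono prod_mono) (use fac[of ?z] r in \<open>auto simp: norm_mult\<close>)
        finally show "norm (f ?z) \<le> norm (\<phi> (of_real r * cis \<theta>') - c) * K ^ (n - 1)"
          unfolding rot using j(1) by simp
      qed auto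
    qed
  qed
  \<comment> \<open>Each point of the disc is a zero of some factor of the vanishing product, but by
    injectivity each factor has at most one zero.\<close>
  then have "ball 0 1 \<subseteq> (\<Union>j<n. {z \<in> ball 0 1. \<phi> (\<omega> (int j) * z) = c})"
    by (auto simp: f_def)
  moreover have "finite (\<Union>j<n. {z \<in> ball 0 1. \<phi> (\<omega> (int j) * z) = c})"
  proof (intro finite_UN_I)
    fix j
    have "z = w" if "z \<in> ball 0 1" "\<phi> (\<omega> (int j) * z) = c" "w \<in> ball 0 1" "\<phi> (\<omega> (int j) * w) = c" for z w
    proof -
      have n\<omega>: "norm (\<omega> (int j)) = 1" by (simp add: \<omega>_def)
      then have "\<omega> (int j) * z \<in> ball 0 1" "\<omega> (int j) * w \<in> ball 0 1" using that by (simp_all add: norm_mult)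
      moreover have "\<phi> (\<omega> (int j) * z) = \<phi> (\<omega> (int j) * w)" using that by simp
      ultimately have "\<omega> (int j) * z = \<omega> (int j) * w" using inj_onD[OF \<phi>(2)] by blast
      then show ?thesis using n\<omega> by auto
    qed
    then have "{z \<in> ball 0 1. \<phi> (\<omega> (int j) * z) = c} \<subseteq> {SOME w. w \<in> ball 0 1 \<and> \<phi> (\<omega> (int j) * w) = c}"
      using someI[of "\<lambda>w. w \<in> ball 0 1 \<and> \<phi> (\<omega> (int j) * w) = c"] by blast
    then show "finite {z \<in> ball 0 1. \<phi> (\<omega> (int j) * z) = c}" using finite_subset by blast
  qed auto
  ultimately have "finite (ball (0::complex) 1)" using finite_subset by blast
  then have "countable (ball (0::complex) 1)" by (rule countable_finite)
  then show False using uncountable_ball[of 1 "0::complex"] by simp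
qed

section \<open>Coefficient bounds for close-to-convex harmonic maps\<close>

lemma flow_inj:
  assumes a: "0 < a" "a < 1" shows "inj_on (flow t a) (ball 0 1)"
proof (rule inj_onI)
  fix z w assume z: "z \<in> ball 0 1" and w: "w \<in> ball 0 1" and eq: "flow t a z = flow t a w"
  define p where "p = of_real a * cis t"
  define q where "q = of_real a * cis (- t)"
  have nz: "1 + q * z \<noteq> 0" "1 + q * w \<noteq> 0" unfolding q_def using flow_denominator(2)[OF a] z w by auto
  have "(z + p) * (1 + q * w) = (w + p) * (1 + q * z)"
    using eq nz unfolding flow_def p_def[symmetric] q_def[symmetric] by (simp add: frac_eq_eq)
  then have "(z - w) * (1 - p * q) = 0" by (simp add: algebra_simps)
  moreover have "p * q = of_real (a * a)" by (simp add: p_def q_def mult.left_commute cis_mult)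
  moreover have "a * a \<noteq> 1" using a by (metis less_irrefl mult_strict_mono' mult_1 less_imp_le)
  ultimately show "z = w" by (metis eq_iff_diff_eq_0 mult_eq_0_iff of_real_eq_1_iff)
qed

lemma normalized_riemann_map:
  assumes G: "open G" "simply_connected G" "0 \<in> G" "G \<noteq> UNIV"
  obtains \<phi> \<psi> \<rho> where "\<phi> holomorphic_on ball 0 1" "\<psi> holomorphic_on G"
    "\<And>z. norm z < 1 \<Longrightarrow> \<phi> z \<in> G" "\<And>z. norm z < 1 \<Longrightarrow> \<psi> (\<phi> z) = z"
    "\<And>w. w \<in> G \<Longrightarrow> norm (\<psi> w) < 1" "\<And>w. w \<in> G \<Longrightarrow> \<phi> (\<psi> w) = w"
    "\<phi> 0 = 0" "deriv \<phi> 0 = of_real \<rho>" "\<rho> > 0"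
proof -
  have "G \<noteq> {}" using G(3) by auto
  then obtain f g where fg: "f holomorphic_on G" "g holomorphic_on ball 0 1"
      "\<And>z. z \<in> G \<Longrightarrow> f z \<in> ball 0 1" "\<And>z. z \<in> G \<Longrightarrow> g (f z) = z"
      "\<And>z. z \<in> ball 0 1 \<Longrightarrow> g z \<in> G" "\<And>z. z \<in> ball 0 1 \<Longrightarrow> f (g z) = z"
    using G Riemann_mapping_theorem[of G] by metis
  obtain p q where pq: "p (f 0) = 0" "p holomorphic_on ball 0 1" "p ` ball 0 1 \<subseteq> ball 0 1"
      "q holomorphic_on ball 0 1" "q ` ball 0 1 \<subseteq> ball 0 1"
      "\<And>z. z \<in> ball 0 1 \<Longrightarrow> p (q z) = z" "\<And>z. z \<in> ball 0 1 \<Longrightarrow> q (p z) = z"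
    using ball_biholomorphism_exists[OF fg(3)[OF G(3)]] by metis
  define \<phi>1 where "\<phi>1 = g \<circ> q"
  define \<psi>1 where "\<psi>1 = p \<circ> f"
  have h1: "\<phi>1 holomorphic_on ball 0 1" unfolding \<phi>1_def
    by (rule holomorphic_on_compose_gen[OF pq(4) fg(2)]) (use pq in auto)
  have h2: "\<psi>1 holomorphic_on G" unfolding \<psi>1_def
    by (rule holomorphic_on_compose_gen[OF fg(1) pq(2)]) (use fg in auto)
  have m1: "\<phi>1 z \<in> G" "\<psi>1 (\<phi>1 z) = z" if "norm z < 1" for z
  proof -
    have "q z \<in> ball 0 1" using pq(5) that by force
    then show "\<phi>1 z \<in> G" "\<psi>1 (\<phi>1 z) = z" using fg pq(6)[of z] that by (auto simp: \<phi>1_def \<psi>1_def)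
  qed
  have m2: "norm (\<psi>1 w) < 1" "\<phi>1 (\<psi>1 w) = w" if "w \<in> G" for w
  proof -
    have "p (f w) \<in> ball 0 1" using pq(3) fg(3)[OF that] by blast
    then show "norm (\<psi>1 w) < 1" by (simp add: \<psi>1_def)
    show "\<phi>1 (\<psi>1 w) = w" using pq(7)[OF fg(3)[OF that]] fg(4)[OF that] by (simp add: \<phi>1_def \<psi>1_def)
  qed
  have p10: "\<phi>1 0 = 0"
    using m2(2)[OF G(3)] pq(1) by (simp add: \<psi>1_def)
  have inj1: "inj_on \<phi>1 (ball 0 1)" using m1(2) by (intro inj_on_inverseI[of _ \<psi>1]) auto
  have d1: "deriv \<phi>1 0 \<noteq> 0"
    by (rule holomorphic_injective_imp_regular[OF h1 _ inj1]) auto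
  define u where "u = cis (- Arg (deriv \<phi>1 0))"
  have u: "norm u = 1" "u \<noteq> 0" by (auto simp: u_def)
  define \<phi> where "\<phi> z = \<phi>1 (u * z)" for z
  define \<psi> where "\<psi> w = \<psi>1 w / u" for w
  show ?thesis
  proof (rule that[of \<phi> \<psi> "norm (deriv \<phi>1 0)"])
    show "\<phi> holomorphic_on ball 0 1" unfolding \<phi>_def
      by (rule holomorphic_on_compose_gen[OF _ h1, of "\<lambda>z. u * z", unfolded o_def])
         (use u in \<open>auto intro!: holomorphic_intros simp: norm_mult\<close>)
    show "\<psi> holomorphic_on G" unfolding \<psi>_def using u by (intro holomorphic_intros h2) auto
    show "\<phi> z \<in> G" "\<psi> (\<phi> z) = z" if "norm z < 1" for z
      using m1[of "u * z"] that u by (auto simp: \<phi>_def \<psi>_def norm_mult)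
    show "norm (\<psi> w) < 1" "\<phi> (\<psi> w) = w" if "w \<in> G" for w
      using m2[OF that] u by (auto simp: \<phi>_def \<psi>_def norm_divide)
    show "\<phi> 0 = 0" using p10 by (simp add: \<phi>_def)
    have "(\<phi>1 has_field_derivative deriv \<phi>1 0) (at (u * 0))"
      using holomorphic_derivI[OF h1, of 0] by simp
    then have "((\<lambda>z. \<phi>1 (u * z)) has_field_derivative deriv \<phi>1 0 * u) (at 0)"
      by (rule DERIV_chain2) (auto intro!: derivative_eq_intros)
    then have "deriv \<phi> 0 = deriv \<phi>1 0 * u" unfolding \<phi>_def[abs_def] by (rule DERIV_imp_deriv)
    also have "deriv \<phi>1 0 = of_real (norm (deriv \<phi>1 0)) * cis (Arg (deriv \<phi>1 0))"
      using cis_Arg_sgn[OF d1] d1 by (simp add: sgn_eq)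
    also have "\<dots> * u = of_real (norm (deriv \<phi>1 0))"
      by (simp add: u_def mult.assoc cis_mult)
    finally show "deriv \<phi> 0 = of_real (norm (deriv \<phi>1 0))" .
    show "norm (deriv \<phi>1 0) > 0" using d1 by simp
  qed
qed

text \<open>Schwarz's lemma for \<open>\<phi>\<close> gives the upper bound, and Schwarz's lemma for
  \<open>\<psi>\<close> on the disc of radius \<open>r\<close>, scaled to the unit disc, the lower
  one.\<close>

lemma riemann_map_derivative_bounds:
  assumes \<phi>: "\<phi> holomorphic_on ball 0 1" "\<psi> holomorphic_on G" "\<And>z. norm z < 1 \<Longrightarrow> \<psi> (\<phi> z) = z"
    and op: "open G" and sub: "\<And>z. norm z < 1 \<Longrightarrow> norm (\<phi> z) < 1" "\<And>w. w \<in> G \<Longrightarrow> norm (\<psi> w) < 1"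
    and \<phi>0: "\<phi> 0 = 0" "deriv \<phi> 0 = of_real \<rho>" "\<rho> > 0" and r: "0 < r" "ball 0 r \<subseteq> G"
  shows "r \<le> \<rho>" "\<rho> \<le> 1"
proof -
  have "norm (deriv \<phi> 0) \<le> 1" by (rule Schwarz_Lemma(2)[OF \<phi>(1) \<phi>0(1) sub(1), of 0]) auto
  then show "\<rho> \<le> 1" using \<phi>0 by simp
  have G0: "0 \<in> G" using r by auto
  have \<psi>0: "\<psi> 0 = 0" using \<phi>(3)[of 0] \<phi>0(1) by simp
  have d\<psi>: "(\<psi> has_field_derivative deriv \<psi> 0) (at 0)" by (rule holomorphic_derivI[OF \<phi>(2) op G0])
  have "(\<phi> has_field_derivative deriv \<phi> 0) (at 0)" using holomorphic_derivI[OF \<phi>(1), of 0] by simp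
  then have "((\<lambda>z. \<psi> (\<phi> z)) has_field_derivative deriv \<psi> 0 * deriv \<phi> 0) (at 0)"
    using d\<psi> \<phi>0(1) by (intro DERIV_chain2[of \<psi>]) auto
  moreover have "((\<lambda>z. \<psi> (\<phi> z)) has_field_derivative 1) (at 0)"
  proof (rule DERIV_cong_ev[THEN iffD2, of 0 0 _ "\<lambda>z. z" 1 1])
    show "eventually (\<lambda>z. \<psi> (\<phi> z) = z) (nhds 0)"
      using eventually_nhds_in_open[of "ball 0 1" "0::complex"] by (rule eventually_mono) (use \<phi>(3) in auto)
  qed auto
  ultimately have one: "deriv \<psi> 0 * of_real \<rho> = 1" using DERIV_unique \<phi>0(2) by metis
  have "((\<lambda>z. \<psi> (of_real r * z)) has_field_derivative deriv \<psi> 0 * of_real r) (at 0)"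
    by (rule DERIV_chain2[of \<psi>]) (use d\<psi> in \<open>auto intro!: derivative_eq_intros\<close>)
  then have dr: "deriv (\<lambda>z. \<psi> (of_real r * z)) 0 = deriv \<psi> 0 * of_real r" by (rule DERIV_imp_deriv)
  have inG: "of_real r * z \<in> G" if "norm z < 1" for z :: complex
    using r that by (intro subsetD[OF r(2)]) (simp add: norm_mult)
  have "norm (deriv (\<lambda>z. \<psi> (of_real r * z)) 0) \<le> 1"
  proof (rule Schwarz_Lemma(2)[of _ 0])
    show "(\<lambda>z. \<psi> (of_real r * z)) holomorphic_on ball 0 1"
      by (rule holomorphic_on_compose_gen[OF _ \<phi>(2), of "\<lambda>z. of_real r * z", unfolded o_def])
         (use inG in \<open>auto intro!: holomorphic_intros\<close>)
  qed (use sub(2) inG \<psi>0 in auto)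
  then have "norm (deriv \<psi> 0) * r \<le> 1" using r by (simp add: dr norm_mult)
  moreover have "norm (deriv \<psi> 0) * \<rho> = 1" using arg_cong[OF one, of norm] \<phi>0(3) by (simp add: norm_mult)
  ultimately have "norm (deriv \<psi> 0) * r \<le> norm (deriv \<psi> 0) * \<rho>" by simp
  moreover have "norm (deriv \<psi> 0) > 0" using one by auto
  ultimately show "r \<le> \<rho>" by simp
qed

text \<open>\<open>\<phi>\<close> is the Riemann map onto the preimage \<open>G\<close> under
  \<open>f\<close> of the component \<open>C\<close>, chosen to contain the image of the closed disc
  of radius \<open>r\<close>. Since that disc lies in \<open>G\<close>, the derivative at 0 is at
  least \<open>r\<close>, and \<open>f\<close> composed with \<open>\<phi>\<close> meets the
  assumptions of the ray argument.\<close>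

lemma approximating_map:
  fixes h g :: "complex \<Rightarrow> complex"
  defines "f \<equiv> \<lambda>z. h z + cnj (g z)"
  assumes holh: "h holomorphic_on ball 0 1" and holg: "g holomorphic_on ball 0 1"
    and injf: "inj_on f (ball 0 1)" and lt: "\<And>z. norm z < 1 \<Longrightarrow> norm (deriv g z) < norm (deriv h z)"
    and g0: "deriv g 0 = 0" and RS: "ray_structure (f ` ball 0 1) d" and r: "0 < r" "r < 1"
  obtains \<phi> \<rho> where "\<phi> holomorphic_on ball 0 1" "\<phi> 0 = 0" "\<And>z. norm z < 1 \<Longrightarrow> norm (\<phi> z) < 1"
    "deriv \<phi> 0 = of_real \<rho>" "r \<le> \<rho>" "\<rho> \<le> 1"
    "\<And>H G n. (h \<circ> \<phi>) has_fps_expansion H \<Longrightarrow> (g \<circ> \<phi>) has_fps_expansion G \<Longrightarrow> n \<ge> 1 \<Longrightarrow>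
       norm (fps_nth H n) \<le> norm (deriv h 0) * (real n + 1) * (2 * real n + 1) / 6 \<and>
       norm (fps_nth G n) \<le> norm (deriv h 0) * (real n - 1) * (2 * real n - 1) / 6"
proof -
  define \<Omega> where "\<Omega> = f ` ball 0 1"
  have contf: "continuous_on (ball 0 1) f" unfolding f_def
    by (intro continuous_intros holomorphic_on_imp_continuous_on holh holg)
  have op\<Omega>: "open \<Omega>" unfolding \<Omega>_def by (rule invariance_of_domain[OF contf open_ball injf])
  define K where "K = f ` cball 0 r"
  have sr: "cball (0::complex) r \<subseteq> ball 0 1" using r by auto
  have K: "compact K" "connected K" unfolding K_def
    by (intro compact_continuous_image connected_continuous_image continuous_on_subset[OF contf sr] compact_cball connected_cball)+
  have K\<Omega>: "K \<subseteq> \<Omega>" using sr by (auto simp: K_def \<Omega>_def)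
  have f0K: "f 0 \<in> K" using r by (auto simp: K_def)
  obtain R where R: "\<And>w. w \<in> K \<Longrightarrow> norm w < R"
  proof -
    obtain M where "\<forall>w\<in>K. norm w \<le> M" using compact_imp_bounded[OF K(1)] by (auto simp: bounded_iff)
    then show ?thesis by (intro that[of "M + 1"]) force
  qed
  define \<Omega>1 where "\<Omega>1 = \<Omega> \<inter> {w. \<bar>Re w\<bar> < R \<and> \<bar>Im w\<bar> < R}"
  obtain d1 where d1: "ray_structure \<Omega>1 d1"
    using ray_structure_cut_square RS unfolding \<Omega>1_def \<Omega>_def by metis
  have op1: "open \<Omega>1" unfolding \<Omega>1_def Collect_conj_eq
    by (intro open_Int op\<Omega> open_Collect_less continuous_intros)
  have bd1: "bounded \<Omega>1"
  proof -
    have "norm w \<le> 2 * R" if "w \<in> \<Omega>1" for w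
      using cmod_le[of w] that by (auto simp: \<Omega>1_def)
    then show ?thesis unfolding bounded_iff by blast
  qed
  have K1: "K \<subseteq> \<Omega>1"
  proof
    fix w assume w: "w \<in> K"
    have "\<bar>Re w\<bar> < R" "\<bar>Im w\<bar> < R"
      using abs_Re_le_cmod[of w] abs_Im_le_cmod[of w] R[OF w] by linarith+
    then show "w \<in> \<Omega>1" using w K\<Omega> by (auto simp: \<Omega>1_def)
  qed
  obtain e where e: "e > 0" "\<And>x y. x \<in> K \<Longrightarrow> y \<in> - \<Omega>1 \<Longrightarrow> e \<le> dist x y"
  proof -
    have "closed (- \<Omega>1)" "K \<inter> - \<Omega>1 = {}" using op1 K1 by auto
    then obtain e where "e > 0" "\<forall>x\<in>K. \<forall>y\<in>- \<Omega>1. e \<le> dist x y" using separate_compact_closed[OF K(1)] by blast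
    then show ?thesis by (intro that[of e]) auto
  qed
  \<comment> \<open>Half of a lower bound for the distance from \<open>K\<close> to the complement,
    so that \<open>K\<close> survives the shrinking.\<close>
  define \<epsilon> where "\<epsilon> = e / 2"
  have \<epsilon>: "\<epsilon> > 0" using e by (simp add: \<epsilon>_def)
  have ne1: "- \<Omega>1 \<noteq> {}" using bd1 not_bounded_UNIV by (metis Compl_UNIV_eq double_complement)
  define U where "U = {w. \<epsilon> < infdist w (- \<Omega>1)}"
  have KU: "K \<subseteq> U"
  proof
    fix x assume x: "x \<in> K"
    have "e \<le> infdist x (- \<Omega>1)" unfolding infdist_notempty[OF ne1]
      by (rule cINF_greatest[OF ne1]) (use e(2)[OF x] in auto)
    then show "x \<in> U" using e(1) by (simp add: U_def \<epsilon>_def)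
  qed
  define C where "C = connected_component_set U (f 0)"
  have CU: "C \<in> components U" unfolding C_def by (rule componentsI) (use KU f0K in auto)
  have KC: "K \<subseteq> C" unfolding C_def by (rule connected_component_maximal[OF f0K K(2) KU])
  obtain foot dir where C: "open C" "closure C \<subseteq> \<Omega>1" "simply_connected C"
    and geo: "\<And>b. b \<in> frontier C \<Longrightarrow> norm (dir b) = 1" "\<And>b. b \<in> frontier C \<Longrightarrow> foot b \<noteq> b"
    "\<And>b w t. b \<in> frontier C \<Longrightarrow> w \<in> closed_segment b (foot b) \<Longrightarrow> 0 \<le> t \<Longrightarrow> w + of_real t * dir b \<notin> C"
    "\<And>b b' w t. b \<in> frontier C \<Longrightarrow> b' \<in> frontier C \<Longrightarrow> w \<in> closed_segment b (foot b) \<Longrightarrow> w \<noteq> foot b \<Longrightarrow>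
       0 \<le> t \<Longrightarrow> w \<noteq> foot b' + of_real t * dir b'"
    "\<And>b b'. b \<in> frontier C \<Longrightarrow> b' \<in> frontier C \<Longrightarrow> foot b \<noteq> foot b' \<Longrightarrow>
       closed_segment b (foot b) \<inter> closed_segment b' (foot b') = {}"
    "\<And>b b'. b \<in> frontier C \<Longrightarrow> b' \<in> frontier C \<Longrightarrow> foot b = foot b' \<Longrightarrow> dir b = dir b'"
    "\<And>b b' t t'. b \<in> frontier C \<Longrightarrow> b' \<in> frontier C \<Longrightarrow> 0 \<le> t \<Longrightarrow> 0 \<le> t' \<Longrightarrow> foot b \<noteq> foot b' \<Longrightarrow>
       foot b + of_real t * dir b = foot b' + of_real t' * dir b' \<Longrightarrow> dir b = dir b'"
    by (rule shrink_ray_structure[OF op1 bd1 d1 \<epsilon> CU[unfolded U_def]], rule that)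
  have bdC: "bounded C" using bounded_subset[OF bd1] C(2) closure_subset by blast
  have cC: "compact (closure C)" using bdC by (simp add: compact_closure)
  have C\<Omega>: "closure C \<subseteq> \<Omega>" using C(2) by (auto simp: \<Omega>1_def)
  obtain k where k: "homeomorphism (ball 0 1) \<Omega> f k"
    using invariance_of_domain_homeomorphism[OF open_ball contf _ injf] unfolding \<Omega>_def by auto
  have kf: "\<And>z. z \<in> ball 0 1 \<Longrightarrow> k (f z) = z" and fk: "\<And>w. w \<in> \<Omega> \<Longrightarrow> f (k w) = w"
    and kb: "\<And>w. w \<in> \<Omega> \<Longrightarrow> k w \<in> ball 0 1" and contk: "continuous_on \<Omega> k"
    using k by (auto simp: homeomorphism_def)
  have CC: "C \<subseteq> closure C" by (rule closure_subset)
  define G where "G = k ` C"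
  have G_iff: "z \<in> G \<longleftrightarrow> z \<in> ball 0 1 \<and> f z \<in> C" for z
    using kf fk kb CC C\<Omega> unfolding G_def by (auto simp: image_iff) (metis in_mono)+
  have opG: "open G"
  proof -
    have "G = ball 0 1 \<inter> f -` C" using G_iff by blast
    then show ?thesis using continuous_open_preimage[OF contf open_ball C(1)] by simp
  qed
  have scG: "simply_connected G"
  proof -
    have "homeomorphism C G k f" unfolding G_def
      by (rule homeomorphism_of_subsets[OF homeomorphism_symD[OF k]]) (use CC C\<Omega> in auto)
    then show ?thesis using C(3) homeomorphic_simply_connected_eq homeomorphic_def by blast
  qed
  have rG: "cball 0 r \<subseteq> G" using KC sr unfolding K_def G_iff subset_iff by blast
  have clG: "closure G \<subseteq> k ` closure C"
  proof (rule closure_minimal)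
    show "closed (k ` closure C)"
      by (intro compact_imp_closed compact_continuous_image continuous_on_subset[OF contk C\<Omega>] cC)
  qed (use CC in \<open>auto simp: G_def\<close>)
  obtain \<phi> \<psi> \<rho> where hol\<phi>: "\<phi> holomorphic_on ball 0 1" and hol\<psi>: "\<psi> holomorphic_on G"
    and \<phi>G: "\<And>z. norm z < 1 \<Longrightarrow> \<phi> z \<in> G" and \<psi>\<phi>: "\<And>z. norm z < 1 \<Longrightarrow> \<psi> (\<phi> z) = z"
    and \<psi>b: "\<And>w. w \<in> G \<Longrightarrow> norm (\<psi> w) < 1" and \<phi>\<psi>: "\<And>w. w \<in> G \<Longrightarrow> \<phi> (\<psi> w) = w"
    and \<phi>0: "\<phi> 0 = 0" "deriv \<phi> 0 = of_real \<rho>" "\<rho> > 0"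
  proof (rule normalized_riemann_map[OF opG scG])
    show "0 \<in> G" using rG r by auto
    have "1 \<notin> G" by (simp add: G_iff)
    then show "G \<noteq> UNIV" by blast
  qed (rule that)
  have \<phi>1: "norm (\<phi> z) < 1" if "norm z < 1" for z using \<phi>G[OF that] by (simp add: G_iff)
  have inj\<phi>: "inj_on \<phi> (ball 0 1)" using \<psi>\<phi> by (intro inj_on_inverseI[of _ \<psi>]) auto
  have \<rho>: "r \<le> \<rho>" "\<rho> \<le> 1"
  proof -
    have "ball 0 r \<subseteq> G" using rG by auto
    then show "r \<le> \<rho>" "\<rho> \<le> 1" using riemann_map_derivative_bounds[OF hol\<phi> hol\<psi> \<psi>\<phi> opG \<phi>1 \<psi>b \<phi>0 r(1)] by auto
  qed
  define F where "F z = f (\<phi> z)" for z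
  have FC: "F ` ball 0 1 = C"
  proof
    show "F ` ball 0 1 \<subseteq> C" using \<phi>G by (auto simp: F_def G_iff)
    show "C \<subseteq> F ` ball 0 1"
    proof
      fix w assume w: "w \<in> C"
      have "k w \<in> G" using w by (simp add: G_def)
      then have "F (\<psi> (k w)) = w" using \<phi>\<psi> fk w CC C\<Omega> by (auto simp: F_def)
      then show "w \<in> F ` ball 0 1" using \<psi>b[OF \<open>k w \<in> G\<close>] by (intro image_eqI[of _ _ "\<psi> (k w)"]) auto
    qed
  qed
  have bimg: "\<phi> ` ball 0 1 \<subseteq> ball 0 1" using \<phi>1 by auto
  have holH: "h \<circ> \<phi> holomorphic_on ball 0 1" and holGg: "g \<circ> \<phi> holomorphic_on ball 0 1"
    by (rule holomorphic_on_compose_gen[OF hol\<phi> _ bimg], rule holh) (rule holomorphic_on_compose_gen[OF hol\<phi> _ bimg], rule holg)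
  have Feq: "F z = (h \<circ> \<phi>) z + cnj ((g \<circ> \<phi>) z)" for z by (simp add: F_def f_def)
  have injF: "inj_on F (ball 0 1)"
  proof -
    have "inj_on (f \<circ> \<phi>) (ball 0 1)" by (intro comp_inj_on inj\<phi> inj_on_subset[OF injf bimg])
    then show ?thesis by (simp add: F_def[abs_def] o_def)
  qed
  have contF: "continuous_on (ball 0 1) F"
    unfolding F_def by (rule continuous_on_compose2[OF contf holomorphic_on_imp_continuous_on[OF hol\<phi>] bimg])
  have dchain: "deriv (u \<circ> \<phi>) z = deriv u (\<phi> z) * deriv \<phi> z" if "u holomorphic_on ball 0 1" "norm z < 1" for u z
    by (rule deriv_chain) (use that \<phi>1[of z] hol\<phi> in \<open>auto simp: holomorphic_on_imp_differentiable_at[of _ "ball 0 1"]\<close>)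
  have \<phi>'0: "deriv \<phi> z \<noteq> 0" if "norm z < 1" for z
    by (rule holomorphic_injective_imp_regular[OF hol\<phi> _ inj\<phi>]) (use that in auto)
  have lt': "norm (deriv (g \<circ> \<phi>) z) < norm (deriv (h \<circ> \<phi>) z)" if "norm z < 1" for z
    unfolding dchain[OF holh that] dchain[OF holg that] norm_mult
    using lt[OF \<phi>1[OF that]] \<phi>'0[OF that] by (intro mult_strict_right_mono) auto
  obtain B where B: "continuous_on disc_pairs (\<lambda>p. B (fst p) (snd p) :: real)"
    "\<And>z w. (z, w) \<in> disc_pairs \<Longrightarrow> cis (B z w) = sgn ((F w - F z) / (w - z))"
    "\<And>z w. (z, w) \<in> disc_pairs \<Longrightarrow> B z w = B w z"
    using chord_argument_exists[OF holH holGg Feq injF lt'[of 0]] by auto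
  \<comment> \<open>The limit \<open>l\<close> of the Riemann map lies in the closure of
    \<open>G\<close> but not in \<open>G\<close>, because otherwise \<open>\<psi>\<close> would
    carry it back to a limit of \<open>c\<close> inside the disc. As \<open>f\<close> is continuous
    at \<open>l\<close>, the limit of \<open>F\<close> exists and lies on the frontier of
    \<open>C\<close>.\<close>
  have rad: "F_lim \<in> frontier C \<and> ((\<lambda>r. F (c r)) \<longlongrightarrow> F_lim) (at_left 1)"
    if l: "((\<lambda>r. \<phi> (c r)) \<longlongrightarrow> l) (at_left 1)" and c1: "(c \<longlongrightarrow> u) (at_left 1)" "norm u = 1"
      and cb: "eventually (\<lambda>r. norm (c r) < 1) (at_left (1::real))" and Fl: "F_lim = f l" for c u l F_lim
  proof -
    have "l \<in> closure G"
    proof (rule Lim_in_closed_set[OF closed_closure _ trivial_limit_at_left_real l])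
      show "eventually (\<lambda>r. \<phi> (c r) \<in> closure G) (at_left 1)"
        using cb by eventually_elim (use \<phi>G closure_subset in blast)
    qed
    then obtain w where w: "w \<in> closure C" "l = k w" using clG by blast
    have lb: "l \<in> ball 0 1" "f l = w" using w kb fk C\<Omega> by auto
    have "l \<notin> G"
    proof
      assume lG: "l \<in> G"
      have "isCont \<psi> l" using holomorphic_on_imp_continuous_on[OF hol\<psi>] lG opG by (simp add: continuous_on_eq_continuous_at)
      then have "((\<lambda>r. \<psi> (\<phi> (c r))) \<longlongrightarrow> \<psi> l) (at_left 1)" using l by (rule isCont_tendsto_compose)
      moreover have "eventually (\<lambda>r. \<psi> (\<phi> (c r)) = c r) (at_left 1)" using cb by eventually_elim (rule \<psi>\<phi>)
      ultimately have "(c \<longlongrightarrow> \<psi> l) (at_left 1)" by (rule Lim_transform_eventually)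
      then have "\<psi> l = u" using c1(1) tendsto_unique trivial_limit_at_left_real by blast
      then show False using \<psi>b[OF lG] c1(2) by simp
    qed
    then have "w \<notin> C" using lb by (auto simp: G_iff)
    then have "f l \<in> frontier C" using w lb C(1) by (simp add: frontier_def interior_open)
    moreover have "isCont f l" using contf lb by (simp add: continuous_on_eq_continuous_at)
    then have "((\<lambda>r. F (c r)) \<longlongrightarrow> f l) (at_left 1)" unfolding F_def using l by (rule isCont_tendsto_compose)
    ultimately show ?thesis using Fl by simp
  qed
  have radial: "f l \<in> frontier C \<and> ((\<lambda>r. F (of_real r * cis \<theta>)) \<longlongrightarrow> f l) (at_left 1)"
    if "((\<lambda>r. \<phi> (of_real r * cis \<theta>)) \<longlongrightarrow> l) (at_left 1)" for \<theta> l
  proof (rule rad[OF that])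
    have "((\<lambda>r. of_real r * cis \<theta>) \<longlongrightarrow> of_real 1 * cis \<theta>) (at_left 1)" by (intro tendsto_intros)
    then show "((\<lambda>r. of_real r * cis \<theta>) \<longlongrightarrow> cis \<theta>) (at_left 1)" by simp
    show "eventually (\<lambda>r. norm (of_real r * cis \<theta>) < 1) (at_left (1::real))"
      unfolding eventually_at_left_field by (rule exI[of _ 0]) (simp add: norm_mult)
  qed auto
  have cont_radial: "continuous_on A (\<lambda>r. of_real r * cis \<theta>)" for A \<theta> by (intro continuous_intros)
  obtain E1 where E1: "negligible E1" "\<And>\<theta>. \<theta> \<notin> E1 \<Longrightarrow> \<exists>l. ((\<lambda>r. \<phi> (of_real r * cis \<theta>)) \<longlongrightarrow> l) (at_left 1)"
    using radial_limits[OF hol\<phi> inj\<phi>, of 1] \<phi>1 less_imp_le by metis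
  interpret ri: ray_image F B foot dir
  proof (rule ray_image.intro, unfold FC)
  qed (rule contF injF B geo; assumption)+
  interpret dense: dense_ray_image F B foot dir
  proof
    fix x y :: real and b :: complex assume xy: "x < y"
    obtain \<theta> where th: "x < \<theta>" "\<theta> < y" "\<theta> \<notin> E1" "\<not> ((\<lambda>r. \<phi> (of_real r * cis \<theta>)) \<longlongrightarrow> k b) (at_left 1)"
      using radial_limits_not_constant[OF hol\<phi> inj\<phi> less_imp_le[OF \<phi>1] xy E1(1), of "k b"] by blast
    obtain l where l: "((\<lambda>r. \<phi> (of_real r * cis \<theta>)) \<longlongrightarrow> l) (at_left 1)" using E1(2)[OF th(3)] by blast
    have fl: "f l \<in> frontier C" "((\<lambda>r. F (of_real r * cis \<theta>)) \<longlongrightarrow> f l) (at_left 1)" using radial[OF l] by auto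
    have "l \<in> closure G"
    proof (rule Lim_in_closed_set[OF closed_closure _ trivial_limit_at_left_real l])
      have "\<phi> (of_real r * cis \<theta>) \<in> closure G" if "0 < r" "r < 1" for r
        using \<phi>G[of "of_real r * cis \<theta>"] that closure_subset[of G] by (auto simp: norm_mult)
      then show "eventually (\<lambda>r. \<phi> (of_real r * cis \<theta>) \<in> closure G) (at_left 1)"
        unfolding eventually_at_left_field by (intro exI[of _ 0]) auto
    qed
    then have "l \<in> ball 0 1" using clG kb C\<Omega> by blast
    then have "f l \<noteq> b" using kf[of l] th(4) l by auto
    moreover have "ri.access \<theta> (f l) (\<lambda>r. of_real r * cis \<theta>)"
    proof -
      have "((\<lambda>r. of_real r * cis \<theta>) \<longlongrightarrow> of_real 1 * cis \<theta>) (at_left 1)" by (intro tendsto_intros)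
      then show ?thesis unfolding ri.access_def using fl cont_radial by (auto simp: FC norm_mult)
    qed
    ultimately show "\<exists>\<theta> b' c. x < \<theta> \<and> \<theta> < y \<and> ri.access \<theta> b' c \<and> b' \<noteq> b" using th by blast
  qed
  interpret harm: harmonic_ray_image F B foot dir "h \<circ> \<phi>" "g \<circ> \<phi>"
  proof
    show "h \<circ> \<phi> holomorphic_on ball 0 1" "g \<circ> \<phi> holomorphic_on ball 0 1" by (fact holH holGg)+
    show "F z = (h \<circ> \<phi>) z + cnj ((g \<circ> \<phi>) z)" for z by (rule Feq)
    show "bounded (F ` ball 0 1)" unfolding FC by (rule bdC)
    fix t a :: real assume a: "0 < a" "a < 1"
    have fb: "flow t a ` ball 0 1 \<subseteq> ball 0 1" using norm_flow_less[OF a] by auto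
    have hol2: "\<phi> \<circ> flow t a holomorphic_on ball 0 1"
      by (rule holomorphic_on_compose_gen[OF holomorphic_on_subset[OF holomorphic_flow[OF a]] hol\<phi> fb]) auto
    have inj2: "inj_on (\<phi> \<circ> flow t a) (ball 0 1)"
      by (intro comp_inj_on flow_inj[OF a] inj_on_subset[OF inj\<phi> fb])
    have b2: "norm ((\<phi> \<circ> flow t a) z) \<le> 1" if "norm z < 1" for z
      using \<phi>1[OF norm_flow_less[OF a that, of t]] by simp
    obtain E2 where E2: "negligible E2" "\<And>\<theta>. \<theta> \<notin> E2 \<Longrightarrow> \<exists>l. ((\<lambda>r. (\<phi> \<circ> flow t a) (of_real r * cis \<theta>)) \<longlongrightarrow> l) (at_left 1)"
      using radial_limits[OF hol2 inj2 b2] by metis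
    have two: "f l \<in> frontier C \<and> ((\<lambda>r. F (flow t a (of_real r * cis \<theta>))) \<longlongrightarrow> f l) (at_left 1)"
      if "((\<lambda>r. \<phi> (flow t a (of_real r * cis \<theta>))) \<longlongrightarrow> l) (at_left 1)" for \<theta> l
    proof (rule rad[OF that])
      have "continuous_on {0..1} (\<lambda>r::real. flow t a (of_real r * cis \<theta>))"
        by (rule continuous_on_compose2[OF continuous_flow[OF a] cont_radial]) (auto simp: norm_mult)
      then have "((\<lambda>r::real. flow t a (of_real r * cis \<theta>)) \<longlongrightarrow> flow t a (of_real 1 * cis \<theta>)) (at 1 within {0..1})"
        unfolding continuous_on_def by (rule bspec) simp
      then show "((\<lambda>r. flow t a (of_real r * cis \<theta>)) \<longlongrightarrow> flow t a (cis \<theta>)) (at_left 1)" by (simp add: at_within_Icc_at_left)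
      show "norm (flow t a (cis \<theta>)) = 1" by (simp add: flow_boundary(1)[OF a])
      show "eventually (\<lambda>r. norm (flow t a (of_real r * cis \<theta>)) < 1) (at_left (1::real))"
        unfolding eventually_at_left_field by (rule exI[of _ 0]) (auto intro!: norm_flow_less[OF a] simp: norm_mult)
    qed auto
    show "\<exists>E. negligible E \<and> (\<forall>\<theta>\<in>{0..2*pi} - E. \<exists>b1 b2.
        ((\<lambda>r. F (of_real r * cis \<theta>)) \<longlongrightarrow> b1) (at_left 1) \<and> b1 \<in> frontier (F ` ball 0 1) \<and>
        ((\<lambda>r. F (flow t a (of_real r * cis \<theta>))) \<longlongrightarrow> b2) (at_left 1) \<and> b2 \<in> frontier (F ` ball 0 1))"
      unfolding FC
    proof (intro exI[of _ "E1 \<union> E2"] conjI ballI negligible_Un E1(1) E2(1))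
      fix \<theta> assume th: "\<theta> \<in> {0..2*pi} - (E1 \<union> E2)"
      obtain l1 where l1: "((\<lambda>r. \<phi> (of_real r * cis \<theta>)) \<longlongrightarrow> l1) (at_left 1)" using E1(2) th by blast
      obtain l2 where l2: "((\<lambda>r. \<phi> (flow t a (of_real r * cis \<theta>))) \<longlongrightarrow> l2) (at_left 1)" using E2(2)[of \<theta>] th by auto
      show "\<exists>b1 b2. ((\<lambda>r. F (of_real r * cis \<theta>)) \<longlongrightarrow> b1) (at_left 1) \<and> b1 \<in> frontier C \<and>
        ((\<lambda>r. F (flow t a (of_real r * cis \<theta>))) \<longlongrightarrow> b2) (at_left 1) \<and> b2 \<in> frontier C"
        using radial[OF l1] two[OF l2] by blast
    qed
  qed
  have dH0: "norm (deriv (h \<circ> \<phi>) 0) \<le> norm (deriv h 0)"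
    using dchain[OF holh, of 0] \<phi>0 \<rho> by (simp add: norm_mult mult_left_le)
  have dG0: "deriv (g \<circ> \<phi>) 0 = 0" using dchain[OF holg, of 0] \<phi>0 g0 by simp
  show ?thesis
  proof (rule that[OF hol\<phi> \<phi>0(1) \<phi>1 \<phi>0(2) \<rho>])
    fix H G' n assume HG: "(h \<circ> \<phi>) has_fps_expansion H" "(g \<circ> \<phi>) has_fps_expansion G'" and n: "n \<ge> (1::nat)"
    have "norm (deriv (h \<circ> \<phi>) 0) * (real n + 1) * (2 * real n + 1) / 6 \<le> norm (deriv h 0) * (real n + 1) * (2 * real n + 1) / 6"
      by (intro divide_right_mono mult_right_mono dH0) auto
    moreover have "norm (deriv (h \<circ> \<phi>) 0) * (real n - 1) * (2 * real n - 1) / 6 \<le> norm (deriv h 0) * (real n - 1) * (2 * real n - 1) / 6"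
      using n by (intro divide_right_mono mult_right_mono dH0) auto
    ultimately show "norm (fps_nth H n) \<le> norm (deriv h 0) * (real n + 1) * (2 * real n + 1) / 6 \<and>
       norm (fps_nth G' n) \<le> norm (deriv h 0) * (real n - 1) * (2 * real n - 1) / 6"
      using harm.ray_image_coefficient_bounds[OF lt' dG0 HG n] by linarith
  qed
qed

text \<open>Write \<open>\<phi> z = z * p z\<close> with |p| at most 1. Then 1 - p has nonnegative
  real part and the value 1 - \<rho> at 0, so Caratheodory's lemma bounds its coefficients by 2 (1 -
  \<rho>).\<close>

lemma disc_map_coeffs_near_identity:
  assumes \<phi>: "\<phi> holomorphic_on ball 0 1" "\<phi> 0 = 0" "\<And>z. norm z < 1 \<Longrightarrow> norm (\<phi> z) < 1"
    and d: "deriv \<phi> 0 = of_real \<rho>" and \<Phi>: "\<phi> has_fps_expansion \<Phi>"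
  shows "norm (fps_nth \<Phi> k - fps_nth fps_X k) \<le> 2 * (1 - \<rho>)"
proof -
  obtain p where p: "p holomorphic_on ball 0 1" "\<And>z. norm z < 1 \<Longrightarrow> \<phi> z = z * p z" "deriv \<phi> 0 = p 0"
    using Schwarz3[OF \<phi>(1,2)] by metis
  have \<rho>1: "\<rho> \<le> 1"
    using Schwarz_Lemma(2)[OF \<phi>, of 0] d by simp
  have p1: "norm (p z) \<le> 1" if "norm z < 1" for z
  proof (cases "z = 0")
    case True
    then show ?thesis using Schwarz_Lemma(2)[OF \<phi>, of 0] p(3) by simp
  next
    case False
    then show ?thesis using Schwarz_Lemma(1)[OF \<phi> that] p(2)[OF that] by (simp add: norm_mult)
  qed
  define ph where "ph = fps_expansion p 0"
  have ph: "p has_fps_expansion ph" unfolding ph_def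
    by (rule has_fps_expansion_fps_expansion[of "ball 0 1"]) (use p in auto)
  have "(\<lambda>z. z * p z) has_fps_expansion fps_X * ph" by (intro fps_expansion_intros ph)
  then have "\<phi> has_fps_expansion fps_X * ph"
  proof (rule has_fps_expansion_transfer)
    show "eventually (\<lambda>z. z * p z = \<phi> z) (nhds 0)"
      using eventually_nhds_in_open[of "ball 0 1" "0::complex"] by (rule eventually_mono) (use p(2) in auto)
  qed
  then have \<Phi>eq: "\<Phi> = fps_X * ph" using \<Phi> fps_expansion_unique_complex by blast
  have P: "(\<lambda>z. 1 - p z) has_fps_expansion 1 - ph" by (intro fps_expansion_intros ph)
  have P0: "1 - p 0 = of_real (1 - \<rho>)" using p(3) d by simp
  have ck: "norm (fps_nth (1 - ph) k) \<le> 2 * (1 - \<rho>)" for k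
  proof (cases "k = 0")
    case True
    have eq: "fps_nth (1 - ph) 0 = of_real (1 - \<rho>)" using has_fps_expansion_imp_0_eq_fps_nth_0[OF P] P0 by simp
    show ?thesis unfolding True eq norm_of_real using \<rho>1 by simp
  next
    case False
    have "norm (fps_nth (1 - ph) k) \<le> 2 * Re (1 - p 0)"
    proof (rule caratheodory_coeff[OF _ P])
      show "(\<lambda>z. 1 - p z) holomorphic_on ball 0 1" by (intro holomorphic_intros p)
      show "Re (1 - p z) \<ge> 0" if "norm z < 1" for z using p1[OF that] complex_Re_le_cmod[of "p z"] by simp
    qed (use False in simp)
    then show ?thesis using P0 by simp
  qed
  show ?thesis
  proof (cases k)
    case 0
    then show ?thesis using \<rho>1 by (simp add: \<Phi>eq)
  next
    case (Suc j)
    then have eq: "fps_nth \<Phi> k - fps_nth fps_X k = - fps_nth (1 - ph) j" by (simp add: \<Phi>eq)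
    show ?thesis unfolding eq norm_minus_cancel by (rule ck)
  qed
qed

text \<open>Each coefficient of the composition is a polynomial in finitely many coefficients of
  \<open>\<Phi> m\<close>.\<close>

lemma fps_compose_tendsto_identity:
  fixes \<Phi> :: "nat \<Rightarrow> complex fps"
  assumes "\<And>k. (\<lambda>m. fps_nth (\<Phi> m) k) \<longlonglongrightarrow> fps_nth fps_X k"
  shows "(\<lambda>m. fps_nth (H oo \<Phi> m) k) \<longlonglongrightarrow> fps_nth H k"
proof -
  have pow: "(\<lambda>m. fps_nth (\<Phi> m ^ i) k) \<longlonglongrightarrow> fps_nth (fps_X ^ i) k" for i k
  proof (induction i arbitrary: k)
    case (Suc i)
    show ?case unfolding power_Suc fps_mult_nth by (intro tendsto_sum tendsto_mult assms Suc)
  qed simp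
  have "(\<lambda>m. fps_nth (H oo \<Phi> m) k) \<longlonglongrightarrow> fps_nth (H oo fps_X) k"
    unfolding fps_compose_nth by (intro tendsto_sum tendsto_mult tendsto_const pow)
  then show ?thesis by simp
qed

text \<open>The bounds hold for \<open>h\<close> and \<open>g\<close> composed with maps whose
  derivative at 0 is at least \<open>r m\<close>, which tends to 1. Such maps tend to the identity
  coefficientwise, so the bounds survive in the limit.\<close>

lemma normalized_coefficient_bounds:
  fixes h g :: "complex \<Rightarrow> complex"
  defines "f \<equiv> \<lambda>z. h z + cnj (g z)"
  assumes holh: "h holomorphic_on ball 0 1" and holg: "g holomorphic_on ball 0 1"
    and injf: "inj_on f (ball 0 1)" and lt: "\<And>z. norm z < 1 \<Longrightarrow> norm (deriv g z) < norm (deriv h z)"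
    and g0: "deriv g 0 = 0" and RS: "ray_structure (f ` ball 0 1) d"
    and H: "h has_fps_expansion H" and G: "g has_fps_expansion G" and n: "n \<ge> 1"
  shows "norm (fps_nth H n) \<le> norm (deriv h 0) * (real n + 1) * (2 * real n + 1) / 6"
    and "norm (fps_nth G n) \<le> norm (deriv h 0) * (real n - 1) * (2 * real n - 1) / 6"
proof -
  define r where "r m = 1 - 1 / (real m + 2)" for m :: nat
  define good where "good m \<phi> \<longleftrightarrow> \<phi> holomorphic_on ball 0 1 \<and> \<phi> 0 = 0 \<and> (\<forall>z. norm z < 1 \<longrightarrow> norm (\<phi> z) < 1) \<and>
     (\<exists>\<rho>. deriv \<phi> 0 = of_real \<rho> \<and> r m \<le> \<rho>) \<and>
     (\<forall>H G. (h \<circ> \<phi>) has_fps_expansion H \<longrightarrow> (g \<circ> \<phi>) has_fps_expansion G \<longrightarrow>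
       norm (fps_nth H n) \<le> norm (deriv h 0) * (real n + 1) * (2 * real n + 1) / 6 \<and>
       norm (fps_nth G n) \<le> norm (deriv h 0) * (real n - 1) * (2 * real n - 1) / 6)" for m \<phi>
  have "\<exists>\<phi>. good m \<phi>" for m
  proof -
    have rm: "0 < r m" "r m < 1" by (auto simp: r_def field_simps)
    obtain \<phi> \<rho> where 1: "\<phi> holomorphic_on ball 0 1" "\<phi> 0 = 0" "\<And>z. norm z < 1 \<Longrightarrow> norm (\<phi> z) < 1"
      "deriv \<phi> 0 = of_real \<rho>" "r m \<le> \<rho>" "\<rho> \<le> 1"
      and 2: "\<And>H G n. (h \<circ> \<phi>) has_fps_expansion H \<Longrightarrow> (g \<circ> \<phi>) has_fps_expansion G \<Longrightarrow> n \<ge> 1 \<Longrightarrow>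
       norm (fps_nth H n) \<le> norm (deriv h 0) * (real n + 1) * (2 * real n + 1) / 6 \<and>
       norm (fps_nth G n) \<le> norm (deriv h 0) * (real n - 1) * (2 * real n - 1) / 6"
      by (rule approximating_map[OF holh holg injf[unfolded f_def] lt g0 RS[unfolded f_def] rm], assumption, rule that)
    show ?thesis unfolding good_def using 1 2[OF _ _ n] by (intro exI[of _ \<phi>] conjI allI impI) blast+
  qed
  then obtain \<phi> where \<phi>: "\<And>m. good m (\<phi> m)" by metis
  define \<Phi> where "\<Phi> m = fps_expansion (\<phi> m) 0" for m
  have \<Phi>: "\<phi> m has_fps_expansion \<Phi> m" for m unfolding \<Phi>_def
    by (rule has_fps_expansion_fps_expansion[of "ball 0 1"]) (use \<phi>[of m] in \<open>auto simp: good_def\<close>)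
  have \<Phi>0: "fps_nth (\<Phi> m) 0 = 0" for m
    using has_fps_expansion_imp_0_eq_fps_nth_0[OF \<Phi>[of m]] \<phi>[of m] by (simp add: good_def)
  have lim: "(\<lambda>m. fps_nth (\<Phi> m) k) \<longlonglongrightarrow> fps_nth fps_X k" for k
  proof (rule LIM_zero_cancel, rule Lim_null_comparison)
    show "eventually (\<lambda>m. norm (fps_nth (\<Phi> m) k - fps_nth fps_X k) \<le> 2 * (1 - r m)) sequentially"
    proof (intro always_eventually allI)
      fix m
      obtain \<rho> where \<rho>: "deriv (\<phi> m) 0 = of_real \<rho>" "r m \<le> \<rho>" using \<phi>[of m] unfolding good_def by blast
      have "norm (fps_nth (\<Phi> m) k - fps_nth fps_X k) \<le> 2 * (1 - \<rho>)"
        by (rule disc_map_coeffs_near_identity[OF _ _ _ \<rho>(1) \<Phi>]) (use \<phi>[of m] in \<open>auto simp: good_def\<close>)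
      then show "norm (fps_nth (\<Phi> m) k - fps_nth fps_X k) \<le> 2 * (1 - r m)" by (rule order_trans) (use \<rho>(2) in simp)
    qed
    show "(\<lambda>m. 2 * (1 - r m)) \<longlonglongrightarrow> 0" unfolding r_def by real_asymp
  qed
  have comp: "norm (fps_nth (H oo \<Phi> m) n) \<le> norm (deriv h 0) * (real n + 1) * (2 * real n + 1) / 6 \<and>
       norm (fps_nth (G oo \<Phi> m) n) \<le> norm (deriv h 0) * (real n - 1) * (2 * real n - 1) / 6" for m
    using \<phi>[of m] has_fps_expansion_compose[OF H \<Phi> \<Phi>0, of m] has_fps_expansion_compose[OF G \<Phi> \<Phi>0, of m]
    unfolding good_def by blast
  show "norm (fps_nth H n) \<le> norm (deriv h 0) * (real n + 1) * (2 * real n + 1) / 6"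
    by (rule LIMSEQ_le_const2[OF tendsto_norm[OF fps_compose_tendsto_identity[OF lim]]]) (use comp in blast)
  show "norm (fps_nth G n) \<le> norm (deriv h 0) * (real n - 1) * (2 * real n - 1) / 6"
    by (rule LIMSEQ_le_const2[OF tendsto_norm[OF fps_compose_tendsto_identity[OF lim]]]) (use comp in blast)
qed


section \<open>Removing the normalization \<open>g' 0 = 0\<close>\<close>

lemma harmonic_has_derivative:
  assumes h: "h holomorphic_on S" "g holomorphic_on S" and S: "open S" "z \<in> S"
    and f: "\<And>z. z \<in> S \<Longrightarrow> f z = h z + cnj (g z)"
  shows "(f has_derivative (\<lambda>v. deriv h z * v + cnj (deriv g z * v))) (at z)"
proof -
  have "(h has_derivative (\<lambda>v. deriv h z * v)) (at z)" "(g has_derivative (\<lambda>v. deriv g z * v)) (at z)"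
    using holomorphic_derivI[OF _ S] h by (auto simp: has_field_derivative_def)
  then have "((\<lambda>z. h z + cnj (g z)) has_derivative (\<lambda>v. deriv h z * v + cnj (deriv g z * v))) (at z)"
    by (intro has_derivative_add bounded_linear.has_derivative[OF bounded_linear_cnj])
  then show ?thesis
    by (rule has_derivative_transform_within_open[OF _ S]) (use f in simp)
qed

lemma harmonic_jacobian:
  assumes h: "h holomorphic_on S" "g holomorphic_on S" and S: "open S" "z \<in> S"
    and f: "\<And>z. z \<in> S \<Longrightarrow> f z = h z + cnj (g z)"
  shows "jacobian f z = (norm (deriv h z))\<^sup>2 - (norm (deriv g z))\<^sup>2"
proof -
  have "frechet_derivative f (at z) = (\<lambda>v. deriv h z * v + cnj (deriv g z * v))"
    using frechet_derivative_at[OF harmonic_has_derivative[OF assms]] by simp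
  then show ?thesis
    unfolding jacobian_def cmod_power2 by (simp add: Let_def algebra_simps power2_eq_square)
qed

text \<open>The difference of the squares is \<open>(1 - (norm c)\<^sup>2) * ((norm u)\<^sup>2 -
  (norm v)\<^sup>2)\<close>. It makes the sheared map sense-preserving.\<close>

lemma disc_shear_less:
  fixes u v c :: complex
  assumes "norm c < 1" "norm v < norm u"
  shows "norm (v - cnj c * u) < norm (u - c * v)"
proof -
  have c2: "(norm c)\<^sup>2 < 1" using assms(1) by (simp add: abs_square_less_1)
  have uv: "(norm v)\<^sup>2 < (norm u)\<^sup>2" using assms(2) by (intro power_strict_mono) auto
  have "0 < (1 - (norm c)\<^sup>2) * ((norm u)\<^sup>2 - (norm v)\<^sup>2)" using c2 uv by simp
  also have "\<dots> = (norm (u - c * v))\<^sup>2 - (norm (v - cnj c * u))\<^sup>2"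
    unfolding cmod_power2 by (simp add: algebra_simps power2_eq_square)
  finally show ?thesis by (simp add: power2_less_imp_less)
qed

text \<open>The real linear map \<open>T\<close> with \<open>c = cnj (g' 0)\<close> sends
  \<open>f\<close> to \<open>h0 + cnj g0\<close> with \<open>g0' 0 = 0\<close> and
  \<open>h0' 0 = D\<close>, and it preserves ray structures. Solving back, \<open>D * H\<close> and
  \<open>D * G\<close> are combinations of the normalized coefficients, and the \<open>D\<close>
  coming from \<open>h0' 0\<close> cancels.\<close>

theorem close_to_convex_coefficient_bounds:
  assumes f: "f \<in> C_H_hat" and dec: "harmonic_decomp f h g"
    and H: "h has_fps_expansion H" and G: "g has_fps_expansion G" and n: "n \<ge> 1"
  shows "norm (fps_nth H n) \<le> (real n + 1) * (2 * real n + 1) / 6 + norm (deriv g 0) * ((real n - 1) * (2 * real n - 1) / 6)"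
    and "norm (fps_nth G n) \<le> (real n - 1) * (2 * real n - 1) / 6 + norm (deriv g 0) * ((real n + 1) * (2 * real n + 1) / 6)"
proof -
  define c where "c = cnj (deriv g 0)"
  define D where "D = 1 - (norm c)\<^sup>2"
  have holh: "h holomorphic_on ball 0 1" and holg: "g holomorphic_on ball 0 1"
    and feq: "\<And>z. z \<in> ball 0 1 \<Longrightarrow> f z = h z + cnj (g z)" and h'0: "deriv h 0 = 1" and c1: "norm c < 1"
    using dec by (auto simp: harmonic_decomp_def c_def)
  have sp: "sense_preserving_on f (ball 0 1)" and injf: "inj_on f (ball 0 1)" and ctc: "close_to_convex (f ` ball 0 1)"
    using f by (auto simp: C_H_hat_def S_H_hat_def)
  have D: "D > 0" using c1 by (simp add: D_def abs_square_less_1)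
  have cc: "c * cnj c = of_real (1 - D)" using complex_norm_square[of c] by (simp add: D_def)
  have lt: "norm (deriv g z) < norm (deriv h z)" if "norm z < 1" for z
  proof -
    have "0 < (norm (deriv h z))\<^sup>2 - (norm (deriv g z))\<^sup>2"
      using sp that harmonic_jacobian[OF holh holg open_ball _ feq, of z]
      unfolding sense_preserving_on_def by (metis dist_0_norm mem_ball)
    then show ?thesis by (simp add: power2_less_imp_less)
  qed
  define h0 where "h0 z = h z - c * g z" for z
  define g0 where "g0 z = g z - cnj c * h z" for z
  have hol0: "h0 holomorphic_on ball 0 1" "g0 holomorphic_on ball 0 1"
    unfolding h0_def g0_def by (intro holomorphic_intros holh holg)+
  have der: "deriv h0 z = deriv h z - c * deriv g z" "deriv g0 z = deriv g z - cnj c * deriv h z" if "norm z < 1" for z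
  proof -
    have d: "(h has_field_derivative deriv h z) (at z)" "(g has_field_derivative deriv g z) (at z)"
      using holomorphic_derivI[OF holh open_ball] holomorphic_derivI[OF holg open_ball] that by auto
    show "deriv h0 z = deriv h z - c * deriv g z" unfolding h0_def[abs_def]
      by (intro DERIV_imp_deriv DERIV_diff DERIV_cmult d)
    show "deriv g0 z = deriv g z - cnj c * deriv h z" unfolding g0_def[abs_def]
      by (intro DERIV_imp_deriv DERIV_diff DERIV_cmult d)
  qed
  define T where "T w = w - c * cnj w" for w
  define T' where "T' w = (w + c * cnj w) / of_real D" for w
  have TT: "T' (T w) = w" "T (T' w) = w" for w
  proof -
    have "w - c * cnj w + c * cnj (w - c * cnj w) = (1 - c * cnj c) * w" by (simp add: algebra_simps)
    then show "T' (T w) = w" using D cc by (simp add: T_def T'_def)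
    have "T (T' w) = (w + c * cnj w - c * cnj (w + c * cnj w)) / of_real D"
      by (simp add: T_def T'_def diff_divide_distrib)
    also have "w + c * cnj w - c * cnj (w + c * cnj w) = (1 - c * cnj c) * w" by (simp add: algebra_simps)
    finally show "T (T' w) = w" using D cc by simp
  qed
  have hom: "homeomorphism UNIV UNIV T T'"
    unfolding homeomorphism_def
  proof (intro conjI ballI)
    show "range T = UNIV" "range T' = UNIV" by (rule surjI[of T T'], rule TT) (rule surjI[of T' T], rule TT)
    show "continuous_on UNIV T" "continuous_on UNIV T'" unfolding T_def T'_def using D by (auto intro!: continuous_intros)
  qed (rule TT)+
  have Tf: "T (f z) = h0 z + cnj (g0 z)" if "z \<in> ball 0 1" for z
    by (simp add: T_def feq[OF that] h0_def g0_def algebra_simps)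
  have img: "(\<lambda>z. h0 z + cnj (g0 z)) ` ball 0 1 = T ` f ` ball 0 1"
    unfolding image_image by (rule image_cong) (use Tf in auto)
  obtain d where "ray_structure (f ` ball 0 1) d" using close_to_convex_ray_structure[OF ctc] by blast
  then obtain d' where d': "ray_structure (T ` f ` ball 0 1) d'"
  proof (rule ray_structure_image[OF _ hom])
    show "T (x + of_real r * v) = T x + of_real r * T v" for x r v by (simp add: T_def algebra_simps)
    show "v = 0" if "T v = 0" for v using TT(1)[of v] that by (simp add: T'_def)
  qed (rule that)
  have inj0: "inj_on (\<lambda>z. h0 z + cnj (g0 z)) (ball 0 1)"
  proof (rule inj_onI)
    fix z w assume zw: "z \<in> ball 0 1" "w \<in> ball 0 1" "h0 z + cnj (g0 z) = h0 w + cnj (g0 w)"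
    then have "T (f z) = T (f w)" by (simp add: Tf)
    then have "f z = f w" by (metis TT(1))
    then show "z = w" using inj_onD[OF injf] zw by blast
  qed
  have lt0: "norm (deriv g0 z) < norm (deriv h0 z)" if "norm z < 1" for z
    unfolding der[OF that] by (rule disc_shear_less[OF c1 lt[OF that]])
  have g00: "deriv g0 0 = 0" and h00: "deriv h0 0 = of_real D"
    using der[of 0] h'0 cc by (simp_all add: c_def)
  define H0 where "H0 = H - fps_const c * G"
  define G0 where "G0 = G - fps_const (cnj c) * H"
  have H0: "h0 has_fps_expansion H0" and G0: "g0 has_fps_expansion G0"
    unfolding h0_def[abs_def] g0_def[abs_def] H0_def G0_def by (intro fps_expansion_intros H G)+
  define A where "A = (real n + 1) * (2 * real n + 1) / 6"
  define B where "B = (real n - 1) * (2 * real n - 1) / 6"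
  have b: "norm (fps_nth H0 n) \<le> D * A" "norm (fps_nth G0 n) \<le> D * B"
    using normalized_coefficient_bounds[OF hol0 inj0 lt0 g00 d'[folded img] H0 G0 n] D h00
    by (simp_all add: A_def B_def mult.assoc)
  have Dc: "of_real D = 1 - c * cnj c" using cc by simp
  have "of_real D * fps_nth H n = fps_nth H0 n + c * fps_nth G0 n"
    unfolding Dc by (simp add: H0_def G0_def algebra_simps)
  then have "D * norm (fps_nth H n) = norm (fps_nth H0 n + c * fps_nth G0 n)" using D by (metis norm_mult norm_of_real abs_of_pos)
  also have "\<dots> \<le> D * A + norm c * (D * B)"
    using b by (intro norm_triangle_le add_mono) (auto simp: norm_mult intro: mult_left_mono)
  finally have "D * norm (fps_nth H n) \<le> D * (A + norm c * B)" by (simp add: algebra_simps)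
  then show "norm (fps_nth H n) \<le> (real n + 1) * (2 * real n + 1) / 6 + norm (deriv g 0) * ((real n - 1) * (2 * real n - 1) / 6)"
    using D by (simp add: A_def B_def c_def)
  have "of_real D * fps_nth G n = fps_nth G0 n + cnj c * fps_nth H0 n"
    unfolding Dc by (simp add: H0_def G0_def algebra_simps)
  then have "D * norm (fps_nth G n) = norm (fps_nth G0 n + cnj c * fps_nth H0 n)" using D by (metis norm_mult norm_of_real abs_of_pos)
  also have "\<dots> \<le> D * B + norm c * (D * A)"
    using b by (intro norm_triangle_le add_mono) (auto simp: norm_mult intro: mult_left_mono)
  finally have "D * norm (fps_nth G n) \<le> D * (B + norm c * A)" by (simp add: algebra_simps)
  then show "norm (fps_nth G n) \<le> (real n - 1) * (2 * real n - 1) / 6 + norm (deriv g 0) * ((real n + 1) * (2 * real n + 1) / 6)"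
    using D by (simp add: A_def B_def c_def)
qed

section \<open>A sufficient coefficient condition\<close>

text \<open>In the geometric factorization of the difference one of the n terms is bounded by 1 and
  the others by |z|; for n at least 2 their average is at most (1 + |z|) / 2. This gain over the
  factor n makes the perturbation strictly contracting in the open disc even when equality holds in
  the coefficient condition.\<close>

lemma norm_power_diff_le:
  fixes z w :: complex
  assumes n: "n \<ge> 2" and zw: "norm z \<le> 1" "norm w \<le> 1"
  shows "norm (z ^ n - w ^ n) \<le> real n * ((1 + norm z) / 2) * norm (z - w)"
proof -
  define \<rho> where "\<rho> = norm z"
  obtain m where m: "n = Suc m" "m \<ge> 1" using n by (cases n) auto
  have "z ^ n - w ^ n = (z - w) * (\<Sum>p<n. z ^ p * w ^ (m - p))" unfolding m(1) diff_power_eq_sum ..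
  moreover have "norm (\<Sum>p<n. z ^ p * w ^ (m - p)) \<le> real n * ((1 + \<rho>) / 2)"
  proof -
    have "norm (\<Sum>p<n. z ^ p * w ^ (m - p)) \<le> (\<Sum>p<n. \<rho> ^ p)"
    proof (rule sum_norm_le)
      fix p
      have "norm w ^ (m - p) \<le> 1" using zw by (simp add: power_le_one)
      then show "norm (z ^ p * w ^ (m - p)) \<le> \<rho> ^ p"
        by (simp add: norm_mult norm_power \<rho>_def mult_left_le)
    qed
    also have "\<dots> = 1 + (\<Sum>p<m. \<rho> ^ Suc p)" unfolding m(1) sum.lessThan_Suc_shift by simp
    also have "(\<Sum>p<m. \<rho> ^ Suc p) \<le> (\<Sum>p<m. \<rho>)"
      using zw by (intro sum_mono) (simp add: \<rho>_def mult_left_le power_le_one)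
    also have "1 + (\<Sum>p<m. \<rho>) \<le> real n * ((1 + \<rho>) / 2)"
    proof -
      have "0 \<le> (real m - 1) * (1 - \<rho>)" using m zw by (simp add: \<rho>_def)
      then show ?thesis by (simp add: m(1) field_simps)
    qed
    finally show ?thesis by simp
  qed
  ultimately have "norm (z ^ n - w ^ n) \<le> norm (z - w) * (real n * ((1 + \<rho>) / 2))"
    by (simp only: norm_mult mult_left_mono norm_ge_zero)
  then show ?thesis by (simp only: \<rho>_def mult.commute)
qed

lemma lipschitz_bound_deriv:
  assumes der: "(P has_field_derivative D) (at z)"
    and lip: "eventually (\<lambda>w. norm (P w - P z) \<le> L * norm (w - z)) (at z)"
  shows "norm (D :: complex) \<le> L"
proof (rule tendsto_upperbound)
  show "((\<lambda>w. norm ((P w - P z) / (w - z))) \<longlongrightarrow> norm D) (at z)"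
    using der unfolding has_field_derivative_iff by (rule tendsto_norm)
  show "eventually (\<lambda>w. norm ((P w - P z) / (w - z)) \<le> L) (at z)"
    using lip eventually_neq_at_within[of z z UNIV] by eventually_elim (simp add: norm_divide divide_le_eq)
qed simp

text \<open>The part of a power series from degree 2 on; \<open>total\<close> is a Lipschitz
  constant for it on the closed disc.\<close>

locale higher_order_series =
  fixes c :: "nat \<Rightarrow> complex"
  assumes low: "c 0 = 0" "c (Suc 0) = 0" and sum: "summable (\<lambda>n. real n * norm (c n))"
begin

definition total :: real where "total = (\<Sum>n. real n * norm (c n))"
definition series :: "complex \<Rightarrow> complex" where "series z = (\<Sum>n. c n * z ^ n)"

lemma summable_terms:
  assumes "norm z \<le> 1" shows "summable (\<lambda>n. c n * z ^ n)"
proof (rule summable_comparison_test'[OF sum, of 0])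
  fix n
  have "norm (c n) * norm z ^ n \<le> norm (c n)" using assms by (simp add: mult_left_le power_le_one)
  also have "\<dots> \<le> real n * norm (c n)"
    using low by (cases n) (auto simp: algebra_simps)
  finally show "norm (c n * z ^ n) \<le> real n * norm (c n)" by (simp add: norm_mult norm_power)
qed

lemma lipschitz:
  assumes "norm z \<le> 1" "norm w \<le> 1"
  shows "norm (series z - series w) \<le> (1 + norm z) / 2 * total * norm (z - w)"
proof -
  have "series z - series w = (\<Sum>n. c n * z ^ n - c n * w ^ n)"
    unfolding series_def by (rule suminf_diff) (intro summable_terms assms)+
  also have "norm \<dots> \<le> (\<Sum>n. (1 + norm z) / 2 * norm (z - w) * (real n * norm (c n)))"
  proof (rule norm_suminf_le)
    fix n
    show "norm (c n * z ^ n - c n * w ^ n) \<le> (1 + norm z) / 2 * norm (z - w) * (real n * norm (c n))"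
    proof (cases "n \<ge> 2")
      case True
      have "norm (c n * z ^ n - c n * w ^ n) = norm (c n) * norm (z ^ n - w ^ n)"
        by (simp add: norm_mult flip: right_diff_distrib)
      also have "\<dots> \<le> norm (c n) * (real n * ((1 + norm z) / 2) * norm (z - w))"
        by (intro mult_left_mono norm_power_diff_le True assms) auto
      finally show ?thesis by (simp add: mult_ac)
    next
      case False
      then have "c n = 0" using low by (cases n) (auto simp: numeral_2_eq_2 not_le less_Suc_eq)
      then show ?thesis by simp
    qed
  qed (intro summable_mult sum)
  also have "\<dots> = (1 + norm z) / 2 * norm (z - w) * total"
    unfolding total_def by (rule suminf_mult[OF sum])
  finally show ?thesis by (simp add: mult_ac)
qed

lemma holomorphic: "series holomorphic_on ball 0 1"
proof (rule power_series_holomorphic[of 0 1 c])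
  show "(\<lambda>n. c n * (w - 0) ^ n) sums series w" if "w \<in> ball 0 1" for w
    using summable_sums[OF summable_terms[of w]] that by (simp add: series_def)
qed

lemma deriv_bound:
  assumes z: "norm z < 1" shows "norm (deriv series z) \<le> (1 + norm z) / 2 * total"
proof (rule lipschitz_bound_deriv)
  show "(series has_field_derivative deriv series z) (at z)"
    by (rule holomorphic_derivI[OF holomorphic]) (use z in auto)
  have "eventually (\<lambda>w. w \<in> ball 0 1) (at z)"
    by (rule eventually_at_in_open') (use z in auto)
  then show "eventually (\<lambda>w. norm (series w - series z) \<le> (1 + norm z) / 2 * total * norm (w - z)) (at z)"
    by eventually_elim (use lipschitz[of z] z in \<open>auto simp: norm_minus_commute\<close>)
qed

lemma deriv_0: "deriv series 0 = 0" and series_0: "series 0 = 0"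
proof -
  show "series 0 = 0" unfolding series_def using low by (simp add: powser_zero)
  have "series has_fps_expansion Abs_fps c"
    by (rule has_fps_expansionI)
       (use summable_sums[OF summable_terms] in \<open>auto simp: series_def eventually_nhds_metric intro!: exI[of _ 1]\<close>)
  from has_fps_expansion_deriv[OF this] have "deriv series 0 = fps_nth (fps_deriv (Abs_fps c)) 0"
    using has_fps_expansion_imp_0_eq_fps_nth_0 by fastforce
  then show "deriv series 0 = 0" using low by simp
qed

end

text \<open>The law of cosines, arranged into a radial and an angular part; the angular part grows
  with the product of the radii, which separates normals outside the unit disc.\<close>

lemma polar_dist:
  fixes x y :: complex
  assumes x: "x \<noteq> 0" "y \<noteq> 0"
  shows "(norm (x - y))\<^sup>2 = (norm x - norm y)\<^sup>2 + norm x * norm y * (norm (sgn x - sgn y))\<^sup>2"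
proof -
  have e: "(norm (u - v))\<^sup>2 = (norm u)\<^sup>2 + (norm v)\<^sup>2 - 2 * Re (u * cnj v)" for u v :: complex
    unfolding cmod_power2 by (simp add: power2_eq_square algebra_simps)
  have "norm x * norm y * Re (sgn x * cnj (sgn y)) = Re (x * cnj y)"
    using x by (simp add: sgn_eq)
  then show ?thesis unfolding e using x by (simp add: norm_sgn power2_eq_square algebra_simps)
qed


theorem harmonic_series_close_to_convex:
  fixes f :: "complex \<Rightarrow> complex"
  assumes \<alpha>: "higher_order_series \<alpha>" and \<beta>: "higher_order_series \<beta>" and b: "norm b < 1"
    and le: "higher_order_series.total \<alpha> + norm b + higher_order_series.total \<beta> \<le> 1"
    and f: "\<And>z. norm z < 1 \<Longrightarrow> f z = z + higher_order_series.series \<alpha> z + cnj (b * z + higher_order_series.series \<beta> z)"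
  shows "f \<in> C_H_hat"
proof -
  interpret p: higher_order_series \<alpha> by (rule \<alpha>)
  interpret q: higher_order_series \<beta> by (rule \<beta>)
  \<comment> \<open>With \<theta> = (1 + |z|) / 2 the coefficient condition gives
    \<open>\<kappa> z \<le> 1 - (1 - \<theta>) * (1 - norm b)\<close>, so \<open>norm b < 1\<close>
    makes it less than 1 in the open disc.\<close>
  define \<kappa> where "\<kappa> z = (1 + norm z) / 2 * (p.total + q.total) + norm b" for z :: complex
  have \<kappa>: "\<kappa> z \<le> 1" "norm z < 1 \<Longrightarrow> \<kappa> z < 1" if z: "norm z \<le> 1" for z
  proof -
    define \<theta> where "\<theta> = (1 + norm z) / 2"
    have "\<theta> * (p.total + q.total) \<le> \<theta> * (1 - norm b)" using le by (intro mult_left_mono) (auto simp: \<theta>_def)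
    then have k: "\<kappa> z \<le> 1 - (1 - \<theta>) * (1 - norm b)" by (simp add: \<kappa>_def \<theta>_def[symmetric] algebra_simps)
    have "(1 - \<theta>) * (1 - norm b) \<ge> 0" using z b by (intro mult_nonneg_nonneg) (auto simp: \<theta>_def)
    then show "\<kappa> z \<le> 1" using k by linarith
    show "\<kappa> z < 1" if "norm z < 1"
    proof -
      have "(1 - \<theta>) * (1 - norm b) > 0" using that b by (intro mult_pos_pos) (auto simp: \<theta>_def)
      then show ?thesis using k by linarith
    qed
  qed
  define \<Phi> where "\<Phi> z = p.series z + cnj (b * z + q.series z)" for z
  have lip: "norm (\<Phi> z - \<Phi> w) \<le> \<kappa> z * norm (z - w)" if "norm z \<le> 1" "norm w \<le> 1" for z w
  proof -
    have "\<Phi> z - \<Phi> w = (p.series z - p.series w) + cnj (b * (z - w) + (q.series z - q.series w))" by (simp add: \<Phi>_def algebra_simps)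
    also have "norm \<dots> \<le> norm (p.series z - p.series w) + (norm (b * (z - w)) + norm (q.series z - q.series w))"
      by (intro norm_triangle_mono order_refl) (simp only: complex_mod_cnj norm_triangle_ineq)
    also have "\<dots> \<le> (1 + norm z) / 2 * p.total * norm (z - w) + (norm b * norm (z - w) + (1 + norm z) / 2 * q.total * norm (z - w))"
      by (intro add_mono p.lipschitz q.lipschitz that) (simp add: norm_mult)
    also have "\<dots> = \<kappa> z * norm (z - w)" by (simp add: \<kappa>_def algebra_simps add_divide_distrib)
    finally show ?thesis .
  qed
  have lip1: "norm (\<Phi> z - \<Phi> w) \<le> norm (z - w)" if "norm z \<le> 1" "norm w \<le> 1" for z w
    using lip[OF that] mult_right_mono[OF \<kappa>(1)[OF that(1)], of "norm (z - w)"] by simp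
  have lip_strict: "norm (\<Phi> z - \<Phi> w) < norm (z - w)" if "norm z < 1" "norm w \<le> 1" "z \<noteq> w" for z w
  proof -
    have "\<kappa> z * norm (z - w) < 1 * norm (z - w)"
      using \<kappa>(2)[of z] that by (intro mult_strict_right_mono) auto
    then show ?thesis using lip[OF less_imp_le[OF that(1)] that(2)] by linarith
  qed
  have \<Phi>0: "\<Phi> 0 = 0" by (simp add: \<Phi>_def p.series_0 q.series_0)
  have \<Phi>1: "norm (\<Phi> z) \<le> 1" if "norm z \<le> 1" for z using lip1[OF that, of 0] that \<Phi>0 by simp
  have f\<Phi>: "f z = z + \<Phi> z" if "norm z < 1" for z using f[OF that] by (simp add: \<Phi>_def add.assoc)
  define h where "h z = z + p.series z" for z
  define g where "g z = b * z + q.series z" for z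
  have hol: "h holomorphic_on ball 0 1" "g holomorphic_on ball 0 1"
    unfolding h_def g_def by (intro holomorphic_intros p.holomorphic q.holomorphic)+
  have feq: "f z = h z + cnj (g z)" if "z \<in> ball 0 1" for z using f[of z] that by (simp add: h_def g_def)
  have der: "deriv h z = 1 + deriv p.series z" "deriv g z = b + deriv q.series z" if "norm z < 1" for z
  proof -
    have d: "(p.series has_field_derivative deriv p.series z) (at z)" "(q.series has_field_derivative deriv q.series z) (at z)"
      using holomorphic_derivI[OF p.holomorphic open_ball] holomorphic_derivI[OF q.holomorphic open_ball] that by auto
    show "deriv h z = 1 + deriv p.series z" unfolding h_def[abs_def]
      by (intro DERIV_imp_deriv DERIV_add DERIV_ident d)
    show "deriv g z = b + deriv q.series z" unfolding g_def[abs_def]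
      by (intro DERIV_imp_deriv DERIV_add DERIV_cmult_Id d)
  qed
  have lt: "norm (deriv g z) < norm (deriv h z)" if z: "norm z < 1" for z
  proof -
    have "norm (deriv g z) \<le> norm b + (1 + norm z) / 2 * q.total"
      unfolding der[OF z] using norm_triangle_ineq[of b "deriv q.series z"] q.deriv_bound[OF z] by linarith
    moreover have "norm (deriv h z) \<ge> 1 - (1 + norm z) / 2 * p.total"
      unfolding der[OF z] using norm_diff_ineq[of 1 "deriv p.series z"] p.deriv_bound[OF z] by simp
    ultimately show ?thesis using \<kappa>(2)[of z] z by (simp add: \<kappa>_def distrib_left)
  qed
  have "harmonic_decomp f h g"
    unfolding harmonic_decomp_def using hol feq der[of 0] b
    by (simp add: h_def g_def p.series_0 q.series_0 p.deriv_0 q.deriv_0)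
  then have Hh: "f \<in> H_hat" by (auto simp: H_hat_def)
  have sp: "sense_preserving_on f (ball 0 1)"
    unfolding sense_preserving_on_def
  proof (intro ballI conjI)
    fix z :: complex assume z: "z \<in> ball 0 1"
    show "f differentiable (at z)"
      using harmonic_has_derivative[OF hol open_ball z feq] by (auto simp: differentiable_def)
    have "(norm (deriv g z))\<^sup>2 < (norm (deriv h z))\<^sup>2" using lt[of z] z by (intro power_strict_mono) auto
    then show "jacobian f z > 0" using harmonic_jacobian[OF hol open_ball z feq] by simp
  qed
  have inj: "inj_on f (ball 0 1)"
  proof (rule inj_onI, rule ccontr)
    fix z w assume zw: "z \<in> ball 0 1" "w \<in> ball 0 1" "f z = f w" "z \<noteq> w"
    then have "\<Phi> z - \<Phi> w = w - z" using f\<Phi>[of z] f\<Phi>[of w] by (simp add: algebra_simps)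
    then show False using lip_strict[of z w] zw by (simp add: norm_minus_commute)
  qed
  have contf: "continuous_on (ball 0 1) f"
  proof (rule continuous_on_eq)
    show "continuous_on (ball 0 1) (\<lambda>z. h z + cnj (g z))"
      by (intro continuous_on_add continuous_on_cnj holomorphic_on_imp_continuous_on hol)
  qed (use feq in auto)
  define pr where "pr x = closest_point (cball 0 1) x" for x :: complex
  have pr_in: "norm (pr x) \<le> 1" for x
    using closest_point_in_set[of "cball 0 1" x] by (simp add: pr_def)
  have pr_self: "pr x = x" if "norm x \<le> 1" for x unfolding pr_def by (rule closest_point_self) (use that in simp)
  have pr_out: "pr x = sgn x" if "norm x > 1" for x
  proof -
    have x0: "x \<noteq> 0" using that by auto
    have "sgn x = closest_point (cball 0 1) x"
    proof (rule closest_point_unique)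
      show "\<forall>z\<in>cball 0 1. dist x (sgn x) \<le> dist x z"
      proof
        fix z :: complex assume z: "z \<in> cball 0 1"
        have "x - sgn x = of_real (norm x - 1) * sgn x" using x0 by (simp add: sgn_eq left_diff_distrib diff_divide_distrib)
        then have "norm (x - sgn x) = \<bar>norm x - 1\<bar> * norm (sgn x)" by (metis norm_mult norm_of_real)
        then have "dist x (sgn x) = norm x - 1" using that x0 by (simp add: dist_norm norm_sgn)
        also have "\<dots> \<le> norm x - norm z" using z by simp
        also have "\<dots> \<le> dist x z" by (simp add: dist_norm norm_triangle_ineq2)
        finally show "dist x (sgn x) \<le> dist x z" .
      qed
    qed (use x0 in \<open>auto simp: norm_sgn\<close>)
    then show ?thesis by (simp add: pr_def)
  qed
  have pr_lip: "norm (pr x - pr y) \<le> norm (x - y)" for x y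
    using closest_point_lipschitz[of "cball 0 1" x y] by (simp add: pr_def dist_norm)
  have pr_cont: "continuous_on S pr" for S unfolding pr_def by (rule continuous_on_closest_point) auto
  have \<Phi>cont: "continuous_on (cball 0 1) \<Phi>"
    unfolding continuous_on_iff
  proof (intro ballI allI impI)
    fix x e assume "x \<in> cball (0::complex) 1" "(0::real) < e"
    then show "\<exists>d>0. \<forall>x'\<in>cball 0 1. dist x' x < d \<longrightarrow> dist (\<Phi> x') (\<Phi> x) < e"
      by (intro exI[of _ e]) (auto simp: dist_norm intro: le_less_trans[OF lip1])
  qed
  \<comment> \<open>The identity plus \<open>\<Phi>\<close> after the nearest point projection: it
    equals \<open>f\<close> on the open disc and maps the outer normal at each
    \<open>\<zeta>\<close> of the circle onto \<open>ray \<zeta>\<close>.\<close>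
  define \<Psi> where "\<Psi> x = x + \<Phi> (pr x)" for x
  \<comment> \<open>A solution of \<open>\<Psi> x = y\<close> is a fixed point of
    \<open>y - \<Phi> (pr x)\<close>, which maps the disc of radius \<open>norm y + 1\<close> into
    itself because \<open>norm (\<Phi> z) \<le> 1\<close> on the closed unit disc.\<close>
  have surj: "\<exists>x. \<Psi> x = y" for y
  proof -
    let ?B = "cball (0::complex) (norm y + 1)"
    obtain x where "y - \<Phi> (pr x) = x"
    proof (rule brouwer[of ?B "\<lambda>x. y - \<Phi> (pr x)"])
      show "?B \<noteq> {}" using norm_ge_zero[of y] by (simp add: not_less del: norm_ge_zero)
      show "continuous_on ?B (\<lambda>x. y - \<Phi> (pr x))"
        by (intro continuous_intros continuous_on_compose2[OF \<Phi>cont pr_cont]) (use pr_in in auto)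
      show "(\<lambda>x. y - \<Phi> (pr x)) \<in> ?B \<rightarrow> ?B"
        using \<Phi>1[OF pr_in] norm_triangle_ineq4[of y] by (fastforce intro: order_trans)
    qed auto
    then have "\<Psi> x = y" by (auto simp: \<Psi>_def algebra_simps)
    then show ?thesis ..
  qed
  define ray where "ray \<zeta> = {\<zeta> + \<Phi> \<zeta> + of_real t * \<zeta> |t. 0 \<le> (t::real)}" for \<zeta>
  have out: "\<Psi> (of_real (1 + t) * \<zeta>) = \<zeta> + \<Phi> \<zeta> + of_real t * \<zeta>" if "norm \<zeta> = 1" "t \<ge> 0" for \<zeta> t
  proof -
    have "pr (of_real (1 + t) * \<zeta>) = \<zeta>"
    proof (cases "t = 0")
      case True then show ?thesis using pr_self[of \<zeta>] that by simp
    next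
      case False
      have n: "norm (of_real (1 + t) * \<zeta>) = 1 + t" using that by (simp only: norm_mult norm_of_real) simp
      have "complex_of_real (1 + t) \<noteq> 0" using that unfolding of_real_eq_0_iff by linarith
      then have "sgn (of_real (1 + t) * \<zeta>) = \<zeta>" unfolding sgn_eq n by simp
      then show ?thesis using pr_out[of "of_real (1 + t) * \<zeta>"] n that False by simp
    qed
    then show ?thesis by (simp add: \<Psi>_def algebra_simps)
  qed
  have compl: "\<Union> (ray ` sphere 0 1) = - f ` ball 0 1"
  proof (intro equalityI subsetI)
    fix y assume "y \<in> \<Union> (ray ` sphere 0 1)"
    then obtain \<zeta> t where z: "norm \<zeta> = 1" "t \<ge> 0" "y = \<zeta> + \<Phi> \<zeta> + of_real t * \<zeta>" by (auto simp: ray_def)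
    have "y \<noteq> f w" if w: "norm w < 1" for w
    proof
      assume "y = f w"
      define x where "x = of_real (1 + t) * \<zeta>"
      have nx: "norm x = 1 + t" unfolding x_def using z by (simp only: norm_mult norm_of_real) simp
      have "\<Psi> x = \<Psi> w" using out[OF z(1,2)] z(3) \<open>y = f w\<close> f\<Phi>[OF w] pr_self[of w] w by (simp add: x_def \<Psi>_def)
      then have "w - x = \<Phi> (pr x) - \<Phi> (pr w)" by (simp add: \<Psi>_def algebra_simps)
      moreover have ne: "w \<noteq> pr x" using pr_out[of x] pr_self[of x] nx z(2) w by (cases "t = 0") (auto simp: norm_sgn split: if_splits)
      \<comment> \<open>\<open>\<Phi>\<close> strictly shrinks the distance between \<open>w\<close>
        and \<open>pr x\<close>, and the projection does not increase distances, so equal images are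
        impossible.\<close>
      ultimately have "norm (w - x) < norm (w - pr x)"
        using lip_strict[OF w pr_in ne] pr_self[of w] w by (simp add: norm_minus_commute)
      also have "\<dots> \<le> norm (w - x)" using pr_lip[of w x] pr_self[of w] w by simp
      finally show False by simp
    qed
    then have "y \<notin> f ` ball 0 1" by (metis imageE dist_0_norm mem_ball)
    then show "y \<in> - f ` ball 0 1" by simp
  next
    fix y assume y: "y \<in> - f ` ball 0 1"
    obtain x where x: "\<Psi> x = y" using surj by blast
    have nx: "norm x \<ge> 1"
    proof (rule ccontr)
      assume "\<not> ?thesis"
      then have "f x = y" using x f\<Phi>[of x] pr_self[of x] by (simp add: \<Psi>_def)
      then show False using y \<open>\<not> 1 \<le> norm x\<close> by auto
    qed
    have x0: "x \<noteq> 0" using nx by auto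
    have xs: "x = of_real (1 + (norm x - 1)) * sgn x" using x0 by (simp add: sgn_eq)
    have s1: "norm (sgn x) = 1" using x0 by (simp add: norm_sgn)
    have "y = sgn x + \<Phi> (sgn x) + of_real (norm x - 1) * sgn x"
      using out[OF s1, of "norm x - 1"] xs x nx by simp
    then have "y \<in> ray (sgn x)" unfolding ray_def using nx by (auto intro!: exI[of _ "norm x - 1"])
    then show "y \<in> \<Union> (ray ` sphere 0 1)" using s1 by auto
  qed
  \<comment> \<open>At a crossing the points \<open>x\<close> and \<open>x'\<close> on the two
    normals are at most as far apart as \<open>\<zeta>\<close> and \<open>\<xi>\<close>, while
    outside the closed disc points of distinct normals are farther apart than the base
    points.\<close>
  have disj: "disjnt (rel_interior (ray \<zeta>)) (rel_interior (ray \<xi>))"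
    if z: "norm \<zeta> = 1" "norm \<xi> = 1" "\<zeta> \<noteq> \<xi>" for \<zeta> \<xi>
    unfolding disjnt_iff
  proof (intro allI notI)
    fix y assume "y \<in> rel_interior (ray \<zeta>) \<and> y \<in> rel_interior (ray \<xi>)"
    moreover have "rel_interior (ray \<zeta>) = {\<zeta> + \<Phi> \<zeta> + of_real t * \<zeta> |t. 0 < (t::real)}"
      "rel_interior (ray \<xi>) = {\<xi> + \<Phi> \<xi> + of_real t * \<xi> |t. 0 < (t::real)}"
      unfolding ray_def by (rule rel_interior_half_line; use z in auto)+
    ultimately obtain t s where ts: "t > 0" "s > 0" "y = \<zeta> + \<Phi> \<zeta> + of_real t * \<zeta>" "y = \<xi> + \<Phi> \<xi> + of_real s * \<xi>" by auto
    define x where "x = of_real (1 + t) * \<zeta>"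
    define x' where "x' = of_real (1 + s) * \<xi>"
    have n: "norm x = 1 + t" "norm x' = 1 + s" unfolding x_def x'_def using z ts by (simp_all only: norm_mult norm_of_real) simp_all
    have "complex_of_real (1 + t) \<noteq> 0" "complex_of_real (1 + s) \<noteq> 0" using ts unfolding of_real_eq_0_iff by linarith+
    then have sg: "sgn x = \<zeta>" "sgn x' = \<xi>" unfolding sgn_eq n by (simp_all add: x_def x'_def)
    have "x - x' = \<Phi> \<xi> - \<Phi> \<zeta>" using ts(3,4) by (simp add: x_def x'_def algebra_simps)
    then have "norm (x - x') \<le> norm (\<zeta> - \<xi>)" using lip1[of \<xi> \<zeta>] z by (simp add: norm_minus_commute)
    then have le: "(norm (x - x'))\<^sup>2 \<le> (norm (\<zeta> - \<xi>))\<^sup>2" by (intro power_mono) auto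
    have x0: "x \<noteq> 0" "x' \<noteq> 0" using n ts by auto
    have "1 < (1 + t) * (1 + s)" using ts by (simp add: algebra_simps add_pos_pos)
    then have "(norm (\<zeta> - \<xi>))\<^sup>2 < (1 + t) * (1 + s) * (norm (\<zeta> - \<xi>))\<^sup>2"
      using z(3) mult_strict_right_mono[of 1 "(1 + t) * (1 + s)" "(norm (\<zeta> - \<xi>))\<^sup>2"] by simp
    also have "\<dots> \<le> (norm (x - x'))\<^sup>2" using polar_dist[OF x0] by (simp add: n sg)
    finally show False using le by simp
  qed
  have "close_to_convex (f ` ball 0 1)"
    unfolding close_to_convex_def
  proof (intro conjI exI[of _ "ray ` sphere 0 1"])
    show "open (f ` ball 0 1)" by (rule invariance_of_domain[OF contf open_ball inj])
    show "connected (f ` ball 0 1)" by (rule connected_continuous_image[OF contf]) simp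
    show "f ` ball 0 1 \<noteq> {}" by simp
    show "\<forall>R\<in>ray ` sphere 0 1. half_line R" unfolding half_line_def ray_def by (auto; metis norm_zero zero_neq_one)
    show "\<Union> (ray ` sphere 0 1) = - f ` ball 0 1" by (rule compl)
    show "pairwise (\<lambda>R R'. disjnt (rel_interior R) (rel_interior R')) (ray ` sphere 0 1)"
    proof (rule pairwiseI)
      fix R R' assume R: "R \<in> ray ` sphere 0 1" "R' \<in> ray ` sphere 0 1" "R \<noteq> R'"
      obtain \<zeta> where \<zeta>: "R = ray \<zeta>" "\<zeta> \<in> sphere 0 1" using R(1) by blast
      obtain \<xi> where \<xi>: "R' = ray \<xi>" "\<xi> \<in> sphere 0 1" using R(2) by blast
      have "\<zeta> \<noteq> \<xi>" using R(3) \<zeta> \<xi> by blast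
      then show "disjnt (rel_interior R) (rel_interior R')" using disj \<zeta> \<xi> by simp
    qed
  qed
  then show ?thesis using Hh sp inj by (simp add: C_H_hat_def S_H_hat_def)
qed

section \<open>Wright functions\<close>

lemma wright_coeff_pos:
  assumes "a > 0" "b \<ge> 0" "c > 0" "d \<ge> 0" "n \<ge> 1" shows "wright_coeff a b c d n > 0"
  using assms by (auto simp: wright_coeff_def intro!: divide_pos_pos mult_pos_pos Gamma_real_pos add_pos_nonneg)

lemma diffs_2: "(diffs ^^ 2) c n = of_nat (Suc n) * (of_nat (n + 2) * c (n + 2))"
  by (simp add: numeral_2_eq_2 diffs_def)

lemma diffs_3: "(diffs ^^ 3) c n = of_nat (Suc n) * (of_nat (n + 2) * (of_nat (n + 3) * c (n + 3)))"
  by (simp add: numeral_3_eq_3 diffs_def)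

lemma sums_shift_zero:
  fixes f :: "nat \<Rightarrow> real"
  assumes "(\<lambda>n. f (n + k)) sums s" "\<And>i. i < k \<Longrightarrow> f i = 0"
  shows "f sums s"
  using assms(1) sums_iff_shift'[of f k s] assms(2) by (simp add: sum.neutral)

text \<open>In falling factorials, n (n + 1) (2 n + 1) = 2 n (n - 1) (n - 2) + 9 n (n - 1) + 6 n and
  n (n - 1) (2 n - 1) = 2 n (n - 1) (n - 2) + 3 n (n - 1). This is the origin of the constants 2, 9,
  6 and 2, 3 in the hypothesis.\<close>

lemma wright_weighted_sums:
  assumes pos: "a > 0" "b \<ge> 0" "c > 0" "d \<ge> 0"
    and sm: "\<forall>k\<in>{1, 2, 3}. summable (wright_deriv_coeff k a b c d)"
  defines "W \<equiv> \<lambda>k. wright_deriv_at_1 k a b c d" and "w \<equiv> wright_coeff a b c d"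
  shows "(\<lambda>n. real n * (real n + 1) * (2 * real n + 1) * w n) sums (2 * W 3 + 9 * W 2 + 6 * W 1)"
    and "(\<lambda>n. real n * (real n - 1) * (2 * real n - 1) * w n) sums (2 * W 3 + 3 * W 2)"
    and "summable (\<lambda>n. real n * w n)"
proof -
  have S: "(diffs ^^ k) w sums W k" if "k \<in> {1, 2, 3}" for k
    using sm that unfolding W_def wright_deriv_at_1_def wright_deriv_coeff_def w_def by (auto intro: summable_sums)
  have 1: "(\<lambda>n. real n * w n) sums W 1"
  proof (rule sums_shift_zero[of _ 1])
    show "(\<lambda>n. real (n + 1) * w (n + 1)) sums W 1" using S[of 1] by (simp add: diffs_def)
  qed simp
  have 2: "(\<lambda>n. real n * (real n - 1) * w n) sums W 2"
  proof (rule sums_shift_zero[of _ 2])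
    have "(\<lambda>n. real (n + 2) * (real (n + 2) - 1) * w (n + 2)) = (diffs ^^ 2) w"
      by (rule ext) (simp add: diffs_2 algebra_simps)
    then show "(\<lambda>n. real (n + 2) * (real (n + 2) - 1) * w (n + 2)) sums W 2" using S[of 2] by simp
  qed (auto simp: numeral_2_eq_2 less_Suc_eq)
  have 3: "(\<lambda>n. real n * (real n - 1) * (real n - 2) * w n) sums W 3"
  proof (rule sums_shift_zero[of _ 3])
    have "(\<lambda>n. real (n + 3) * (real (n + 3) - 1) * (real (n + 3) - 2) * w (n + 3)) = (diffs ^^ 3) w"
      by (rule ext) (simp add: diffs_3 algebra_simps)
    then show "(\<lambda>n. real (n + 3) * (real (n + 3) - 1) * (real (n + 3) - 2) * w (n + 3)) sums W 3" using S[of 3] by simp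
  qed (auto simp: numeral_3_eq_3 less_Suc_eq)
  have "(\<lambda>n. 2 * (real n * (real n - 1) * (real n - 2) * w n) + 9 * (real n * (real n - 1) * w n) + 6 * (real n * w n)) sums
      (2 * W 3 + 9 * W 2 + 6 * W 1)"
    by (intro sums_add sums_mult 1 2 3)
  moreover have "2 * (real n * (real n - 1) * (real n - 2) * w n) + 9 * (real n * (real n - 1) * w n) + 6 * (real n * w n) =
      real n * (real n + 1) * (2 * real n + 1) * w n" for n by (simp add: algebra_simps)
  ultimately show "(\<lambda>n. real n * (real n + 1) * (2 * real n + 1) * w n) sums (2 * W 3 + 9 * W 2 + 6 * W 1)" by simp
  have "(\<lambda>n. 2 * (real n * (real n - 1) * (real n - 2) * w n) + 3 * (real n * (real n - 1) * w n)) sums (2 * W 3 + 3 * W 2)"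
    by (intro sums_add sums_mult 2 3)
  moreover have "2 * (real n * (real n - 1) * (real n - 2) * w n) + 3 * (real n * (real n - 1) * w n) =
      real n * (real n - 1) * (2 * real n - 1) * w n" for n by (simp add: algebra_simps)
  ultimately show "(\<lambda>n. real n * (real n - 1) * (2 * real n - 1) * w n) sums (2 * W 3 + 3 * W 2)" by simp
  show "summable (\<lambda>n. real n * w n)" using 1 by (rule sums_summable)
qed

text \<open>The Hadamard product is defined through \<open>fps_expansion\<close>, so the expansion
  of the Wright function has to be identified with its coefficients. Convergence at 1 of the
  weighted series dominates the series in the disc.\<close>

lemma wright_fps_expansion:
  assumes pos: "a > 0" "b \<ge> 0" "c > 0" "d \<ge> 0" and sm: "summable (\<lambda>n. real n * wright_coeff a b c d n)"
  shows "fps_nth (fps_expansion (wright a b c d) 0) n = of_real (wright_coeff a b c d n)"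
proof -
  have sz: "summable (\<lambda>n. of_real (wright_coeff a b c d n) * z ^ n)" if "norm z < 1" for z :: complex
  proof (rule summable_comparison_test'[OF sm, of 0])
    fix n
    have w0: "wright_coeff a b c d n \<ge> 0"
      using wright_coeff_pos[OF pos, of n] by (cases "n = 0") (auto simp: wright_coeff_def)
    have "wright_coeff a b c d n * norm z ^ n \<le> wright_coeff a b c d n"
      using w0 that by (simp add: mult_left_le power_le_one)
    also have "\<dots> \<le> real n * wright_coeff a b c d n"
      using w0 by (cases n) (auto simp: wright_coeff_def algebra_simps)
    finally show "norm (of_real (wright_coeff a b c d n) * z ^ n) \<le> real n * wright_coeff a b c d n"
      using w0 by (simp add: norm_mult norm_power)
  qed
  have su: "(\<lambda>n. of_real (wright_coeff a b c d n) * z ^ n) sums wright a b c d z" if "norm z < 1" for z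
    using summable_sums[OF sz[OF that]] by (simp add: wright_def)
  have "wright a b c d has_fps_expansion Abs_fps (\<lambda>n. of_real (wright_coeff a b c d n))"
    by (rule has_fps_expansionI)
       (use su in \<open>auto simp: eventually_nhds_metric intro!: exI[of _ 1]\<close>)
  moreover have "wright a b c d holomorphic_on ball 0 1"
    by (rule power_series_holomorphic[of 0 1 "\<lambda>n. of_real (wright_coeff a b c d n)"]) (use su in auto)
  then have "wright a b c d has_fps_expansion fps_expansion (wright a b c d) 0"
    by (intro has_fps_expansion_fps_expansion[of "ball 0 1"]) auto
  ultimately have "fps_expansion (wright a b c d) 0 = Abs_fps (\<lambda>n. of_real (wright_coeff a b c d n))"
    using fps_expansion_unique_complex by blast
  then show ?thesis by simp
qed

text \<open>The linear term is split off. The majorant \<open>A\<close> is summed over all n, so its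
  term at 1 has to be subtracted again.\<close>

lemma weighted_series:
  fixes A :: "nat \<Rightarrow> real" and C c :: "nat \<Rightarrow> complex"
  assumes cdef: "c = (\<lambda>n. if n < 2 then 0 else C n)"
    and C0: "C 0 = 0"
    and le: "\<And>n. n \<ge> 2 \<Longrightarrow> real n * norm (C n) \<le> A n" and sA: "A sums s" and A0: "A 0 = 0"
  shows "higher_order_series c" "higher_order_series.total c \<le> s - A 1"
    "\<And>z. norm z < 1 \<Longrightarrow> (\<lambda>n. C n * z ^ n) sums (C 1 * z + higher_order_series.series c z)"
proof -
  define A' where "A' n = (if n = 1 then 0 else A n)" for n
  have sA': "A' sums (s - A 1)"
  proof -
    have "(\<lambda>n. A n - (if n = 1 then A 1 else 0)) sums (s - A 1)"
      using sums_diff[OF sA sums_single[of 1 "\<lambda>_. A 1"]] by simp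
    moreover have "(\<lambda>n. A n - (if n = 1 then A 1 else 0)) = A'" by (auto simp: A'_def)
    ultimately show ?thesis by simp
  qed
  have bd: "real n * norm (c n) \<le> A' n" for n
    using le[of n] A0 by (cases "n < 2") (auto simp: cdef A'_def numeral_2_eq_2 less_Suc_eq)
  have sc: "summable (\<lambda>n. real n * norm (c n))"
    by (rule summable_comparison_test'[OF sums_summable[OF sA'], of 0]) (use bd in auto)
  show hs: "higher_order_series c"
    by unfold_locales (use sc in \<open>auto simp: cdef\<close>)
  interpret higher_order_series c by (rule hs)
  show "total \<le> s - A 1"
    unfolding total_def by (rule sums_le[OF bd summable_sums[OF sc] sA'])
  fix z :: complex assume z: "norm z < 1"
  have "(\<lambda>n. (if n = 1 then C 1 * z ^ 1 else 0) + c n * z ^ n) sums (C 1 * z ^ 1 + series z)"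
    unfolding series_def by (intro sums_add sums_single summable_sums summable_terms) (use z in auto)
  moreover have "(\<lambda>n. (if n = 1 then C 1 * z ^ 1 else 0) + c n * z ^ n) = (\<lambda>n. C n * z ^ n)"
    using C0 by (auto simp: cdef numeral_2_eq_2 less_Suc_eq)
  ultimately show "(\<lambda>n. C n * z ^ n) sums (C 1 * z + series z)" by simp
qed

theorem theorem10:
  fixes \<alpha>\<^sub>1 \<beta>\<^sub>1 \<gamma>\<^sub>1 \<delta>\<^sub>1 \<alpha>\<^sub>2 \<beta>\<^sub>2 \<gamma>\<^sub>2 \<delta>\<^sub>2 :: real and \<sigma> B\<^sub>1 :: complex
    and f h g :: "complex \<Rightarrow> complex"
    and W\<^sub>1 W\<^sub>2 :: "nat \<Rightarrow> real"
  assumes "\<beta>\<^sub>1 \<ge> 0" "\<beta>\<^sub>2 \<ge> 0" "\<delta>\<^sub>1 \<ge> 0" "\<delta>\<^sub>2 \<ge> 0"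
    and "\<alpha>\<^sub>1 > 0" "\<alpha>\<^sub>2 > 0" "\<gamma>\<^sub>1 > 0" "\<gamma>\<^sub>2 > 0"
    and "norm \<sigma> < 1"
    and "f \<in> C_H_hat" and "harmonic_decomp f h g"
  defines "B\<^sub>1 \<equiv> deriv g 0"
    and "W\<^sub>1 \<equiv> \<lambda>k. wright_deriv_at_1 k \<alpha>\<^sub>1 \<beta>\<^sub>1 \<gamma>\<^sub>1 \<delta>\<^sub>1"
    and "W\<^sub>2 \<equiv> \<lambda>k. wright_deriv_at_1 k \<alpha>\<^sub>2 \<beta>\<^sub>2 \<gamma>\<^sub>2 \<delta>\<^sub>2"
  assumes "\<forall>k\<in>{1, 2, 3}. summable (wright_deriv_coeff k \<alpha>\<^sub>1 \<beta>\<^sub>1 \<gamma>\<^sub>1 \<delta>\<^sub>1)"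
    and "\<forall>k\<in>{1, 2, 3}. summable (wright_deriv_coeff k \<alpha>\<^sub>2 \<beta>\<^sub>2 \<gamma>\<^sub>2 \<delta>\<^sub>2)"
    and "2 * W\<^sub>1 3 + 9 * W\<^sub>1 2 + 6 * (W\<^sub>1 1 - 1) + norm B\<^sub>1 * (2 * W\<^sub>1 3 + 3 * W\<^sub>1 2)
         + 2 * W\<^sub>2 3 + 3 * W\<^sub>2 2 + norm B\<^sub>1 * (2 * W\<^sub>2 3 + 9 * W\<^sub>2 2 + 6 * (W\<^sub>2 1 - 1))
         \<le> 6 * (1 - norm B\<^sub>1)"
  shows "L_op \<alpha>\<^sub>1 \<beta>\<^sub>1 \<gamma>\<^sub>1 \<delta>\<^sub>1 \<alpha>\<^sub>2 \<beta>\<^sub>2 \<gamma>\<^sub>2 \<delta>\<^sub>2 \<sigma> h g \<in> C_H_hat"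
proof -
  note f = \<open>f \<in> C_H_hat\<close> and dec = \<open>harmonic_decomp f h g\<close> and \<sigma> = \<open>norm \<sigma> < 1\<close>
  note pos1 = \<open>\<alpha>\<^sub>1 > 0\<close> \<open>\<beta>\<^sub>1 \<ge> 0\<close> \<open>\<gamma>\<^sub>1 > 0\<close> \<open>\<delta>\<^sub>1 \<ge> 0\<close>
  note pos2 = \<open>\<alpha>\<^sub>2 > 0\<close> \<open>\<beta>\<^sub>2 \<ge> 0\<close> \<open>\<gamma>\<^sub>2 > 0\<close> \<open>\<delta>\<^sub>2 \<ge> 0\<close>
  note sm1 = \<open>\<forall>k\<in>{1, 2, 3}. summable (wright_deriv_coeff k \<alpha>\<^sub>1 \<beta>\<^sub>1 \<gamma>\<^sub>1 \<delta>\<^sub>1)\<close>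
  note sm2 = \<open>\<forall>k\<in>{1, 2, 3}. summable (wright_deriv_coeff k \<alpha>\<^sub>2 \<beta>\<^sub>2 \<gamma>\<^sub>2 \<delta>\<^sub>2)\<close>
  note s1 = wright_weighted_sums[OF pos1 sm1]
  note s2 = wright_weighted_sums[OF pos2 sm2]
  define w1 where "w1 = wright_coeff \<alpha>\<^sub>1 \<beta>\<^sub>1 \<gamma>\<^sub>1 \<delta>\<^sub>1"
  define w2 where "w2 = wright_coeff \<alpha>\<^sub>2 \<beta>\<^sub>2 \<gamma>\<^sub>2 \<delta>\<^sub>2"
  have w: "w1 1 = 1" "w2 1 = 1" by (auto simp: w1_def w2_def wright_coeff_def)
  have wn: "w1 n \<ge> 0" "w2 n \<ge> 0" if "n \<ge> 1" for n
    using wright_coeff_pos[OF pos1 that] wright_coeff_pos[OF pos2 that] by (auto simp: w1_def w2_def)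
  define H where "H = fps_expansion h 0"
  define G where "G = fps_expansion g 0"
  have holh: "h holomorphic_on ball 0 1" and holg: "g holomorphic_on ball 0 1"
    and n0: "h 0 = 0" "deriv h 0 = 1" "g 0 = 0" and B1: "norm B\<^sub>1 < 1"
    using dec by (auto simp: harmonic_decomp_def B\<^sub>1_def)
  have H: "h has_fps_expansion H" and G: "g has_fps_expansion G"
    unfolding H_def G_def by (rule has_fps_expansion_fps_expansion[of "ball 0 1"]; use holh holg in auto)+
  have H01: "fps_nth H 0 = 0" "fps_nth H 1 = 1" and G01: "fps_nth G 0 = 0" "fps_nth G 1 = B\<^sub>1"
    using n0 by (simp_all add: H_def G_def fps_expansion_def B\<^sub>1_def)
  define C1 where "C1 n = fps_nth H n * of_real (w1 n)" for n
  define C2 where "C2 n = \<sigma> * (fps_nth G n * of_real (w2 n))" for n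
  define c1 where "c1 n = (if n < 2 then 0 else C1 n)" for n
  define c2 where "c2 n = (if n < 2 then 0 else C2 n)" for n
  define p where "p n = real n * (real n + 1) * (2 * real n + 1)" for n
  define q where "q n = real n * (real n - 1) * (2 * real n - 1)" for n
  \<comment> \<open>\<open>n * w1 n\<close> times the coefficient bound for \<open>h\<close>, the
    factor \<open>n\<close> being included in \<open>p\<close> and \<open>q\<close>.\<close>
  define A1 where "A1 n = (p n * w1 n + norm B\<^sub>1 * (q n * w1 n)) / 6" for n
  define A2 where "A2 n = (q n * w2 n + norm B\<^sub>1 * (p n * w2 n)) / 6" for n
  have sA1: "A1 sums ((2 * W\<^sub>1 3 + 9 * W\<^sub>1 2 + 6 * W\<^sub>1 1 + norm B\<^sub>1 * (2 * W\<^sub>1 3 + 3 * W\<^sub>1 2)) / 6)"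
    unfolding A1_def p_def q_def w1_def W\<^sub>1_def by (intro sums_divide sums_add sums_mult s1)
  have sA2: "A2 sums ((2 * W\<^sub>2 3 + 3 * W\<^sub>2 2 + norm B\<^sub>1 * (2 * W\<^sub>2 3 + 9 * W\<^sub>2 2 + 6 * W\<^sub>2 1)) / 6)"
    unfolding A2_def p_def q_def w2_def W\<^sub>2_def by (intro sums_divide sums_add sums_mult s2)
  have le1: "real n * norm (C1 n) \<le> A1 n" if "n \<ge> 2" for n
  proof -
    have n: "n \<ge> 1" using that by simp
    have "real n * norm (C1 n) = real n * w1 n * norm (fps_nth H n)"
      using wn[OF n] by (simp add: C1_def norm_mult)
    also have "\<dots> \<le> real n * w1 n * ((real n + 1) * (2 * real n + 1) / 6 + norm B\<^sub>1 * ((real n - 1) * (2 * real n - 1) / 6))"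
      using close_to_convex_coefficient_bounds(1)[OF f dec H G n] wn[OF n]
      by (intro mult_left_mono) (auto simp: B\<^sub>1_def)
    also have "\<dots> = A1 n" by (simp add: A1_def p_def q_def field_simps)
    finally show ?thesis .
  qed
  have le2: "real n * norm (C2 n) \<le> A2 n" if "n \<ge> 2" for n
  proof -
    have n: "n \<ge> 1" using that by simp
    have "real n * norm (C2 n) = norm \<sigma> * (real n * w2 n * norm (fps_nth G n))"
      using wn[OF n] by (simp add: C2_def norm_mult)
    also have "\<dots> \<le> 1 * (real n * w2 n * norm (fps_nth G n))"
      using \<sigma> wn[OF n] by (intro mult_right_mono) auto
    also have "\<dots> \<le> 1 * (real n * w2 n * ((real n - 1) * (2 * real n - 1) / 6 + norm B\<^sub>1 * ((real n + 1) * (2 * real n + 1) / 6)))"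
      using close_to_convex_coefficient_bounds(2)[OF f dec H G n] wn[OF n]
      by (intro mult_left_mono) (auto simp: B\<^sub>1_def)
    also have "\<dots> = A2 n" by (simp add: A2_def p_def q_def field_simps)
    finally show ?thesis .
  qed
  \<comment> \<open>The terms at index 1 are the linear parts 1 and \<open>norm B\<^sub>1\<close>;
    removing them produces the summands \<open>W\<^sub>1 1 - 1\<close> and
    \<open>W\<^sub>2 1 - 1\<close> of the hypothesis.\<close>
  have A01: "A1 0 = 0" "A2 0 = 0" "A1 1 = 1" "A2 1 = norm B\<^sub>1"
    by (simp_all add: A1_def A2_def p_def q_def w[unfolded One_nat_def])
  have C0: "C1 0 = 0" "C2 0 = 0" "C1 1 = 1" "C2 1 = \<sigma> * B\<^sub>1"
    using H01 G01 w by (simp_all add: C1_def C2_def)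
  have c12: "c1 = (\<lambda>n. if n < 2 then 0 else C1 n)" "c2 = (\<lambda>n. if n < 2 then 0 else C2 n)"
    by (auto simp: c1_def c2_def)
  note k1 = weighted_series[OF c12(1) C0(1) le1 sA1 A01(1)]
  note k2 = weighted_series[OF c12(2) C0(2) le2 sA2 A01(2)]
  have "L_op \<alpha>\<^sub>1 \<beta>\<^sub>1 \<gamma>\<^sub>1 \<delta>\<^sub>1 \<alpha>\<^sub>2 \<beta>\<^sub>2 \<gamma>\<^sub>2 \<delta>\<^sub>2 \<sigma> h g z =
      z + higher_order_series.series c1 z + cnj (\<sigma> * B\<^sub>1 * z + higher_order_series.series c2 z)" if z: "norm z < 1" for z
  proof -
    have t1: "(\<lambda>n. C1 n * z ^ n) sums (z + higher_order_series.series c1 z)"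
      and t2: "(\<lambda>n. C2 n * z ^ n) sums (\<sigma> * B\<^sub>1 * z + higher_order_series.series c2 z)"
      using k1(3)[OF _ z] k2(3)[OF _ z] C0 by simp_all
    have "hadamard h (wright \<alpha>\<^sub>1 \<beta>\<^sub>1 \<gamma>\<^sub>1 \<delta>\<^sub>1) z = (\<Sum>n. C1 n * z ^ n)"
      unfolding hadamard_def C1_def H_def w1_def wright_fps_expansion[OF pos1 s1(3)] ..
    moreover have "\<sigma> * hadamard g (wright \<alpha>\<^sub>2 \<beta>\<^sub>2 \<gamma>\<^sub>2 \<delta>\<^sub>2) z = (\<Sum>n. C2 n * z ^ n)"
    \<comment> \<open>For \<open>\<sigma> = 0\<close> the convergence of the series for
      \<open>g\<close> cannot be read off from \<open>t2\<close>, but both sides are 0.\<close>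
    proof (cases "\<sigma> = 0")
      case False
      have eq: "C2 n * z ^ n = \<sigma> * (fps_nth G n * of_real (w2 n) * z ^ n)" for n by (simp add: C2_def mult.assoc)
      have "summable (\<lambda>n. fps_nth G n * of_real (w2 n) * z ^ n)"
        using sums_summable[OF t2] False unfolding eq by (simp add: summable_cmult_iff)
      then show ?thesis
        unfolding hadamard_def wright_fps_expansion[OF pos2 s2(3)] eq G_def w2_def by (rule suminf_mult[symmetric])
    qed (simp add: C2_def)
    ultimately show ?thesis using t1 t2 by (simp add: L_op_def sums_iff)
  qed
  moreover have "norm (\<sigma> * B\<^sub>1) < 1" and \<sigma>B: "norm (\<sigma> * B\<^sub>1) \<le> norm B\<^sub>1"
    using \<sigma> B1 mult_left_le_one_le[of "norm B\<^sub>1" "norm \<sigma>"] by (simp_all add: norm_mult)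
  moreover have "higher_order_series.total c1 + norm (\<sigma> * B\<^sub>1) + higher_order_series.total c2 \<le> 1"
    using k1(2) k2(2) \<sigma>B A01 assms(17) by (simp add: field_simps)
  moreover have "higher_order_series c1" "higher_order_series c2" using k1(1) k2(1) A01 by simp_all
  ultimately show ?thesis by (intro harmonic_series_close_to_convex[of c1 c2 "\<sigma> * B\<^sub>1"]) auto
qed

end
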